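(* Let $p$ be an odd prime and let $k$ be a field of characteristic not $p$ containing a primitive $p$-th root of unity $\zeta$; put $\mu_p=\langle\zeta\rangle$. Let $n_1\le n_2\le\cdots\le n_t$ be natural numbers, let $H\cong\prod_{i=1}^t C_{p^{n_i}}$, and let $L/k$ be a Galois extension with Galois group $H$. Let $$1\longrightarrow \mu_p\longrightarrow G\longrightarrow H\longrightarrow 1$$ be a non-split central group extension with cohomology class $\gamma\in H^2(H,\mu_p)$. For $i=1,\dots,t$ let $\sigma_i$ be a generator of the factor $C_{p^{n_i}}$ and let $K_i/k$ be the subextension of $L/k$ corresponding to this factor, i.e. $K_i$ is the fixed subfield of $\prod_{j\neq i}C_{p^{n_j}}$. Choose $a_i\in k^\times$ such that $\sqrt[p]{a_i}\in K_i^\times$ and $\sigma_j(\sqrt[p]{a_i})=\zeta^{\delta_{ij}}\sqrt[p]{a_i}$ for all $i,j$, where $\delta_{ij}$ is the Kronecker delta. Let $s_1,\dots,s_t\in G$ be pre-images of $\sigma_1,\dots,\sigma_t$, let $d_{ij}\in\{0,\dots,p-1\}$ be given by $s_is_j=\zeta^{d_{ji}}s_js_i$, and let $m_i\in\{0,\dots,p-1\}$ be given by $s_i^{p^{n_i}}=\zeta^{m_i}$. Define $r=\max\{i: m_i>0\}$, $n=n_r$, $A=\{i: n_i=n,\ m_i>0\}$, and assume that $k$ contains a primitive $p^n$-th root of unity $\zeta_{p^n}$, where $\zeta=\zeta_{p^n}^{p^{n-1}}$. (If all $m_i=0$, then $A=\emptyset$, the first product below is empty, and no further root of unity is required.) Then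 the obstruction to the proper solvability of the embedding problem $(L/k,G,\mu_p)$ given by $\gamma$ is $$\prod_{i\in A}(a_i,\zeta_{p^n}^{m_i};\zeta)\cdot\prod_{i<j}(a_j,a_i;\zeta)^{d_{ij}}\in \mathrm{Br}(k).$$
   Context: $\mu_p\subset k^\times$ is identified with the central kernel of $G\to H$, so $\zeta$ also denotes an element of $G$. For $a,b\in k^\times$, $(a,b;\zeta)\in\mathrm{Br}(k)$ denotes the class of the $p$-cyclic $k$-algebra generated by $i_1,i_2$ with $i_1^p=b$, $i_2^p=a$, $i_1i_2=\zeta i_2i_1$. The Brauer group is written multiplicatively. Embedding problem: given a Galois extension $L/k$ with group $H$ and a group extension $1\to\mu_p\to G\to H\to1$, the embedding problem $(L/k,G,\mu_p)$ is properly solvable if there is a Galois field extension $M/k$ containing $L$ and an isomorphism $\mathrm{Gal}(M/k)\cong G$ under which the restriction map $\mathrm{Gal}(M/k)\to\mathrm{Gal}(L/k)=H$ corresponds to the given map $G\to H$. The obstruction is the image of $\gamma$ under the inflation map $H^2(H,\mu_p)\to H^2(\Omega_k,\mu_p)\cong\mathrm{Br}_p(k)$ (where $\Omega_k$ is the absolute Galois group of $k$ and $\mathrm{Br}_p(k)$ is the $p$-torsion of the Brauer group); equivalently it is the class of the crossed product algebra of $L/k$ with respect to the image of $\gamma$ in $H^2(H,L^\times)$. For a non-split central group extension $1\to\mu_p\to G\to H\to1$ with class $\gamma\in H^2(H,\mu_p)$, where $H=\mathrm{Gal}(L/k)$ and $\mu_p\subset k^\times$, the embedding problem $(L/k,G,\mu_p)$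 is properly solvable if and only if the obstruction is trivial in $\mathrm{Br}(k)$. *)

theory Defs
  imports
    "HOL-Algebra.Algebra"
    "HOL-Computational_Algebra.Primes"
begin

text \<open>Fields are types of class \<open>field\<close>; \<open>field_ring\<close> is such a field seen as a ring record, so that
  \<open>mult_of field_ring\<close> is its multiplicative group.\<close>

definition field_ring :: "'k::field ring" where
  "field_ring = \<lparr>carrier = UNIV, monoid.mult = (*), one = 1, ring.zero = 0, ring.add = (+)\<rparr>"

definition primitive_root_of_unity :: "nat \<Rightarrow> 'k::field \<Rightarrow> bool" where
  "primitive_root_of_unity n z \<longleftrightarrow> 0 < n \<and> z ^ n = 1 \<and> (\<forall>j. 0 < j \<and> j < n \<longrightarrow> z ^ j \<noteq> 1)"

definition root_group :: "'k::field \<Rightarrow> 'k monoid" where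
  "root_group \<zeta> = subgroup_generated (mult_of field_ring) {\<zeta>}"

text \<open>An extension \<open>L/k\<close> is given by a field embedding \<open>h\<close> of the type \<open>'k\<close> into the type \<open>'l\<close>.\<close>

definition galois_group :: "('k::field \<Rightarrow> 'l::field) \<Rightarrow> ('l \<Rightarrow> 'l) monoid" where
  "galois_group h =
     \<lparr>carrier = {\<sigma> \<in> ring_iso field_ring field_ring. \<forall>c. \<sigma> (h c) = h c}, monoid.mult = (\<circ>), one = id\<rparr>"

definition fixed_field :: "('l \<Rightarrow> 'l) set \<Rightarrow> 'l set" where
  "fixed_field S = {x. \<forall>\<sigma>\<in>S. \<sigma> x = x}"

text \<open>Finite Galois extensions: finite degree, and \<open>k\<close> is the fixed field of \<open>Aut(L/k)\<close>.\<close>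

definition galois_extension :: "('k::field \<Rightarrow> 'l::field) \<Rightarrow> bool" where
  "galois_extension h \<longleftrightarrow>
     h \<in> ring_hom field_ring field_ring \<and>
     (\<exists>B. finite B \<and> (\<forall>x. \<exists>c. x = (\<Sum>b\<in>B. h (c b) * b))) \<and>
     fixed_field (carrier (galois_group h)) = range h"

text \<open>The subgroup \<open>\<Prod>j\<in>J. C j\<close> of \<open>\<Prod>i\<in>I. C i\<close>, transported along a map \<open>\<phi>\<close> from the product.\<close>

definition subproduct ::
    "(('i \<Rightarrow> 'c) \<Rightarrow> 'h) \<Rightarrow> 'i set \<Rightarrow> ('i \<Rightarrow> 'c monoid) \<Rightarrow> 'i set \<Rightarrow> 'h set" where
  "subproduct \<phi> I C J = \<phi> ` {x \<in> carrier (product_group I C). \<forall>i\<in>I - J. x i = \<one>\<^bsub>C i\<^esub>}"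

text \<open>\<open>1 \<rightarrow> M \<rightarrow> G \<rightarrow> H \<rightarrow> 1\<close> with maps \<open>\<iota>\<close> and \<open>\<pi>\<close>.  The library's \<open>short_exact_sequence\<close> would force
  the three groups to have the same element type.\<close>

definition central_extension ::
    "'m monoid \<Rightarrow> ('m \<Rightarrow> 'g) \<Rightarrow> 'g monoid \<Rightarrow> ('g \<Rightarrow> 'h) \<Rightarrow> 'h monoid \<Rightarrow> bool" where
  "central_extension M \<iota> G \<pi> H \<longleftrightarrow>
     group M \<and> group G \<and> group H \<and> \<iota> \<in> mon M G \<and> \<pi> \<in> epi G H \<and>
     \<iota> ` carrier M = kernel G H \<pi> \<and>
     (\<forall>z\<in>carrier M. \<forall>g\<in>carrier G. \<iota> z \<otimes>\<^bsub>G\<^esub> g = g \<otimes>\<^bsub>G\<^esub> \<iota> z)"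

definition split_extension :: "'g monoid \<Rightarrow> ('g \<Rightarrow> 'h) \<Rightarrow> 'h monoid \<Rightarrow> bool" where
  "split_extension G \<pi> H \<longleftrightarrow> (\<exists>s\<in>hom H G. \<forall>x\<in>carrier H. \<pi> (s x) = x)"

text \<open>Inhomogeneous 2-cocycles and 2-coboundaries of \<open>H\<close> with values in an abelian group \<open>M\<close>
  (written multiplicatively) on which \<open>H\<close> acts by \<open>act\<close>.\<close>

definition cocycles2 ::
    "'h monoid \<Rightarrow> 'm monoid \<Rightarrow> ('h \<Rightarrow> 'm \<Rightarrow> 'm) \<Rightarrow> ('h \<times> 'h \<Rightarrow> 'm) monoid" where
  "cocycles2 H M act =
     \<lparr>carrier = {c \<in> carrier H \<times> carrier H \<rightarrow>\<^sub>E carrier M.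
        \<forall>\<sigma>\<in>carrier H. \<forall>\<tau>\<in>carrier H. \<forall>\<rho>\<in>carrier H.
          act \<sigma> (c (\<tau>, \<rho>)) \<otimes>\<^bsub>M\<^esub> c (\<sigma>, \<tau> \<otimes>\<^bsub>H\<^esub> \<rho>) = c (\<sigma>, \<tau>) \<otimes>\<^bsub>M\<^esub> c (\<sigma> \<otimes>\<^bsub>H\<^esub> \<tau>, \<rho>)},
      monoid.mult = (\<lambda>c d. \<lambda>x\<in>carrier H \<times> carrier H. c x \<otimes>\<^bsub>M\<^esub> d x),
      one = (\<lambda>x\<in>carrier H \<times> carrier H. \<one>\<^bsub>M\<^esub>)\<rparr>"

definition coboundaries2 ::
    "'h monoid \<Rightarrow> 'm monoid \<Rightarrow> ('h \<Rightarrow> 'm \<Rightarrow> 'm) \<Rightarrow> ('h \<times> 'h \<Rightarrow> 'm) set" where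
  "coboundaries2 H M act =
     {(\<lambda>(\<sigma>, \<tau>)\<in>carrier H \<times> carrier H.
        (b \<sigma> \<otimes>\<^bsub>M\<^esub> act \<sigma> (b \<tau>)) \<otimes>\<^bsub>M\<^esub> inv\<^bsub>M\<^esub> b (\<sigma> \<otimes>\<^bsub>H\<^esub> \<tau>)) | b. b \<in> carrier H \<rightarrow> carrier M}"

definition H2 ::
    "'h monoid \<Rightarrow> 'm monoid \<Rightarrow> ('h \<Rightarrow> 'm \<Rightarrow> 'm) \<Rightarrow> ('h \<times> 'h \<Rightarrow> 'm) set monoid" where
  "H2 H M act = cocycles2 H M act Mod coboundaries2 H M act"

text \<open>The map on \<open>H2\<close> induced by an equivariant homomorphism \<open>f\<close> into the module \<open>M'\<close>.\<close>

definition H2_map ::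
    "'h monoid \<Rightarrow> 'n monoid \<Rightarrow> ('h \<Rightarrow> 'n \<Rightarrow> 'n) \<Rightarrow> ('m \<Rightarrow> 'n) \<Rightarrow>
      ('h \<times> 'h \<Rightarrow> 'm) set \<Rightarrow> ('h \<times> 'h \<Rightarrow> 'n) set" where
  "H2_map H M' act' f \<gamma> =
     (\<Union>c\<in>\<gamma>. coboundaries2 H M' act' #>\<^bsub>cocycles2 H M' act'\<^esub>
                (\<lambda>x\<in>carrier H \<times> carrier H. f (c x)))"

text \<open>The extension has class \<open>\<gamma>\<close>: for some set-theoretic 
  with \<open>s \<sigma> s \<tau> = c (\<sigma>, \<tau>) s (\<sigma> \<tau>)\<close>.  The action is trivial since the extension is central.\<close>

definition has_extension_class ::
    "'m monoid \<Rightarrow> ('m \<Rightarrow> 'g) \<Rightarrow> 'g monoid \<Rightarrow> ('g \<Rightarrow> 'h) \<Rightarrow> 'h monoid \<Rightarrow> ('h \<times> 'h \<Rightarrow> 'm) set \<Rightarrow> bool" where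
  "has_extension_class M \<iota> G \<pi> H \<gamma> \<longleftrightarrow>
     \<gamma> \<in> carrier (H2 H M (\<lambda>_ z. z)) \<and>
     (\<exists>s\<in>carrier H \<rightarrow> carrier G. \<exists>c\<in>\<gamma>.
        (\<forall>\<sigma>\<in>carrier H. \<pi> (s \<sigma>) = \<sigma>) \<and>
        (\<forall>\<sigma>\<in>carrier H. \<forall>\<tau>\<in>carrier H. s \<sigma> \<otimes>\<^bsub>G\<^esub> s \<tau> = \<iota> (c (\<sigma>, \<tau>)) \<otimes>\<^bsub>G\<^esub> s (\<sigma> \<otimes>\<^bsub>H\<^esub> \<tau>)))"

text \<open>Associative unital algebras are \<open>module\<close> records, whose ring part is not assumed commutative
  (unlike in the library's locale \<open>algebra\<close>).\<close>

definition k_algebra :: "('k::field, 'a) module \<Rightarrow> bool" where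
  "k_algebra A \<longleftrightarrow> ring A \<and> Module.module field_ring A \<and>
     (\<forall>c. \<forall>x\<in>carrier A. \<forall>y\<in>carrier A.
        (c \<odot>\<^bsub>A\<^esub> x) \<otimes>\<^bsub>A\<^esub> y = c \<odot>\<^bsub>A\<^esub> (x \<otimes>\<^bsub>A\<^esub> y) \<and> x \<otimes>\<^bsub>A\<^esub> (c \<odot>\<^bsub>A\<^esub> y) = c \<odot>\<^bsub>A\<^esub> (x \<otimes>\<^bsub>A\<^esub> y))"

definition algebra_iso :: "('k::field, 'a) module \<Rightarrow> ('k, 'b) module \<Rightarrow> ('a \<Rightarrow> 'b) set" where
  "algebra_iso A B = {f \<in> ring_iso A B. \<forall>c. \<forall>x\<in>carrier A. f (c \<odot>\<^bsub>A\<^esub> x) = c \<odot>\<^bsub>B\<^esub> f x}"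

definition central_simple :: "('k::field, 'a) module \<Rightarrow> bool" where
  "central_simple A \<longleftrightarrow> k_algebra A \<and>
     (\<exists>B. finite B \<and> B \<subseteq> carrier A \<and> (\<forall>x\<in>carrier A. \<exists>c. x = (\<Oplus>\<^bsub>A\<^esub>b\<in>B. c b \<odot>\<^bsub>A\<^esub> b))) \<and>
     \<one>\<^bsub>A\<^esub> \<noteq> \<zero>\<^bsub>A\<^esub> \<and> (\<forall>I. ideal I A \<longrightarrow> I = {\<zero>\<^bsub>A\<^esub>} \<or> I = carrier A) \<and>
     (\<forall>z\<in>carrier A. (\<forall>x\<in>carrier A. z \<otimes>\<^bsub>A\<^esub> x = x \<otimes>\<^bsub>A\<^esub> z) \<longrightarrow> (\<exists>c. z = c \<odot>\<^bsub>A\<^esub> \<one>\<^bsub>A\<^esub>))"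

definition matrix_algebra :: "nat \<Rightarrow> ('k, 'a) module \<Rightarrow> ('k, nat \<times> nat \<Rightarrow> 'a) module" where
  "matrix_algebra n A =
     \<lparr>carrier = {..<n} \<times> {..<n} \<rightarrow>\<^sub>E carrier A,
      monoid.mult = (\<lambda>P Q. \<lambda>(i, j)\<in>{..<n} \<times> {..<n}. \<Oplus>\<^bsub>A\<^esub>l\<in>{..<n}. P (i, l) \<otimes>\<^bsub>A\<^esub> Q (l, j)),
      one = (\<lambda>(i, j)\<in>{..<n} \<times> {..<n}. if i = j then \<one>\<^bsub>A\<^esub> else \<zero>\<^bsub>A\<^esub>),
      ring.zero = (\<lambda>_\<in>{..<n} \<times> {..<n}. \<zero>\<^bsub>A\<^esub>),
      ring.add = (\<lambda>P Q. \<lambda>e\<in>{..<n} \<times> {..<n}. P e \<oplus>\<^bsub>A\<^esub> Q e),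
      module.smult = (\<lambda>c P. \<lambda>e\<in>{..<n} \<times> {..<n}. c \<odot>\<^bsub>A\<^esub> P e)\<rparr>"

definition brauer_equiv :: "('k::field, 'a) module \<Rightarrow> ('k, 'b) module \<Rightarrow> bool" where
  "brauer_equiv A B \<longleftrightarrow>
     (\<exists>m>0. \<exists>n>0. algebra_iso (matrix_algebra m A) (matrix_algebra n B) \<noteq> {})"

text \<open>A Brauer class must live in one fixed type, whereas algebras may have any carrier type.
  Every finite-dimensional algebra is isomorphic to one with underlying space \<open>k^n\<close>, given by the
  coordinates \<open>sc_unit\<close> of its unit and its structure constants
  \<open>e_i * e_j = \<Sum>l<n. sc_prod i j l * e_l\<close>.  Hence the class of an algebra is represented by the set of
  all central simple algebras of this form that are Brauer equivalent to it.\<close>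

record 'k struct_consts =
  sc_dim :: nat
  sc_unit :: "nat \<Rightarrow> 'k"
  sc_prod :: "nat \<Rightarrow> nat \<Rightarrow> nat \<Rightarrow> 'k"

definition sc_algebra :: "'k::field struct_consts \<Rightarrow> ('k, nat \<Rightarrow> 'k) module" where
  "sc_algebra S =
     \<lparr>carrier = {x. \<forall>l\<ge>sc_dim S. x l = 0},
      monoid.mult = (\<lambda>x y l. if l < sc_dim S
                then \<Sum>i<sc_dim S. \<Sum>j<sc_dim S. x i * y j * sc_prod S i j l else 0),
      one = (\<lambda>l. if l < sc_dim S then sc_unit S l else 0),
      ring.zero = (\<lambda>_. 0),
      ring.add = (\<lambda>x y l. x l + y l),
      module.smult = (\<lambda>c x l. c * x l)\<rparr>"

text \<open>Tensor product, with respect to the basis in which \<open>e_i \<otimes> f_j\<close> has index \<open>i * sc_dim T + j\<close>.\<close>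

definition sc_tensor :: "'k::field struct_consts \<Rightarrow> 'k struct_consts \<Rightarrow> 'k struct_consts" where
  "sc_tensor S T = (let q = sc_dim T in
     \<lparr>sc_dim = sc_dim S * q,
      sc_unit = (\<lambda>l. sc_unit S (l div q) * sc_unit T (l mod q)),
      sc_prod = (\<lambda>i j l. sc_prod S (i div q) (j div q) (l div q) * sc_prod T (i mod q) (j mod q) (l mod q))\<rparr>)"

definition brauer_class :: "('k::field, 'a) module \<Rightarrow> 'k struct_consts set" where
  "brauer_class A = {S. central_simple (sc_algebra S) \<and> brauer_equiv (sc_algebra S) A}"

definition field_algebra :: "('k::field, 'k) module" where
  "field_algebra = \<lparr>carrier = UNIV, monoid.mult = (*), one = 1, ring.zero = 0, ring.add = (+), module.smult = (*)\<rparr>"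

definition brauer_group :: "'k::field struct_consts set monoid" where
  "brauer_group =
     \<lparr>carrier = {brauer_class (sc_algebra S) | S. central_simple (sc_algebra S)},
      monoid.mult = (\<lambda>P Q. \<Union>S\<in>P. \<Union>T\<in>Q. brauer_class (sc_algebra (sc_tensor S T))),
      one = brauer_class field_algebra\<rparr>"

text \<open>The \<open>p\<close>-cyclic algebra \<open>(a, b; \<zeta>)\<close> generated by \<open>i_1\<close>, \<open>i_2\<close> with \<open>i_1^p = b\<close>, \<open>i_2^p = a\<close>,
  \<open>i_1 i_2 = \<zeta> i_2 i_1\<close>.  An element is its coefficient function with respect to the basis
  \<open>e_(v, u) = i_2^v i_1^u\<close>, where \<open>v, u < p\<close>; thus
  \<open>e_(v, u) e_(v', u') = \<zeta>^(u v') i_2^(v + v') i_1^(u + u')\<close>.\<close>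

definition symbol_algebra :: "nat \<Rightarrow> 'k::field \<Rightarrow> 'k \<Rightarrow> 'k \<Rightarrow> ('k, nat \<times> nat \<Rightarrow> 'k) module" where
  "symbol_algebra p a b \<zeta> =
     \<lparr>carrier = {f. \<forall>e. e \<notin> {..<p} \<times> {..<p} \<longrightarrow> f e = 0},
      monoid.mult = (\<lambda>f g e. \<Sum>(v, u)\<in>{..<p} \<times> {..<p}. \<Sum>(v', u')\<in>{..<p} \<times> {..<p}.
                if e = ((v + v') mod p, (u + u') mod p)
                then f (v, u) * g (v', u') * \<zeta> ^ (u * v') * a ^ ((v + v') div p) * b ^ ((u + u') div p)
                else 0),
      one = (\<lambda>e. if e = (0, 0) then 1 else 0),
      ring.zero = (\<lambda>_. 0),
      ring.add = (\<lambda>f g e. f e + g e),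
      module.smult = (\<lambda>c f e. c * f e)\<rparr>"

text \<open>The crossed product \<open>\<Oplus>\<sigma>. L u_\<sigma>\<close> with \<open>u_\<sigma> x = \<sigma>(x) u_\<sigma>\<close> and \<open>u_\<sigma> u_\<tau> = c (\<sigma>, \<tau>) u_(\<sigma> \<tau>)\<close>.
  As \<open>c\<close> need not be normalised, the unit is \<open>c (1, 1)^(-1) u_1\<close>.\<close>

definition crossed_product ::
    "('k::field \<Rightarrow> 'l::field) \<Rightarrow> (('l \<Rightarrow> 'l) \<times> ('l \<Rightarrow> 'l) \<Rightarrow> 'l) \<Rightarrow> ('k, ('l \<Rightarrow> 'l) \<Rightarrow> 'l) module" where
  "crossed_product h c = (let H = carrier (galois_group h) in
     \<lparr>carrier = {x. \<forall>\<rho>. \<rho> \<notin> H \<longrightarrow> x \<rho> = 0},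
      monoid.mult = (\<lambda>x y \<rho>. \<Sum>\<sigma>\<in>H. \<Sum>\<tau>\<in>H. if \<rho> = \<sigma> \<circ> \<tau> then x \<sigma> * \<sigma> (y \<tau>) * c (\<sigma>, \<tau>) else 0),
      one = (\<lambda>\<rho>. if \<rho> = id then inverse (c (id, id)) else 0),
      ring.zero = (\<lambda>_. 0),
      ring.add = (\<lambda>x y \<rho>. x \<rho> + y \<rho>),
      module.smult = (\<lambda>a x \<rho>. h a * x \<rho>)\<rparr>)"

text \<open>The obstruction given by \<open>\<gamma> \<in> H\<^sup>2(Gal(L/k), \<mu>)\<close>: the Brauer class of the crossed product of \<open>L/k\<close>
  with respect to the image of \<open>\<gamma>\<close> in \<open>H\<^sup>2(Gal(L/k), L^*)\<close>.  It does not depend on the cocycle chosen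
  in that image; as in the library's treatment of maps on quotients this is expressed by \<open>the_elem\<close>.\<close>

definition obstruction ::
    "('k::field \<Rightarrow> 'l::field) \<Rightarrow> (('l \<Rightarrow> 'l) \<times> ('l \<Rightarrow> 'l) \<Rightarrow> 'k) set \<Rightarrow> 'k struct_consts set" where
  "obstruction h \<gamma> =
     the_elem ((\<lambda>c. brauer_class (crossed_product h c)) `
       H2_map (galois_group h) (mult_of field_ring) (\<lambda>\<sigma> x. \<sigma> x) h \<gamma>)"

end

theory Submission
  imports Defs
begin

text \<open>The obstruction is the class of a crossed product for any cocycle in the image of \<open>\<gamma>\<close>. Normal
  forms \<open>s\<^sub>1^{e\<^sub>1} \<dots> s\<^sub>t^{e\<^sub>t}\<close> in \<open>G\<close> give such a cocycle explicitly, and multiplying by powers of the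
  \<open>p^{n\<^sub>i-1}\<close>-th roots \<open>z\<^sub>i\<close> of \<open>\<zeta>^{m\<^sub>i}\<close> makes it a cocycle inflated from the elementary abelian quotient
  \<open>Gal(k(\<alpha>\<^sub>1, \<dots>, \<alpha>\<^sub>t)/k)\<close>. The crossed product is then Brauer equivalent to a corner \<open>e A e\<close>, whose
  generators \<open>\<alpha>\<^sub>j\<close> and \<open>(\<Prod>i<j. \<alpha>\<^sub>i^{d\<^sub>i\<^sub>j}) u\<^sub>j\<close> commute in different pairs, so that it is the tensor product of
  the symbol algebras \<open>(a\<^sub>j, z\<^sub>j \<Prod>i<j. a\<^sub>i^{d\<^sub>i\<^sub>j})\<close>. Bilinearity of symbols splits these into the stated factors, and
  \<open>z\<^sub>i\<close> is a \<open>p\<close>-th power when \<open>i \<notin> A\<close>.\<close>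


section \<open>Algebras over a field\<close>

text \<open>Only the subextension k(\<alpha>_1, ..., \<alpha>_t) is under explicit control: k need
  not contain the roots of unity that would make L/k a Kummer extension. Hence the descent to
  exponent p. The obstacle is that normal forms carry at multiples of p^(n_i), with value
  \<zeta>^(m_i), while a cocycle of the quotient carries at multiples of p. One factor z_i for every
  p steps gathers to \<zeta>^(m_i) after p^(n_i) steps, which trades one kind of carry for the
  other; taking z_i as a power of the given root of unity is what creates the set A. The factor
  \<alpha>_i^(d_ij) in front of u_j has a similar origin: u_j u_i = \<zeta>^(d_ij) u_i u_j, and
  moving u_i past \<alpha>_i^(d_ij) costs exactly that scalar. Its p-th power a_i^(d_ij) then enters
  the second slot of the symbol. No dimension is ever counted. The tensor product of the symbols is
  simple, so a homomorphism to the corner is injective for free, and surjectivity is checked on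
  generators. Brauer equivalence with a corner comes from explicit matrix units, here made from a
  basis of L and its dual under the trace to the subextension.\<close>

locale kalg = ring A for A :: "('k::field, 'a) module" (structure) +
  assumes smult_closed [simp, intro]: "x \<in> carrier A ==> c \<odot> x \<in> carrier A"
    and smult_ladd: "x \<in> carrier A ==> (c + d) \<odot> x = c \<odot> x \<oplus> d \<odot> x"
    and smult_radd: "[|x \<in> carrier A; y \<in> carrier A|] ==> c \<odot> (x \<oplus> y) = c \<odot> x \<oplus> c \<odot> y"
    and smult_smult: "x \<in> carrier A ==> c \<odot> (d \<odot> x) = (c * d) \<odot> x"
    and smult_1 [simp]: "x \<in> carrier A ==> 1 \<odot> x = x"
    and smult_lmult: "[|x \<in> carrier A; y \<in> carrier A|] ==> (c \<odot> x) \<otimes> y = c \<odot> (x \<otimes> y)"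
    and smult_rmult: "[|x \<in> carrier A; y \<in> carrier A|] ==> x \<otimes> (c \<odot> y) = c \<odot> (x \<otimes> y)"

lemma field_ring_simps [simp]:
  "carrier field_ring = UNIV" "\<one>\<^bsub>field_ring\<^esub> = 1" "\<zero>\<^bsub>field_ring\<^esub> = 0"
  "x \<otimes>\<^bsub>field_ring\<^esub> y = x * y" "x \<oplus>\<^bsub>field_ring\<^esub> y = x + y"
  by (auto simp: field_ring_def)

lemma cring_field_ring: "cring (field_ring :: 'k::field ring)"
proof (intro cringI abelian_groupI comm_monoidI)
  fix x :: 'k show "\<exists>y\<in>carrier field_ring. y \<oplus>\<^bsub>field_ring\<^esub> x = \<zero>\<^bsub>field_ring\<^esub>"
    by (rule bexI[of _ "- x"]) auto
qed (auto simp: algebra_simps)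

text \<open>The definition of an algebra goes through \<open>Module.module\<close> over a record;
  this equivalence moves everything into one locale, where the scalar laws can be used as rewrite
  rules.\<close>

lemma k_algebra_iff: "k_algebra A \<longleftrightarrow> kalg A"
proof
  assume "k_algebra A"
  then interpret R: ring A + M: Module.module field_ring A
    by (auto simp: k_algebra_def)
  show "kalg A"
    using \<open>k_algebra A\<close> M.smult_closed M.smult_l_distr M.smult_r_distr M.smult_assoc1 M.smult_one
    by unfold_locales (auto simp: k_algebra_def)
next
  assume "kalg A"
  then interpret kalg A .
  have "Module.module field_ring A"
    by (rule moduleI)
      (auto intro: cring_field_ring smult_ladd smult_radd smult_smult[symmetric] is_abelian_group)
  then show "k_algebra A"
    by (auto simp: k_algebra_def smult_lmult smult_rmult ring_axioms)
qed

text \<open>Additive inverses enter only through the sixth premise: the scalar multiple by -1 serves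
  as the negative, so no subtraction has to be exhibited.\<close>

lemma kalgI:
  assumes "\<And>x y. x \<in> carrier A ==> y \<in> carrier A ==> x \<oplus>\<^bsub>A\<^esub> y \<in> carrier A"
    and "\<zero>\<^bsub>A\<^esub> \<in> carrier A"
    and "\<And>x y z. [|x \<in> carrier A; y \<in> carrier A; z \<in> carrier A|] ==> (x \<oplus>\<^bsub>A\<^esub> y) \<oplus>\<^bsub>A\<^esub> z = x \<oplus>\<^bsub>A\<^esub> (y \<oplus>\<^bsub>A\<^esub> z)"
    and "\<And>x y. x \<in> carrier A ==> y \<in> carrier A ==> x \<oplus>\<^bsub>A\<^esub> y = y \<oplus>\<^bsub>A\<^esub> x"
    and "\<And>x. x \<in> carrier A ==> \<zero>\<^bsub>A\<^esub> \<oplus>\<^bsub>A\<^esub> x = x"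
    and "\<And>x. x \<in> carrier A ==> (- 1) \<odot>\<^bsub>A\<^esub> x \<oplus>\<^bsub>A\<^esub> x = \<zero>\<^bsub>A\<^esub>"
    and "\<And>x y. x \<in> carrier A ==> y \<in> carrier A ==> x \<otimes>\<^bsub>A\<^esub> y \<in> carrier A"
    and "\<one>\<^bsub>A\<^esub> \<in> carrier A"
    and "\<And>x y z. [|x \<in> carrier A; y \<in> carrier A; z \<in> carrier A|] ==> (x \<otimes>\<^bsub>A\<^esub> y) \<otimes>\<^bsub>A\<^esub> z = x \<otimes>\<^bsub>A\<^esub> (y \<otimes>\<^bsub>A\<^esub> z)"
    and "\<And>x. x \<in> carrier A ==> \<one>\<^bsub>A\<^esub> \<otimes>\<^bsub>A\<^esub> x = x" and "\<And>x. x \<in> carrier A ==> x \<otimes>\<^bsub>A\<^esub> \<one>\<^bsub>A\<^esub> = x"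
    and "\<And>x y z. [|x \<in> carrier A; y \<in> carrier A; z \<in> carrier A|] ==> (x \<oplus>\<^bsub>A\<^esub> y) \<otimes>\<^bsub>A\<^esub> z = x \<otimes>\<^bsub>A\<^esub> z \<oplus>\<^bsub>A\<^esub> y \<otimes>\<^bsub>A\<^esub> z"
    and "\<And>x y z. [|x \<in> carrier A; y \<in> carrier A; z \<in> carrier A|] ==> z \<otimes>\<^bsub>A\<^esub> (x \<oplus>\<^bsub>A\<^esub> y) = z \<otimes>\<^bsub>A\<^esub> x \<oplus>\<^bsub>A\<^esub> z \<otimes>\<^bsub>A\<^esub> y"
    and "\<And>c x. x \<in> carrier A ==> c \<odot>\<^bsub>A\<^esub> x \<in> carrier A"
    and "\<And>c d x. x \<in> carrier A ==> (c + d) \<odot>\<^bsub>A\<^esub> x = c \<odot>\<^bsub>A\<^esub> x \<oplus>\<^bsub>A\<^esub> d \<odot>\<^bsub>A\<^esub> x"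
    and "\<And>c x y. [|x \<in> carrier A; y \<in> carrier A|] ==> c \<odot>\<^bsub>A\<^esub> (x \<oplus>\<^bsub>A\<^esub> y) = c \<odot>\<^bsub>A\<^esub> x \<oplus>\<^bsub>A\<^esub> c \<odot>\<^bsub>A\<^esub> y"
    and "\<And>c d x. x \<in> carrier A ==> c \<odot>\<^bsub>A\<^esub> (d \<odot>\<^bsub>A\<^esub> x) = (c * d) \<odot>\<^bsub>A\<^esub> x"
    and "\<And>x. x \<in> carrier A ==> 1 \<odot>\<^bsub>A\<^esub> x = x"
    and "\<And>c x y. [|x \<in> carrier A; y \<in> carrier A|] ==> (c \<odot>\<^bsub>A\<^esub> x) \<otimes>\<^bsub>A\<^esub> y = c \<odot>\<^bsub>A\<^esub> (x \<otimes>\<^bsub>A\<^esub> y)"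
    and "\<And>c x y. [|x \<in> carrier A; y \<in> carrier A|] ==> x \<otimes>\<^bsub>A\<^esub> (c \<odot>\<^bsub>A\<^esub> y) = c \<odot>\<^bsub>A\<^esub> (x \<otimes>\<^bsub>A\<^esub> y)"
  shows "kalg A"
proof -
  have "abelian_group A"
  proof (rule abelian_groupI)
    fix x assume "x \<in> carrier A"
    then show "\<exists>y\<in>carrier A. y \<oplus>\<^bsub>A\<^esub> x = \<zero>\<^bsub>A\<^esub>"
      using assms(6,14) by blast
  qed (use assms(1-5) in simp_all)
  moreover have "monoid A"
    using assms(7-11) by (intro monoidI) simp_all
  ultimately have "ring A"
    using assms(12,13) by (intro ringI) simp_all
  then show ?thesis
    using assms(14-20) by (intro kalg.intro kalg_axioms.intro) simp_all
qed

section \<open>Finite sums in commutative monoids\<close>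

context abelian_monoid
begin

lemma finsum_swap:
  assumes "finite I" "finite J" "\<And>i j. i \<in> I ==> j \<in> J ==> f i j \<in> carrier G"
  shows "(\<Oplus>i\<in>I. \<Oplus>j\<in>J. f i j) = (\<Oplus>j\<in>J. \<Oplus>i\<in>I. f i j)"
  using assms(1,3)
proof (induction I rule: finite_induct)
  case empty then show ?case by simp
next
  case (insert x F)
  then have "(\<Oplus>j\<in>J. \<Oplus>i\<in>insert x F. f i j) = (\<Oplus>j\<in>J. f x j \<oplus> (\<Oplus>i\<in>F. f i j))"
    by (intro finsum_cong') (auto intro!: finsum_closed simp: Pi_def)
  also have "\<dots> = (\<Oplus>j\<in>J. f x j) \<oplus> (\<Oplus>j\<in>J. \<Oplus>i\<in>F. f i j)"
    using insert by (intro finsum_addf) (auto intro!: finsum_closed)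
  finally show ?case
    using insert by (auto intro!: finsum_closed simp: Pi_def)
qed

text \<open>Every \<open>l < m * n\<close> is uniquely \<open>u * n + v\<close>; this is the index
  arithmetic behind matrices of matrices.\<close>

lemma finsum_lessThan_mult:
  fixes f :: "nat => 'a"
  assumes "\<And>l. l < m * n ==> f l \<in> carrier G"
  shows "(\<Oplus>l\<in>{..<m * n}. f l) = (\<Oplus>u\<in>{..<m}. \<Oplus>v\<in>{..<n}. f (u * n + v))"
  using assms
proof (induction m)
  case 0 then show ?case by simp
next
  case (Suc m)
  have split: "{..<Suc m * n} = {..<m * n} \<union> (\<lambda>v. m * n + v) ` {..<n}" (is "_ = _ \<union> ?B")
  proof (intro equalityI subsetI)
    fix l assume l: "l \<in> {..<Suc m * n}"
    show "l \<in> {..<m * n} \<union> ?B"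
    proof (cases "l < m * n")
      case False
      then have "l = m * n + (l - m * n)" "l - m * n < n" using l by auto
      then show ?thesis by blast
    qed auto
  qed auto
  have inj: "inj_on (\<lambda>v. m * n + v) {..<n}"
    by (auto simp: inj_on_def)
  have B: "f \<in> ?B \<rightarrow> carrier G"
    using Suc.prems by auto
  have cl: "u * n + v < Suc m * n" if "u \<le> m" "v < n" for u v
  proof -
    have "u * n + v < Suc u * n" using that by simp
    also have "\<dots> \<le> Suc m * n" using that by (intro mult_right_mono) auto
    finally show ?thesis .
  qed
  have "(\<Oplus>l\<in>{..<Suc m * n}. f l) = (\<Oplus>l\<in>{..<m * n}. f l) \<oplus> (\<Oplus>l\<in>?B. f l)"
    unfolding split using Suc.prems B by (intro finsum_Un_disjoint) (auto simp: Pi_def)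
  also have "(\<Oplus>l\<in>?B. f l) = (\<Oplus>v\<in>{..<n}. f (m * n + v))"
    using finsum_reindex[OF B inj] by simp
  also have "(\<Oplus>l\<in>{..<m * n}. f l) = (\<Oplus>u\<in>{..<m}. \<Oplus>v\<in>{..<n}. f (u * n + v))"
    using Suc by auto
  finally show ?case
    unfolding lessThan_Suc using Suc.prems cl
    by (subst finsum_insert) (auto intro!: finsum_closed a_comm simp: Pi_def)
qed

lemma finsum_delta:
  assumes "finite I" "j \<in> I" "\<And>i. i \<in> I ==> i \<noteq> j ==> f i = \<zero>" "f j \<in> carrier G"
  shows "(\<Oplus>i\<in>I. f i) = f j"
proof -
  have "(\<Oplus>i\<in>I. f i) = (\<Oplus>i\<in>insert j (I - {j}). f i)"
    using assms by (simp add: insert_absorb)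
  also have "\<dots> = f j \<oplus> (\<Oplus>i\<in>I - {j}. f i)"
    using assms by (subst finsum_insert) (auto simp: Pi_def)
  also have "(\<Oplus>i\<in>I - {j}. f i) = (\<Oplus>i\<in>I - {j}. \<zero>)"
    using assms by (intro finsum_cong') auto
  finally show ?thesis using assms by simp
qed

end

text \<open>\<open>g\<close> is only assumed additive, so this covers scalar multiplication, reading
  off a matrix entry or a coordinate, and the inclusion of a corner, which does not preserve the
  unit.\<close>

lemma finsum_additive:
  assumes "abelian_monoid A" "abelian_monoid B" "finite I" "f \<in> I \<rightarrow> carrier A"
    and "\<And>x. x \<in> carrier A ==> g x \<in> carrier B"
    and "\<And>x y. x \<in> carrier A ==> y \<in> carrier A ==> g (x \<oplus>\<^bsub>A\<^esub> y) = g x \<oplus>\<^bsub>B\<^esub> g y"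
    and "g \<zero>\<^bsub>A\<^esub> = \<zero>\<^bsub>B\<^esub>"
  shows "g (finsum A f I) = finsum B (\<lambda>i. g (f i)) I"
proof -
  interpret A: abelian_monoid A by fact
  interpret B: abelian_monoid B by fact
  show ?thesis
    using assms(3,4)
    by (induction I rule: finite_induct)
      (use assms in \<open>auto simp: Pi_def intro!: A.finsum_closed\<close>)
qed

context kalg
begin

lemma smult_l0 [simp]: "x \<in> carrier A ==> 0 \<odot> x = \<zero>"
  using smult_ladd[of x 0 0] by (metis add.r_cancel_one' smult_closed add_0)

lemma smult_r0 [simp]: "c \<odot> \<zero> = \<zero>"
  using smult_radd[of \<zero> \<zero> c] by (metis add.r_cancel_one' smult_closed zero_closed l_zero)

lemma smult_finsum:
  assumes "finite I" "f \<in> I \<rightarrow> carrier A"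
  shows "c \<odot> (\<Oplus>i\<in>I. f i) = (\<Oplus>i\<in>I. c \<odot> f i)"
  using assms
  by (intro finsum_additive[where g = "\<lambda>x. c \<odot> x"]) (auto simp: smult_radd abelian_monoid_axioms)

lemma finsum_smult:
  assumes "finite I" "x \<in> carrier A"
  shows "(\<Sum>i\<in>I. c i) \<odot> x = (\<Oplus>i\<in>I. c i \<odot> x)"
  using assms by (induction I rule: finite_induct) (auto simp: smult_ladd)

lemma minus_smult: "x \<in> carrier A ==> \<ominus> x = (- 1) \<odot> x"
proof (rule minus_equality)
  assume "x \<in> carrier A"
  then show "(- 1) \<odot> x \<oplus> x = \<zero>"
    using smult_ladd[of x "- 1" 1] by simp
qed auto

lemma smult_cancel0: "x \<in> carrier A ==> c \<noteq> 0 ==> c \<odot> x = \<zero> ==> x = \<zero>"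
  by (metis smult_smult smult_1 smult_r0 left_inverse)

end

section \<open>Homomorphisms, isomorphisms and simple central algebras\<close>

locale kalg_hom = S: kalg A + T: kalg B
  for A :: "('k::field, 'a) module" (structure) and B :: "('k, 'b) module" (structure) and f :: "'a => 'b" +
  assumes closed [simp, intro]: "x \<in> carrier A ==> f x \<in> carrier B"
    and hom_add: "[|x \<in> carrier A; y \<in> carrier A|] ==> f (x \<oplus>\<^bsub>A\<^esub> y) = f x \<oplus>\<^bsub>B\<^esub> f y"
    and hom_mult: "[|x \<in> carrier A; y \<in> carrier A|] ==> f (x \<otimes>\<^bsub>A\<^esub> y) = f x \<otimes>\<^bsub>B\<^esub> f y"
    and hom_one: "f \<one>\<^bsub>A\<^esub> = \<one>\<^bsub>B\<^esub>"
    and hom_smult: "x \<in> carrier A ==> f (c \<odot>\<^bsub>A\<^esub> x) = c \<odot>\<^bsub>B\<^esub> f x"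
begin

lemma hom_zero: "f \<zero>\<^bsub>A\<^esub> = \<zero>\<^bsub>B\<^esub>"
  by (metis S.smult_l0 S.zero_closed T.smult_l0 closed hom_smult)

lemma hom_finsum: "finite I ==> g \<in> I \<rightarrow> carrier A ==> f (finsum A g I) = finsum B (\<lambda>i. f (g i)) I"
  by (rule finsum_additive)
    (auto simp: hom_add hom_zero S.abelian_monoid_axioms T.abelian_monoid_axioms)

lemma iso: "bij_betw f (carrier A) (carrier B) ==> f \<in> algebra_iso A B"
  by (auto simp: algebra_iso_def ring_iso_def ring_hom_def hom_add hom_mult hom_one hom_smult)

end

lemma algebra_iso_hom: "f \<in> algebra_iso A B ==> kalg A ==> kalg B ==> kalg_hom A B f"
  by (auto simp: algebra_iso_def ring_iso_def ring_hom_def kalg_hom_def kalg_hom_axioms_def)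

lemma algebra_iso_bij: "f \<in> algebra_iso A B ==> bij_betw f (carrier A) (carrier B)"
  by (auto simp: algebra_iso_def ring_iso_def)

definition iso_rel :: "('k::field, 'a) module => ('k, 'b) module => bool" where
  "iso_rel A B \<longleftrightarrow> algebra_iso A B \<noteq> {}"

lemma iso_relI: "kalg_hom A B f ==> bij_betw f (carrier A) (carrier B) ==> iso_rel A B"
  unfolding iso_rel_def using kalg_hom.iso by fast

lemma iso_relE:
  assumes "iso_rel A B" "kalg A" "kalg B"
  obtains f where "kalg_hom A B f" "bij_betw f (carrier A) (carrier B)"
  using assms algebra_iso_hom algebra_iso_bij unfolding iso_rel_def by (metis ex_in_conv)

lemma iso_rel_refl: "kalg A ==> iso_rel A A"
  by (rule iso_relI[where f = id]) (auto simp: kalg_hom_def kalg_hom_axioms_def)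

lemma iso_rel_sym:
  assumes "iso_rel A B" "kalg A" "kalg B"
  shows "iso_rel B A"
proof -
  obtain f where f: "kalg_hom A B f" "bij_betw f (carrier A) (carrier B)"
    using assms by (rule iso_relE)
  interpret f: kalg_hom A B f by fact
  let ?g = "inv_into (carrier A) f"
  have g: "?g y \<in> carrier A" "f (?g y) = y" if "y \<in> carrier B" for y
    using that f(2) by (auto simp: bij_betw_def inv_into_into f_inv_into_f)
  have gI: "?g y = x" if "x \<in> carrier A" "f x = y" for x y
    using that f(2) by (auto simp: bij_betw_def)
  have "kalg_hom B A ?g"
    using assms g by (intro kalg_hom.intro kalg_hom_axioms.intro)
      (auto intro!: gI simp: f.hom_add f.hom_mult f.hom_one f.hom_smult)
  then show ?thesis
    by (rule iso_relI) (use f(2) bij_betw_inv_into in blast)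
qed

lemma iso_rel_trans:
  assumes "iso_rel A B" "iso_rel B C" "kalg A" "kalg B" "kalg C"
  shows "iso_rel A C"
proof -
  obtain f g where f: "kalg_hom A B f" "bij_betw f (carrier A) (carrier B)"
    and g: "kalg_hom B C g" "bij_betw g (carrier B) (carrier C)"
    using assms by (metis iso_relE)
  interpret f: kalg_hom A B f by fact
  interpret g: kalg_hom B C g by fact
  have "kalg_hom A C (g \<circ> f)"
    using assms by (intro kalg_hom.intro kalg_hom_axioms.intro)
      (auto simp: f.hom_add f.hom_mult f.hom_one f.hom_smult g.hom_add g.hom_mult g.hom_one g.hom_smult)
  then show ?thesis
    by (rule iso_relI) (use f(2) g(2) bij_betw_trans in blast)
qed

text \<open>The laws of \<open>B\<close> are all pulled back along the bijection, so an algebra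
  given by formulas on coordinates, such as that of \<open>sc_tensor\<close>, inherits them from one
  where they are easy.\<close>

lemma kalg_transport:
  assumes "kalg A" "bij_betw f (carrier A) (carrier B)"
    and "\<And>x y. x \<in> carrier A ==> y \<in> carrier A ==> f (x \<oplus>\<^bsub>A\<^esub> y) = f x \<oplus>\<^bsub>B\<^esub> f y"
    and "\<And>x y. x \<in> carrier A ==> y \<in> carrier A ==> f (x \<otimes>\<^bsub>A\<^esub> y) = f x \<otimes>\<^bsub>B\<^esub> f y"
    and "\<And>c x. x \<in> carrier A ==> f (c \<odot>\<^bsub>A\<^esub> x) = c \<odot>\<^bsub>B\<^esub> f x"
    and "f \<one>\<^bsub>A\<^esub> = \<one>\<^bsub>B\<^esub>" and "f \<zero>\<^bsub>A\<^esub> = \<zero>\<^bsub>B\<^esub>"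
  shows "kalg B" "kalg_hom A B f" "iso_rel A B"
proof -
  interpret A: kalg A by fact
  have car: "carrier B = f ` carrier A"
    using assms(2) by (auto simp: bij_betw_def)
  have neg: "(- 1) \<odot>\<^bsub>A\<^esub> x \<oplus>\<^bsub>A\<^esub> x = \<zero>\<^bsub>A\<^esub>" if "x \<in> carrier A" for x
    using that by (simp add: A.l_neg flip: A.minus_smult)
  show kB: "kalg B"
    by (rule kalgI; unfold car; (elim imageE)?; hypsubst?;
        ((simp add: neg A.a_assoc A.m_assoc A.l_distr A.r_distr A.smult_ladd A.smult_radd
          A.smult_smult A.smult_lmult A.smult_rmult flip: assms(3-7); fail) | metis A.a_comm assms(3)))
  show h: "kalg_hom A B f"
    using assms(1) kB by (intro kalg_hom.intro kalg_hom_axioms.intro) (auto simp: assms(3-6) car)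
  show "iso_rel A B" using iso_relI[OF h assms(2)] .
qed

text \<open>This is \<open>central_simple\<close> without the finiteness clause, so that
  intermediate algebras need not be given a basis; for structure constants the two notions agree
  (\<open>central_simple_sc_iff\<close>).\<close>

definition simple_central :: "('k::field, 'a) module => bool" where
  "simple_central A \<longleftrightarrow> kalg A \<and> \<one>\<^bsub>A\<^esub> \<noteq> \<zero>\<^bsub>A\<^esub> \<and>
     (\<forall>I. ideal I A \<longrightarrow> I = {\<zero>\<^bsub>A\<^esub>} \<or> I = carrier A) \<and>
     (\<forall>z\<in>carrier A. (\<forall>x\<in>carrier A. z \<otimes>\<^bsub>A\<^esub> x = x \<otimes>\<^bsub>A\<^esub> z) \<longrightarrow> (\<exists>c. z = c \<odot>\<^bsub>A\<^esub> \<one>\<^bsub>A\<^esub>))"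

lemma central_simple_imp_simple_central: "central_simple A ==> simple_central A"
  by (simp add: central_simple_def simple_central_def k_algebra_iff)

text \<open>The kernel is an ideal that does not contain the unit, hence zero by simplicity. This
  takes the place of every dimension count: for an isomorphism it is enough that the map be
  onto.\<close>

lemma kalg_hom_iso_rel:
  assumes f: "kalg_hom A B f" and simple: "simple_central A" and nz: "\<one>\<^bsub>B\<^esub> \<noteq> \<zero>\<^bsub>B\<^esub>"
    and surj: "\<And>y. y \<in> carrier B ==> \<exists>x\<in>carrier A. y = f x"
  shows "iso_rel A B"
proof -
  interpret f: kalg_hom A B f by fact
  let ?K = "{x \<in> carrier A. f x = \<zero>\<^bsub>B\<^esub>}"
  have neg: "f (\<ominus>\<^bsub>A\<^esub> x) = \<ominus>\<^bsub>B\<^esub> f x" if "x \<in> carrier A" for x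
    using that by (simp add: f.S.minus_smult f.T.minus_smult f.hom_smult)
  have "ideal ?K A"
  proof (rule idealI)
    show "subgroup ?K (add_monoid A)"
      by (rule subgroup.intro)
        (auto simp: f.hom_add f.hom_zero neg simp flip: a_inv_def)
  qed (auto simp: f.hom_mult f.S.ring_axioms)
  moreover have "\<one>\<^bsub>A\<^esub> \<notin> ?K"
    using nz by (simp add: f.hom_one)
  ultimately have K: "?K = {\<zero>\<^bsub>A\<^esub>}"
    using simple unfolding simple_central_def by blast
  have "inj_on f (carrier A)"
  proof (rule inj_onI)
    fix x y assume xy: "x \<in> carrier A" "y \<in> carrier A" "f x = f y"
    then have "x \<ominus>\<^bsub>A\<^esub> y \<in> ?K"
      by (auto simp: f.S.minus_eq f.hom_add neg f.T.r_neg)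
    then show "x = y"
      using K xy f.S.r_right_minus_eq by auto
  qed
  then have "bij_betw f (carrier A) (carrier B)"
    using surj by (auto simp: bij_betw_def)
  then show ?thesis by (rule iso_relI[OF f])
qed

lemma simple_central_transport:
  assumes A: "simple_central A" and f: "kalg_hom A B f" and bij: "bij_betw f (carrier A) (carrier B)"
  shows "simple_central B"
proof -
  interpret f: kalg_hom A B f by fact
  have inj: "x = y" if "f x = f y" "x \<in> carrier A" "y \<in> carrier A" for x y
    using that bij by (auto simp: bij_betw_def inj_on_def)
  have surj: "\<exists>x\<in>carrier A. y = f x" if "y \<in> carrier B" for y
    using that bij by (auto simp: bij_betw_def)
  have ideal: "I = {\<zero>\<^bsub>B\<^esub>} \<or> I = carrier B" if I: "ideal I B" for I
  proof -
    interpret I: ideal I B by fact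
    let ?J = "{x \<in> carrier A. f x \<in> I}"
    have neg: "f (\<ominus>\<^bsub>A\<^esub> x) = \<ominus>\<^bsub>B\<^esub> f x" if "x \<in> carrier A" for x
      using that by (simp add: f.S.minus_smult f.T.minus_smult f.hom_smult)
    have "ideal ?J A"
    proof (rule idealI)
      show "subgroup ?J (add_monoid A)"
        by (rule subgroup.intro)
          (auto simp: f.hom_add f.hom_zero neg simp flip: a_inv_def)
    qed (auto simp: f.hom_mult f.S.ring_axioms I.I_l_closed I.I_r_closed)
    then have "?J = {\<zero>\<^bsub>A\<^esub>} \<or> ?J = carrier A"
      using A by (auto simp: simple_central_def)
    moreover have "I = f ` ?J"
    proof (intro equalityI subsetI)
      fix y assume "y \<in> I"
      then show "y \<in> f ` ?J" using surj[of y] I.a_subset by auto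
    qed auto
    moreover have "f ` carrier A = carrier B" using bij by (auto simp: bij_betw_def)
    ultimately show ?thesis by (elim disjE) (simp_all add: f.hom_zero)
  qed
  have center: "\<exists>c. z = c \<odot>\<^bsub>B\<^esub> \<one>\<^bsub>B\<^esub>" if z: "z \<in> carrier B" "\<forall>x\<in>carrier B. z \<otimes>\<^bsub>B\<^esub> x = x \<otimes>\<^bsub>B\<^esub> z" for z
  proof -
    obtain w where w: "w \<in> carrier A" "z = f w" using surj z by blast
    have "w \<otimes>\<^bsub>A\<^esub> x = x \<otimes>\<^bsub>A\<^esub> w" if "x \<in> carrier A" for x
      using that w z by (intro inj) (auto simp: f.hom_mult)
    then obtain c where "w = c \<odot>\<^bsub>A\<^esub> \<one>\<^bsub>A\<^esub>" using A w by (auto simp: simple_central_def)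
    then show ?thesis using w by (auto simp: f.hom_smult f.hom_one)
  qed
  have "\<one>\<^bsub>B\<^esub> \<noteq> \<zero>\<^bsub>B\<^esub>"
    using A inj[of "\<one>\<^bsub>A\<^esub>" "\<zero>\<^bsub>A\<^esub>"] by (auto simp: simple_central_def f.hom_one f.hom_zero)
  then show ?thesis
    unfolding simple_central_def using f.T.kalg_axioms ideal center by simp
qed

section \<open>Matrix algebras and Brauer equivalence\<close>

lemma carrier_matrix: "carrier (matrix_algebra n A) = {..<n} \<times> {..<n} \<rightarrow>\<^sub>E carrier A"
  by (simp add: matrix_algebra_def)

lemma matrix_entry [simp]:
  assumes "i < n" "j < n"
  shows "(P \<otimes>\<^bsub>matrix_algebra n A\<^esub> Q) (i, j) = (\<Oplus>\<^bsub>A\<^esub>l\<in>{..<n}. P (i, l) \<otimes>\<^bsub>A\<^esub> Q (l, j))"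
    and "(P \<oplus>\<^bsub>matrix_algebra n A\<^esub> Q) (i, j) = P (i, j) \<oplus>\<^bsub>A\<^esub> Q (i, j)"
    and "(c \<odot>\<^bsub>matrix_algebra n A\<^esub> P) (i, j) = c \<odot>\<^bsub>A\<^esub> P (i, j)"
    and "\<one>\<^bsub>matrix_algebra n A\<^esub> (i, j) = (if i = j then \<one>\<^bsub>A\<^esub> else \<zero>\<^bsub>A\<^esub>)"
    and "\<zero>\<^bsub>matrix_algebra n A\<^esub> (i, j) = \<zero>\<^bsub>A\<^esub>"
  using assms by (simp_all add: matrix_algebra_def)

lemma matrix_entry_closed [simp]:
  "P \<in> carrier (matrix_algebra n A) ==> i < n ==> j < n ==> P (i, j) \<in> carrier A"
  by (auto simp: carrier_matrix)

lemma matrix_eqI: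
  assumes "P \<in> carrier (matrix_algebra n A)" "Q \<in> carrier (matrix_algebra n A)"
    and "\<And>i j. i < n ==> j < n ==> P (i, j) = Q (i, j)"
  shows "P = Q"
  using assms unfolding carrier_matrix by (intro PiE_ext) auto

lemma matrixI:
  "(\<And>i j. i < n ==> j < n ==> f i j \<in> carrier A) ==>
    (\<lambda>(i, j)\<in>{..<n} \<times> {..<n}. f i j) \<in> carrier (matrix_algebra n A)"
  by (auto simp: carrier_matrix)

context kalg
begin

lemma matrix_smult_closed:
  "P \<in> carrier (matrix_algebra n A) ==> c \<odot>\<^bsub>matrix_algebra n A\<^esub> P \<in> carrier (matrix_algebra n A)"
  unfolding carrier_matrix by (auto simp: matrix_algebra_def PiE_mem)

lemma matrix_add_mult_closed:
  assumes "P \<in> carrier (matrix_algebra n A)" "Q \<in> carrier (matrix_algebra n A)"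
  shows "P \<oplus>\<^bsub>matrix_algebra n A\<^esub> Q \<in> carrier (matrix_algebra n A)"
    and "P \<otimes>\<^bsub>matrix_algebra n A\<^esub> Q \<in> carrier (matrix_algebra n A)"
proof -
  have "P (i, j) \<in> carrier A" "Q (i, j) \<in> carrier A" if "i < n" "j < n" for i j
    using that assms by auto
  then show "P \<oplus>\<^bsub>matrix_algebra n A\<^esub> Q \<in> carrier (matrix_algebra n A)"
    "P \<otimes>\<^bsub>matrix_algebra n A\<^esub> Q \<in> carrier (matrix_algebra n A)"
    unfolding carrier_matrix by (auto simp: matrix_algebra_def intro!: finsum_closed)
qed

lemmas matrix_closed = matrix_add_mult_closed matrix_smult_closed

lemma matrix_closed0: "\<one>\<^bsub>matrix_algebra n A\<^esub> \<in> carrier (matrix_algebra n A)"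
    "\<zero>\<^bsub>matrix_algebra n A\<^esub> \<in> carrier (matrix_algebra n A)"
  by (auto simp: matrix_algebra_def)

lemma kalg_matrix: "kalg (matrix_algebra n A)"
proof -
  let ?M = "matrix_algebra n A"
  have assoc: "(P \<otimes>\<^bsub>?M\<^esub> Q) \<otimes>\<^bsub>?M\<^esub> R = P \<otimes>\<^bsub>?M\<^esub> (Q \<otimes>\<^bsub>?M\<^esub> R)"
    if PQR: "P \<in> carrier ?M" "Q \<in> carrier ?M" "R \<in> carrier ?M" for P Q R
  proof (rule matrix_eqI[of _ n A])
    fix i j assume ij: "i < n" "j < n"
    have e: "P (a, b) \<in> carrier A" "Q (a, b) \<in> carrier A" "R (a, b) \<in> carrier A"
      if "a < n" "b < n" for a b
      using that PQR by auto
    have "((P \<otimes>\<^bsub>?M\<^esub> Q) \<otimes>\<^bsub>?M\<^esub> R) (i, j) =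
        (\<Oplus>l\<in>{..<n}. (\<Oplus>k\<in>{..<n}. P (i, k) \<otimes> Q (k, l)) \<otimes> R (l, j))"
      using ij e by (auto intro!: finsum_cong' finsum_closed)
    also have "\<dots> = (\<Oplus>l\<in>{..<n}. \<Oplus>k\<in>{..<n}. P (i, k) \<otimes> (Q (k, l) \<otimes> R (l, j)))"
    proof (rule finsum_cong')
      fix l assume "l \<in> {..<n}"
      then have "(\<Oplus>k\<in>{..<n}. P (i, k) \<otimes> Q (k, l)) \<otimes> R (l, j) = (\<Oplus>k\<in>{..<n}. P (i, k) \<otimes> Q (k, l) \<otimes> R (l, j))"
        using ij e by (intro finsum_ldistr) auto
      also have "\<dots> = (\<Oplus>k\<in>{..<n}. P (i, k) \<otimes> (Q (k, l) \<otimes> R (l, j)))"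
        using ij e \<open>l \<in> {..<n}\<close> by (intro finsum_cong') (auto simp: m_assoc)
      finally show "(\<Oplus>k\<in>{..<n}. P (i, k) \<otimes> Q (k, l)) \<otimes> R (l, j) =
        (\<Oplus>k\<in>{..<n}. P (i, k) \<otimes> (Q (k, l) \<otimes> R (l, j)))" .
    qed (use ij e in \<open>auto intro!: finsum_closed\<close>)
    also have "\<dots> = (\<Oplus>k\<in>{..<n}. \<Oplus>l\<in>{..<n}. P (i, k) \<otimes> (Q (k, l) \<otimes> R (l, j)))"
      using ij e by (intro finsum_swap) auto
    also have "\<dots> = (\<Oplus>k\<in>{..<n}. P (i, k) \<otimes> (\<Oplus>l\<in>{..<n}. Q (k, l) \<otimes> R (l, j)))"
      using ij e by (intro finsum_cong' finsum_rdistr[symmetric]) (auto intro!: finsum_closed)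
    also have "\<dots> = (P \<otimes>\<^bsub>?M\<^esub> (Q \<otimes>\<^bsub>?M\<^esub> R)) (i, j)"
      using ij e by (auto intro!: finsum_cong' finsum_closed)
    finally show "((P \<otimes>\<^bsub>?M\<^esub> Q) \<otimes>\<^bsub>?M\<^esub> R) (i, j) = (P \<otimes>\<^bsub>?M\<^esub> (Q \<otimes>\<^bsub>?M\<^esub> R)) (i, j)" .
  qed (intro matrix_closed that)+
  have one: "\<one>\<^bsub>?M\<^esub> \<otimes>\<^bsub>?M\<^esub> P = P" "P \<otimes>\<^bsub>?M\<^esub> \<one>\<^bsub>?M\<^esub> = P" if P: "P \<in> carrier ?M" for P
  proof -
    have e: "P (a, b) \<in> carrier A" if "a < n" "b < n" for a b
      using that P by auto
    show "\<one>\<^bsub>?M\<^esub> \<otimes>\<^bsub>?M\<^esub> P = P"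
    proof (rule matrix_eqI[of _ n A])
      fix i j assume ij: "i < n" "j < n"
      then have "(\<one>\<^bsub>?M\<^esub> \<otimes>\<^bsub>?M\<^esub> P) (i, j) = (\<Oplus>l\<in>{..<n}. (if i = l then \<one> else \<zero>) \<otimes> P (l, j))"
        using e by (auto intro!: finsum_cong')
      also have "\<dots> = P (i, j)"
        using ij e by (subst finsum_delta[of _ i]) auto
      finally show "(\<one>\<^bsub>?M\<^esub> \<otimes>\<^bsub>?M\<^esub> P) (i, j) = P (i, j)" .
    qed (intro matrix_closed matrix_closed0 that)+
    show "P \<otimes>\<^bsub>?M\<^esub> \<one>\<^bsub>?M\<^esub> = P"
    proof (rule matrix_eqI[of _ n A])
      fix i j assume ij: "i < n" "j < n"
      then have "(P \<otimes>\<^bsub>?M\<^esub> \<one>\<^bsub>?M\<^esub>) (i, j) = (\<Oplus>l\<in>{..<n}. P (i, l) \<otimes> (if l = j then \<one> else \<zero>))"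
        using e by (auto intro!: finsum_cong')
      also have "\<dots> = P (i, j)"
        using ij e by (subst finsum_delta[of _ j]) auto
      finally show "(P \<otimes>\<^bsub>?M\<^esub> \<one>\<^bsub>?M\<^esub>) (i, j) = P (i, j)" .
    qed (intro matrix_closed matrix_closed0 that)+
  qed
  have entry: "x (i, j) \<in> carrier A" if "x \<in> carrier ?M" "i < n" "j < n" for x i j
    using that by auto
  note cl = matrix_closed matrix_closed0 assoc one
  show ?thesis
  proof (rule kalgI)
    fix x y z assume "x \<in> carrier ?M" "y \<in> carrier ?M" "z \<in> carrier ?M"
    note xyz = this
    show "x \<oplus>\<^bsub>?M\<^esub> y \<oplus>\<^bsub>?M\<^esub> z = x \<oplus>\<^bsub>?M\<^esub> (y \<oplus>\<^bsub>?M\<^esub> z)"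
      by (rule matrix_eqI[of _ n A]) (simp_all add: xyz cl entry a_assoc)
    show "(x \<oplus>\<^bsub>?M\<^esub> y) \<otimes>\<^bsub>?M\<^esub> z = x \<otimes>\<^bsub>?M\<^esub> z \<oplus>\<^bsub>?M\<^esub> y \<otimes>\<^bsub>?M\<^esub> z"
    proof (rule matrix_eqI[of _ n A])
      fix i j assume ij: "i < n" "j < n"
      have "((x \<oplus>\<^bsub>?M\<^esub> y) \<otimes>\<^bsub>?M\<^esub> z) (i, j) = (\<Oplus>l\<in>{..<n}. x (i, l) \<otimes> z (l, j) \<oplus> y (i, l) \<otimes> z (l, j))"
        unfolding matrix_entry(1)[OF ij] using ij xyz by (intro finsum_cong') (simp_all add: l_distr entry Pi_def)
      also have "\<dots> = (\<Oplus>l\<in>{..<n}. x (i, l) \<otimes> z (l, j)) \<oplus> (\<Oplus>l\<in>{..<n}. y (i, l) \<otimes> z (l, j))"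
        using ij xyz by (intro finsum_addf) (auto simp: entry)
      finally show "((x \<oplus>\<^bsub>?M\<^esub> y) \<otimes>\<^bsub>?M\<^esub> z) (i, j) = (x \<otimes>\<^bsub>?M\<^esub> z \<oplus>\<^bsub>?M\<^esub> y \<otimes>\<^bsub>?M\<^esub> z) (i, j)"
        unfolding matrix_entry[OF ij] .
    qed (simp_all add: xyz cl)
    show "z \<otimes>\<^bsub>?M\<^esub> (x \<oplus>\<^bsub>?M\<^esub> y) = z \<otimes>\<^bsub>?M\<^esub> x \<oplus>\<^bsub>?M\<^esub> z \<otimes>\<^bsub>?M\<^esub> y"
    proof (rule matrix_eqI[of _ n A])
      fix i j assume ij: "i < n" "j < n"
      have "(z \<otimes>\<^bsub>?M\<^esub> (x \<oplus>\<^bsub>?M\<^esub> y)) (i, j) = (\<Oplus>l\<in>{..<n}. z (i, l) \<otimes> x (l, j) \<oplus> z (i, l) \<otimes> y (l, j))"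
        unfolding matrix_entry(1)[OF ij] using ij xyz by (intro finsum_cong') (simp_all add: r_distr entry Pi_def)
      also have "\<dots> = (\<Oplus>l\<in>{..<n}. z (i, l) \<otimes> x (l, j)) \<oplus> (\<Oplus>l\<in>{..<n}. z (i, l) \<otimes> y (l, j))"
        using ij xyz by (intro finsum_addf) (auto simp: entry)
      finally show "(z \<otimes>\<^bsub>?M\<^esub> (x \<oplus>\<^bsub>?M\<^esub> y)) (i, j) = (z \<otimes>\<^bsub>?M\<^esub> x \<oplus>\<^bsub>?M\<^esub> z \<otimes>\<^bsub>?M\<^esub> y) (i, j)"
        unfolding matrix_entry[OF ij] .
    qed (simp_all add: xyz cl)
  next
    fix x y c assume "x \<in> carrier ?M" "y \<in> carrier ?M"
    note xyz = this
    show "x \<oplus>\<^bsub>?M\<^esub> y = y \<oplus>\<^bsub>?M\<^esub> x"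
      by (rule matrix_eqI[of _ n A]) (simp_all add: xyz cl entry a_comm)
    show "c \<odot>\<^bsub>?M\<^esub> (x \<oplus>\<^bsub>?M\<^esub> y) = c \<odot>\<^bsub>?M\<^esub> x \<oplus>\<^bsub>?M\<^esub> c \<odot>\<^bsub>?M\<^esub> y"
      by (rule matrix_eqI[of _ n A]) (simp_all add: xyz cl entry smult_radd)
    show "(c \<odot>\<^bsub>?M\<^esub> x) \<otimes>\<^bsub>?M\<^esub> y = c \<odot>\<^bsub>?M\<^esub> (x \<otimes>\<^bsub>?M\<^esub> y)"
    proof (rule matrix_eqI[of _ n A])
      fix i j assume ij: "i < n" "j < n"
      have "((c \<odot>\<^bsub>?M\<^esub> x) \<otimes>\<^bsub>?M\<^esub> y) (i, j) = (\<Oplus>l\<in>{..<n}. c \<odot> (x (i, l) \<otimes> y (l, j)))"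
        using ij xyz by (auto intro!: finsum_cong' simp: smult_lmult entry)
      then show "((c \<odot>\<^bsub>?M\<^esub> x) \<otimes>\<^bsub>?M\<^esub> y) (i, j) = (c \<odot>\<^bsub>?M\<^esub> (x \<otimes>\<^bsub>?M\<^esub> y)) (i, j)"
        using ij xyz smult_finsum[of "{..<n}" "\<lambda>l. x (i, l) \<otimes> y (l, j)" c] by (simp add: entry Pi_def)
    qed (simp_all add: xyz cl)
    show "x \<otimes>\<^bsub>?M\<^esub> (c \<odot>\<^bsub>?M\<^esub> y) = c \<odot>\<^bsub>?M\<^esub> (x \<otimes>\<^bsub>?M\<^esub> y)"
    proof (rule matrix_eqI[of _ n A])
      fix i j assume ij: "i < n" "j < n"
      have "(x \<otimes>\<^bsub>?M\<^esub> (c \<odot>\<^bsub>?M\<^esub> y)) (i, j) = (\<Oplus>l\<in>{..<n}. c \<odot> (x (i, l) \<otimes> y (l, j)))"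
        using ij xyz by (auto intro!: finsum_cong' simp: smult_rmult entry)
      then show "(x \<otimes>\<^bsub>?M\<^esub> (c \<odot>\<^bsub>?M\<^esub> y)) (i, j) = (c \<odot>\<^bsub>?M\<^esub> (x \<otimes>\<^bsub>?M\<^esub> y)) (i, j)"
        using ij xyz smult_finsum[of "{..<n}" "\<lambda>l. x (i, l) \<otimes> y (l, j)" c] by (simp add: entry Pi_def)
    qed (simp_all add: xyz cl)
  next
    fix x c d assume "x \<in> carrier ?M"
    note xyz = this
    show "\<zero>\<^bsub>?M\<^esub> \<oplus>\<^bsub>?M\<^esub> x = x"
      by (rule matrix_eqI[of _ n A]) (simp_all add: xyz cl entry)
    have "(- 1) \<odot> y \<oplus> y = \<zero>" if "y \<in> carrier A" for y
      using that l_neg[of y] by (simp add: minus_smult)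
    then show "(- 1) \<odot>\<^bsub>?M\<^esub> x \<oplus>\<^bsub>?M\<^esub> x = \<zero>\<^bsub>?M\<^esub>"
      by (intro matrix_eqI[of _ n A]) (simp_all add: xyz cl entry)
    show "(c + d) \<odot>\<^bsub>?M\<^esub> x = c \<odot>\<^bsub>?M\<^esub> x \<oplus>\<^bsub>?M\<^esub> d \<odot>\<^bsub>?M\<^esub> x"
      by (rule matrix_eqI[of _ n A]) (simp_all add: xyz cl entry smult_ladd)
    show "c \<odot>\<^bsub>?M\<^esub> (d \<odot>\<^bsub>?M\<^esub> x) = (c * d) \<odot>\<^bsub>?M\<^esub> x"
      by (rule matrix_eqI[of _ n A]) (simp_all add: xyz cl entry smult_smult)
    show "1 \<odot>\<^bsub>?M\<^esub> x = x"
      by (rule matrix_eqI[of _ n A]) (simp_all add: xyz cl entry)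
  qed (simp_all add: cl)
qed

lemma finsum_matrix_entry:
  assumes "finite I" "\<And>i. i \<in> I ==> P i \<in> carrier (matrix_algebra n A)" "a < n" "b < n"
  shows "(finsum (matrix_algebra n A) P I) (a, b) = (\<Oplus>i\<in>I. P i (a, b))"
proof -
  interpret M: kalg "matrix_algebra n A" by (rule kalg_matrix)
  show ?thesis
    using assms
    by (intro finsum_additive[where g = "\<lambda>Q. Q (a, b)"] M.abelian_monoid_axioms abelian_monoid_axioms)
      auto
qed

end

lemma iso_rel_matrix_cong:
  assumes "iso_rel A B" "kalg A" "kalg B"
  shows "iso_rel (matrix_algebra n A) (matrix_algebra n B)"
proof -
  obtain f where f: "kalg_hom A B f" "bij_betw f (carrier A) (carrier B)"
    using assms by (rule iso_relE)
  interpret f: kalg_hom A B f by fact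
  let ?M = "matrix_algebra n A" and ?N = "matrix_algebra n B"
  let ?F = "\<lambda>P. \<lambda>(i, j)\<in>{..<n} \<times> {..<n}. f (P (i, j))"
  have cl: "?F P \<in> carrier ?N" if "P \<in> carrier ?M" for P
    using that by (intro matrixI) auto
  have hom: "kalg_hom ?M ?N ?F"
  proof (intro kalg_hom.intro kalg_hom_axioms.intro f.S.kalg_matrix f.T.kalg_matrix)
    fix P Q c assume PQ: "P \<in> carrier ?M" "Q \<in> carrier ?M"
    show "?F (P \<oplus>\<^bsub>?M\<^esub> Q) = ?F P \<oplus>\<^bsub>?N\<^esub> ?F Q"
      using PQ by (intro matrix_eqI[of _ n B] cl f.T.matrix_closed f.S.matrix_closed) (simp_all add: f.hom_add)
    show "?F (P \<otimes>\<^bsub>?M\<^esub> Q) = ?F P \<otimes>\<^bsub>?N\<^esub> ?F Q"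
    proof (intro matrix_eqI[of _ n B] cl f.T.matrix_closed f.S.matrix_closed PQ)
      fix i j assume "i < n" "j < n"
      then show "?F (P \<otimes>\<^bsub>?M\<^esub> Q) (i, j) = (?F P \<otimes>\<^bsub>?N\<^esub> ?F Q) (i, j)"
        using PQ by (auto simp: f.hom_finsum f.hom_mult Pi_def intro!: f.T.finsum_cong')
    qed
  next
    show "?F \<one>\<^bsub>?M\<^esub> = \<one>\<^bsub>?N\<^esub>"
      by (intro matrix_eqI[of _ n B] cl f.T.matrix_closed0 f.S.matrix_closed0)
        (simp_all add: f.hom_one f.hom_zero)
  next
    fix P c assume PQ: "P \<in> carrier ?M"
    show "?F (c \<odot>\<^bsub>?M\<^esub> P) = c \<odot>\<^bsub>?N\<^esub> ?F P"
      by (rule matrix_eqI[OF cl[OF f.S.matrix_closed(3)[OF PQ]] f.T.matrix_closed(3)[OF cl[OF PQ]]])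
        (use PQ in \<open>simp add: f.hom_smult\<close>)
  qed (rule cl)
  have inj: "inj_on f (carrier A)" and surj: "f ` carrier A = carrier B"
    using f(2) by (auto simp: bij_betw_def)
  have "inj_on ?F (carrier ?M)"
  proof (rule inj_onI)
    fix P Q assume PQ: "P \<in> carrier ?M" "Q \<in> carrier ?M" "?F P = ?F Q"
    show "P = Q"
    proof (rule matrix_eqI[OF PQ(1,2)])
      fix i j assume ij: "i < n" "j < n"
      then have "f (P (i, j)) = f (Q (i, j))"
        using fun_cong[OF PQ(3), of "(i, j)"] by simp
      then show "P (i, j) = Q (i, j)"
        using inj ij PQ by (meson inj_onD matrix_entry_closed)
    qed
  qed
  moreover have "R \<in> ?F ` carrier ?M" if R: "R \<in> carrier ?N" for R
  proof
    let ?P = "\<lambda>(i, j)\<in>{..<n} \<times> {..<n}. inv_into (carrier A) f (R (i, j))"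
    have R': "R (i, j) \<in> f ` carrier A" if "i < n" "j < n" for i j
      unfolding surj using matrix_entry_closed[OF R that] .
    show P: "?P \<in> carrier ?M"
      using R' by (intro matrixI) (auto intro: inv_into_into)
    show "R = ?F ?P"
      using R' by (intro matrix_eqI[OF R cl[OF P]]) (simp_all add: f_inv_into_f)
  qed
  ultimately have "bij_betw ?F (carrier ?M) (carrier ?N)"
    using cl by (auto simp: bij_betw_def)
  with hom show ?thesis by (rule iso_relI)
qed

lemma mult_add_less: "u < l ==> v < m ==> u * m + v < l * (m::nat)"
proof -
  assume "u < l" "v < m"
  then have "u * m + v < Suc u * m" by simp
  also have "\<dots> \<le> l * m" using \<open>u < l\<close> by (intro mult_right_mono) auto
  finally show ?thesis .
qed

lemma div_less_of_mult: "x < l * m ==> x div m < (l::nat)"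
  by (simp add: less_mult_imp_div_less)

lemma mod_less_of_mult: "x < l * m ==> x mod m < (m::nat)"
  by (cases "m = 0") auto

text \<open>Block matrices: \<open>x div m\<close> names the block and \<open>x mod m\<close> the
  place inside it. This is what allows two Brauer equivalences with different matrix sizes to be
  composed.\<close>

lemma iso_rel_matrix_matrix:
  assumes A: "kalg A"
  shows "iso_rel (matrix_algebra l (matrix_algebra m A)) (matrix_algebra (l * m) A)"
proof -
  interpret A: kalg A by fact
  let ?M = "matrix_algebra m A"
  let ?L = "matrix_algebra l ?M" and ?N = "matrix_algebra (l * m) A"
  interpret M: kalg ?M by (rule A.kalg_matrix)
  let ?F = "\<lambda>P. \<lambda>(x, y)\<in>{..<l * m} \<times> {..<l * m}. P (x div m, y div m) (x mod m, y mod m)"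
  have entry: "P (x div m, y div m) (x mod m, y mod m) \<in> carrier A"
    if "P \<in> carrier ?L" "x < l * m" "y < l * m" for P x y
    using matrix_entry_closed[OF matrix_entry_closed[OF that(1)], of "x div m" "y div m" "x mod m" "y mod m"]
      that(2,3) by (simp add: div_less_of_mult mod_less_of_mult)
  note dm = div_less_of_mult mod_less_of_mult
  have cl: "?F P \<in> carrier ?N" if "P \<in> carrier ?L" for P
    using that by (intro matrixI entry) auto
  have hom: "kalg_hom ?L ?N ?F"
  proof (intro kalg_hom.intro kalg_hom_axioms.intro A.kalg_matrix M.kalg_matrix)
    fix P Q c assume PQ: "P \<in> carrier ?L" "Q \<in> carrier ?L"
    show "?F (P \<oplus>\<^bsub>?L\<^esub> Q) = ?F P \<oplus>\<^bsub>?N\<^esub> ?F Q"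
      using PQ by (intro matrix_eqI[of _ "l * m" A] cl A.matrix_closed M.matrix_closed) (simp_all add: dm)
    show "?F (P \<otimes>\<^bsub>?L\<^esub> Q) = ?F P \<otimes>\<^bsub>?N\<^esub> ?F Q"
    proof (intro matrix_eqI[of _ "l * m" A] cl A.matrix_closed M.matrix_closed PQ)
      fix i j assume ij: "i < l * m" "j < l * m"
      have e: "P (a, b) \<in> carrier ?M" "Q (a, b) \<in> carrier ?M" if "a < l" "b < l" for a b
        using that PQ by auto
      have e': "P (a, b) (c, d) \<in> carrier A" "Q (a, b) (c, d) \<in> carrier A"
        if "a < l" "b < l" "c < m" "d < m" for a b c d
        using that e by (simp_all add: matrix_entry_closed[of _ m])
      have "?F (P \<otimes>\<^bsub>?L\<^esub> Q) (i, j) =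
          (\<Oplus>\<^bsub>?M\<^esub>u\<in>{..<l}. P (i div m, u) \<otimes>\<^bsub>?M\<^esub> Q (u, j div m)) (i mod m, j mod m)"
        using ij by (simp add: dm)
      also have "\<dots> = (\<Oplus>\<^bsub>A\<^esub>u\<in>{..<l}. (P (i div m, u) \<otimes>\<^bsub>?M\<^esub> Q (u, j div m)) (i mod m, j mod m))"
        using ij e by (intro A.finsum_matrix_entry) (auto simp: dm intro!: A.matrix_closed)
      also have "\<dots> = (\<Oplus>\<^bsub>A\<^esub>u\<in>{..<l}. \<Oplus>\<^bsub>A\<^esub>v\<in>{..<m}. P (i div m, u) (i mod m, v) \<otimes>\<^bsub>A\<^esub> Q (u, j div m) (v, j mod m))"
        using ij e by (intro A.finsum_cong') (auto simp: dm e' intro!: A.finsum_closed)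
      also have "\<dots> = (\<Oplus>\<^bsub>A\<^esub>u\<in>{..<l}. \<Oplus>\<^bsub>A\<^esub>v\<in>{..<m}. ?F P (i, u * m + v) \<otimes>\<^bsub>A\<^esub> ?F Q (u * m + v, j))"
        using ij e by (intro A.finsum_cong') (auto simp: dm mult_add_less e' intro!: A.finsum_closed A.finsum_cong')
      also have "\<dots> = (\<Oplus>\<^bsub>A\<^esub>z\<in>{..<l * m}. ?F P (i, z) \<otimes>\<^bsub>A\<^esub> ?F Q (z, j))"
        using ij PQ by (intro A.finsum_lessThan_mult[symmetric]) (simp add: entry)
      finally show "?F (P \<otimes>\<^bsub>?L\<^esub> Q) (i, j) = (?F P \<otimes>\<^bsub>?N\<^esub> ?F Q) (i, j)"
        using ij by simp
    qed
  next
    show "?F \<one>\<^bsub>?L\<^esub> = \<one>\<^bsub>?N\<^esub>"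
    proof (intro matrix_eqI[of _ "l * m" A] cl A.matrix_closed0 M.matrix_closed0)
      fix i j assume ij: "i < l * m" "j < l * m"
      have "i = j \<longleftrightarrow> i div m = j div m \<and> i mod m = j mod m"
        by (metis div_mult_mod_eq)
      then show "?F \<one>\<^bsub>?L\<^esub> (i, j) = \<one>\<^bsub>?N\<^esub> (i, j)"
        using ij by (auto simp: dm)
    qed
  next
    fix P c assume PQ: "P \<in> carrier ?L"
    show "?F (c \<odot>\<^bsub>?L\<^esub> P) = c \<odot>\<^bsub>?N\<^esub> ?F P"
      by (rule matrix_eqI[OF cl[OF M.matrix_closed(3)[OF PQ]] A.matrix_closed(3)[OF cl[OF PQ]]])
        (use PQ in \<open>simp add: dm\<close>)
  qed (rule cl)
  have "inj_on ?F (carrier ?L)"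
  proof (rule inj_onI)
    fix P Q assume PQ: "P \<in> carrier ?L" "Q \<in> carrier ?L" "?F P = ?F Q"
    show "P = Q"
    proof (rule matrix_eqI[OF PQ(1,2)])
      fix i j assume ij: "i < l" "j < l"
      show "P (i, j) = Q (i, j)"
      proof (rule matrix_eqI[of _ m A])
        fix a b assume "a < m" "b < m"
        then show "P (i, j) (a, b) = Q (i, j) (a, b)"
          using fun_cong[OF PQ(3), of "(i * m + a, j * m + b)"] ij by (simp add: mult_add_less)
      qed (use PQ ij in auto)
    qed
  qed
  moreover have "R \<in> ?F ` carrier ?L" if R: "R \<in> carrier ?N" for R
  proof
    let ?P = "\<lambda>(i, j)\<in>{..<l} \<times> {..<l}. \<lambda>(a, b)\<in>{..<m} \<times> {..<m}. R (i * m + a, j * m + b)"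
    show P: "?P \<in> carrier ?L"
      by (intro matrixI matrix_entry_closed[OF R] mult_add_less)
    show "R = ?F ?P"
    proof (rule matrix_eqI[OF R cl[OF P]])
      fix i j assume "i < l * m" "j < l * m"
      then show "R (i, j) = ?F ?P (i, j)"
        using dm[of i l m] dm[of j l m] by simp
    qed
  qed
  ultimately have "bij_betw ?F (carrier ?L) (carrier ?N)"
    using cl by (auto simp: bij_betw_def)
  with hom show ?thesis by (rule iso_relI)
qed

lemma brauer_equiv_iff:
  "brauer_equiv A B \<longleftrightarrow> (\<exists>m>0. \<exists>n>0. iso_rel (matrix_algebra m A) (matrix_algebra n B))"
  by (simp add: brauer_equiv_def iso_rel_def)

lemma iso_rel_imp_brauer_equiv: "iso_rel A B ==> kalg A ==> kalg B ==> brauer_equiv A B"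
  unfolding brauer_equiv_iff using iso_rel_matrix_cong zero_less_one by blast

lemma brauer_equiv_refl: "kalg A ==> brauer_equiv A A"
  by (simp add: iso_rel_imp_brauer_equiv iso_rel_refl)

lemma brauer_equiv_sym: "brauer_equiv A B ==> kalg A ==> kalg B ==> brauer_equiv B A"
  unfolding brauer_equiv_iff using iso_rel_sym kalg.kalg_matrix by meson

text \<open>The two isomorphisms meet in matrices of size \<open>n * l\<close> over
  \<open>B\<close>: the first is enlarged by \<open>l\<close>, the second by
  \<open>n\<close>.\<close>

lemma brauer_equiv_trans:
  assumes "brauer_equiv A B" "brauer_equiv B C" and k: "kalg A" "kalg B" "kalg C"
  shows "brauer_equiv A C"
proof -
  obtain m n where mn: "m > 0" "n > 0" "iso_rel (matrix_algebra m A) (matrix_algebra n B)"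
    using assms by (auto simp: brauer_equiv_iff)
  obtain l q where lq: "l > 0" "q > 0" "iso_rel (matrix_algebra l B) (matrix_algebra q C)"
    using assms by (auto simp: brauer_equiv_iff)
  note K = k kalg.kalg_matrix
  have 1: "iso_rel (matrix_algebra (l * m) A) (matrix_algebra l (matrix_algebra m A))"
    by (rule iso_rel_sym[OF iso_rel_matrix_matrix]) (intro K)+
  have 2: "iso_rel (matrix_algebra l (matrix_algebra m A)) (matrix_algebra l (matrix_algebra n B))"
    by (intro iso_rel_matrix_cong mn K)
  have 3: "iso_rel (matrix_algebra l (matrix_algebra n B)) (matrix_algebra (n * l) B)"
    unfolding mult.commute[of n l] by (intro iso_rel_matrix_matrix K)
  have 4: "iso_rel (matrix_algebra (n * l) B) (matrix_algebra n (matrix_algebra l B))"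
    by (rule iso_rel_sym[OF iso_rel_matrix_matrix]) (intro K)+
  have 5: "iso_rel (matrix_algebra n (matrix_algebra l B)) (matrix_algebra n (matrix_algebra q C))"
    by (intro iso_rel_matrix_cong lq K)
  have 6: "iso_rel (matrix_algebra n (matrix_algebra q C)) (matrix_algebra (n * q) C)"
    by (intro iso_rel_matrix_matrix K)
  have "iso_rel (matrix_algebra (l * m) A) (matrix_algebra (n * q) C)"
    by (rule iso_rel_trans[OF 1 iso_rel_trans[OF 2 iso_rel_trans[OF 3 iso_rel_trans[OF 4 iso_rel_trans[OF 5 6]]]]])
      (intro K)+
  then show ?thesis
    unfolding brauer_equiv_iff using mn lq by (intro exI[of _ "l * m"] conjI exI[of _ "n * q"]) simp_all
qed

section \<open>Corners and matrix units\<close>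

definition corner :: "('k::field, 'a) module => 'a => ('k, 'a) module" where
  "corner A e = A\<lparr>carrier := {x \<in> carrier A. e \<otimes>\<^bsub>A\<^esub> x = x \<and> x \<otimes>\<^bsub>A\<^esub> e = x}, one := e\<rparr>"

lemma corner_simps [simp]:
  "carrier (corner A e) = {x \<in> carrier A. e \<otimes>\<^bsub>A\<^esub> x = x \<and> x \<otimes>\<^bsub>A\<^esub> e = x}"
  "\<one>\<^bsub>corner A e\<^esub> = e" "\<zero>\<^bsub>corner A e\<^esub> = \<zero>\<^bsub>A\<^esub>" "x \<otimes>\<^bsub>corner A e\<^esub> y = x \<otimes>\<^bsub>A\<^esub> y"
  "x \<oplus>\<^bsub>corner A e\<^esub> y = x \<oplus>\<^bsub>A\<^esub> y" "c \<odot>\<^bsub>corner A e\<^esub> x = c \<odot>\<^bsub>A\<^esub> x"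
  by (simp_all add: corner_def)

context kalg
begin

lemma kalg_corner:
  assumes e: "e \<in> carrier A" "e \<otimes> e = e"
  shows "kalg (corner A e)"
proof -
  have neg: "(- 1) \<odot> y \<oplus> y = \<zero>" "y \<oplus> (- 1) \<odot> y = \<zero>" if "y \<in> carrier A" for y
    using that l_neg[of y] r_neg[of y] by (simp_all add: minus_smult)
  have 1: "e \<otimes> (x \<otimes> y) = x \<otimes> y" if "e \<otimes> x = x" "x \<in> carrier A" "y \<in> carrier A" for x y
    using that e by (simp flip: m_assoc)
  have 2: "(x \<otimes> y) \<otimes> e = x \<otimes> y" if "y \<otimes> e = y" "x \<in> carrier A" "y \<in> carrier A" for x y
    using that e by (simp add: m_assoc)
  show ?thesis
  proof (rule kalgI, goal_cases)
    case (7 x y)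
    then show ?case using 1[of x y] 2[of y x] by simp
  qed (simp_all add: e neg l_distr r_distr a_ac smult_ladd smult_radd smult_smult
      smult_lmult smult_rmult m_assoc)
qed

lemma finsum_corner:
  assumes e: "e \<in> carrier A" "e \<otimes> e = e" and "finite I" "f \<in> I \<rightarrow> carrier (corner A e)"
  shows "finsum (corner A e) f I = finsum A f I"
proof -
  interpret C: kalg "corner A e" by (rule kalg_corner[OF e])
  show ?thesis
    using finsum_additive[OF C.abelian_monoid_axioms abelian_monoid_axioms assms(3,4), of "\<lambda>x. x"]
    by simp
qed

text \<open>A full system of matrix units identifies \<open>A\<close> with matrices over the corner
  at \<open>E 0 0\<close>: the Peirce component of \<open>r\<close> at (i, j) is carried into that
  corner by \<open>E 0 i\<close> on the left and \<open>E j 0\<close> on the right.\<close>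

lemma iso_rel_matrix_corner:
  fixes n :: nat
  assumes Ecl: "\<And>i j. i < n ==> j < n ==> E i j \<in> carrier A"
    and EE: "\<And>i j k l. [|i < n; j < n; k < n; l < n|] ==> E i j \<otimes> E k l = (if j = k then E i l else \<zero>)"
    and Esum: "(\<Oplus>i\<in>{..<n}. E i i) = \<one>" and n: "0 < n"
  shows "iso_rel A (matrix_algebra n (corner A (E 0 0)))"
proof -
  let ?C = "corner A (E 0 0)" and ?M = "matrix_algebra n (corner A (E 0 0))"
  have e: "E 0 0 \<in> carrier A" "E 0 0 \<otimes> E 0 0 = E 0 0" using n by (simp_all add: Ecl EE)
  interpret C: kalg ?C by (rule kalg_corner[OF e])
  have EEr: "E i j \<otimes> (E k l \<otimes> x) = (if j = k then E i l \<otimes> x else \<zero>)"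
    if "i < n" "j < n" "k < n" "l < n" "x \<in> carrier A" for i j k l x
    using that EE[of i j k l] by (simp add: Ecl flip: m_assoc)
  let ?F = "\<lambda>r. \<lambda>(i, j)\<in>{..<n} \<times> {..<n}. E 0 i \<otimes> (r \<otimes> E j 0)"
  have ecl: "E 0 i \<otimes> (r \<otimes> E j 0) \<in> carrier ?C" if "r \<in> carrier A" "i < n" "j < n" for r i j
    using that n by (simp add: Ecl EE EEr m_assoc)
  then have cl: "?F r \<in> carrier ?M" if "r \<in> carrier A" for r
    using that by (intro matrixI)
  have entry: "?F r (i, j) = E 0 i \<otimes> (r \<otimes> E j 0)" if "i < n" "j < n" for r i j
    using that by simp
  \<comment> \<open>Inserting 1 = \<Sum> \<open>E l l\<close> = \<Sum>
    \<open>E l 0 \<otimes> E 0 l\<close> between two factors turns a product into a row-by-column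
    sum over the corner.\<close>
  have insert1: "x \<otimes> y = (\<Oplus>l\<in>{..<n}. (x \<otimes> E l 0) \<otimes> (E 0 l \<otimes> y))" if "x \<in> carrier A" "y \<in> carrier A" for x y
  proof -
    have "(\<Oplus>l\<in>{..<n}. (x \<otimes> E l 0) \<otimes> (E 0 l \<otimes> y)) = (\<Oplus>l\<in>{..<n}. x \<otimes> (E l l \<otimes> y))"
      using that n by (intro finsum_cong') (auto simp: Ecl m_assoc EEr)
    also have "\<dots> = x \<otimes> (\<Oplus>l\<in>{..<n}. E l l \<otimes> y)"
      using that by (intro finsum_rdistr[symmetric]) (auto simp: Ecl)
    also have "(\<Oplus>l\<in>{..<n}. E l l \<otimes> y) = y"
      using that finsum_ldistr[of "{..<n}" y "\<lambda>l. E l l"] by (simp add: Ecl Esum)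
    finally show ?thesis by simp
  qed
  have hom: "kalg_hom A ?M ?F"
  proof (intro kalg_hom.intro kalg_hom_axioms.intro kalg_axioms C.kalg_matrix)
    fix x y assume xy: "x \<in> carrier A" "y \<in> carrier A"
    show "?F (x \<oplus> y) = ?F x \<oplus>\<^bsub>?M\<^esub> ?F y"
    proof (rule matrix_eqI[of _ n ?C])
      fix i j assume "i < n" "j < n"
      then show "?F (x \<oplus> y) (i, j) = (?F x \<oplus>\<^bsub>?M\<^esub> ?F y) (i, j)"
        using xy n by (simp add: l_distr r_distr Ecl)
    qed (use xy cl C.matrix_closed in simp_all)
    show "?F (x \<otimes> y) = ?F x \<otimes>\<^bsub>?M\<^esub> ?F y"
    proof (rule matrix_eqI[of _ n ?C])
      fix i j assume ij: "i < n" "j < n"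
      have mc: "(E 0 i \<otimes> (x \<otimes> E l 0)) \<otimes> (E 0 l \<otimes> (y \<otimes> E j 0)) \<in> carrier ?C" if "l < n" for l
        using C.m_closed[OF ecl[OF xy(1) ij(1) that] ecl[OF xy(2) that ij(2)]] unfolding corner_simps(4) .
      have "(?F x \<otimes>\<^bsub>?M\<^esub> ?F y) (i, j) =
          (\<Oplus>\<^bsub>?C\<^esub>l\<in>{..<n}. (E 0 i \<otimes> (x \<otimes> E l 0)) \<otimes> (E 0 l \<otimes> (y \<otimes> E j 0)))"
        unfolding matrix_entry[OF ij]
      proof (rule C.finsum_cong'[OF refl])
        show "(\<lambda>l. (E 0 i \<otimes> (x \<otimes> E l 0)) \<otimes> (E 0 l \<otimes> (y \<otimes> E j 0))) \<in> {..<n} \<rightarrow> carrier ?C"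
          by (rule Pi_I) (rule mc, simp)
      qed (use ij in simp)
      also have "\<dots> = (\<Oplus>l\<in>{..<n}. (E 0 i \<otimes> (x \<otimes> E l 0)) \<otimes> (E 0 l \<otimes> (y \<otimes> E j 0)))"
        by (intro finsum_corner e Pi_I mc) simp_all
      also have "\<dots> = (\<Oplus>l\<in>{..<n}. ((E 0 i \<otimes> x) \<otimes> E l 0) \<otimes> (E 0 l \<otimes> (y \<otimes> E j 0)))"
        using ij xy n by (intro finsum_cong') (auto simp: Ecl m_assoc)
      also have "\<dots> = (E 0 i \<otimes> x) \<otimes> (y \<otimes> E j 0)"
        using ij xy n by (intro insert1[symmetric]) (auto simp: Ecl)
      also have "\<dots> = ?F (x \<otimes> y) (i, j)"
        using ij xy n by (simp add: Ecl m_assoc)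
      finally show "?F (x \<otimes> y) (i, j) = (?F x \<otimes>\<^bsub>?M\<^esub> ?F y) (i, j)" by simp
    qed (use xy cl C.matrix_closed in simp_all)
  next
    show "?F \<one> = \<one>\<^bsub>?M\<^esub>"
    proof (rule matrix_eqI[of _ n ?C])
      fix i j assume ij: "i < n" "j < n"
      then show "?F \<one> (i, j) = \<one>\<^bsub>?M\<^esub> (i, j)"
        using n by (simp add: Ecl EE)
    qed (use cl C.matrix_closed0 in simp_all)
  next
    fix x c assume x: "x \<in> carrier A"
    show "?F (c \<odot> x) = c \<odot>\<^bsub>?M\<^esub> ?F x"
    proof (rule matrix_eqI[of _ n ?C])
      fix i j assume "i < n" "j < n"
      then show "?F (c \<odot> x) (i, j) = (c \<odot>\<^bsub>?M\<^esub> ?F x) (i, j)"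
        using x n by (simp add: smult_lmult smult_rmult Ecl)
    qed (use x cl C.matrix_closed in simp_all)
  qed (rule cl)
  \<comment> \<open>Moving the entries back with \<open>E i 0\<close> and \<open>E 0 j\<close> gives
    the components of \<open>r\<close> between \<open>E i i\<close> and \<open>E j j\<close>, which
    add up to \<open>r\<close>; so \<open>r\<close> is determined by its matrix.\<close>
  have expand: "r = (\<Oplus>i\<in>{..<n}. \<Oplus>j\<in>{..<n}. E i 0 \<otimes> ((E 0 i \<otimes> (r \<otimes> E j 0)) \<otimes> E 0 j))"
    if r: "r \<in> carrier A" for r
  proof -
    have inner: "E i i \<otimes> r = (\<Oplus>j\<in>{..<n}. E i 0 \<otimes> ((E 0 i \<otimes> (r \<otimes> E j 0)) \<otimes> E 0 j))" if "i < n" for i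
    proof -
      have "E i i \<otimes> r = E i i \<otimes> r \<otimes> \<one>" using r that by (simp add: Ecl)
      also have "\<dots> = (\<Oplus>j\<in>{..<n}. (E i i \<otimes> r \<otimes> E j 0) \<otimes> (E 0 j \<otimes> \<one>))"
        using r that by (intro insert1) (auto simp: Ecl)
      also have "\<dots> = (\<Oplus>j\<in>{..<n}. E i 0 \<otimes> ((E 0 i \<otimes> (r \<otimes> E j 0)) \<otimes> E 0 j))"
        using r that n by (intro finsum_cong') (auto simp: Ecl EEr m_assoc)
      finally show ?thesis .
    qed
    have "r = (\<Oplus>i\<in>{..<n}. E i i \<otimes> r)"
      using r finsum_ldistr[of "{..<n}" r "\<lambda>i. E i i"] by (simp add: Ecl Esum)
    also have "\<dots> = (\<Oplus>i\<in>{..<n}. \<Oplus>j\<in>{..<n}. E i 0 \<otimes> ((E 0 i \<otimes> (r \<otimes> E j 0)) \<otimes> E 0 j))"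
      using r n by (intro finsum_cong' inner) (auto simp: Ecl intro!: finsum_closed)
    finally show ?thesis .
  qed
  have "inj_on ?F (carrier A)"
  proof (rule inj_onI)
    fix r s assume rs: "r \<in> carrier A" "s \<in> carrier A" "?F r = ?F s"
    have eq: "E 0 i \<otimes> (r \<otimes> E j 0) = E 0 i \<otimes> (s \<otimes> E j 0)" if "i < n" "j < n" for i j
      using fun_cong[OF rs(3), of "(i, j)"] that by simp
    have "r = (\<Oplus>i\<in>{..<n}. \<Oplus>j\<in>{..<n}. E i 0 \<otimes> ((E 0 i \<otimes> (r \<otimes> E j 0)) \<otimes> E 0 j))"
      by (rule expand[OF rs(1)])
    also have "\<dots> = (\<Oplus>i\<in>{..<n}. \<Oplus>j\<in>{..<n}. E i 0 \<otimes> ((E 0 i \<otimes> (s \<otimes> E j 0)) \<otimes> E 0 j))"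
      using rs n by (intro finsum_cong') (auto simp: Ecl eq intro!: finsum_closed)
    also have "\<dots> = s"
      by (rule expand[OF rs(2), symmetric])
    finally show "r = s" .
  qed
  moreover have "P \<in> ?F ` carrier A" if P: "P \<in> carrier ?M" for P
  proof
    have Pc: "P (i, j) \<in> carrier A" "E 0 0 \<otimes> P (i, j) = P (i, j)" "P (i, j) \<otimes> E 0 0 = P (i, j)"
      if "i < n" "j < n" for i j
      using matrix_entry_closed[OF P that] by simp_all
    \<comment> \<open>The preimage puts every entry of the corner back to its place (i, j) in
      \<open>A\<close>.\<close>
    let ?r = "\<Oplus>i\<in>{..<n}. \<Oplus>j\<in>{..<n}. E i 0 \<otimes> (P (i, j) \<otimes> E 0 j)"
    show r: "?r \<in> carrier A" using n by (auto intro!: finsum_closed simp: Ecl Pc)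
    show "P = ?F ?r"
    proof (rule matrix_eqI[OF P cl[OF r]])
      fix k l assume kl: "k < n" "l < n"
      have in1: "(\<Oplus>j\<in>{..<n}. E i 0 \<otimes> (P (i, j) \<otimes> E 0 j)) \<otimes> E l 0 = E i 0 \<otimes> P (i, l)" if "i < n" for i
      proof -
        have "(\<Oplus>j\<in>{..<n}. E i 0 \<otimes> (P (i, j) \<otimes> E 0 j)) \<otimes> E l 0 =
            (\<Oplus>j\<in>{..<n}. E i 0 \<otimes> (P (i, j) \<otimes> E 0 j) \<otimes> E l 0)"
          using that kl n by (intro finsum_ldistr) (auto simp: Ecl Pc)
        also have "\<dots> = E i 0 \<otimes> (P (i, l) \<otimes> E 0 l) \<otimes> E l 0"
          using that kl n by (intro finsum_delta) (auto simp: Ecl Pc m_assoc EE)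
        also have "\<dots> = E i 0 \<otimes> P (i, l)"
          using that kl n by (simp add: Ecl Pc m_assoc EE)
        finally show ?thesis .
      qed
      have "?r \<otimes> E l 0 = (\<Oplus>i\<in>{..<n}. (\<Oplus>j\<in>{..<n}. E i 0 \<otimes> (P (i, j) \<otimes> E 0 j)) \<otimes> E l 0)"
        using kl n by (intro finsum_ldistr) (auto simp: Ecl Pc intro!: finsum_closed)
      also have "\<dots> = (\<Oplus>i\<in>{..<n}. E i 0 \<otimes> P (i, l))"
        using kl n by (intro finsum_cong') (auto simp: Ecl Pc in1)
      finally have "E 0 k \<otimes> (?r \<otimes> E l 0) = (\<Oplus>i\<in>{..<n}. E 0 k \<otimes> (E i 0 \<otimes> P (i, l)))"
        using kl n by (simp add: Ecl Pc finsum_rdistr Pi_def)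
      also have "\<dots> = E 0 k \<otimes> (E k 0 \<otimes> P (k, l))"
        using kl n by (intro finsum_delta) (auto simp: Ecl Pc EEr)
      also have "\<dots> = P (k, l)" using kl n by (simp add: Ecl Pc EEr)
      finally show "P (k, l) = ?F ?r (k, l)" using kl by simp
    qed
  qed
  ultimately have "bij_betw ?F (carrier A) (carrier ?M)"
    using cl by (auto simp: bij_betw_def simp del: corner_simps(1))
  with hom show ?thesis by (rule iso_relI)
qed

text \<open>\<open>brauer_equiv\<close> compares matrix algebras only, so \<open>A\<close> itself
  enters as the matrices of size 1.\<close>

lemma brauer_equiv_corner:
  fixes n :: nat
  assumes "\<And>i j. i < n ==> j < n ==> E i j \<in> carrier A"
    and "\<And>i j k l. [|i < n; j < n; k < n; l < n|] ==> E i j \<otimes> E k l = (if j = k then E i l else \<zero>)"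
    and "(\<Oplus>i\<in>{..<n}. E i i) = \<one>" and n: "0 < n"
  shows "kalg (corner A (E 0 0))" "brauer_equiv A (corner A (E 0 0))"
proof -
  let ?C = "corner A (E 0 0)"
  show C: "kalg ?C" using assms by (intro kalg_corner) auto
  interpret C: kalg ?C by fact
  have 1: "iso_rel (matrix_algebra 1 A) (matrix_algebra 1 (matrix_algebra n ?C))"
    by (intro iso_rel_matrix_cong iso_rel_matrix_corner assms kalg_axioms C.kalg_matrix)
  have 2: "iso_rel (matrix_algebra 1 (matrix_algebra n ?C)) (matrix_algebra (1 * n) ?C)"
    by (rule iso_rel_matrix_matrix[OF C])
  have "iso_rel (matrix_algebra 1 A) (matrix_algebra n ?C)"
    using iso_rel_trans[OF 1 2] kalg_matrix C.kalg_matrix kalg.kalg_matrix[OF C.kalg_matrix] by simp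
  then show "brauer_equiv A ?C"
    unfolding brauer_equiv_iff using n by (intro exI[of _ 1] conjI exI[of _ n]) simp_all
qed

end

section \<open>Tensor products with a structure constant algebra\<close>

lemma sc_simps:
  "carrier (sc_algebra S) = {x. \<forall>l\<ge>sc_dim S. x l = 0}"
  "\<zero>\<^bsub>sc_algebra S\<^esub> = (\<lambda>_. 0)" "x \<oplus>\<^bsub>sc_algebra S\<^esub> y = (\<lambda>l. x l + y l)"
  "c \<odot>\<^bsub>sc_algebra S\<^esub> x = (\<lambda>l. c * x l)"
  "\<one>\<^bsub>sc_algebra S\<^esub> = (\<lambda>l. if l < sc_dim S then sc_unit S l else 0)"
  "x \<otimes>\<^bsub>sc_algebra S\<^esub> y = (\<lambda>l. if l < sc_dim S
     then \<Sum>i<sc_dim S. \<Sum>j<sc_dim S. x i * y j * sc_prod S i j l else 0)"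
  by (simp_all add: sc_algebra_def)

text \<open>The tensor product written in the basis of \<open>T\<close>: the entry at
  \<open>b\<close> is the coefficient in \<open>A\<close> of the basis vector \<open>b\<close>. Only
  the second factor carries a basis, so \<open>A\<close> may be a matrix algebra.\<close>

definition tens :: "('k::field, 'a) module => 'k struct_consts => ('k, nat => 'a) module" where
  "tens A T =
     \<lparr>carrier = {..<sc_dim T} \<rightarrow>\<^sub>E carrier A,
      monoid.mult = (\<lambda>x y. \<lambda>b\<in>{..<sc_dim T}.
        \<Oplus>\<^bsub>A\<^esub>i\<in>{..<sc_dim T}. \<Oplus>\<^bsub>A\<^esub>j\<in>{..<sc_dim T}. sc_prod T i j b \<odot>\<^bsub>A\<^esub> (x i \<otimes>\<^bsub>A\<^esub> y j)),
      one = (\<lambda>b\<in>{..<sc_dim T}. sc_unit T b \<odot>\<^bsub>A\<^esub> \<one>\<^bsub>A\<^esub>),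
      ring.zero = (\<lambda>b\<in>{..<sc_dim T}. \<zero>\<^bsub>A\<^esub>),
      ring.add = (\<lambda>x y. \<lambda>b\<in>{..<sc_dim T}. x b \<oplus>\<^bsub>A\<^esub> y b),
      module.smult = (\<lambda>c x. \<lambda>b\<in>{..<sc_dim T}. c \<odot>\<^bsub>A\<^esub> x b)\<rparr>"

definition pure_tensor :: "('k::field, 'a) module => 'k struct_consts => 'a => (nat => 'k) => nat => 'a" where
  "pure_tensor A T x t = (\<lambda>b\<in>{..<sc_dim T}. t b \<odot>\<^bsub>A\<^esub> x)"

lemma tens_simps:
  "carrier (tens A T) = {..<sc_dim T} \<rightarrow>\<^sub>E carrier A"
  "b < sc_dim T ==> (x \<otimes>\<^bsub>tens A T\<^esub> y) b =
     (\<Oplus>\<^bsub>A\<^esub>i\<in>{..<sc_dim T}. \<Oplus>\<^bsub>A\<^esub>j\<in>{..<sc_dim T}. sc_prod T i j b \<odot>\<^bsub>A\<^esub> (x i \<otimes>\<^bsub>A\<^esub> y j))"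
  "b < sc_dim T ==> \<one>\<^bsub>tens A T\<^esub> b = sc_unit T b \<odot>\<^bsub>A\<^esub> \<one>\<^bsub>A\<^esub>"
  "b < sc_dim T ==> \<zero>\<^bsub>tens A T\<^esub> b = \<zero>\<^bsub>A\<^esub>"
  "b < sc_dim T ==> (x \<oplus>\<^bsub>tens A T\<^esub> y) b = x b \<oplus>\<^bsub>A\<^esub> y b"
  "b < sc_dim T ==> (c \<odot>\<^bsub>tens A T\<^esub> x) b = c \<odot>\<^bsub>A\<^esub> x b"
  "b < sc_dim T ==> pure_tensor A T a t b = t b \<odot>\<^bsub>A\<^esub> a"
  by (simp_all add: tens_def pure_tensor_def)

lemma tens_entry: "x \<in> carrier (tens A T) ==> b < sc_dim T ==> x b \<in> carrier A"
  by (auto simp: tens_simps)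

lemma tens_eqI:
  assumes "x \<in> carrier (tens A T)" "y \<in> carrier (tens A T)" "\<And>b. b < sc_dim T ==> x b = y b"
  shows "x = y"
  using assms unfolding tens_simps(1) by (intro PiE_ext) auto

locale tensor = A: kalg A + T: kalg "sc_algebra T"
  for A :: "('k::field, 'a) module" (structure) and T :: "'k struct_consts"
begin

abbreviation "B \<equiv> tens A T"
abbreviation "U \<equiv> sc_algebra T"

lemma tens_closed:
  "x \<in> carrier B ==> y \<in> carrier B ==> x \<otimes>\<^bsub>B\<^esub> y \<in> carrier B"
  "x \<in> carrier B ==> y \<in> carrier B ==> x \<oplus>\<^bsub>B\<^esub> y \<in> carrier B"
  "x \<in> carrier B ==> c \<odot>\<^bsub>B\<^esub> x \<in> carrier B"
  "\<one>\<^bsub>B\<^esub> \<in> carrier B" "\<zero>\<^bsub>B\<^esub> \<in> carrier B"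
  by (auto simp: tens_def PiE_mem intro!: A.finsum_closed)

lemma pure_closed: "x \<in> carrier A ==> pure_tensor A T x t \<in> carrier B"
  by (auto simp: tens_def pure_tensor_def)

lemma tens_ldistr:
  assumes "x \<in> carrier B" "y \<in> carrier B" "z \<in> carrier B"
  shows "(x \<oplus>\<^bsub>B\<^esub> y) \<otimes>\<^bsub>B\<^esub> z = x \<otimes>\<^bsub>B\<^esub> z \<oplus>\<^bsub>B\<^esub> y \<otimes>\<^bsub>B\<^esub> z"
proof (rule tens_eqI[of _ A T])
  fix b assume b: "b < sc_dim T"
  note e = tens_entry[OF assms(1)] tens_entry[OF assms(2)] tens_entry[OF assms(3)]
  let ?f = "\<lambda>x i j. sc_prod T i j b \<odot> (x i \<otimes> z j)"
  have "((x \<oplus>\<^bsub>B\<^esub> y) \<otimes>\<^bsub>B\<^esub> z) b =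
      (\<Oplus>i\<in>{..<sc_dim T}. (\<Oplus>j\<in>{..<sc_dim T}. ?f x i j) \<oplus> (\<Oplus>j\<in>{..<sc_dim T}. ?f y i j))"
    unfolding tens_simps(2)[OF b]
  proof (rule A.finsum_cong'[OF refl])
    fix i assume i: "i \<in> {..<sc_dim T}"
    have "(\<Oplus>j\<in>{..<sc_dim T}. sc_prod T i j b \<odot> ((x \<oplus>\<^bsub>B\<^esub> y) i \<otimes> z j)) = (\<Oplus>j\<in>{..<sc_dim T}. ?f x i j \<oplus> ?f y i j)"
      using i by (intro A.finsum_cong') (auto simp: e tens_simps(5) A.l_distr A.smult_radd)
    also have "\<dots> = (\<Oplus>j\<in>{..<sc_dim T}. ?f x i j) \<oplus> (\<Oplus>j\<in>{..<sc_dim T}. ?f y i j)"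
      using i by (intro A.finsum_addf) (auto simp: e)
    finally show "(\<Oplus>j\<in>{..<sc_dim T}. sc_prod T i j b \<odot> ((x \<oplus>\<^bsub>B\<^esub> y) i \<otimes> z j)) = \<dots>" .
  qed (auto intro!: A.finsum_closed simp: e)
  also have "\<dots> = (\<Oplus>i\<in>{..<sc_dim T}. \<Oplus>j\<in>{..<sc_dim T}. ?f x i j) \<oplus> (\<Oplus>i\<in>{..<sc_dim T}. \<Oplus>j\<in>{..<sc_dim T}. ?f y i j)"
    by (intro A.finsum_addf) (auto simp: e intro!: A.finsum_closed)
  finally show "((x \<oplus>\<^bsub>B\<^esub> y) \<otimes>\<^bsub>B\<^esub> z) b = (x \<otimes>\<^bsub>B\<^esub> z \<oplus>\<^bsub>B\<^esub> y \<otimes>\<^bsub>B\<^esub> z) b"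
    unfolding tens_simps(2)[OF b] tens_simps(5)[OF b] .
qed (intro tens_closed assms)+

lemma tens_rdistr:
  assumes "x \<in> carrier B" "y \<in> carrier B" "z \<in> carrier B"
  shows "z \<otimes>\<^bsub>B\<^esub> (x \<oplus>\<^bsub>B\<^esub> y) = z \<otimes>\<^bsub>B\<^esub> x \<oplus>\<^bsub>B\<^esub> z \<otimes>\<^bsub>B\<^esub> y"
proof (rule tens_eqI[of _ A T])
  fix b assume b: "b < sc_dim T"
  note e = tens_entry[OF assms(1)] tens_entry[OF assms(2)] tens_entry[OF assms(3)]
  let ?f = "\<lambda>x i j. sc_prod T i j b \<odot> (z i \<otimes> x j)"
  have "(z \<otimes>\<^bsub>B\<^esub> (x \<oplus>\<^bsub>B\<^esub> y)) b =
      (\<Oplus>i\<in>{..<sc_dim T}. (\<Oplus>j\<in>{..<sc_dim T}. ?f x i j) \<oplus> (\<Oplus>j\<in>{..<sc_dim T}. ?f y i j))"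
    unfolding tens_simps(2)[OF b]
  proof (rule A.finsum_cong'[OF refl])
    fix i assume i: "i \<in> {..<sc_dim T}"
    have "(\<Oplus>j\<in>{..<sc_dim T}. sc_prod T i j b \<odot> (z i \<otimes> (x \<oplus>\<^bsub>B\<^esub> y) j)) = (\<Oplus>j\<in>{..<sc_dim T}. ?f x i j \<oplus> ?f y i j)"
      using i by (intro A.finsum_cong') (auto simp: e tens_simps(5) A.r_distr A.smult_radd)
    also have "\<dots> = (\<Oplus>j\<in>{..<sc_dim T}. ?f x i j) \<oplus> (\<Oplus>j\<in>{..<sc_dim T}. ?f y i j)"
      using i by (intro A.finsum_addf) (auto simp: e)
    finally show "(\<Oplus>j\<in>{..<sc_dim T}. sc_prod T i j b \<odot> (z i \<otimes> (x \<oplus>\<^bsub>B\<^esub> y) j)) = \<dots>" .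
  qed (auto intro!: A.finsum_closed simp: e)
  also have "\<dots> = (\<Oplus>i\<in>{..<sc_dim T}. \<Oplus>j\<in>{..<sc_dim T}. ?f x i j) \<oplus> (\<Oplus>i\<in>{..<sc_dim T}. \<Oplus>j\<in>{..<sc_dim T}. ?f y i j)"
    by (intro A.finsum_addf) (auto simp: e intro!: A.finsum_closed)
  finally show "(z \<otimes>\<^bsub>B\<^esub> (x \<oplus>\<^bsub>B\<^esub> y)) b = (z \<otimes>\<^bsub>B\<^esub> x \<oplus>\<^bsub>B\<^esub> z \<otimes>\<^bsub>B\<^esub> y) b"
    unfolding tens_simps(2)[OF b] tens_simps(5)[OF b] .
qed (intro tens_closed assms)+

lemma tens_smult_assoc:
  assumes "x \<in> carrier B" "y \<in> carrier B"
  shows "(c \<odot>\<^bsub>B\<^esub> x) \<otimes>\<^bsub>B\<^esub> y = c \<odot>\<^bsub>B\<^esub> (x \<otimes>\<^bsub>B\<^esub> y)" "x \<otimes>\<^bsub>B\<^esub> (c \<odot>\<^bsub>B\<^esub> y) = c \<odot>\<^bsub>B\<^esub> (x \<otimes>\<^bsub>B\<^esub> y)"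
proof -
  note e = tens_entry[OF assms(1)] tens_entry[OF assms(2)]
  have key: "(c \<odot>\<^bsub>B\<^esub> (x \<otimes>\<^bsub>B\<^esub> y)) b =
      (\<Oplus>i\<in>{..<sc_dim T}. \<Oplus>j\<in>{..<sc_dim T}. c \<odot> (sc_prod T i j b \<odot> (x i \<otimes> y j)))" if b: "b < sc_dim T" for b
  proof -
    have "(c \<odot>\<^bsub>B\<^esub> (x \<otimes>\<^bsub>B\<^esub> y)) b =
       (\<Oplus>i\<in>{..<sc_dim T}. c \<odot> (\<Oplus>j\<in>{..<sc_dim T}. (sc_prod T i j b \<odot> (x i \<otimes> y j))))"
      unfolding tens_simps(6)[OF b] tens_simps(2)[OF b]
      by (intro A.smult_finsum) (auto simp: e intro!: A.finsum_closed)
    also have "\<dots> = (\<Oplus>i\<in>{..<sc_dim T}. \<Oplus>j\<in>{..<sc_dim T}. c \<odot> (sc_prod T i j b \<odot> (x i \<otimes> y j)))"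
      by (intro A.finsum_cong' A.smult_finsum) (auto simp: e intro!: A.finsum_closed)
    finally show ?thesis .
  qed
  show "(c \<odot>\<^bsub>B\<^esub> x) \<otimes>\<^bsub>B\<^esub> y = c \<odot>\<^bsub>B\<^esub> (x \<otimes>\<^bsub>B\<^esub> y)"
  proof (rule tens_eqI[of _ A T])
    fix b assume b: "b < sc_dim T"
    show "((c \<odot>\<^bsub>B\<^esub> x) \<otimes>\<^bsub>B\<^esub> y) b = (c \<odot>\<^bsub>B\<^esub> (x \<otimes>\<^bsub>B\<^esub> y)) b"
      unfolding key[OF b] tens_simps(2)[OF b]
      by (intro A.finsum_cong')
        (auto simp: e tens_simps(6) A.smult_lmult A.smult_smult mult.commute intro!: A.finsum_closed A.finsum_cong')
  qed (intro tens_closed assms)+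
  show "x \<otimes>\<^bsub>B\<^esub> (c \<odot>\<^bsub>B\<^esub> y) = c \<odot>\<^bsub>B\<^esub> (x \<otimes>\<^bsub>B\<^esub> y)"
  proof (rule tens_eqI[of _ A T])
    fix b assume b: "b < sc_dim T"
    show "(x \<otimes>\<^bsub>B\<^esub> (c \<odot>\<^bsub>B\<^esub> y)) b = (c \<odot>\<^bsub>B\<^esub> (x \<otimes>\<^bsub>B\<^esub> y)) b"
      unfolding key[OF b] tens_simps(2)[OF b]
      by (intro A.finsum_cong')
        (auto simp: e tens_simps(6) A.smult_rmult A.smult_smult mult.commute intro!: A.finsum_closed A.finsum_cong')
  qed (intro tens_closed assms)+
qed

lemma pure_mult:
  assumes "x \<in> carrier A" "y \<in> carrier A"
  shows "pure_tensor A T x t \<otimes>\<^bsub>B\<^esub> pure_tensor A T y u = pure_tensor A T (x \<otimes> y) (t \<otimes>\<^bsub>U\<^esub> u)"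
proof (rule tens_eqI[of _ A T])
  fix b assume b: "b < sc_dim T"
  have "(pure_tensor A T x t \<otimes>\<^bsub>B\<^esub> pure_tensor A T y u) b =
      (\<Oplus>i\<in>{..<sc_dim T}. \<Oplus>j\<in>{..<sc_dim T}. (t i * u j * sc_prod T i j b) \<odot> (x \<otimes> y))"
    unfolding tens_simps(2)[OF b] using assms
    by (intro A.finsum_cong')
      (auto simp: tens_simps(7) A.smult_rmult A.smult_lmult A.smult_smult mult_ac
        intro!: A.finsum_closed A.finsum_cong')
  also have "\<dots> = (\<Oplus>i\<in>{..<sc_dim T}. (\<Sum>j<sc_dim T. t i * u j * sc_prod T i j b) \<odot> (x \<otimes> y))"
    using assms by (intro A.finsum_cong' A.finsum_smult[symmetric]) auto
  also have "\<dots> = (\<Sum>i<sc_dim T. \<Sum>j<sc_dim T. t i * u j * sc_prod T i j b) \<odot> (x \<otimes> y)"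
    using assms by (intro A.finsum_smult[symmetric]) auto
  finally show "(pure_tensor A T x t \<otimes>\<^bsub>B\<^esub> pure_tensor A T y u) b = pure_tensor A T (x \<otimes> y) (t \<otimes>\<^bsub>U\<^esub> u) b"
    using b by (simp add: tens_simps(7) sc_simps(6))
qed (use assms in \<open>simp_all add: tens_closed pure_closed\<close>)

lemma one_eq_pure: "\<one>\<^bsub>B\<^esub> = pure_tensor A T \<one> \<one>\<^bsub>U\<^esub>"
  by (rule tens_eqI[of _ A T]) (simp_all add: tens_closed pure_closed tens_simps(2-) sc_simps(2-))

text \<open>Bilinear identities have to be checked on pure tensors only. A vector is built up by
  adding its coordinates one at a time, each as a pure tensor with a standard basis vector.\<close>

lemma tens_induct [consumes 1, case_names zero add pure]:
  assumes z: "z \<in> carrier B" and "P \<zero>\<^bsub>B\<^esub>"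
    and "\<And>x y. [|x \<in> carrier B; y \<in> carrier B; P x; P y|] ==> P (x \<oplus>\<^bsub>B\<^esub> y)"
    and "\<And>x t. x \<in> carrier A ==> t \<in> carrier U ==> P (pure_tensor A T x t)"
  shows "P z"
proof -
  note e = tens_entry[OF z]
  let ?z = "\<lambda>m. \<lambda>b\<in>{..<sc_dim T}. if b < m then z b else \<zero>"
  have cl: "?z m \<in> carrier B" for m
    using e by (auto simp: tens_simps(1))
  have "P (?z m)" if "m \<le> sc_dim T" for m
    using that
  proof (induction m)
    case 0
    have "?z 0 = \<zero>\<^bsub>B\<^esub>" by (rule tens_eqI[OF cl tens_closed(5)]) (simp add: tens_simps)
    then show ?case using assms(2) by simp
  next
    case (Suc m)
    let ?p = "pure_tensor A T (z m) (\<lambda>b. if b = m then 1 else 0)"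
    have p: "P ?p" "?p \<in> carrier B"
      using Suc.prems e by (auto intro!: assms(4) pure_closed simp: sc_simps)
    have Pm: "P (?z m)" by (rule Suc.IH[OF Suc_leD[OF Suc.prems]])
    have eq: "?z (Suc m) = ?z m \<oplus>\<^bsub>B\<^esub> ?p"
    proof (rule tens_eqI[OF cl tens_closed(2)[OF cl p(2)]])
      fix b assume b: "b < sc_dim T"
      consider "b < m" | "b = m" | "b > m" by linarith
      then show "?z (Suc m) b = (?z m \<oplus>\<^bsub>B\<^esub> ?p) b"
        using b e[OF b] e[of m] Suc.prems by cases (simp_all add: tens_simps)
    qed
    show ?case unfolding eq by (rule assms(3)[OF cl p(2) Pm p(1)])
  qed
  from this[OF order_refl] have "P (?z (sc_dim T))" .
  moreover have "?z (sc_dim T) = z" by (rule tens_eqI[OF cl z]) simp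
  ultimately show "P z" by simp
qed

lemma tens_zero_mult:
  assumes "x \<in> carrier B"
  shows "x \<otimes>\<^bsub>B\<^esub> \<zero>\<^bsub>B\<^esub> = \<zero>\<^bsub>B\<^esub>" "\<zero>\<^bsub>B\<^esub> \<otimes>\<^bsub>B\<^esub> x = \<zero>\<^bsub>B\<^esub>"
proof -
  have s0: "0 \<odot>\<^bsub>B\<^esub> y = \<zero>\<^bsub>B\<^esub>" if "y \<in> carrier B" for y
    by (rule tens_eqI[of _ A T]) (use that tens_entry[OF that] in \<open>simp_all add: tens_closed tens_simps(2-)\<close>)
  then show "x \<otimes>\<^bsub>B\<^esub> \<zero>\<^bsub>B\<^esub> = \<zero>\<^bsub>B\<^esub>" "\<zero>\<^bsub>B\<^esub> \<otimes>\<^bsub>B\<^esub> x = \<zero>\<^bsub>B\<^esub>"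
    using tens_smult_assoc[OF assms tens_closed(5), of 0] tens_smult_assoc[OF tens_closed(5) assms, of 0] assms
    by (simp_all add: tens_closed)
qed

text \<open>Three nested inductions reduce to pure tensors, where the two sides agree by
  associativity in \<open>A\<close> and in \<open>sc_algebra T\<close>; the distributive laws take
  care of sums.\<close>

lemma tens_assoc:
  assumes "x \<in> carrier B" "y \<in> carrier B" "z \<in> carrier B"
  shows "(x \<otimes>\<^bsub>B\<^esub> y) \<otimes>\<^bsub>B\<^esub> z = x \<otimes>\<^bsub>B\<^esub> (y \<otimes>\<^bsub>B\<^esub> z)"
  using assms(1)
proof (induction x rule: tens_induct)
  case (pure a t)
  show ?case
    using assms(2)
  proof (induction y rule: tens_induct)
    case (pure b u)
    note ab = \<open>a \<in> carrier A\<close> \<open>t \<in> carrier U\<close> pure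
    show ?case
      using assms(3)
    proof (induction z rule: tens_induct)
      case (pure c v)
      then show ?case using ab by (simp add: pure_mult A.m_assoc T.m_assoc)
    qed (use ab in \<open>simp_all add: tens_zero_mult tens_closed pure_closed tens_rdistr\<close>)
  qed (use assms pure in \<open>simp_all add: tens_zero_mult tens_closed pure_closed tens_rdistr tens_ldistr\<close>)
qed (use assms in \<open>simp_all add: tens_zero_mult tens_closed tens_ldistr\<close>)

lemma tens_one:
  assumes "x \<in> carrier B"
  shows "\<one>\<^bsub>B\<^esub> \<otimes>\<^bsub>B\<^esub> x = x" "x \<otimes>\<^bsub>B\<^esub> \<one>\<^bsub>B\<^esub> = x"
proof -
  show "\<one>\<^bsub>B\<^esub> \<otimes>\<^bsub>B\<^esub> x = x" using assms
    by (induction x rule: tens_induct)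
      (simp_all add: tens_zero_mult tens_closed tens_rdistr, simp add: one_eq_pure pure_mult)
  show "x \<otimes>\<^bsub>B\<^esub> \<one>\<^bsub>B\<^esub> = x" using assms
    by (induction x rule: tens_induct)
      (simp_all add: tens_zero_mult tens_closed tens_ldistr, simp add: one_eq_pure pure_mult)
qed

lemma kalg_tens: "kalg B"
proof -
  have neg: "(- 1) \<odot> y \<oplus> y = \<zero>" if "y \<in> carrier A" for y
    using that A.l_neg[of y] by (simp add: A.minus_smult)
  show ?thesis
  proof (rule kalgI)
    fix x y z assume "x \<in> carrier B" "y \<in> carrier B" "z \<in> carrier B"
    then show "x \<oplus>\<^bsub>B\<^esub> y \<oplus>\<^bsub>B\<^esub> z = x \<oplus>\<^bsub>B\<^esub> (y \<oplus>\<^bsub>B\<^esub> z)"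
      by (intro tens_eqI[of _ A T]) (simp_all add: tens_closed tens_simps(2-) tens_entry[of _ A T] A.a_assoc)
  next
    fix x y c assume "x \<in> carrier B" "y \<in> carrier B"
    note xy = this
    show "x \<oplus>\<^bsub>B\<^esub> y = y \<oplus>\<^bsub>B\<^esub> x"
      using xy by (intro tens_eqI[of _ A T]) (simp_all add: tens_closed tens_simps(2-) tens_entry[of _ A T] A.a_comm)
    show "c \<odot>\<^bsub>B\<^esub> (x \<oplus>\<^bsub>B\<^esub> y) = c \<odot>\<^bsub>B\<^esub> x \<oplus>\<^bsub>B\<^esub> c \<odot>\<^bsub>B\<^esub> y"
      using xy by (intro tens_eqI[of _ A T]) (simp_all add: tens_closed tens_simps(2-) tens_entry[of _ A T] A.smult_radd)
  next
    fix x c d assume x: "x \<in> carrier B"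
    show "\<zero>\<^bsub>B\<^esub> \<oplus>\<^bsub>B\<^esub> x = x"
      using x by (intro tens_eqI[of _ A T]) (simp_all add: tens_closed tens_simps(2-) tens_entry[of _ A T])
    show "(- 1) \<odot>\<^bsub>B\<^esub> x \<oplus>\<^bsub>B\<^esub> x = \<zero>\<^bsub>B\<^esub>"
      using x by (intro tens_eqI[of _ A T]) (simp_all add: tens_closed tens_simps(2-) tens_entry[of _ A T] neg)
    show "(c + d) \<odot>\<^bsub>B\<^esub> x = c \<odot>\<^bsub>B\<^esub> x \<oplus>\<^bsub>B\<^esub> d \<odot>\<^bsub>B\<^esub> x"
      using x by (intro tens_eqI[of _ A T]) (simp_all add: tens_closed tens_simps(2-) tens_entry[of _ A T] A.smult_ladd)
    show "c \<odot>\<^bsub>B\<^esub> (d \<odot>\<^bsub>B\<^esub> x) = (c * d) \<odot>\<^bsub>B\<^esub> x"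
      using x by (intro tens_eqI[of _ A T]) (simp_all add: tens_closed tens_simps(2-) tens_entry[of _ A T] A.smult_smult)
    show "1 \<odot>\<^bsub>B\<^esub> x = x"
      using x by (intro tens_eqI[of _ A T]) (simp_all add: tens_closed tens_simps(2-) tens_entry[of _ A T])
  qed (simp_all add: tens_closed tens_assoc tens_one tens_ldistr tens_rdistr tens_smult_assoc)
qed

lemma pure_add:
  assumes "x \<in> carrier A" "t \<in> carrier U" "u \<in> carrier U"
  shows "pure_tensor A T x (t \<oplus>\<^bsub>U\<^esub> u) = pure_tensor A T x t \<oplus>\<^bsub>B\<^esub> pure_tensor A T x u"
  by (rule tens_eqI[of _ A T]) (use assms in \<open>simp_all add: tens_closed pure_closed tens_simps(2-) sc_simps A.smult_ladd\<close>)

lemma pure_smult: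
  assumes "x \<in> carrier A"
  shows "pure_tensor A T x (c \<odot>\<^bsub>U\<^esub> t) = c \<odot>\<^bsub>B\<^esub> pure_tensor A T x t"
  by (rule tens_eqI[of _ A T]) (use assms in \<open>simp_all add: tens_closed pure_closed tens_simps(2-) sc_simps A.smult_smult\<close>)

text \<open>The element a \<otimes> 1 acts on each coordinate separately, so it never enlarges the
  support; the minimality argument in \<open>simple_central_tens\<close> rests on this.\<close>

lemma pure_one_mult_entry:
  assumes a: "a \<in> carrier A" and z: "z \<in> carrier B" and b: "b < sc_dim T"
  shows "(pure_tensor A T a \<one>\<^bsub>U\<^esub> \<otimes>\<^bsub>B\<^esub> z) b = a \<otimes> z b" "(z \<otimes>\<^bsub>B\<^esub> pure_tensor A T a \<one>\<^bsub>U\<^esub>) b = z b \<otimes> a"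
proof -
  show "(pure_tensor A T a \<one>\<^bsub>U\<^esub> \<otimes>\<^bsub>B\<^esub> z) b = a \<otimes> z b" using z
  proof (induction z rule: tens_induct)
    case (add x y)
    then show ?case
      using a b tens_entry[OF add(1) b] tens_entry[OF add(2) b]
      by (simp add: tens_rdistr pure_closed tens_simps(5) A.r_distr)
  qed (use a b in \<open>simp_all add: tens_zero_mult pure_closed tens_simps(4,7) pure_mult A.smult_rmult\<close>)
  show "(z \<otimes>\<^bsub>B\<^esub> pure_tensor A T a \<one>\<^bsub>U\<^esub>) b = z b \<otimes> a" using z
  proof (induction z rule: tens_induct)
    case (add x y)
    then show ?case
      using a b tens_entry[OF add(1) b] tens_entry[OF add(2) b]
      by (simp add: tens_ldistr pure_closed tens_simps(5) A.l_distr)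
  qed (use a b in \<open>simp_all add: tens_zero_mult pure_closed tens_simps(4,7) pure_mult A.smult_lmult\<close>)
qed

end

text \<open>A ring ideal is a subspace because \<open>c\<close> acts as multiplication by the ring
  element \<open>c \<odot> \<one>\<close>.\<close>

lemma (in kalg) ideal_smult: "ideal I A ==> x \<in> I ==> c \<odot> x \<in> I"
proof -
  assume I: "ideal I A" "x \<in> I"
  then have x: "x \<in> carrier A" by (rule ideal.Icarr)
  have "(c \<odot> \<one>) \<otimes> x \<in> I" using ideal.I_l_closed[OF I] by simp
  then show "c \<odot> x \<in> I" using x by (simp add: smult_lmult)
qed

context tensor
begin

text \<open>Elements of \<open>B\<close> are written in the basis of \<open>T\<close>, with coordinates in \<open>A\<close>. A nonzero element of an
  ideal with the smallest number of nonzero coordinates can be normalised to have a coordinate \<open>1\<close>;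
  then it commutes with \<open>A\<close> by minimality, so all its coordinates are scalars and it comes from \<open>T\<close>.\<close>

lemma simple_central_tens:
  assumes sA: "simple_central A" and sT: "simple_central U"
  shows "simple_central B"
proof -
  interpret B: kalg B by (rule kalg_tens)
  have A1: "\<one> \<noteq> \<zero>" and T1: "\<one>\<^bsub>U\<^esub> \<noteq> \<zero>\<^bsub>U\<^esub>"
    using sA sT by (simp_all add: simple_central_def)
  have inj: "t = u" if "pure_tensor A T \<one> t = pure_tensor A T \<one> u" "t \<in> carrier U" "u \<in> carrier U" for t u
  proof
    fix b
    show "t b = u b"
    proof (cases "b < sc_dim T")
      case True
      then have "t b \<odot> \<one> = u b \<odot> \<one>" using fun_cong[OF that(1), of b] by (simp add: tens_simps)
      then have "(t b - u b) \<odot> \<one> = \<zero>"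
        using A.smult_ladd[of \<one> "t b" "- u b"] A.smult_ladd[of \<one> "u b" "- u b"] by simp
      then show ?thesis using A.smult_cancel0[of \<one> "t b - u b"] A1 by auto
    qed (use that in \<open>simp add: sc_simps\<close>)
  qed
  \<comment> \<open>Coordinates that commute with all of \<open>A\<close> are scalars because
    \<open>A\<close> is central; such an element lies in the copy of \<open>T\<close>.\<close>
  have central: "\<exists>t\<in>carrier U. z = pure_tensor A T \<one> t"
    if z: "z \<in> carrier B" "\<And>b a. b < sc_dim T ==> a \<in> carrier A ==> z b \<otimes> a = a \<otimes> z b" for z
  proof -
    have "\<exists>c. z b = c \<odot> \<one>" if "b < sc_dim T" for b
      using sA z(2)[OF that] tens_entry[OF z(1) that] by (simp add: simple_central_def)
    then obtain t where t: "\<And>b. b < sc_dim T ==> z b = t b \<odot> \<one>" by metis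
    let ?t = "\<lambda>b. if b < sc_dim T then t b else 0"
    have "z = pure_tensor A T \<one> ?t"
      by (rule tens_eqI[OF z(1)]) (simp_all add: pure_closed t tens_simps(7))
    moreover have "?t \<in> carrier U" by (simp add: sc_simps)
    ultimately show ?thesis by blast
  qed
  have "I = carrier B" if I: "ideal I B" and nz: "I \<noteq> {\<zero>\<^bsub>B\<^esub>}" for I
  proof -
    interpret I: ideal I B by fact
    let ?supp = "\<lambda>w. {b. b < sc_dim T \<and> w b \<noteq> \<zero>}"
    obtain z0 where "z0 \<in> I \<and> z0 \<noteq> \<zero>\<^bsub>B\<^esub>" using nz I.zero_closed by blast
    then obtain z where z: "z \<in> I" "z \<noteq> \<zero>\<^bsub>B\<^esub>"
      and least: "\<And>w. w \<in> I ==> w \<noteq> \<zero>\<^bsub>B\<^esub> ==> card (?supp z) \<le> card (?supp w)"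
      using ex_has_least_nat[of "\<lambda>w. w \<in> I \<and> w \<noteq> \<zero>\<^bsub>B\<^esub>" z0 "\<lambda>w. card (?supp w)"] by blast
    have small: "w = \<zero>\<^bsub>B\<^esub>" if "w \<in> I" "?supp w \<subset> ?supp z" for w
      using least[OF that(1)] psubset_card_mono[OF _ that(2)] by force
    obtain b0 where b0: "b0 < sc_dim T" "z b0 \<noteq> \<zero>"
      using z(2) tens_eqI[OF I.Icarr[OF z(1)] tens_closed(5)] tens_simps(4) by metis
    \<comment> \<open>The values at \<open>b0\<close> of those elements of \<open>I\<close> whose
      support stays inside that of \<open>z\<close>. They form a nonzero two-sided ideal of the
      simple algebra \<open>A\<close>, hence include \<open>\<one>\<close>, which provides the
      normalised element \<open>w\<close>.\<close>
    let ?J = "{a. \<exists>w\<in>I. a = w b0 \<and> ?supp w \<subseteq> ?supp z}"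
    have Jcar: "a \<in> carrier A" if "a \<in> ?J" for a
      using that tens_entry[OF I.Icarr b0(1)] by auto
    have e: "w b \<in> carrier A" if "w \<in> I" "b < sc_dim T" for w b
      using tens_entry[OF I.Icarr] that by blast
    have "ideal ?J A"
    proof (rule idealI[OF A.ring_axioms])
      show "subgroup ?J (add_monoid A)"
      proof (rule subgroup.intro)
        show "?J \<subseteq> carrier (add_monoid A)" using Jcar by auto
      next
        fix x y assume "x \<in> ?J" "y \<in> ?J"
        then obtain v w where vw: "v \<in> I" "w \<in> I" "x = v b0" "y = w b0"
          "?supp v \<subseteq> ?supp z" "?supp w \<subseteq> ?supp z" by blast
        have "x \<otimes>\<^bsub>add_monoid A\<^esub> y = (v \<oplus>\<^bsub>B\<^esub> w) b0" using vw b0 by (simp add: tens_simps(5))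
        moreover have "?supp (v \<oplus>\<^bsub>B\<^esub> w) \<subseteq> ?supp z"
        proof
          fix b assume b: "b \<in> ?supp (v \<oplus>\<^bsub>B\<^esub> w)"
          then have "v b \<noteq> \<zero> \<or> w b \<noteq> \<zero>" by (auto simp: tens_simps(5))
          then show "b \<in> ?supp z" using b vw by auto
        qed
        ultimately show "x \<otimes>\<^bsub>add_monoid A\<^esub> y \<in> ?J" using I.a_closed[OF vw(1,2)] by blast
      next
        have "\<zero> = \<zero>\<^bsub>B\<^esub> b0" "?supp \<zero>\<^bsub>B\<^esub> \<subseteq> ?supp z" using b0 by (auto simp: tens_simps(4))
        then show "\<one>\<^bsub>add_monoid A\<^esub> \<in> ?J" using I.zero_closed by auto
      next
        fix x assume "x \<in> ?J"
        then obtain v where v: "v \<in> I" "x = v b0" "?supp v \<subseteq> ?supp z" by blast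
        have "inv\<^bsub>add_monoid A\<^esub> x = ((-1) \<odot>\<^bsub>B\<^esub> v) b0"
          using v b0 e by (simp add: tens_simps(6) A.minus_smult flip: a_inv_def)
        moreover have "?supp ((-1) \<odot>\<^bsub>B\<^esub> v) \<subseteq> ?supp z"
          using v by (auto simp: tens_simps(6))
        ultimately show "inv\<^bsub>add_monoid A\<^esub> x \<in> ?J" using B.ideal_smult[OF I v(1)] by blast
      qed
    next
      fix a x assume "a \<in> ?J" and x: "x \<in> carrier A"
      then obtain v where v: "v \<in> I" "a = v b0" "?supp v \<subseteq> ?supp z" by blast
      let ?l = "pure_tensor A T x \<one>\<^bsub>U\<^esub> \<otimes>\<^bsub>B\<^esub> v" and ?r = "v \<otimes>\<^bsub>B\<^esub> pure_tensor A T x \<one>\<^bsub>U\<^esub>"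
      have lr: "?l b = x \<otimes> v b" "?r b = v b \<otimes> x" if "b < sc_dim T" for b
        using pure_one_mult_entry[OF x I.Icarr[OF v(1)] that] .
      have "?l \<in> I" "?r \<in> I"
        using I.I_l_closed[OF v(1) pure_closed[OF x]] I.I_r_closed[OF v(1) pure_closed[OF x]] .
      moreover have "?supp ?l \<subseteq> ?supp z" "?supp ?r \<subseteq> ?supp z"
        using v(3) x by (auto simp: lr)
      ultimately show "x \<otimes> a \<in> ?J" "a \<otimes> x \<in> ?J" using lr[OF b0(1)] v(2) by auto
    qed
    moreover have "z b0 \<in> ?J" using z by auto
    then have "?J \<noteq> {\<zero>}" using b0 by auto
    ultimately have "?J = carrier A" using sA unfolding simple_central_def by blast
    then have "\<one> \<in> ?J" by simp
    then obtain w where w: "w \<in> I" "w b0 = \<one>" "?supp w \<subseteq> ?supp z" by auto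
    \<comment> \<open>The commutator of \<open>w\<close> with a \<otimes> 1 lies in \<open>I\<close>
      and vanishes at \<open>b0\<close>, where \<open>w\<close> has the value \<open>\<one>\<close>;
      having smaller support than \<open>z\<close>, it is zero.\<close>
    have "w b \<otimes> a = a \<otimes> w b" if b: "b < sc_dim T" and a: "a \<in> carrier A" for b a
    proof -
      let ?p = "pure_tensor A T a \<one>\<^bsub>U\<^esub>"
      let ?v = "w \<otimes>\<^bsub>B\<^esub> ?p \<oplus>\<^bsub>B\<^esub> (-1) \<odot>\<^bsub>B\<^esub> (?p \<otimes>\<^bsub>B\<^esub> w)"
      have v: "?v b = w b \<otimes> a \<ominus> a \<otimes> w b" if "b < sc_dim T" for b
        using that a e[OF w(1) that] pure_one_mult_entry[OF a I.Icarr[OF w(1)] that]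
        by (simp add: tens_simps(5,6) A.minus_smult A.minus_eq)
      have "?v \<in> I"
        using I.I_l_closed[OF w(1) pure_closed[OF a]] I.I_r_closed[OF w(1) pure_closed[OF a]]
        by (intro I.a_closed B.ideal_smult[OF I])
      moreover have "?supp ?v \<subset> ?supp z"
      proof
        show "?supp ?v \<subseteq> ?supp z" using w(3) a by (auto simp: v A.minus_eq)
        have "b0 \<notin> ?supp ?v" using a by (simp add: v[OF b0(1)] w(2) A.minus_eq A.r_neg)
        then show "?supp ?v \<noteq> ?supp z" using b0 by blast
      qed
      ultimately have "?v = \<zero>\<^bsub>B\<^esub>" by (rule small)
      then have "w b \<otimes> a \<ominus> a \<otimes> w b = \<zero>" using v[OF b] b by (simp add: tens_simps(4))
      then show ?thesis using a e[OF w(1) b] by (simp add: A.r_right_minus_eq)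
    qed
    then obtain t where t: "t \<in> carrier U" "w = pure_tensor A T \<one> t"
      using central[OF I.Icarr[OF w(1)]] by blast
    \<comment> \<open>The part of \<open>I\<close> inside the copy of \<open>T\<close>. It contains
      the nonzero \<open>t\<close>, so simplicity of \<open>T\<close> puts the unit into
      \<open>I\<close>.\<close>
    let ?K = "{u \<in> carrier U. pure_tensor A T \<one> u \<in> I}"
    have pm: "pure_tensor A T \<one> u \<otimes>\<^bsub>B\<^esub> pure_tensor A T \<one> v = pure_tensor A T \<one> (u \<otimes>\<^bsub>U\<^esub> v)" for u v
      by (simp add: pure_mult)
    have "ideal ?K U"
    proof (rule idealI[OF T.ring_axioms])
      have "pure_tensor A T \<one> \<zero>\<^bsub>U\<^esub> = \<zero>\<^bsub>B\<^esub>"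
        by (rule tens_eqI[of _ A T]) (simp_all add: pure_closed tens_closed tens_simps(4,7) sc_simps)
      then show "subgroup ?K (add_monoid U)"
        by (intro subgroup.intro)
          (auto simp: pure_add I.a_closed I.zero_closed T.minus_smult pure_smult B.ideal_smult[OF I] simp flip: a_inv_def)
    qed (auto simp: pure_closed I.I_l_closed I.I_r_closed simp flip: pm)
    moreover have "t \<in> ?K" "t \<noteq> \<zero>\<^bsub>U\<^esub>"
      using t w(1,2) b0(1) A1 by (auto simp: tens_simps(7) sc_simps)
    ultimately have "?K = carrier U" using sT unfolding simple_central_def by blast
    then have "\<one>\<^bsub>U\<^esub> \<in> ?K" by simp
    then have "\<one>\<^bsub>B\<^esub> \<in> I" by (simp add: one_eq_pure)
    then show "I = carrier B" by (rule I.one_imp_carrier)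
  qed
  moreover have "\<exists>c. z = c \<odot>\<^bsub>B\<^esub> \<one>\<^bsub>B\<^esub>"
    if z: "z \<in> carrier B" and c: "\<And>x. x \<in> carrier B ==> z \<otimes>\<^bsub>B\<^esub> x = x \<otimes>\<^bsub>B\<^esub> z" for z
  proof -
    \<comment> \<open>Commuting with all a \<otimes> 1 makes \<open>z\<close> equal to some 1
      \<otimes> t; commuting with all 1 \<otimes> u then makes \<open>t\<close> central in
      \<open>T\<close>.\<close>
    have "z b \<otimes> a = a \<otimes> z b" if "b < sc_dim T" "a \<in> carrier A" for b a
      using pure_one_mult_entry[OF that(2) z that(1)] c[OF pure_closed[OF that(2)]] by metis
    then obtain t where t: "t \<in> carrier U" "z = pure_tensor A T \<one> t" using central[OF z] by blast
    have "t \<otimes>\<^bsub>U\<^esub> u = u \<otimes>\<^bsub>U\<^esub> t" if u: "u \<in> carrier U" for u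
      using c[OF pure_closed[OF A.one_closed, of u]] t u by (intro inj) (simp_all add: pure_mult)
    then obtain c where "t = c \<odot>\<^bsub>U\<^esub> \<one>\<^bsub>U\<^esub>" using sT t(1) unfolding simple_central_def by blast
    then have "z = c \<odot>\<^bsub>B\<^esub> \<one>\<^bsub>B\<^esub>" by (simp add: t one_eq_pure pure_smult)
    then show ?thesis ..
  qed
  moreover have "\<one>\<^bsub>B\<^esub> \<noteq> \<zero>\<^bsub>B\<^esub>"
  proof
    assume "\<one>\<^bsub>B\<^esub> = \<zero>\<^bsub>B\<^esub>"
    moreover have "pure_tensor A T \<one> \<zero>\<^bsub>U\<^esub> = \<zero>\<^bsub>B\<^esub>"
      by (rule tens_eqI[of _ A T]) (simp_all add: pure_closed tens_closed tens_simps(4,7) sc_simps)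
    ultimately show False using inj[of "\<one>\<^bsub>U\<^esub>" "\<zero>\<^bsub>U\<^esub>"] T1 by (simp add: one_eq_pure)
  qed
  ultimately show ?thesis
    unfolding simple_central_def using kalg_tens by blast
qed

lemma finsum_tens_entry:
  assumes "finite I" "\<And>i. i \<in> I ==> x i \<in> carrier B" "b < sc_dim T"
  shows "(finsum B x I) b = (\<Oplus>i\<in>I. x i b)"
proof -
  interpret B: kalg B by (rule kalg_tens)
  show ?thesis
    using assms
    by (intro finsum_additive[where g = "\<lambda>y. y b"] B.abelian_monoid_axioms A.abelian_monoid_axioms)
      (auto simp: tens_simps(4,5) tens_entry)
qed

end

lemma finsum_sc_algebra:
  assumes "kalg (sc_algebra S)" "finite I" "f \<in> I \<rightarrow> carrier (sc_algebra S)"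
  shows "finsum (sc_algebra S) f I = (\<lambda>l. \<Sum>i\<in>I. f i l)"
proof -
  interpret kalg "sc_algebra S" by fact
  show ?thesis
    using assms(2,3)
  proof (induction I rule: finite_induct)
    case empty then show ?case by (simp only: finsum_empty) (simp add: sc_simps)
  next
    case (insert x F)
    then have "finsum (sc_algebra S) f (insert x F) = f x \<oplus>\<^bsub>sc_algebra S\<^esub> finsum (sc_algebra S) f F"
      by (intro finsum_insert) auto
    then show ?case using insert by (simp add: sc_simps(3))
  qed
qed

lemma sc_basis_expand:
  assumes "kalg (sc_algebra S)" "t \<in> carrier (sc_algebra S)"
  shows "t = finsum (sc_algebra S) (\<lambda>b. t b \<odot>\<^bsub>sc_algebra S\<^esub> (\<lambda>l. if l = b then 1 else 0)) {..<sc_dim S}"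
proof -
  have "finsum (sc_algebra S) (\<lambda>b. t b \<odot>\<^bsub>sc_algebra S\<^esub> (\<lambda>l. if l = b then 1 else 0)) {..<sc_dim S} =
      (\<lambda>l. \<Sum>b<sc_dim S. (t b \<odot>\<^bsub>sc_algebra S\<^esub> (\<lambda>l. if l = b then 1 else 0)) l)"
    by (rule finsum_sc_algebra[OF assms(1)]) (auto simp: sc_simps)
  also have "\<dots> = t"
  proof
    fix l show "(\<Sum>b<sc_dim S. (t b \<odot>\<^bsub>sc_algebra S\<^esub> (\<lambda>l. if l = b then 1 else 0)) l) = t l"
      using assms(2) by (cases "l < sc_dim S") (auto simp: sc_simps if_distrib cong: if_cong)
  qed
  finally show ?thesis by simp
qed

text \<open>The standard basis vectors span, so for structure constants the finiteness clause of
  \<open>central_simple\<close> holds automatically.\<close>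

lemma central_simple_sc_iff: "central_simple (sc_algebra S) \<longleftrightarrow> simple_central (sc_algebra S)"
proof
  assume s: "simple_central (sc_algebra S)"
  then have k: "kalg (sc_algebra S)" by (simp add: simple_central_def)
  interpret kalg "sc_algebra S" by fact
  let ?e = "\<lambda>b l. if l = b then 1 else (0::'a)"
  have inj: "inj_on ?e {..<sc_dim S}" by (auto simp: inj_on_def fun_eq_iff split: if_splits)
  have "\<exists>c. x = (\<Oplus>\<^bsub>sc_algebra S\<^esub>b\<in>?e ` {..<sc_dim S}. c b \<odot>\<^bsub>sc_algebra S\<^esub> b)"
    if x: "x \<in> carrier (sc_algebra S)" for x
  proof -
    \<comment> \<open>The spanning set consists of vectors, not of indices; the coefficient of a
      vector is found through the inverse of the injective enumeration \<open>?e\<close>.\<close>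
    let ?c = "\<lambda>b. x (inv_into {..<sc_dim S} ?e b)"
    have "x = (\<Oplus>\<^bsub>sc_algebra S\<^esub>i\<in>{..<sc_dim S}. x i \<odot>\<^bsub>sc_algebra S\<^esub> ?e i)"
      by (rule sc_basis_expand[OF k x])
    also have "\<dots> = (\<Oplus>\<^bsub>sc_algebra S\<^esub>i\<in>{..<sc_dim S}. ?c (?e i) \<odot>\<^bsub>sc_algebra S\<^esub> ?e i)"
    proof (rule finsum_cong')
      fix i assume "i \<in> {..<sc_dim S}"
      from inv_into_f_f[OF inj this]
      show "x i \<odot>\<^bsub>sc_algebra S\<^esub> ?e i = ?c (?e i) \<odot>\<^bsub>sc_algebra S\<^esub> ?e i" by simp
    qed (auto simp: sc_simps)
    also have "\<dots> = (\<Oplus>\<^bsub>sc_algebra S\<^esub>b\<in>?e ` {..<sc_dim S}. ?c b \<odot>\<^bsub>sc_algebra S\<^esub> b)"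
      by (rule finsum_reindex[symmetric, OF _ inj]) (auto simp: sc_simps)
    finally show ?thesis by (rule exI[where x = ?c])
  qed
  then have "\<exists>B. finite B \<and> B \<subseteq> carrier (sc_algebra S) \<and>
      (\<forall>x\<in>carrier (sc_algebra S). \<exists>c. x = (\<Oplus>\<^bsub>sc_algebra S\<^esub>b\<in>B. c b \<odot>\<^bsub>sc_algebra S\<^esub> b))"
    by (intro exI[of _ "?e ` {..<sc_dim S}"]) (auto simp: sc_simps)
  then show "central_simple (sc_algebra S)"
    using s by (simp add: central_simple_def simple_central_def k_algebra_iff)
qed (rule central_simple_imp_simple_central)

lemma sum_lessThan_mult:
  "(\<Sum>l<s * q. f l) = (\<Sum>i<s. \<Sum>c<q. f (i * q + c :: nat))"
  by (simp add: sum.nat_group[symmetric] sum.shift_bounds_nat_ivl[of f 0, simplified] atLeast0LessThan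
      add.commute[of "_ * q"] flip: sum.shift_bounds_nat_ivl)

text \<open>Universal property of the tensor product. \<open>F\<close> is fixed by its values on the
  basis of \<open>T\<close>; on pure tensors it is multiplicative because the images of
  \<open>f\<close> and \<open>g\<close> commute, and \<open>tens_induct\<close> extends this to all
  elements.\<close>

lemma (in tensor) tensor_hom:
  assumes f: "kalg_hom A C f" and g: "kalg_hom U C g"
    and comm: "\<And>x t. x \<in> carrier A ==> t \<in> carrier U ==> f x \<otimes>\<^bsub>C\<^esub> g t = g t \<otimes>\<^bsub>C\<^esub> f x"
  obtains F where "kalg_hom B C F"
    "\<And>x t. x \<in> carrier A ==> t \<in> carrier U ==> F (pure_tensor A T x t) = f x \<otimes>\<^bsub>C\<^esub> g t"
proof -
  interpret f: kalg_hom A C f by fact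
  interpret g: kalg_hom U C g by fact
  interpret B: kalg B by (rule kalg_tens)
  let ?e = "\<lambda>b l. if l = b then 1 else (0::'k)"
  have e: "?e b \<in> carrier U" if "b < sc_dim T" for b using that by (simp add: sc_simps)
  let ?F = "\<lambda>z. \<Oplus>\<^bsub>C\<^esub>b\<in>{..<sc_dim T}. f (z b) \<otimes>\<^bsub>C\<^esub> g (?e b)"
  have cl: "f (z b) \<otimes>\<^bsub>C\<^esub> g (?e b) \<in> carrier C" if "z \<in> carrier B" "b < sc_dim T" for z b
    using tens_entry[OF that] e[OF that(2)] by simp
  have Fcl: "?F z \<in> carrier C" if "z \<in> carrier B" for z
    using cl[OF that] by (intro f.T.finsum_closed) auto
  have add: "?F (x \<oplus>\<^bsub>B\<^esub> y) = ?F x \<oplus>\<^bsub>C\<^esub> ?F y" if xy: "x \<in> carrier B" "y \<in> carrier B" for x y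
  proof -
    have "?F (x \<oplus>\<^bsub>B\<^esub> y) = (\<Oplus>\<^bsub>C\<^esub>b\<in>{..<sc_dim T}. f (x b) \<otimes>\<^bsub>C\<^esub> g (?e b) \<oplus>\<^bsub>C\<^esub> f (y b) \<otimes>\<^bsub>C\<^esub> g (?e b))"
      by (rule f.T.finsum_cong')
        (use xy e in \<open>auto simp: tens_simps(5) tens_entry[of _ A T] f.hom_add f.T.l_distr\<close>)
    also have "\<dots> = ?F x \<oplus>\<^bsub>C\<^esub> ?F y"
      using cl xy by (intro f.T.finsum_addf) auto
    finally show ?thesis .
  qed
  have zero: "?F \<zero>\<^bsub>B\<^esub> = \<zero>\<^bsub>C\<^esub>"
  proof -
    have "?F \<zero>\<^bsub>B\<^esub> = (\<Oplus>\<^bsub>C\<^esub>b\<in>{..<sc_dim T}. \<zero>\<^bsub>C\<^esub>)"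
      by (rule f.T.finsum_cong') (use e in \<open>auto simp: tens_simps(4) f.hom_zero\<close>)
    then show ?thesis by simp
  qed
  have pure: "?F (pure_tensor A T x t) = f x \<otimes>\<^bsub>C\<^esub> g t" if x: "x \<in> carrier A" and t: "t \<in> carrier U" for x t
  proof -
    have "?F (pure_tensor A T x t) = (\<Oplus>\<^bsub>C\<^esub>b\<in>{..<sc_dim T}. f x \<otimes>\<^bsub>C\<^esub> g (t b \<odot>\<^bsub>U\<^esub> ?e b))"
      by (rule f.T.finsum_cong')
        (use x e in \<open>auto simp: tens_simps(7) f.hom_smult g.hom_smult f.T.smult_lmult f.T.smult_rmult\<close>)
    also have "\<dots> = f x \<otimes>\<^bsub>C\<^esub> (\<Oplus>\<^bsub>C\<^esub>b\<in>{..<sc_dim T}. g (t b \<odot>\<^bsub>U\<^esub> ?e b))"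
      using x e by (intro f.T.finsum_rdistr[symmetric]) auto
    also have "(\<Oplus>\<^bsub>C\<^esub>b\<in>{..<sc_dim T}. g (t b \<odot>\<^bsub>U\<^esub> ?e b)) = g (\<Oplus>\<^bsub>U\<^esub>b\<in>{..<sc_dim T}. t b \<odot>\<^bsub>U\<^esub> ?e b)"
      using e by (intro g.hom_finsum[symmetric]) auto
    also have "(\<Oplus>\<^bsub>U\<^esub>b\<in>{..<sc_dim T}. t b \<odot>\<^bsub>U\<^esub> ?e b) = t"
      using sc_basis_expand[OF T.kalg_axioms t] by simp
    finally show ?thesis .
  qed
  have mult: "?F (x \<otimes>\<^bsub>B\<^esub> y) = ?F x \<otimes>\<^bsub>C\<^esub> ?F y" if x: "x \<in> carrier B" and y: "y \<in> carrier B" for x y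
    using x
  proof (induction x rule: tens_induct)
    case (pure a t)
    note at = this
    show ?case
      using y
    proof (induction y rule: tens_induct)
      case (pure b u)
      have "?F (pure_tensor A T a t \<otimes>\<^bsub>B\<^esub> pure_tensor A T b u) = f (a \<otimes> b) \<otimes>\<^bsub>C\<^esub> g (t \<otimes>\<^bsub>U\<^esub> u)"
        using at pure by (subst pure_mult) (simp_all add: \<open>\<And>x t. x \<in> carrier A ==> t \<in> carrier U ==> ?F (pure_tensor A T x t) = f x \<otimes>\<^bsub>C\<^esub> g t\<close>)
      also have "\<dots> = f a \<otimes>\<^bsub>C\<^esub> ((f b \<otimes>\<^bsub>C\<^esub> g t) \<otimes>\<^bsub>C\<^esub> g u)"
        using at pure by (simp add: f.hom_mult g.hom_mult f.T.m_assoc)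
      also have "\<dots> = (f a \<otimes>\<^bsub>C\<^esub> g t) \<otimes>\<^bsub>C\<^esub> (f b \<otimes>\<^bsub>C\<^esub> g u)"
        using at pure by (simp only: comm[OF pure(1) at(2)] f.T.m_assoc f.closed g.closed f.T.m_closed)
      also have "\<dots> = ?F (pure_tensor A T a t) \<otimes>\<^bsub>C\<^esub> ?F (pure_tensor A T b u)"
        using at pure by (simp add: \<open>\<And>x t. x \<in> carrier A ==> t \<in> carrier U ==> ?F (pure_tensor A T x t) = f x \<otimes>\<^bsub>C\<^esub> g t\<close>)
      finally show ?case .
    next
      case zero
      show ?case using at by (simp only: tens_zero_mult pure_closed \<open>?F \<zero>\<^bsub>B\<^esub> = \<zero>\<^bsub>C\<^esub>\<close> f.T.r_null Fcl)
    next
      case (add y z)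
      then show ?case
        using at by (simp only: tens_rdistr pure_closed tens_closed Fcl
          \<open>\<And>x y. x \<in> carrier B ==> y \<in> carrier B ==> ?F (x \<oplus>\<^bsub>B\<^esub> y) = ?F x \<oplus>\<^bsub>C\<^esub> ?F y\<close> f.T.r_distr)
    qed
  next
    case zero
    show ?case using y by (simp only: tens_zero_mult \<open>?F \<zero>\<^bsub>B\<^esub> = \<zero>\<^bsub>C\<^esub>\<close> f.T.l_null Fcl)
  next
    case (add x z)
    then show ?case
      using y by (simp only: tens_ldistr tens_closed Fcl
        \<open>\<And>x y. x \<in> carrier B ==> y \<in> carrier B ==> ?F (x \<oplus>\<^bsub>B\<^esub> y) = ?F x \<oplus>\<^bsub>C\<^esub> ?F y\<close> f.T.l_distr)
  qed
  have "kalg_hom B C ?F"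
  proof (intro kalg_hom.intro kalg_hom_axioms.intro B.kalg_axioms f.T.kalg_axioms)
    fix x c assume x: "x \<in> carrier B"
    have "?F (c \<odot>\<^bsub>B\<^esub> x) = (\<Oplus>\<^bsub>C\<^esub>b\<in>{..<sc_dim T}. c \<odot>\<^bsub>C\<^esub> (f (x b) \<otimes>\<^bsub>C\<^esub> g (?e b)))"
      by (rule f.T.finsum_cong')
        (use x e in \<open>auto simp: tens_simps(6) tens_entry[of _ A T] f.hom_smult f.T.smult_lmult\<close>)
    also have "\<dots> = c \<odot>\<^bsub>C\<^esub> ?F x"
      using cl[OF x] by (intro f.T.smult_finsum[symmetric]) auto
    finally show "?F (c \<odot>\<^bsub>B\<^esub> x) = c \<odot>\<^bsub>C\<^esub> ?F x" .
  next
    show "?F \<one>\<^bsub>B\<^esub> = \<one>\<^bsub>C\<^esub>"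
      unfolding one_eq_pure using pure[of \<one> "\<one>\<^bsub>U\<^esub>"] by (simp add: f.hom_one g.hom_one)
  qed (rule Fcl add mult; assumption)+
  then show thesis using pure that by blast
qed

lemma iso_rel_tens_cong:
  assumes "iso_rel A A'" "kalg A" "kalg A'" and T: "kalg (sc_algebra T)"
  shows "iso_rel (tens A T) (tens A' T)"
proof -
  obtain f where f: "kalg_hom A A' f" "bij_betw f (carrier A) (carrier A')"
    using assms by (metis iso_relE)
  interpret f: kalg_hom A A' f by fact
  interpret t: tensor A T by (intro tensor.intro f.S.kalg_axioms T)
  interpret t': tensor A' T by (intro tensor.intro f.T.kalg_axioms T)
  let ?F = "\<lambda>z. \<lambda>b\<in>{..<sc_dim T}. f (z b)"
  have car: "f ` carrier A = carrier A'" and inj: "inj_on f (carrier A)"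
    using f(2) by (auto simp: bij_betw_def)
  have Fcl: "?F z \<in> carrier t'.B" if "z \<in> carrier t.B" for z
    using tens_entry[OF that] by (auto simp: tens_simps(1))
  have hom: "kalg_hom t.B t'.B ?F"
  proof (intro kalg_hom.intro kalg_hom_axioms.intro t.kalg_tens t'.kalg_tens)
    fix x y assume xy: "x \<in> carrier t.B" "y \<in> carrier t.B"
    note e = tens_entry[OF xy(1)] tens_entry[OF xy(2)]
    show "?F (x \<oplus>\<^bsub>t.B\<^esub> y) = ?F x \<oplus>\<^bsub>t'.B\<^esub> ?F y"
      by (rule tens_eqI[of _ A' T]) (use xy e in \<open>simp_all add: Fcl t.tens_closed t'.tens_closed tens_simps(5) f.hom_add\<close>)
    show "?F (x \<otimes>\<^bsub>t.B\<^esub> y) = ?F x \<otimes>\<^bsub>t'.B\<^esub> ?F y"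
    proof (rule tens_eqI[of _ A' T])
      fix b assume b: "b < sc_dim T"
      have "?F (x \<otimes>\<^bsub>t.B\<^esub> y) b = f (\<Oplus>\<^bsub>A\<^esub>i\<in>{..<sc_dim T}. \<Oplus>\<^bsub>A\<^esub>j\<in>{..<sc_dim T}. sc_prod T i j b \<odot>\<^bsub>A\<^esub> (x i \<otimes>\<^bsub>A\<^esub> y j))"
        using b by (simp add: tens_simps(2))
      also have "\<dots> = (\<Oplus>\<^bsub>A'\<^esub>i\<in>{..<sc_dim T}. f (\<Oplus>\<^bsub>A\<^esub>j\<in>{..<sc_dim T}. sc_prod T i j b \<odot>\<^bsub>A\<^esub> (x i \<otimes>\<^bsub>A\<^esub> y j)))"
        by (rule f.hom_finsum) (auto simp: e intro!: f.S.finsum_closed)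
      also have "\<dots> = (\<Oplus>\<^bsub>A'\<^esub>i\<in>{..<sc_dim T}. \<Oplus>\<^bsub>A'\<^esub>j\<in>{..<sc_dim T}. f (sc_prod T i j b \<odot>\<^bsub>A\<^esub> (x i \<otimes>\<^bsub>A\<^esub> y j)))"
        by (intro f.T.finsum_cong' f.hom_finsum) (auto simp: e intro!: f.T.finsum_closed)
      also have "\<dots> = (?F x \<otimes>\<^bsub>t'.B\<^esub> ?F y) b"
        unfolding tens_simps(2)[OF b]
        by (intro f.T.finsum_cong') (auto simp: e f.hom_mult f.hom_smult intro!: f.T.finsum_closed f.T.finsum_cong')
      finally show "?F (x \<otimes>\<^bsub>t.B\<^esub> y) b = (?F x \<otimes>\<^bsub>t'.B\<^esub> ?F y) b" .
    qed (use xy in \<open>simp_all add: Fcl t.tens_closed t'.tens_closed\<close>)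
  next
    show "?F \<one>\<^bsub>t.B\<^esub> = \<one>\<^bsub>t'.B\<^esub>"
      by (rule tens_eqI[of _ A' T]) (simp_all add: Fcl t.tens_closed t'.tens_closed tens_simps(3) f.hom_smult f.hom_one)
  next
    fix x c assume x: "x \<in> carrier t.B"
    show "?F (c \<odot>\<^bsub>t.B\<^esub> x) = c \<odot>\<^bsub>t'.B\<^esub> ?F x"
      by (rule tens_eqI[of _ A' T])
        (use x tens_entry[OF x] in \<open>simp_all add: Fcl t.tens_closed t'.tens_closed tens_simps(6) f.hom_smult\<close>)
  qed (rule Fcl)
  have "inj_on ?F (carrier t.B)"
  proof (rule inj_onI)
    fix x y assume xy: "x \<in> carrier t.B" "y \<in> carrier t.B" "?F x = ?F y"
    show "x = y"
    proof (rule tens_eqI[OF xy(1,2)])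
      fix b assume b: "b < sc_dim T"
      then have "f (x b) = f (y b)" using fun_cong[OF xy(3), of b] by simp
      then show "x b = y b" by (rule inj_onD[OF inj _ tens_entry[OF xy(1) b] tens_entry[OF xy(2) b]])
    qed
  qed
  moreover have "z \<in> ?F ` carrier t.B" if z: "z \<in> carrier t'.B" for z
  proof
    let ?x = "\<lambda>b\<in>{..<sc_dim T}. inv_into (carrier A) f (z b)"
    have zb: "z b \<in> f ` carrier A" if "b < sc_dim T" for b
      unfolding car using tens_entry[OF z that] .
    show x: "?x \<in> carrier t.B"
      using inv_into_into[OF zb] by (auto simp: tens_simps(1))
    show "z = ?F ?x"
      by (rule tens_eqI[OF z Fcl[OF x]]) (simp add: f_inv_into_f[OF zb])
  qed
  ultimately have "bij_betw ?F (carrier t.B) (carrier t'.B)"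
    using Fcl by (auto simp: bij_betw_def)
  with hom show ?thesis by (rule iso_relI)
qed

text \<open>The isomorphism exchanges the matrix position with the coordinate in \<open>T\<close>.
  For products this only changes the order of three finite sums, over the inner matrix index and
  over the two basis indices of \<open>T\<close>.\<close>

lemma iso_rel_matrix_tens:
  assumes A: "kalg A" and T: "kalg (sc_algebra T)"
  shows "iso_rel (matrix_algebra n (tens A T)) (tens (matrix_algebra n A) T)"
proof -
  interpret A: kalg A by fact
  let ?M = "matrix_algebra n A"
  interpret t: tensor A T by (intro tensor.intro A T)
  interpret M: kalg ?M by (rule A.kalg_matrix)
  interpret m: tensor ?M T by (intro tensor.intro M.kalg_axioms T)
  interpret B: kalg t.B by (rule t.kalg_tens)
  let ?L = "matrix_algebra n t.B"
  interpret L: kalg ?L by (rule B.kalg_matrix)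
  let ?F = "\<lambda>P. \<lambda>b\<in>{..<sc_dim T}. \<lambda>(i, j)\<in>{..<n} \<times> {..<n}. P (i, j) b"
  have e: "P (i, j) b \<in> carrier A" if "P \<in> carrier ?L" "i < n" "j < n" "b < sc_dim T" for P i j b
    using tens_entry[OF matrix_entry_closed[OF that(1-3)] that(4)] .
  have Fb: "?F P b \<in> carrier ?M" if "P \<in> carrier ?L" "b < sc_dim T" for P b
    using e[OF that(1) _ _ that(2)] that(2) by (auto intro!: matrixI)
  have Fcl: "?F P \<in> carrier m.B" if "P \<in> carrier ?L" for P
    unfolding tens_simps(1)
  proof (rule PiE_I)
    fix b assume "b \<in> {..<sc_dim T}" then show "?F P b \<in> carrier ?M" using Fb[OF that, of b] by simp
  qed simp
  have eqI: "v = w" if "v \<in> carrier m.B" "w \<in> carrier m.B"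
    "\<And>b i j. [|b < sc_dim T; i < n; j < n|] ==> v b (i, j) = w b (i, j)" for v w
    by (rule tens_eqI[OF that(1,2)], rule matrix_eqI[OF tens_entry[OF that(1)] tens_entry[OF that(2)]])
      (simp_all add: that(3))
  have Fe: "?F P b (i, j) = P (i, j) b" if "b < sc_dim T" "i < n" "j < n" for P b i j
    using that by simp
  have hom: "kalg_hom ?L m.B ?F"
  proof (intro kalg_hom.intro kalg_hom_axioms.intro L.kalg_axioms m.kalg_tens)
    fix P Q assume PQ: "P \<in> carrier ?L" "Q \<in> carrier ?L"
    note eP = e[OF PQ(1)] and eQ = e[OF PQ(2)]
    show "?F (P \<oplus>\<^bsub>?L\<^esub> Q) = ?F P \<oplus>\<^bsub>m.B\<^esub> ?F Q"
      by (rule eqI) (use PQ in \<open>simp_all add: Fcl m.tens_closed tens_simps(5)\<close>)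
    show "?F (P \<otimes>\<^bsub>?L\<^esub> Q) = ?F P \<otimes>\<^bsub>m.B\<^esub> ?F Q"
    proof (rule eqI)
      fix b i j assume b: "b < sc_dim T" and ij: "i < n" "j < n"
      let ?g = "\<lambda>l c d. sc_prod T c d b \<odot>\<^bsub>A\<^esub> (P (i, l) c \<otimes>\<^bsub>A\<^esub> Q (l, j) d)"
      have g: "?g l c d \<in> carrier A" if "l < n" "c < sc_dim T" "d < sc_dim T" for l c d
        using that ij by (simp add: eP eQ)
      define N where "N c d = sc_prod T c d b \<odot>\<^bsub>?M\<^esub> (?F P c \<otimes>\<^bsub>?M\<^esub> ?F Q d)" for c d
      have N: "N c d \<in> carrier ?M" if "c < sc_dim T" "d < sc_dim T" for c d
        unfolding N_def by (rule M.smult_closed[OF M.m_closed[OF Fb[OF PQ(1) that(1)] Fb[OF PQ(2) that(2)]]])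
      have N': "N c d (i, j) \<in> carrier A" if "c < sc_dim T" "d < sc_dim T" for c d
        by (rule matrix_entry_closed[OF N[OF that] ij])
      have N2: "(\<Oplus>\<^bsub>?M\<^esub>d\<in>{..<sc_dim T}. N c d) (i, j) \<in> carrier A" if "c < sc_dim T" for c
        by (rule matrix_entry_closed[OF M.finsum_closed ij]) (use N that in auto)
      have "?F (P \<otimes>\<^bsub>?L\<^esub> Q) b (i, j) = (\<Oplus>\<^bsub>t.B\<^esub>l\<in>{..<n}. P (i, l) \<otimes>\<^bsub>t.B\<^esub> Q (l, j)) b"
        using b ij by simp
      also have "\<dots> = (\<Oplus>\<^bsub>A\<^esub>l\<in>{..<n}. (P (i, l) \<otimes>\<^bsub>t.B\<^esub> Q (l, j)) b)"
        by (rule t.finsum_tens_entry[OF _ t.tens_closed(1)[OF matrix_entry_closed[OF PQ(1)] matrix_entry_closed[OF PQ(2)]] b])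
          (use ij in simp_all)
      also have "\<dots> = (\<Oplus>\<^bsub>A\<^esub>l\<in>{..<n}. \<Oplus>\<^bsub>A\<^esub>c\<in>{..<sc_dim T}. \<Oplus>\<^bsub>A\<^esub>d\<in>{..<sc_dim T}. ?g l c d)"
        unfolding tens_simps(2)[OF b] ..
      also have "\<dots> = (\<Oplus>\<^bsub>A\<^esub>c\<in>{..<sc_dim T}. \<Oplus>\<^bsub>A\<^esub>l\<in>{..<n}. \<Oplus>\<^bsub>A\<^esub>d\<in>{..<sc_dim T}. ?g l c d)"
        by (intro A.finsum_swap) (auto intro!: A.finsum_closed g)
      also have "\<dots> = (\<Oplus>\<^bsub>A\<^esub>c\<in>{..<sc_dim T}. \<Oplus>\<^bsub>A\<^esub>d\<in>{..<sc_dim T}. \<Oplus>\<^bsub>A\<^esub>l\<in>{..<n}. ?g l c d)"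
        by (intro A.finsum_cong' A.finsum_swap) (auto intro!: A.finsum_closed g)
      also have "\<dots> = (\<Oplus>\<^bsub>A\<^esub>c\<in>{..<sc_dim T}. \<Oplus>\<^bsub>A\<^esub>d\<in>{..<sc_dim T}. N c d (i, j))"
      proof (intro A.finsum_cong' refl)
        fix c d assume cd: "c \<in> {..<sc_dim T}" "d \<in> {..<sc_dim T}"
        have "(\<Oplus>\<^bsub>A\<^esub>l\<in>{..<n}. ?g l c d) = sc_prod T c d b \<odot>\<^bsub>A\<^esub> (\<Oplus>\<^bsub>A\<^esub>l\<in>{..<n}. P (i, l) c \<otimes>\<^bsub>A\<^esub> Q (l, j) d)"
          using cd ij by (intro A.smult_finsum[symmetric]) (auto simp: eP eQ)
        also have "(\<Oplus>\<^bsub>A\<^esub>l\<in>{..<n}. P (i, l) c \<otimes>\<^bsub>A\<^esub> Q (l, j) d) = (?F P c \<otimes>\<^bsub>?M\<^esub> ?F Q d) (i, j)"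
          unfolding matrix_entry[OF ij] using cd ij by (intro A.finsum_cong') (auto simp: eP eQ)
        finally show "(\<Oplus>\<^bsub>A\<^esub>l\<in>{..<n}. ?g l c d) = N c d (i, j)"
          unfolding N_def matrix_entry(3)[OF ij] .
      qed (use N' in \<open>auto intro!: A.finsum_closed\<close>)
      also have "\<dots> = (\<Oplus>\<^bsub>A\<^esub>c\<in>{..<sc_dim T}. (\<Oplus>\<^bsub>?M\<^esub>d\<in>{..<sc_dim T}. N c d) (i, j))"
        using N N' ij by (intro A.finsum_cong' refl A.finsum_matrix_entry[symmetric] Pi_I)
          (simp_all add: N2 Pi_def)
      also have "\<dots> = (\<Oplus>\<^bsub>?M\<^esub>c\<in>{..<sc_dim T}. \<Oplus>\<^bsub>?M\<^esub>d\<in>{..<sc_dim T}. N c d) (i, j)"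
        using N ij by (intro A.finsum_matrix_entry[symmetric]) (simp_all add: M.finsum_closed Pi_def)
      also have "\<dots> = (?F P \<otimes>\<^bsub>m.B\<^esub> ?F Q) b (i, j)"
        unfolding tens_simps(2)[OF b] N_def ..
      finally show "?F (P \<otimes>\<^bsub>?L\<^esub> Q) b (i, j) = (?F P \<otimes>\<^bsub>m.B\<^esub> ?F Q) b (i, j)" .
    qed (use PQ in \<open>simp_all add: Fcl m.tens_closed\<close>)
  next
    show "?F \<one>\<^bsub>?L\<^esub> = \<one>\<^bsub>m.B\<^esub>"
      by (rule eqI) (simp_all add: Fcl m.tens_closed tens_simps(3,4))
  next
    fix P c assume P: "P \<in> carrier ?L"
    show "?F (c \<odot>\<^bsub>?L\<^esub> P) = c \<odot>\<^bsub>m.B\<^esub> ?F P"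
      by (rule eqI) (use P in \<open>simp_all add: Fcl m.tens_closed tens_simps(6)\<close>)
  qed (rule Fcl)
  have "inj_on ?F (carrier ?L)"
  proof (rule inj_onI)
    fix P Q assume PQ: "P \<in> carrier ?L" "Q \<in> carrier ?L" "?F P = ?F Q"
    show "P = Q"
    proof (rule matrix_eqI[OF PQ(1,2)])
      fix i j assume ij: "i < n" "j < n"
      show "P (i, j) = Q (i, j)"
      proof (rule tens_eqI[OF matrix_entry_closed[OF PQ(1) ij] matrix_entry_closed[OF PQ(2) ij]])
        fix b assume "b < sc_dim T"
        then show "P (i, j) b = Q (i, j) b"
          using fun_cong[OF fun_cong[OF PQ(3), of b], of "(i, j)"] ij by simp
      qed
    qed
  qed
  moreover have "Z \<in> ?F ` carrier ?L" if Z: "Z \<in> carrier m.B" for Z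
  proof
    let ?P = "\<lambda>(i, j)\<in>{..<n} \<times> {..<n}. \<lambda>b\<in>{..<sc_dim T}. Z b (i, j)"
    show P: "?P \<in> carrier ?L"
      using matrix_entry_closed[OF tens_entry[OF Z]] by (intro matrixI) (auto simp: tens_simps(1))
    show "Z = ?F ?P"
      by (rule eqI[OF Z Fcl[OF P]]) simp
  qed
  ultimately have "bij_betw ?F (carrier ?L) (carrier m.B)"
    using Fcl by (auto simp: bij_betw_def)
  with hom show ?thesis by (rule iso_relI)
qed

section \<open>The Brauer group\<close>

lemma sc_tensor_simps [simp]:
  "sc_dim (sc_tensor S T) = sc_dim S * sc_dim T"
  "sc_unit (sc_tensor S T) l = sc_unit S (l div sc_dim T) * sc_unit T (l mod sc_dim T)"
  "sc_prod (sc_tensor S T) i j l = sc_prod S (i div sc_dim T) (j div sc_dim T) (l div sc_dim T) *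
      sc_prod T (i mod sc_dim T) (j mod sc_dim T) (l mod sc_dim T)"
  by (simp_all add: sc_tensor_def Let_def)

text \<open>Index \<open>l\<close> of the tensor record splits into \<open>l div ?q\<close> for
  \<open>S\<close> and \<open>l mod ?q\<close> for \<open>T\<close>. The last statement exposes the
  isomorphism as a bijective homomorphism, the form that \<open>simple_central_transport\<close> and
  \<open>sc_tensor_hom\<close> take.\<close>

lemma sc_tensor_iso_tens:
  assumes S: "kalg (sc_algebra S)" and T: "kalg (sc_algebra T)"
  shows "kalg (sc_algebra (sc_tensor S T))"
    and "iso_rel (tens (sc_algebra S) T) (sc_algebra (sc_tensor S T))"
    and "\<exists>F. kalg_hom (tens (sc_algebra S) T) (sc_algebra (sc_tensor S T)) F \<and>
          bij_betw F (carrier (tens (sc_algebra S) T)) (carrier (sc_algebra (sc_tensor S T)))"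
proof -
  let ?S = "sc_algebra S" and ?V = "sc_algebra (sc_tensor S T)"
  let ?s = "sc_dim S" and ?q = "sc_dim T"
  interpret S: kalg ?S by fact
  interpret t: tensor ?S T by (intro tensor.intro S T)
  interpret B: kalg t.B by (rule t.kalg_tens)
  let ?F = "\<lambda>z l. if l < ?s * ?q then z (l mod ?q) (l div ?q) else (0::'a)"
  note dm = div_less_of_mult mod_less_of_mult
  have carV: "x \<in> carrier ?V \<longleftrightarrow> (\<forall>l\<ge>?s * ?q. x l = 0)" for x by (simp add: sc_simps)
  have bij: "bij_betw ?F (carrier t.B) (carrier ?V)"
    unfolding bij_betw_def
  proof
    show "inj_on ?F (carrier t.B)"
    proof (rule inj_onI)
      fix x y assume xy: "x \<in> carrier t.B" "y \<in> carrier t.B" "?F x = ?F y"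
      show "x = y"
      proof (rule tens_eqI[OF xy(1,2)])
        fix b assume b: "b < ?q"
        show "x b = y b"
        proof
          fix i
          show "x b i = y b i"
          proof (cases "i < ?s")
            case True
            then show ?thesis using fun_cong[OF xy(3), of "i * ?q + b"] b by (simp add: mult_add_less)
          qed (use tens_entry[OF xy(1) b] tens_entry[OF xy(2) b] in \<open>simp add: sc_simps\<close>)
        qed
      qed
    qed
    show "?F ` carrier t.B = carrier ?V"
    proof (intro equalityI subsetI)
      fix v assume v: "v \<in> carrier ?V"
      let ?z = "\<lambda>b\<in>{..<?q}. \<lambda>i. if i < ?s then v (i * ?q + b) else 0"
      have zc: "?z \<in> carrier t.B" by (auto simp: tens_simps(1) sc_simps)
      have zv: "?F ?z = v"
      proof
        fix l show "?F ?z l = v l"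
        proof (cases "l < ?s * ?q")
          case True
          then show ?thesis using dm[OF True] by simp
        qed (use v in \<open>simp add: carV\<close>)
      qed
      show "v \<in> ?F ` carrier t.B" by (rule image_eqI) (rule zv[symmetric], rule zc)
    qed (auto simp: carV)
  qed
  have mult: "?F (x \<otimes>\<^bsub>t.B\<^esub> y) = ?F x \<otimes>\<^bsub>?V\<^esub> ?F y" if x: "x \<in> carrier t.B" and y: "y \<in> carrier t.B" for x y
  proof
    fix l
    show "?F (x \<otimes>\<^bsub>t.B\<^esub> y) l = (?F x \<otimes>\<^bsub>?V\<^esub> ?F y) l"
    proof (cases "l < ?s * ?q")
      case True
      note l = dm[OF True]
      have xm: "x c \<otimes>\<^bsub>?S\<^esub> y d \<in> carrier ?S" if "c < ?q" "d < ?q" for c d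
        using tens_entry[OF x that(1)] tens_entry[OF y that(2)] by simp
      let ?g = "\<lambda>c d i j. x c i * y d j * (sc_prod S i j (l div ?q) * sc_prod T c d (l mod ?q))"
      have "(x \<otimes>\<^bsub>t.B\<^esub> y) (l mod ?q) (l div ?q) =
          (\<Sum>c<?q. (finsum ?S (\<lambda>d. sc_prod T c d (l mod ?q) \<odot>\<^bsub>?S\<^esub> (x c \<otimes>\<^bsub>?S\<^esub> y d)) {..<?q}) (l div ?q))"
        unfolding tens_simps(2)[OF l(2)]
        by (rule fun_cong[OF finsum_sc_algebra[OF S finite_lessThan]])
          (intro Pi_I S.finsum_closed S.smult_closed xm; simp)
      also have "\<dots> = (\<Sum>c<?q. \<Sum>d<?q. sc_prod T c d (l mod ?q) * (\<Sum>i<?s. \<Sum>j<?s. x c i * y d j * sc_prod S i j (l div ?q)))"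
      proof (rule sum.cong[OF refl])
        fix c assume c: "c \<in> {..<?q}"
        show "(finsum ?S (\<lambda>d. sc_prod T c d (l mod ?q) \<odot>\<^bsub>?S\<^esub> (x c \<otimes>\<^bsub>?S\<^esub> y d)) {..<?q}) (l div ?q) =
            (\<Sum>d<?q. sc_prod T c d (l mod ?q) * (\<Sum>i<?s. \<Sum>j<?s. x c i * y d j * sc_prod S i j (l div ?q)))"
        proof -
          have cl: "(\<lambda>d. sc_prod T c d (l mod ?q) \<odot>\<^bsub>?S\<^esub> (x c \<otimes>\<^bsub>?S\<^esub> y d)) \<in> {..<?q} \<rightarrow> carrier ?S"
            using c by (intro Pi_I S.smult_closed xm) simp_all
          show ?thesis
            unfolding fun_cong[OF finsum_sc_algebra[OF S finite_lessThan cl]] using l by (simp add: sc_simps(4,6))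
        qed
      qed
      also have "\<dots> = (\<Sum>c<?q. \<Sum>d<?q. \<Sum>i<?s. \<Sum>j<?s. ?g c d i j)"
        by (simp add: sum_distrib_left mult_ac)
      also have "\<dots> = (\<Sum>i<?s. \<Sum>c<?q. \<Sum>j<?s. \<Sum>d<?q. ?g c d i j)"
      proof -
        have "(\<Sum>c<?q. \<Sum>d<?q. \<Sum>i<?s. \<Sum>j<?s. ?g c d i j) = (\<Sum>c<?q. \<Sum>i<?s. \<Sum>d<?q. \<Sum>j<?s. ?g c d i j)"
          by (intro sum.cong refl sum.swap)
        also have "\<dots> = (\<Sum>c<?q. \<Sum>i<?s. \<Sum>j<?s. \<Sum>d<?q. ?g c d i j)"
          by (intro sum.cong refl sum.swap)
        also have "\<dots> = (\<Sum>i<?s. \<Sum>c<?q. \<Sum>j<?s. \<Sum>d<?q. ?g c d i j)"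
          by (rule sum.swap)
        finally show ?thesis .
      qed
      also have "\<dots> = (\<Sum>i<?s. \<Sum>c<?q. \<Sum>j<?s. \<Sum>d<?q. ?F x (i * ?q + c) * ?F y (j * ?q + d) *
          sc_prod (sc_tensor S T) (i * ?q + c) (j * ?q + d) l)"
        by (intro sum.cong refl) (simp add: mult_add_less)
      also have "\<dots> = (\<Sum>i<?s * ?q. \<Sum>j<?s * ?q. ?F x i * ?F y j * sc_prod (sc_tensor S T) i j l)"
        unfolding sum_lessThan_mult ..
      finally show ?thesis using True by (simp add: sc_simps(6))
    qed (simp add: sc_simps)
  qed
  have add: "?F (x \<oplus>\<^bsub>t.B\<^esub> y) = ?F x \<oplus>\<^bsub>?V\<^esub> ?F y" for x y
    by (rule ext) (simp add: sc_simps(3) dm tens_simps(5))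
  have smult: "?F (c \<odot>\<^bsub>t.B\<^esub> x) = c \<odot>\<^bsub>?V\<^esub> ?F x" for c x
    by (rule ext) (simp add: sc_simps(4) dm tens_simps(6))
  have one: "?F \<one>\<^bsub>t.B\<^esub> = \<one>\<^bsub>?V\<^esub>"
    by (rule ext) (simp add: sc_simps(4,5) dm tens_simps(3))
  have zero: "?F \<zero>\<^bsub>t.B\<^esub> = \<zero>\<^bsub>?V\<^esub>"
    by (rule ext) (simp add: sc_simps(2) dm tens_simps(4))
  have "kalg ?V \<and> kalg_hom t.B ?V ?F \<and> iso_rel t.B ?V"
    by (intro conjI; rule kalg_transport[OF B.kalg_axioms bij]; (rule add smult one zero | rule mult; assumption))
  then show "kalg ?V" "iso_rel t.B ?V"
    "\<exists>F. kalg_hom t.B ?V F \<and> bij_betw F (carrier t.B) (carrier ?V)"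
    using bij by blast+
qed

text \<open>A renumbering of the basis is an isomorphism; it reads the coordinates at the permuted
  index.\<close>

lemma sc_perm_iso:
  assumes S: "kalg (sc_algebra S)" and dim: "sc_dim S' = sc_dim S"
    and p: "bij_betw p {..<sc_dim S} {..<sc_dim S}"
    and unit: "\<And>l. l < sc_dim S ==> sc_unit S' l = sc_unit S (p l)"
    and prod: "\<And>i j l. [|i < sc_dim S; j < sc_dim S; l < sc_dim S|] ==> sc_prod S' i j l = sc_prod S (p i) (p j) (p l)"
  shows "iso_rel (sc_algebra S) (sc_algebra S')"
proof -
  let ?n = "sc_dim S" and ?A = "sc_algebra S" and ?B = "sc_algebra S'"
  let ?F = "\<lambda>x l. if l < ?n then x (p l) else (0::'a)"
  have pn: "p l < ?n" if "l < ?n" for l using p that by (auto simp: bij_betw_def)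
  have surj: "\<exists>l<?n. i = p l" if "i < ?n" for i using p that by (auto simp: bij_betw_def image_iff set_eq_iff)
  have bij: "bij_betw ?F (carrier ?A) (carrier ?B)"
    unfolding bij_betw_def
  proof
    show "inj_on ?F (carrier ?A)"
    proof (rule inj_onI, rule ext)
      fix x y i assume xy: "x \<in> carrier ?A" "y \<in> carrier ?A" "?F x = ?F y"
      show "x i = y i"
      proof (cases "i < ?n")
        case True
        then obtain l where "l < ?n" "i = p l" using surj by blast
        then show ?thesis using fun_cong[OF xy(3), of l] by simp
      qed (use xy in \<open>simp add: sc_simps\<close>)
    qed
    show "?F ` carrier ?A = carrier ?B"
    proof (intro equalityI subsetI)
      fix v assume v: "v \<in> carrier ?B"
      let ?z = "\<lambda>i. if i < ?n then v (inv_into {..<?n} p i) else 0"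
      have zc: "?z \<in> carrier ?A" by (simp add: sc_simps)
      have zv: "?F ?z = v"
      proof
        fix l show "?F ?z l = v l"
        proof (cases "l < ?n")
          case True
          then have "inv_into {..<?n} p (p l) = l" using p by (auto simp: bij_betw_def)
          then show ?thesis using True by (simp add: pn)
        qed (use v dim in \<open>simp add: sc_simps\<close>)
      qed
      show "v \<in> ?F ` carrier ?A" by (rule image_eqI) (rule zv[symmetric], rule zc)
    qed (auto simp: sc_simps dim)
  qed
  have mult: "?F (x \<otimes>\<^bsub>?A\<^esub> y) = ?F x \<otimes>\<^bsub>?B\<^esub> ?F y" for x y
  proof
    fix l
    show "?F (x \<otimes>\<^bsub>?A\<^esub> y) l = (?F x \<otimes>\<^bsub>?B\<^esub> ?F y) l"
    proof (cases "l < ?n")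
      case True
      have "(\<Sum>i<?n. \<Sum>j<?n. ?F x i * ?F y j * sc_prod S' i j l) =
          (\<Sum>i<?n. \<Sum>j<?n. x (p i) * y (p j) * sc_prod S (p i) (p j) (p l))"
        using True by (intro sum.cong refl) (simp add: prod)
      also have "\<dots> = (\<Sum>i<?n. \<Sum>j<?n. x (p i) * y j * sc_prod S (p i) j (p l))"
        by (intro sum.cong refl sum.reindex_bij_betw[OF p])
      also have "\<dots> = (\<Sum>i<?n. \<Sum>j<?n. x i * y j * sc_prod S i j (p l))"
        by (rule sum.reindex_bij_betw[OF p])
      finally show ?thesis using True by (simp add: sc_simps(6) dim pn)
    qed (simp add: sc_simps dim)
  qed
  show ?thesis
    by (rule kalg_transport(3)[OF S bij])
      (rule mult | (simp add: sc_simps(2-5) dim unit pn fun_eq_iff; fail))+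
qed

text \<open>The permutation exchanges quotient and remainder: an index of the product of
  \<open>T\<close> and \<open>S\<close> with parts (j, i) becomes the index of the product of
  \<open>S\<close> and \<open>T\<close> with parts (i, j).\<close>

lemma sc_tensor_commute:
  assumes "kalg (sc_algebra S)" "kalg (sc_algebra T)"
  shows "iso_rel (sc_algebra (sc_tensor S T)) (sc_algebra (sc_tensor T S))"
proof -
  let ?s = "sc_dim S" and ?t = "sc_dim T"
  let ?p = "\<lambda>l. (l mod ?s) * ?t + l div ?s"
  have dm: "l div ?s < ?t" "l mod ?s < ?s" if "l < ?s * ?t" for l
    using that by (simp_all add: div_less_of_mult mod_less_of_mult[of l ?t] mult.commute)
  have dm': "l div ?t < ?s" "l mod ?t < ?t" if "l < ?s * ?t" for l
    using that by (simp_all add: div_less_of_mult mod_less_of_mult[of l ?s])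
  have dv: "(x * q + y) div q = x" "(x * q + y) mod q = y" if "y < q" for x y q :: nat
    using that by simp_all
  have bij: "bij_betw ?p {..<?s * ?t} {..<?s * ?t}"
  proof (rule bij_betw_byWitness[where f' = "\<lambda>l. (l mod ?t) * ?s + l div ?t"])
    show "?p ` {..<?s * ?t} \<subseteq> {..<?s * ?t}"
    proof
      fix x assume "x \<in> ?p ` {..<?s * ?t}"
      then obtain l where "l < ?s * ?t" "x = ?p l" by auto
      then show "x \<in> {..<?s * ?t}" using mult_add_less[OF dm(2) dm(1)] by simp
    qed
    show "(\<lambda>l. (l mod ?t) * ?s + l div ?t) ` {..<?s * ?t} \<subseteq> {..<?s * ?t}"
    proof
      fix x assume "x \<in> (\<lambda>l. (l mod ?t) * ?s + l div ?t) ` {..<?s * ?t}"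
      then obtain l where "l < ?s * ?t" "x = (l mod ?t) * ?s + l div ?t" by auto
      then show "x \<in> {..<?s * ?t}" using mult_add_less[OF dm'(2) dm'(1)] by (simp add: mult.commute)
    qed
  next
    show "\<forall>l\<in>{..<?s * ?t}. ?p l mod ?t * ?s + ?p l div ?t = l"
      by (intro ballI) (simp only: dv[OF dm(1)] lessThan_iff div_mult_mod_eq)
    show "\<forall>l\<in>{..<?s * ?t}. (l mod ?t * ?s + l div ?t) mod ?s * ?t + (l mod ?t * ?s + l div ?t) div ?s = l"
      by (intro ballI) (simp only: dv[OF dm'(1)] lessThan_iff div_mult_mod_eq)
  qed
  show ?thesis
  proof (rule sc_perm_iso[where p = ?p])
    fix i j l assume "i < sc_dim (sc_tensor S T)" "j < sc_dim (sc_tensor S T)" "l < sc_dim (sc_tensor S T)"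
    then have ijl: "i < ?s * ?t" "j < ?s * ?t" "l < ?s * ?t" by simp_all
    show "sc_unit (sc_tensor T S) l = sc_unit (sc_tensor S T) (?p l)"
      by (simp only: sc_tensor_simps dv[OF dm(1)[OF ijl(3)]]) (rule mult.commute)
    show "sc_prod (sc_tensor T S) i j l = sc_prod (sc_tensor S T) (?p i) (?p j) (?p l)"
      by (simp only: sc_tensor_simps dv[OF dm(1)[OF ijl(1)]] dv[OF dm(1)[OF ijl(2)]] dv[OF dm(1)[OF ijl(3)]]) (rule mult.commute)
  qed (use bij sc_tensor_iso_tens(1)[OF assms] in \<open>simp_all add: mult.commute[of ?t ?s]\<close>)
qed

text \<open>An equality of records, not merely an isomorphism: both sides decode an index by the
  same mixed radix expansion, also outside the range of valid indices.\<close>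

lemma sc_tensor_assoc: "sc_tensor (sc_tensor S T) V = sc_tensor S (sc_tensor T V)"
proof -
  have d: "l div (sc_dim T * sc_dim V) = l div sc_dim V div sc_dim T" for l
    by (simp add: mult.commute[of "sc_dim T"] div_mult2_eq)
  have m: "l mod (sc_dim T * sc_dim V) div sc_dim V = l div sc_dim V mod sc_dim T" for l
    by (cases "sc_dim V = 0") (simp_all add: mult.commute[of "sc_dim T"] mod_mult2_eq)
  have m2: "l mod (sc_dim T * sc_dim V) mod sc_dim V = l mod sc_dim V" for l
    by (simp add: mod_mod_cancel)
  show ?thesis
    by (rule struct_consts.equality) (simp_all add: d m m2 mult.assoc fun_eq_iff)
qed

definition sc_one :: "'k::field struct_consts" where
  "sc_one = \<lparr>sc_dim = 1, sc_unit = (\<lambda>_. 1), sc_prod = (\<lambda>_ _ _. 1)\<rparr>"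

text \<open>Quotient and remainder by 1 are trivial for every index, so the right unit law is again
  an equality of records.\<close>

lemma sc_tensor_one: "sc_tensor S sc_one = S"
  by (rule struct_consts.equality) (simp_all add: sc_one_def fun_eq_iff)

lemma kalg_field_algebra: "kalg field_algebra"
  by (rule kalgI) (auto simp: field_algebra_def algebra_simps)

lemma sc_one_iso:
  "kalg (sc_algebra (sc_one :: 'k::field struct_consts))"
  "iso_rel field_algebra (sc_algebra (sc_one :: 'k struct_consts))"
  "simple_central (sc_algebra (sc_one :: 'k struct_consts))"
proof -
  let ?F = "\<lambda>c l. if l = (0::nat) then c else (0::'k)"
  have bij: "bij_betw ?F (carrier field_algebra) (carrier (sc_algebra sc_one))"
  proof (rule bij_betwI[where g = "\<lambda>x. x 0"])
    fix x :: "nat => 'k" assume "x \<in> carrier (sc_algebra sc_one)"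
    then have "x l = 0" if "l \<noteq> 0" for l using that by (simp add: sc_simps sc_one_def)
    then show "?F (x 0) = x" by auto
  qed (auto simp: field_algebra_def sc_simps sc_one_def)
  have T: "kalg (sc_algebra (sc_one :: 'k struct_consts)) \<and> kalg_hom field_algebra (sc_algebra sc_one) ?F \<and>
      iso_rel field_algebra (sc_algebra (sc_one :: 'k struct_consts))"
    by (intro conjI; rule kalg_transport[OF kalg_field_algebra bij])
      (auto simp: field_algebra_def sc_simps sc_one_def fun_eq_iff)
  then show "kalg (sc_algebra (sc_one :: 'k struct_consts))" "iso_rel field_algebra (sc_algebra (sc_one :: 'k struct_consts))" by simp_all
  interpret kalg "field_algebra :: ('k, 'k) module" by (rule kalg_field_algebra)
  have "I = {0} \<or> I = UNIV" if I: "ideal I (field_algebra :: ('k, 'k) module)" for I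
  proof (cases "I \<subseteq> {0}")
    case True
    then show ?thesis using additive_subgroup.zero_closed[OF ideal.axioms(1)[OF I]] by (auto simp: field_algebra_def)
  next
    case False
    then obtain x where x: "x \<in> I" "x \<noteq> 0" by blast
    have "y \<in> I" for y
      using ideal_smult[OF I x(1), of "y / x"] x(2) by (simp add: field_algebra_def)
    then show ?thesis by auto
  qed
  then have "simple_central (field_algebra :: ('k, 'k) module)"
    using kalg_field_algebra by (simp add: simple_central_def) (simp add: field_algebra_def)
  then show "simple_central (sc_algebra (sc_one :: 'k struct_consts))"
    using simple_central_transport[OF _ _ bij] T by blast
qed

lemma simple_central_sc_tensor:
  assumes "simple_central (sc_algebra S)" "simple_central (sc_algebra T)"
  shows "simple_central (sc_algebra (sc_tensor S T))"
proof -
  have k: "kalg (sc_algebra S)" "kalg (sc_algebra T)"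
    using assms by (simp_all add: simple_central_def)
  interpret t: tensor "sc_algebra S" T by (intro tensor.intro k)
  obtain F where "kalg_hom t.B (sc_algebra (sc_tensor S T)) F"
    "bij_betw F (carrier t.B) (carrier (sc_algebra (sc_tensor S T)))"
    using sc_tensor_iso_tens(3)[OF k] by blast
  then show ?thesis by (rule simple_central_transport[OF t.simple_central_tens[OF assms]])
qed

text \<open>Tensoring with \<open>T\<close> commutes with forming matrices, so an isomorphism
  between matrix algebras over \<open>S\<close> and \<open>S'\<close> survives it.\<close>

lemma brauer_equiv_sc_tensor_left:
  assumes e: "brauer_equiv (sc_algebra S) (sc_algebra S')"
    and k: "kalg (sc_algebra S)" "kalg (sc_algebra S')" "kalg (sc_algebra T)"
  shows "brauer_equiv (sc_algebra (sc_tensor S T)) (sc_algebra (sc_tensor S' T))"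
proof -
  obtain m n where mn: "m > 0" "n > 0" "iso_rel (matrix_algebra m (sc_algebra S)) (matrix_algebra n (sc_algebra S'))"
    using e by (auto simp: brauer_equiv_iff)
  have kt: "kalg (tens A T)" if "kalg A" for A :: "('a, nat \<times> nat => nat => 'a) module"
    using that k(3) by (intro tensor.kalg_tens tensor.intro)
  have ks: "kalg (tens (sc_algebra S) T)" "kalg (tens (sc_algebra S') T)"
    using k by (simp_all add: tensor.kalg_tens tensor.intro)
  note kv = sc_tensor_iso_tens(1)[OF k(1,3)] sc_tensor_iso_tens(1)[OF k(2,3)]
  note K = k kt ks kv kalg.kalg_matrix[OF ks(1)] kalg.kalg_matrix[OF ks(2)] kalg.kalg_matrix[OF kv(1)]
    kalg.kalg_matrix[OF kv(2)] kalg.kalg_matrix[OF k(1)] kalg.kalg_matrix[OF k(2)]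
  have 1: "iso_rel (matrix_algebra m (sc_algebra (sc_tensor S T))) (matrix_algebra m (tens (sc_algebra S) T))"
    by (rule iso_rel_matrix_cong[OF iso_rel_sym[OF sc_tensor_iso_tens(2)]]) (intro K)+
  have 2: "iso_rel (matrix_algebra m (tens (sc_algebra S) T)) (tens (matrix_algebra m (sc_algebra S)) T)"
    by (rule iso_rel_matrix_tens) (intro K)+
  have 3: "iso_rel (tens (matrix_algebra m (sc_algebra S)) T) (tens (matrix_algebra n (sc_algebra S')) T)"
    by (rule iso_rel_tens_cong[OF mn(3)]) (intro K)+
  have 4: "iso_rel (tens (matrix_algebra n (sc_algebra S')) T) (matrix_algebra n (tens (sc_algebra S') T))"
    by (rule iso_rel_sym[OF iso_rel_matrix_tens]) (intro K)+
  have 5: "iso_rel (matrix_algebra n (tens (sc_algebra S') T)) (matrix_algebra n (sc_algebra (sc_tensor S' T)))"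
    by (rule iso_rel_matrix_cong[OF sc_tensor_iso_tens(2)]) (intro K)+
  have "iso_rel (matrix_algebra m (sc_algebra (sc_tensor S T))) (matrix_algebra n (sc_algebra (sc_tensor S' T)))"
    by (rule iso_rel_trans[OF 1 iso_rel_trans[OF 2 iso_rel_trans[OF 3 iso_rel_trans[OF 4 5]]]]) (intro K)+
  then show ?thesis
    unfolding brauer_equiv_iff using mn by (intro exI[of _ m] conjI exI[of _ n]) simp_all
qed

lemma brauer_class_eqI:
  assumes "brauer_equiv A B" "kalg A" "kalg B"
  shows "brauer_class A = brauer_class B"
proof -
  have "brauer_equiv (sc_algebra S) A \<longleftrightarrow> brauer_equiv (sc_algebra S) B" if "central_simple (sc_algebra S)" for S
  proof -
    have S: "kalg (sc_algebra S)"
      using that by (simp add: central_simple_def k_algebra_iff)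
    show ?thesis
      using brauer_equiv_trans[OF _ assms(1) S assms(2,3)]
        brauer_equiv_trans[OF _ brauer_equiv_sym[OF assms] S assms(3,2)] by blast
  qed
  then show ?thesis by (auto simp: brauer_class_def)
qed

text \<open>The second factor is replaced by commuting it into the first position and back.\<close>

lemma brauer_equiv_sc_tensor:
  assumes e: "brauer_equiv (sc_algebra S) (sc_algebra S')" "brauer_equiv (sc_algebra T) (sc_algebra T')"
    and k: "kalg (sc_algebra S)" "kalg (sc_algebra S')" "kalg (sc_algebra T)" "kalg (sc_algebra T')"
  shows "brauer_equiv (sc_algebra (sc_tensor S T)) (sc_algebra (sc_tensor S' T'))"
proof -
  note kv = sc_tensor_iso_tens(1)[OF k(1,3)] sc_tensor_iso_tens(1)[OF k(2,3)] sc_tensor_iso_tens(1)[OF k(3,2)]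
    sc_tensor_iso_tens(1)[OF k(4,2)] sc_tensor_iso_tens(1)[OF k(2,4)]
  have 1: "brauer_equiv (sc_algebra (sc_tensor S T)) (sc_algebra (sc_tensor S' T))"
    by (rule brauer_equiv_sc_tensor_left[OF e(1) k(1-3)])
  have 2: "brauer_equiv (sc_algebra (sc_tensor S' T)) (sc_algebra (sc_tensor T S'))"
    by (rule iso_rel_imp_brauer_equiv[OF sc_tensor_commute[OF k(2,3)] kv(2,3)])
  have 3: "brauer_equiv (sc_algebra (sc_tensor T S')) (sc_algebra (sc_tensor T' S'))"
    by (rule brauer_equiv_sc_tensor_left[OF e(2) k(3,4,2)])
  have 4: "brauer_equiv (sc_algebra (sc_tensor T' S')) (sc_algebra (sc_tensor S' T'))"
    by (rule iso_rel_imp_brauer_equiv[OF sc_tensor_commute[OF k(4,2)] kv(4,5)])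
  show ?thesis
    by (rule brauer_equiv_trans[OF 1 brauer_equiv_trans[OF 2 brauer_equiv_trans[OF 3 4]]]) (rule kv)+
qed

text \<open>The product of classes is a union over all pairs of representatives. By compatibility
  all pairs yield one and the same class, and as both classes are nonempty the union is that
  class.\<close>

lemma brauer_group_mult:
  assumes S: "simple_central (sc_algebra S)" and T: "simple_central (sc_algebra T)"
  shows "brauer_class (sc_algebra S) \<otimes>\<^bsub>brauer_group\<^esub> brauer_class (sc_algebra T) =
    brauer_class (sc_algebra (sc_tensor S T))"
proof -
  have k: "kalg (sc_algebra S)" "kalg (sc_algebra T)"
    using S T by (simp_all add: simple_central_def)
  have eq: "brauer_class (sc_algebra (sc_tensor S' T')) = brauer_class (sc_algebra (sc_tensor S T))"
    if "S' \<in> brauer_class (sc_algebra S)" "T' \<in> brauer_class (sc_algebra T)" for S' T'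
  proof -
    have k': "kalg (sc_algebra S')" "kalg (sc_algebra T')"
      using that by (auto simp: brauer_class_def central_simple_def k_algebra_iff)
    show ?thesis
      by (rule brauer_class_eqI[OF brauer_equiv_sc_tensor])
        (use that k k' sc_tensor_iso_tens(1)[OF k] sc_tensor_iso_tens(1)[OF k'] in \<open>simp_all add: brauer_class_def\<close>)
  qed
  have mem: "S \<in> brauer_class (sc_algebra S)" "T \<in> brauer_class (sc_algebra T)"
    using S T k by (simp_all add: brauer_class_def central_simple_sc_iff brauer_equiv_refl)
  have "(\<Union>S'\<in>brauer_class (sc_algebra S). \<Union>T'\<in>brauer_class (sc_algebra T). brauer_class (sc_algebra (sc_tensor S' T'))) =
      (\<Union>S'\<in>brauer_class (sc_algebra S). \<Union>T'\<in>brauer_class (sc_algebra T). brauer_class (sc_algebra (sc_tensor S T)))"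
    by (intro SUP_cong refl eq)
  also have "\<dots> = brauer_class (sc_algebra (sc_tensor S T))"
    using mem by (subst UN_constant)+ (simp split: if_splits, blast?)
  finally show ?thesis
    by (simp only: brauer_group_def monoid.simps)
qed

lemma brauer_group_one: "\<one>\<^bsub>brauer_group\<^esub> = brauer_class (sc_algebra sc_one)"
  unfolding brauer_group_def monoid.simps
  by (rule brauer_class_eqI[OF iso_rel_imp_brauer_equiv[OF sc_one_iso(2)]]) (rule sc_one_iso kalg_field_algebra)+

lemma brauer_class_closed:
  "simple_central (sc_algebra S) ==> brauer_class (sc_algebra S) \<in> carrier brauer_group"
  by (auto simp: brauer_group_def central_simple_sc_iff)

lemma carrier_brauer_groupE:
  assumes "x \<in> carrier brauer_group"
  obtains S where "simple_central (sc_algebra S)" "x = brauer_class (sc_algebra S)"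
  using assms by (auto simp: brauer_group_def central_simple_sc_iff)

text \<open>The structure in which the products and powers of the theorem are formed. Associativity
  holds already for structure constants, commutativity only up to isomorphism.\<close>

lemma comm_monoid_brauer_group: "comm_monoid (brauer_group :: 'k::field struct_consts set monoid)"
proof (rule comm_monoidI)
  fix x y :: "'k struct_consts set" assume x: "x \<in> carrier brauer_group" and y: "y \<in> carrier brauer_group"
  obtain S where S: "simple_central (sc_algebra S)" "x = brauer_class (sc_algebra S)"
    using x by (rule carrier_brauer_groupE)
  obtain T where T: "simple_central (sc_algebra T)" "y = brauer_class (sc_algebra T)"
    using y by (rule carrier_brauer_groupE)
  note ST = S T
  then have k: "kalg (sc_algebra S)" "kalg (sc_algebra T)" by (simp_all add: simple_central_def)
  show "x \<otimes>\<^bsub>brauer_group\<^esub> y \<in> carrier brauer_group"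
    using ST by (simp add: brauer_group_mult brauer_class_closed simple_central_sc_tensor)
  show "x \<otimes>\<^bsub>brauer_group\<^esub> y = y \<otimes>\<^bsub>brauer_group\<^esub> x"
    unfolding S(2) T(2) brauer_group_mult[OF S(1) T(1)] brauer_group_mult[OF T(1) S(1)]
    by (rule brauer_class_eqI[OF iso_rel_imp_brauer_equiv[OF sc_tensor_commute]])
      (rule k sc_tensor_iso_tens(1)[OF k] sc_tensor_iso_tens(1)[OF k(2,1)])+
next
  fix x y z :: "'k struct_consts set"
  assume x: "x \<in> carrier brauer_group" and y: "y \<in> carrier brauer_group" and z: "z \<in> carrier brauer_group"
  obtain S where S: "simple_central (sc_algebra S)" "x = brauer_class (sc_algebra S)"
    using x by (rule carrier_brauer_groupE)
  obtain T where T: "simple_central (sc_algebra T)" "y = brauer_class (sc_algebra T)"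
    using y by (rule carrier_brauer_groupE)
  obtain V where V: "simple_central (sc_algebra V)" "z = brauer_class (sc_algebra V)"
    using z by (rule carrier_brauer_groupE)
  from S T V show "x \<otimes>\<^bsub>brauer_group\<^esub> y \<otimes>\<^bsub>brauer_group\<^esub> z = x \<otimes>\<^bsub>brauer_group\<^esub> (y \<otimes>\<^bsub>brauer_group\<^esub> z)"
    by (simp add: brauer_group_mult simple_central_sc_tensor sc_tensor_assoc)
next
  fix x :: "'k struct_consts set" assume "x \<in> carrier brauer_group"
  then obtain S where S: "simple_central (sc_algebra S)" "x = brauer_class (sc_algebra S)"
    by (rule carrier_brauer_groupE)
  then have k: "kalg (sc_algebra S)" by (simp add: simple_central_def)
  \<comment> \<open>On the left \<open>sc_one\<close> is a unit only up to isomorphism, since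
    indices are reduced modulo the dimension of \<open>S\<close>; the law is obtained by commuting
    the factors.\<close>
  have "brauer_class (sc_algebra (sc_tensor sc_one S)) = brauer_class (sc_algebra (sc_tensor S sc_one))"
    by (rule brauer_class_eqI[OF iso_rel_imp_brauer_equiv[OF sc_tensor_commute]])
      (rule k sc_one_iso(1) sc_tensor_iso_tens(1)[OF sc_one_iso(1) k] sc_tensor_iso_tens(1)[OF k sc_one_iso(1)])+
  then show "\<one>\<^bsub>brauer_group\<^esub> \<otimes>\<^bsub>brauer_group\<^esub> x = x"
    using S by (simp add: brauer_group_one brauer_group_mult sc_one_iso(3) sc_tensor_one)
qed (simp add: brauer_group_one brauer_class_closed sc_one_iso(3))

section \<open>Twisted group algebras\<close>

text \<open>One construction for two purposes: the Galois group with its natural action gives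
  crossed products, and (Z/p)^2 with trivial action gives symbol algebras.\<close>

definition twisted :: "('k::field => 'l::field) => 'q monoid => ('q => 'l => 'l) => ('q \<times> 'q => 'l) => ('k, 'q => 'l) module" where
  "twisted h Q act c =
     \<lparr>carrier = {x. \<forall>\<rho>. \<rho> \<notin> carrier Q \<longrightarrow> x \<rho> = 0},
      monoid.mult = (\<lambda>x y \<rho>. \<Sum>\<sigma>\<in>carrier Q. \<Sum>\<tau>\<in>carrier Q.
        if \<rho> = \<sigma> \<otimes>\<^bsub>Q\<^esub> \<tau> then x \<sigma> * act \<sigma> (y \<tau>) * c (\<sigma>, \<tau>) else 0),
      one = (\<lambda>\<rho>. if \<rho> = \<one>\<^bsub>Q\<^esub> then inverse (c (\<one>\<^bsub>Q\<^esub>, \<one>\<^bsub>Q\<^esub>)) else 0),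
      ring.zero = (\<lambda>_. 0),
      ring.add = (\<lambda>x y \<rho>. x \<rho> + y \<rho>),
      module.smult = (\<lambda>a x \<rho>. h a * x \<rho>)\<rparr>"

lemma twisted_simps:
  "carrier (twisted h Q act c) = {x. \<forall>\<rho>. \<rho> \<notin> carrier Q \<longrightarrow> x \<rho> = 0}"
  "x \<otimes>\<^bsub>twisted h Q act c\<^esub> y = (\<lambda>\<rho>. \<Sum>\<sigma>\<in>carrier Q. \<Sum>\<tau>\<in>carrier Q.
        if \<rho> = \<sigma> \<otimes>\<^bsub>Q\<^esub> \<tau> then x \<sigma> * act \<sigma> (y \<tau>) * c (\<sigma>, \<tau>) else 0)"
  "\<one>\<^bsub>twisted h Q act c\<^esub> = (\<lambda>\<rho>. if \<rho> = \<one>\<^bsub>Q\<^esub> then inverse (c (\<one>\<^bsub>Q\<^esub>, \<one>\<^bsub>Q\<^esub>)) else 0)"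
  "\<zero>\<^bsub>twisted h Q act c\<^esub> = (\<lambda>_. 0)"
  "x \<oplus>\<^bsub>twisted h Q act c\<^esub> y = (\<lambda>\<rho>. x \<rho> + y \<rho>)"
  "a \<odot>\<^bsub>twisted h Q act c\<^esub> x = (\<lambda>\<rho>. h a * x \<rho>)"
  by (simp_all add: twisted_def)

text \<open>The element a u_\<sigma>; every element of a twisted algebra is a finite sum of
  these.\<close>

definition mon_elem :: "'q => 'l::zero => 'q => 'l" where
  "mon_elem \<sigma> a = (\<lambda>\<rho>. if \<rho> = \<sigma> then a else 0)"

locale twisted_algebra = Q: group Q
  for h :: "'k::field => 'l::field" and Q :: "'q monoid" and act :: "'q => 'l => 'l" and c :: "'q \<times> 'q => 'l" +
  assumes finite_Q: "finite (carrier Q)"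
    and h_add: "h (x + y) = h x + h y" and h_mult: "h (x * y) = h x * h y" and h_one: "h 1 = 1"
    and act_add: "\<sigma> \<in> carrier Q ==> act \<sigma> (a + b) = act \<sigma> a + act \<sigma> b"
    and act_mult: "\<sigma> \<in> carrier Q ==> act \<sigma> (a * b) = act \<sigma> a * act \<sigma> b"
    and act_h: "\<sigma> \<in> carrier Q ==> act \<sigma> (h x) = h x"
    and act_act: "[|\<sigma> \<in> carrier Q; \<tau> \<in> carrier Q|] ==> act \<sigma> (act \<tau> a) = act (\<sigma> \<otimes>\<^bsub>Q\<^esub> \<tau>) a"
    and act_one: "act \<one>\<^bsub>Q\<^esub> a = a"
    and c_nonzero: "[|\<sigma> \<in> carrier Q; \<tau> \<in> carrier Q|] ==> c (\<sigma>, \<tau>) \<noteq> 0"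
    and cocycle: "[|\<sigma> \<in> carrier Q; \<tau> \<in> carrier Q; \<rho> \<in> carrier Q|] ==>
      act \<sigma> (c (\<tau>, \<rho>)) * c (\<sigma>, \<tau> \<otimes>\<^bsub>Q\<^esub> \<rho>) = c (\<sigma>, \<tau>) * c (\<sigma> \<otimes>\<^bsub>Q\<^esub> \<tau>, \<rho>)"
begin

abbreviation "W \<equiv> twisted h Q act c"

lemma act_0: "\<sigma> \<in> carrier Q ==> act \<sigma> 0 = 0"
  using act_add[of \<sigma> 0 0] by (metis add_0_right add_cancel_right_right)

lemma act_1: "\<sigma> \<in> carrier Q ==> act \<sigma> 1 = 1"
  using act_h[of \<sigma> 1] by (simp add: h_one)

lemma act_inverse: "\<sigma> \<in> carrier Q ==> act \<sigma> (inverse a) = inverse (act \<sigma> a)"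
proof (cases "a = 0")
  case False
  moreover assume "\<sigma> \<in> carrier Q"
  ultimately have "act \<sigma> a * act \<sigma> (inverse a) = 1"
    by (simp add: act_1 flip: act_mult)
  then show ?thesis by (metis inverse_unique)
qed (simp add: act_0)

lemma act_sum: "\<sigma> \<in> carrier Q ==> act \<sigma> (\<Sum>i\<in>I. f i) = (\<Sum>i\<in>I. act \<sigma> (f i))"
  by (induction I rule: infinite_finite_induct) (simp_all add: act_0 act_add)

lemma act_power: "\<sigma> \<in> carrier Q ==> act \<sigma> (a ^ n) = act \<sigma> a ^ n"
  by (induction n) (simp_all add: act_1 act_mult)

lemma h_0: "h 0 = 0"
  using h_add[of 0 0] by (metis add_0_right add_cancel_right_right)

lemma h_minus: "h (- a) = - h a"
  using h_add[of a "- a"] h_0 by (simp add: add_eq_0_iff)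

lemma h_inj: "h a = 0 ==> a = 0"
  by (metis h_mult h_one mult_zero_left right_inverse zero_neq_one)

lemma h_power: "h (a ^ n) = h a ^ n"
  by (induction n) (simp_all add: h_one h_mult)

lemma h_inverse: "h (inverse a) = inverse (h a)"
  by (cases "a = 0") (simp_all add: h_0, metis h_mult h_one inverse_unique right_inverse)

lemma h_sum: "h (\<Sum>i\<in>I. f i) = (\<Sum>i\<in>I. h (f i))"
  by (induction I rule: infinite_finite_induct) (simp_all add: h_0 h_add)

lemma h_prod: "h (\<Prod>i\<in>I. f i) = (\<Prod>i\<in>I. h (f i))"
  by (induction I rule: infinite_finite_induct) (simp_all add: h_one h_mult)

lemma twisted_closed:
  "x \<in> carrier W ==> y \<in> carrier W ==> x \<otimes>\<^bsub>W\<^esub> y \<in> carrier W"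
  "x \<in> carrier W ==> y \<in> carrier W ==> x \<oplus>\<^bsub>W\<^esub> y \<in> carrier W"
  "x \<in> carrier W ==> a \<odot>\<^bsub>W\<^esub> x \<in> carrier W"
  "\<one>\<^bsub>W\<^esub> \<in> carrier W" "\<zero>\<^bsub>W\<^esub> \<in> carrier W"
proof -
  show "x \<otimes>\<^bsub>W\<^esub> y \<in> carrier W"
    unfolding twisted_simps
    by (clarsimp intro!: sum.neutral)
qed (auto simp: twisted_simps)

lemma mon_closed: "\<sigma> \<in> carrier Q ==> mon_elem \<sigma> a \<in> carrier W"
  by (auto simp: twisted_simps mon_elem_def)

lemma mon_mult:
  assumes "\<sigma> \<in> carrier Q" "\<tau> \<in> carrier Q"
  shows "mon_elem \<sigma> a \<otimes>\<^bsub>W\<^esub> mon_elem \<tau> b = mon_elem (\<sigma> \<otimes>\<^bsub>Q\<^esub> \<tau>) (a * act \<sigma> b * c (\<sigma>, \<tau>))"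
proof
  fix \<rho>
  have "(mon_elem \<sigma> a \<otimes>\<^bsub>W\<^esub> mon_elem \<tau> b) \<rho> = (\<Sum>\<sigma>'\<in>carrier Q. if \<sigma>' = \<sigma> then
      (\<Sum>\<tau>'\<in>carrier Q. if \<tau>' = \<tau> then mon_elem (\<sigma> \<otimes>\<^bsub>Q\<^esub> \<tau>) (a * act \<sigma> b * c (\<sigma>, \<tau>)) \<rho> else 0) else 0)"
    unfolding twisted_simps by (intro sum.cong refl) (auto simp: mon_elem_def act_0 intro!: sum.cong sum.neutral)
  then show "(mon_elem \<sigma> a \<otimes>\<^bsub>W\<^esub> mon_elem \<tau> b) \<rho> = mon_elem (\<sigma> \<otimes>\<^bsub>Q\<^esub> \<tau>) (a * act \<sigma> b * c (\<sigma>, \<tau>)) \<rho>"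
    using assms finite_Q by simp
qed

lemma twisted_ldistr: "(x \<oplus>\<^bsub>W\<^esub> y) \<otimes>\<^bsub>W\<^esub> z = x \<otimes>\<^bsub>W\<^esub> z \<oplus>\<^bsub>W\<^esub> y \<otimes>\<^bsub>W\<^esub> z"
  unfolding twisted_simps by (rule ext) (auto simp: algebra_simps simp flip: sum.distrib intro!: sum.cong)

lemma twisted_rdistr: "z \<otimes>\<^bsub>W\<^esub> (x \<oplus>\<^bsub>W\<^esub> y) = z \<otimes>\<^bsub>W\<^esub> x \<oplus>\<^bsub>W\<^esub> z \<otimes>\<^bsub>W\<^esub> y"
  unfolding twisted_simps by (rule ext) (auto simp: algebra_simps act_add simp flip: sum.distrib intro!: sum.cong)

lemma twisted_smult:
  "(a \<odot>\<^bsub>W\<^esub> x) \<otimes>\<^bsub>W\<^esub> y = a \<odot>\<^bsub>W\<^esub> (x \<otimes>\<^bsub>W\<^esub> y)" "x \<otimes>\<^bsub>W\<^esub> (a \<odot>\<^bsub>W\<^esub> y) = a \<odot>\<^bsub>W\<^esub> (x \<otimes>\<^bsub>W\<^esub> y)"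
  unfolding twisted_simps
  by (rule ext; auto simp: sum_distrib_left act_mult act_h mult_ac intro!: sum.cong)+

lemma twisted_zero: "x \<otimes>\<^bsub>W\<^esub> \<zero>\<^bsub>W\<^esub> = \<zero>\<^bsub>W\<^esub>" "\<zero>\<^bsub>W\<^esub> \<otimes>\<^bsub>W\<^esub> x = \<zero>\<^bsub>W\<^esub>"
  unfolding twisted_simps by (rule ext; auto simp: act_0 intro!: sum.neutral)+

text \<open>As for tensor products: an identity that is additive in \<open>z\<close> has to be
  checked on monomials only.\<close>

lemma twisted_induct [consumes 1, case_names zero add mon]:
  assumes z: "z \<in> carrier W" and "P \<zero>\<^bsub>W\<^esub>"
    and add: "\<And>x y. [|x \<in> carrier W; y \<in> carrier W; P x; P y|] ==> P (x \<oplus>\<^bsub>W\<^esub> y)"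
    and mon: "\<And>\<sigma> a. \<sigma> \<in> carrier Q ==> P (mon_elem \<sigma> a)"
  shows "P z"
proof -
  let ?z = "\<lambda>F \<rho>. if \<rho> \<in> F then z \<rho> else 0"
  have "P (?z F)" if "finite F" "F \<subseteq> carrier Q" for F
    using that
  proof (induction F rule: finite_induct)
    case empty
    then show ?case using assms(2) by (simp add: twisted_simps)
  next
    case (insert \<sigma> F)
    have eq: "?z (insert \<sigma> F) = mon_elem \<sigma> (z \<sigma>) \<oplus>\<^bsub>W\<^esub> ?z F"
      using insert.hyps by (auto simp: twisted_simps mon_elem_def)
    show ?case
      unfolding eq
    proof (rule add)
      show "?z F \<in> carrier W" using insert.prems by (auto simp: twisted_simps)
    qed (use insert in \<open>simp_all add: mon mon_closed\<close>)
  qed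
  from this[OF finite_Q order_refl] have "P (?z (carrier Q))" .
  moreover have "?z (carrier Q) = z" using z by (auto simp: twisted_simps)
  ultimately show "P z" by simp
qed

text \<open>On monomials associativity is the cocycle identity; the rest is distributivity.\<close>

lemma twisted_assoc:
  assumes "x \<in> carrier W" "y \<in> carrier W" "z \<in> carrier W"
  shows "(x \<otimes>\<^bsub>W\<^esub> y) \<otimes>\<^bsub>W\<^esub> z = x \<otimes>\<^bsub>W\<^esub> (y \<otimes>\<^bsub>W\<^esub> z)"
  using assms(1)
proof (induction x rule: twisted_induct)
  case (mon \<sigma> a)
  note 1 = mon
  show ?case
    using assms(2)
  proof (induction y rule: twisted_induct)
    case (mon \<tau> b)
    note 2 = mon
    show ?case
      using assms(3)
    proof (induction z rule: twisted_induct)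
      case (mon \<rho> d)
      have "a * act \<sigma> b * c (\<sigma>, \<tau>) * act (\<sigma> \<otimes>\<^bsub>Q\<^esub> \<tau>) d * c (\<sigma> \<otimes>\<^bsub>Q\<^esub> \<tau>, \<rho>) =
          a * act \<sigma> b * act (\<sigma> \<otimes>\<^bsub>Q\<^esub> \<tau>) d * (c (\<sigma>, \<tau>) * c (\<sigma> \<otimes>\<^bsub>Q\<^esub> \<tau>, \<rho>))"
        by simp
      also have "\<dots> = a * act \<sigma> (b * act \<tau> d * c (\<tau>, \<rho>)) * c (\<sigma>, \<tau> \<otimes>\<^bsub>Q\<^esub> \<rho>)"
        unfolding cocycle[OF 1 2 mon, symmetric] using 1 2 mon by (simp add: act_mult act_act mult_ac)
      finally show ?case
        unfolding mon_mult[OF 1 2] mon_mult[OF Q.m_closed[OF 1 2] mon] mon_mult[OF 2 mon]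
          mon_mult[OF 1 Q.m_closed[OF 2 mon]] Q.m_assoc[OF 1 2 mon] by (rule arg_cong)
    qed (simp_all add: twisted_zero twisted_rdistr)
  qed (simp_all add: twisted_zero twisted_rdistr twisted_ldistr)
qed (simp_all add: twisted_zero twisted_ldistr)

lemma one_mon: "\<one>\<^bsub>W\<^esub> = mon_elem \<one>\<^bsub>Q\<^esub> (inverse (c (\<one>\<^bsub>Q\<^esub>, \<one>\<^bsub>Q\<^esub>)))"
  by (simp add: twisted_simps mon_elem_def)

text \<open>The cocycle is not normalised. Two neutral arguments in the cocycle identity, followed
  by cancellation, express the values with one neutral argument by the value at the neutral pair;
  this is why \<open>one_mon\<close> gives a unit.\<close>

lemma c_one: 
  assumes "\<sigma> \<in> carrier Q"
  shows "c (\<one>\<^bsub>Q\<^esub>, \<sigma>) = c (\<one>\<^bsub>Q\<^esub>, \<one>\<^bsub>Q\<^esub>)" "c (\<sigma>, \<one>\<^bsub>Q\<^esub>) = act \<sigma> (c (\<one>\<^bsub>Q\<^esub>, \<one>\<^bsub>Q\<^esub>))"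
  using cocycle[of "\<one>\<^bsub>Q\<^esub>" "\<one>\<^bsub>Q\<^esub>" \<sigma>] cocycle[of \<sigma> "\<one>\<^bsub>Q\<^esub>" "\<one>\<^bsub>Q\<^esub>"] assms c_nonzero[of "\<one>\<^bsub>Q\<^esub>" \<sigma>] c_nonzero[of \<sigma> "\<one>\<^bsub>Q\<^esub>"]
  by (simp_all add: act_one)

lemma twisted_one:
  assumes "x \<in> carrier W"
  shows "\<one>\<^bsub>W\<^esub> \<otimes>\<^bsub>W\<^esub> x = x" "x \<otimes>\<^bsub>W\<^esub> \<one>\<^bsub>W\<^esub> = x"
proof -
  have nz: "act \<sigma> (c (\<one>\<^bsub>Q\<^esub>, \<one>\<^bsub>Q\<^esub>)) \<noteq> 0" if "\<sigma> \<in> carrier Q" for \<sigma>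
    unfolding c_one(2)[OF that, symmetric] by (rule c_nonzero[OF that Q.one_closed])
  have c: "act \<sigma> (inverse (c (\<one>\<^bsub>Q\<^esub>, \<one>\<^bsub>Q\<^esub>))) * c (\<sigma>, \<one>\<^bsub>Q\<^esub>) = 1" if "\<sigma> \<in> carrier Q" for \<sigma>
    unfolding act_inverse[OF that] c_one(2)[OF that] by (rule left_inverse[OF nz[OF that]])
  show "\<one>\<^bsub>W\<^esub> \<otimes>\<^bsub>W\<^esub> x = x" using assms
  proof (induction x rule: twisted_induct)
    case (mon \<sigma> a)
    then show ?case using c_nonzero[of "\<one>\<^bsub>Q\<^esub>" "\<one>\<^bsub>Q\<^esub>"] by (simp add: one_mon mon_mult act_one c_one(1)[OF mon] field_simps)
  qed (simp_all add: twisted_zero twisted_rdistr)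
  show "x \<otimes>\<^bsub>W\<^esub> \<one>\<^bsub>W\<^esub> = x" using assms
  proof (induction x rule: twisted_induct)
    case (mon \<sigma> a)
    then show ?case using c[OF mon] by (simp add: one_mon mon_mult mult.assoc)
  qed (simp_all add: twisted_zero twisted_ldistr)
qed

lemma kalg_twisted: "kalg W"
proof (rule kalgI, goal_cases)
  case 3 then show ?case by (simp add: twisted_simps(5) add.assoc)
next
  case 4 then show ?case by (simp add: twisted_simps(5) add.commute)
next
  case 6 then show ?case by (simp add: twisted_simps(4-6) h_minus h_one)
qed (simp_all only: twisted_closed twisted_assoc twisted_one twisted_ldistr twisted_rdistr twisted_smult,
     simp_all add: twisted_simps(4-6) algebra_simps h_add h_mult h_one)

lemma mon_mult_entry:
  assumes \<mu>: "\<mu> \<in> carrier Q" and \<sigma>: "\<sigma> \<in> carrier Q" and x: "x \<in> carrier W"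
  shows "(mon_elem \<mu> a \<otimes>\<^bsub>W\<^esub> x) (\<mu> \<otimes>\<^bsub>Q\<^esub> \<sigma>) = a * act \<mu> (x \<sigma>) * c (\<mu>, \<sigma>)"
    and "(x \<otimes>\<^bsub>W\<^esub> mon_elem \<mu> a) (\<sigma> \<otimes>\<^bsub>Q\<^esub> \<mu>) = x \<sigma> * act \<sigma> a * c (\<sigma>, \<mu>)"
proof -
  show "(mon_elem \<mu> a \<otimes>\<^bsub>W\<^esub> x) (\<mu> \<otimes>\<^bsub>Q\<^esub> \<sigma>) = a * act \<mu> (x \<sigma>) * c (\<mu>, \<sigma>)" using x
  proof (induction x rule: twisted_induct)
    case zero show ?case unfolding twisted_zero using \<mu> by (simp add: twisted_simps act_0)
  next
    case (add x y) then show ?case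
      unfolding twisted_rdistr unfolding twisted_simps(5) using \<mu> by (simp add: act_add algebra_simps)
  next
    case (mon \<tau> b) then show ?case
      unfolding mon_mult[OF \<mu> mon] using \<mu> \<sigma> by (simp add: mon_elem_def act_0)
  qed
  show "(x \<otimes>\<^bsub>W\<^esub> mon_elem \<mu> a) (\<sigma> \<otimes>\<^bsub>Q\<^esub> \<mu>) = x \<sigma> * act \<sigma> a * c (\<sigma>, \<mu>)" using x
  proof (induction x rule: twisted_induct)
    case zero show ?case unfolding twisted_zero by (simp add: twisted_simps)
  next
    case (add x y) then show ?case
      unfolding twisted_ldistr unfolding twisted_simps(5) by (simp add: algebra_simps)
  next
    case (mon \<tau> b) then show ?case
      unfolding mon_mult[OF mon \<mu>] using \<mu> \<sigma> by (simp add: mon_elem_def)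
  qed
qed

end

text \<open>A twisted group algebra of an abelian group is simple central if the commutator pairing of the
  cocycle is nondegenerate: an element of an ideal of minimal support, translated so that its support
  contains \<open>1\<close>, commutes with all monomials, hence is a scalar.\<close>

lemma simple_central_twisted:
  fixes c :: "'q \<times> 'q => 'k::field"
  assumes tw: "twisted_algebra (\<lambda>x. x) Q (\<lambda>_ x. x) c" and Q: "comm_group Q"
    and nondeg: "\<And>\<sigma>. \<sigma> \<in> carrier Q ==> \<sigma> \<noteq> \<one>\<^bsub>Q\<^esub> ==> \<exists>\<mu>\<in>carrier Q. c (\<mu>, \<sigma>) \<noteq> c (\<sigma>, \<mu>)"
  shows "simple_central (twisted (\<lambda>x. x) Q (\<lambda>_ x. x) c)"
proof -
  interpret twisted_algebra "\<lambda>x. x" Q "\<lambda>_ x. x" c by fact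
  interpret Q: comm_group Q by fact
  interpret W: kalg W by (rule kalg_twisted)
  have scalar: "z = (z \<one>\<^bsub>Q\<^esub> * c (\<one>\<^bsub>Q\<^esub>, \<one>\<^bsub>Q\<^esub>)) \<odot>\<^bsub>W\<^esub> \<one>\<^bsub>W\<^esub>"
    if z: "z \<in> carrier W" and "\<And>\<sigma>. \<sigma> \<in> carrier Q ==> \<sigma> \<noteq> \<one>\<^bsub>Q\<^esub> ==> z \<sigma> = 0" for z
  proof
    fix \<sigma>
    show "z \<sigma> = ((z \<one>\<^bsub>Q\<^esub> * c (\<one>\<^bsub>Q\<^esub>, \<one>\<^bsub>Q\<^esub>)) \<odot>\<^bsub>W\<^esub> \<one>\<^bsub>W\<^esub>) \<sigma>"
      using that(2)[of \<sigma>] z c_nonzero[OF Q.one_closed Q.one_closed]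
      by (cases "\<sigma> \<in> carrier Q") (auto simp: twisted_simps)
  qed
  have "I = carrier W" if I: "ideal I W" and nz: "I \<noteq> {\<zero>\<^bsub>W\<^esub>}" for I
  proof -
    interpret I: ideal I W by fact
    let ?supp = "\<lambda>w. {\<sigma> \<in> carrier Q. w \<sigma> \<noteq> 0}"
    have fin: "finite (?supp w)" for w using finite_Q by simp
    obtain z0 where "z0 \<in> I \<and> z0 \<noteq> \<zero>\<^bsub>W\<^esub>" using nz I.zero_closed by blast
    then obtain z where z: "z \<in> I" "z \<noteq> \<zero>\<^bsub>W\<^esub>"
      and least: "\<And>w. w \<in> I ==> w \<noteq> \<zero>\<^bsub>W\<^esub> ==> card (?supp z) \<le> card (?supp w)"
      using ex_has_least_nat[of "\<lambda>w. w \<in> I \<and> w \<noteq> \<zero>\<^bsub>W\<^esub>" z0 "\<lambda>w. card (?supp w)"] by blast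
    obtain \<sigma>0 where \<sigma>0: "\<sigma>0 \<in> carrier Q" "z \<sigma>0 \<noteq> 0"
      using z(2) I.Icarr[OF z(1)] by (auto simp: twisted_simps fun_eq_iff)
    let ?\<mu> = "inv\<^bsub>Q\<^esub> \<sigma>0"
    let ?g = "z \<otimes>\<^bsub>W\<^esub> mon_elem ?\<mu> 1"
    have \<mu>: "?\<mu> \<in> carrier Q" using \<sigma>0 by simp
    have g: "?g \<in> I" using I.I_r_closed[OF z(1) mon_closed[OF \<mu>]] .
    have gc: "?g \<in> carrier W" by (rule I.Icarr[OF g])
    have ge: "?g (\<sigma> \<otimes>\<^bsub>Q\<^esub> ?\<mu>) = z \<sigma> * c (\<sigma>, ?\<mu>)" if "\<sigma> \<in> carrier Q" for \<sigma>
      using mon_mult_entry(2)[OF \<mu> that I.Icarr[OF z(1)], of 1] by simp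
    have g1: "?g \<one>\<^bsub>Q\<^esub> \<noteq> 0"
      using ge[OF \<sigma>0(1)] \<sigma>0 c_nonzero[OF \<sigma>0(1) \<mu>] by simp
    have "?supp ?g \<subseteq> (\<lambda>\<sigma>. \<sigma> \<otimes>\<^bsub>Q\<^esub> ?\<mu>) ` ?supp z"
    proof
      fix \<rho> assume \<rho>: "\<rho> \<in> ?supp ?g"
      let ?\<sigma> = "\<rho> \<otimes>\<^bsub>Q\<^esub> \<sigma>0"
      have "?\<sigma> \<in> carrier Q" "\<rho> = ?\<sigma> \<otimes>\<^bsub>Q\<^esub> ?\<mu>" using \<rho> \<sigma>0 by (simp_all add: Q.m_assoc)
      with \<rho> ge[of ?\<sigma>] show "\<rho> \<in> (\<lambda>\<sigma>. \<sigma> \<otimes>\<^bsub>Q\<^esub> ?\<mu>) ` ?supp z" by (intro image_eqI) auto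
    qed
    then have card_g: "card (?supp ?g) \<le> card (?supp z)"
      by (rule surj_card_le[OF fin])
    have "?g \<sigma> = 0" if \<sigma>: "\<sigma> \<in> carrier Q" "\<sigma> \<noteq> \<one>\<^bsub>Q\<^esub>" for \<sigma>
    proof -
      obtain \<mu> where \<mu>: "\<mu> \<in> carrier Q" "c (\<mu>, \<sigma>) \<noteq> c (\<sigma>, \<mu>)" using nondeg[OF \<sigma>] by blast
      \<comment> \<open>At \<mu> \<tau> the commutator with u_\<mu> has the coefficient
        \<open>?g \<tau> * (c (\<mu>, \<tau>) - c (\<tau>, \<mu>))\<close>. It vanishes for \<tau> =
        1, so the support shrinks and minimality makes the commutator zero; for \<tau> = \<sigma>
        the bracket is nonzero, so \<open>?g \<sigma>\<close> has to vanish.\<close>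
      let ?v = "mon_elem \<mu> 1 \<otimes>\<^bsub>W\<^esub> ?g \<oplus>\<^bsub>W\<^esub> (- 1) \<odot>\<^bsub>W\<^esub> (?g \<otimes>\<^bsub>W\<^esub> mon_elem \<mu> 1)"
      have v: "?v (\<mu> \<otimes>\<^bsub>Q\<^esub> \<tau>) = ?g \<tau> * (c (\<mu>, \<tau>) - c (\<tau>, \<mu>))" if "\<tau> \<in> carrier Q" for \<tau>
        using mon_mult_entry[OF \<mu>(1) that gc, of 1] unfolding Q.m_comm[OF that \<mu>(1)] twisted_simps(5,6)
        by (simp add: algebra_simps)
      have vI: "?v \<in> I"
        using I.I_l_closed[OF g mon_closed[OF \<mu>(1)]] I.I_r_closed[OF g mon_closed[OF \<mu>(1)]]
        by (intro I.a_closed W.ideal_smult[OF I])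
      have "?supp ?v \<subseteq> (\<lambda>\<tau>. \<mu> \<otimes>\<^bsub>Q\<^esub> \<tau>) ` (?supp ?g - {\<one>\<^bsub>Q\<^esub>})"
      proof
        fix \<rho> assume \<rho>: "\<rho> \<in> ?supp ?v"
        let ?\<tau> = "inv\<^bsub>Q\<^esub> \<mu> \<otimes>\<^bsub>Q\<^esub> \<rho>"
        have \<tau>: "?\<tau> \<in> carrier Q" "\<rho> = \<mu> \<otimes>\<^bsub>Q\<^esub> ?\<tau>" using \<rho> \<mu> by (simp_all flip: Q.m_assoc)
        then have nz: "?g ?\<tau> * (c (\<mu>, ?\<tau>) - c (?\<tau>, \<mu>)) \<noteq> 0"
          using \<rho> v[OF \<tau>(1)] by simp
        moreover have "?\<tau> \<noteq> \<one>\<^bsub>Q\<^esub>"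
        proof
          assume "?\<tau> = \<one>\<^bsub>Q\<^esub>"
          then show False using nz c_one[OF \<mu>(1)] by simp
        qed
        ultimately have "?\<tau> \<in> ?supp ?g - {\<one>\<^bsub>Q\<^esub>}" using \<tau>(1) by auto
        then show "\<rho> \<in> (\<lambda>\<tau>. \<mu> \<otimes>\<^bsub>Q\<^esub> \<tau>) ` (?supp ?g - {\<one>\<^bsub>Q\<^esub>})" by (rule image_eqI[where f = "\<lambda>\<tau>. \<mu> \<otimes>\<^bsub>Q\<^esub> \<tau>" and x = ?\<tau>, OF \<tau>(2)])
      qed
      then have "card (?supp ?v) \<le> card (?supp ?g - {\<one>\<^bsub>Q\<^esub>})"
        by (rule surj_card_le[rotated]) (simp add: finite_Q)
      also have "\<dots> < card (?supp ?g)"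
        using g1 by (intro card_Diff1_less fin) simp
      finally have "?v = \<zero>\<^bsub>W\<^esub>"
        using least[OF vI] card_g by linarith
      then have "?v (\<mu> \<otimes>\<^bsub>Q\<^esub> \<sigma>) = 0" by (simp add: twisted_simps(4))
      then show ?thesis using v[OF \<sigma>(1)] \<mu>(2) by simp
    qed
    from scalar[OF gc this] have eq: "?g = (?g \<one>\<^bsub>Q\<^esub> * c (\<one>\<^bsub>Q\<^esub>, \<one>\<^bsub>Q\<^esub>)) \<odot>\<^bsub>W\<^esub> \<one>\<^bsub>W\<^esub>" .
    let ?k = "?g \<one>\<^bsub>Q\<^esub> * c (\<one>\<^bsub>Q\<^esub>, \<one>\<^bsub>Q\<^esub>)"
    have k: "?k \<noteq> 0" using g1 c_nonzero[OF Q.one_closed Q.one_closed] by simp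
    have "inverse ?k \<odot>\<^bsub>W\<^esub> (?k \<odot>\<^bsub>W\<^esub> \<one>\<^bsub>W\<^esub>) \<in> I"
      using W.ideal_smult[OF I g, of "inverse ?k"] eq by simp
    then have "\<one>\<^bsub>W\<^esub> \<in> I" unfolding W.smult_smult[OF W.one_closed] left_inverse[OF k] W.smult_1[OF W.one_closed] .
    then show "I = carrier W" by (rule I.one_imp_carrier)
  qed
  moreover have "\<exists>k. z = k \<odot>\<^bsub>W\<^esub> \<one>\<^bsub>W\<^esub>"
    if z: "z \<in> carrier W" and c: "\<And>x. x \<in> carrier W ==> z \<otimes>\<^bsub>W\<^esub> x = x \<otimes>\<^bsub>W\<^esub> z" for z
  proof -
    have "z \<sigma> = 0" if \<sigma>: "\<sigma> \<in> carrier Q" "\<sigma> \<noteq> \<one>\<^bsub>Q\<^esub>" for \<sigma>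
    proof -
      obtain \<mu> where \<mu>: "\<mu> \<in> carrier Q" "c (\<mu>, \<sigma>) \<noteq> c (\<sigma>, \<mu>)" using nondeg[OF \<sigma>] by blast
      have "z \<sigma> * c (\<mu>, \<sigma>) = (mon_elem \<mu> 1 \<otimes>\<^bsub>W\<^esub> z) (\<mu> \<otimes>\<^bsub>Q\<^esub> \<sigma>)"
        unfolding mon_mult_entry(1)[OF \<mu>(1) \<sigma>(1) z] by simp
      also have "\<dots> = (z \<otimes>\<^bsub>W\<^esub> mon_elem \<mu> 1) (\<sigma> \<otimes>\<^bsub>Q\<^esub> \<mu>)"
        unfolding Q.m_comm[OF \<sigma>(1) \<mu>(1)] c[OF mon_closed[OF \<mu>(1)]] ..
      also have "\<dots> = z \<sigma> * c (\<sigma>, \<mu>)"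
        unfolding mon_mult_entry(2)[OF \<mu>(1) \<sigma>(1) z] by simp
      finally have "z \<sigma> * c (\<mu>, \<sigma>) = z \<sigma> * c (\<sigma>, \<mu>)" .
      then show ?thesis using \<mu>(2) by simp
    qed
    from scalar[OF z this] show ?thesis by blast
  qed
  moreover have "\<one>\<^bsub>W\<^esub> \<noteq> \<zero>\<^bsub>W\<^esub>"
    using c_nonzero[OF Q.one_closed Q.one_closed] by (auto simp: twisted_simps fun_eq_iff)
  ultimately show ?thesis
    unfolding simple_central_def using kalg_twisted by blast
qed

section \<open>Subalgebras, generators and homomorphisms defined on generators\<close>

definition subalg :: "('k::field, 'a) module => 'a set => bool" where
  "subalg A M \<longleftrightarrow> M \<subseteq> carrier A \<and> \<one>\<^bsub>A\<^esub> \<in> M \<and> (\<forall>x\<in>M. \<forall>y\<in>M. x \<oplus>\<^bsub>A\<^esub> y \<in> M \<and> x \<otimes>\<^bsub>A\<^esub> y \<in> M) \<and>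
     (\<forall>c. \<forall>x\<in>M. c \<odot>\<^bsub>A\<^esub> x \<in> M)"

text \<open>Stated with subalgebras instead of words in the generators: to show that a map is onto,
  or that a property holds everywhere, it suffices to exhibit a subalgebra that contains
  \<open>gs\<close>.\<close>

definition generated_by :: "('k::field, 'a) module => 'a set => bool" where
  "generated_by A gs \<longleftrightarrow> gs \<subseteq> carrier A \<and> (\<forall>M. subalg A M \<longrightarrow> gs \<subseteq> M \<longrightarrow> M = carrier A)"

lemma (in kalg) subalg_nat_pow: "subalg A M ==> x \<in> M ==> x [^] (n::nat) \<in> M"
proof (induction n)
  case (Suc n)
  then have "x [^] n \<otimes> x \<in> M" unfolding subalg_def by blast
  then show ?case by simp
next
  case 0 then have "\<one> \<in> M" unfolding subalg_def by blast
  then show ?case by simp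
qed

lemma generated_byI:
  "gs \<subseteq> carrier A ==> (\<And>M x. [|subalg A M; gs \<subseteq> M; x \<in> carrier A|] ==> x \<in> M) ==> generated_by A gs"
  unfolding generated_by_def by (metis subalg_def subsetI subset_antisym)

lemma generated_byD:
  "[|generated_by A gs; subalg A M; gs \<subseteq> M; x \<in> carrier A|] ==> x \<in> M"
  unfolding generated_by_def by metis

lemma generated_by_subset: "generated_by A gs ==> gs \<subseteq> carrier A"
  unfolding generated_by_def by metis

context kalg_hom
begin

lemma subalg_image:
  assumes "subalg A M"
  shows "subalg B (f ` M)"
proof -
  have M: "x \<in> carrier A" if "x \<in> M" for x using that assms by (auto simp: subalg_def)
  show ?thesis
    using assms unfolding subalg_def
    by (auto simp: M hom_one[symmetric] simp flip: hom_add hom_mult hom_smult)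
qed

lemma subalg_vimage:
  "subalg B M ==> subalg A {x \<in> carrier A. f x \<in> M}"
  unfolding subalg_def by (auto simp: hom_one hom_add hom_mult hom_smult)

lemma subalg_carrier: "subalg A (carrier A)"
  by (auto simp: subalg_def)

lemma generated_image:
  assumes "generated_by A gs" "f ` carrier A = carrier B"
  shows "generated_by B (f ` gs)"
proof (rule generated_byI)
  show "f ` gs \<subseteq> carrier B" using assms by (auto simp: generated_by_def)
  fix M y assume M: "subalg B M" "f ` gs \<subseteq> M" and y: "y \<in> carrier B"
  have "x \<in> {x \<in> carrier A. f x \<in> M}" if "x \<in> carrier A" for x
    by (rule generated_byD[OF assms(1) subalg_vimage[OF M(1)] _ that])
      (use M(2) generated_by_subset[OF assms(1)] in auto)
  then show "y \<in> M" using y unfolding assms(2)[symmetric] by auto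
qed

lemma surj_of_generated:
  assumes "generated_by B gs" "gs \<subseteq> f ` carrier A" "y \<in> carrier B"
  shows "\<exists>x\<in>carrier A. y = f x"
  using assms subalg_image[OF subalg_carrier] unfolding generated_by_def by auto

lemma hom_nat_pow: "x \<in> carrier A ==> f (x [^]\<^bsub>A\<^esub> (n::nat)) = f x [^]\<^bsub>B\<^esub> n"
  by (induction n) (simp_all add: hom_one hom_mult)

lemma hom_comp:
  assumes "kalg_hom B C g"
  shows "kalg_hom A C (g \<circ> f)"
proof -
  interpret g: kalg_hom B C g by fact
  show ?thesis
    by (intro kalg_hom.intro kalg_hom_axioms.intro S.kalg_axioms g.T.kalg_axioms)
      (auto simp: hom_add hom_mult hom_one hom_smult g.hom_add g.hom_mult g.hom_one g.hom_smult)
qed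

end

text \<open>Since x \<otimes> t = (x \<otimes> 1)(1 \<otimes> t), the copies of the two factors
  generate everything.\<close>

lemma (in tensor) generated_tens:
  assumes gs: "generated_by A gs" and hs: "generated_by U hs"
  shows "generated_by B ((\<lambda>x. pure_tensor A T x \<one>\<^bsub>U\<^esub>) ` gs \<union> pure_tensor A T \<one> ` hs)"
proof (rule generated_byI)
  interpret B: kalg B by (rule kalg_tens)
  have gs': "gs \<subseteq> carrier A" and hs': "hs \<subseteq> carrier U" using gs hs by (auto simp: generated_by_def)
  show "(\<lambda>x. pure_tensor A T x \<one>\<^bsub>U\<^esub>) ` gs \<union> pure_tensor A T \<one> ` hs \<subseteq> carrier B"
    using gs' by (auto intro!: pure_closed)
  fix M z assume M: "subalg B M" "(\<lambda>x. pure_tensor A T x \<one>\<^bsub>U\<^esub>) ` gs \<union> pure_tensor A T \<one> ` hs \<subseteq> M"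
    and z: "z \<in> carrier B"
  have padd: "pure_tensor A T (x \<oplus> y) \<one>\<^bsub>U\<^esub> = pure_tensor A T x \<one>\<^bsub>U\<^esub> \<oplus>\<^bsub>B\<^esub> pure_tensor A T y \<one>\<^bsub>U\<^esub>"
    if "x \<in> carrier A" "y \<in> carrier A" for x y
    by (rule tens_eqI[of _ A T]) (use that in \<open>simp_all add: pure_closed tens_closed tens_simps(5,7) A.smult_radd\<close>)
  have psm: "pure_tensor A T (c \<odot> x) \<one>\<^bsub>U\<^esub> = c \<odot>\<^bsub>B\<^esub> pure_tensor A T x \<one>\<^bsub>U\<^esub>" if "x \<in> carrier A" for x c
    by (rule tens_eqI[of _ A T]) (use that in \<open>simp_all add: pure_closed tens_closed tens_simps(6,7) A.smult_smult mult.commute\<close>)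
  have "subalg A {x \<in> carrier A. pure_tensor A T x \<one>\<^bsub>U\<^esub> \<in> M}"
    using M(1) unfolding subalg_def by (auto simp: padd psm one_eq_pure[symmetric] pure_mult[of _ _ "\<one>\<^bsub>U\<^esub>" "\<one>\<^bsub>U\<^esub>", simplified, symmetric])
  then have 1: "x \<in> {x \<in> carrier A. pure_tensor A T x \<one>\<^bsub>U\<^esub> \<in> M}" if "x \<in> carrier A" for x
    by (rule generated_byD[OF gs _ _ that]) (use M(2) gs' in auto)
  have "subalg U {t \<in> carrier U. pure_tensor A T \<one> t \<in> M}"
    using M(1) unfolding subalg_def by (auto simp: pure_add pure_smult one_eq_pure[symmetric] pure_mult[of \<one> \<one>, simplified, symmetric])
  then have 2: "t \<in> {t \<in> carrier U. pure_tensor A T \<one> t \<in> M}" if "t \<in> carrier U" for t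
    by (rule generated_byD[OF hs _ _ that]) (use M(2) hs' in auto)
  have pm: "pure_tensor A T x t = pure_tensor A T x \<one>\<^bsub>U\<^esub> \<otimes>\<^bsub>B\<^esub> pure_tensor A T \<one> t"
    if "x \<in> carrier A" "t \<in> carrier U" for x t
    using that by (simp add: pure_mult)
  show "z \<in> M" using z
  proof (induction z rule: tens_induct)
    case zero
    have "0 \<odot>\<^bsub>B\<^esub> \<one>\<^bsub>B\<^esub> \<in> M" using M(1) unfolding subalg_def by blast
    then show ?case by simp
  next
    case (add x y) then show ?case using M(1) unfolding subalg_def by blast
  next
    case (pure x t)
    then have "pure_tensor A T x \<one>\<^bsub>U\<^esub> \<in> M" "pure_tensor A T \<one> t \<in> M" using 1[of x] 2[of t] by auto
    then show ?case unfolding pm[OF pure] using M(1) unfolding subalg_def by blast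
  qed
qed

text \<open>A family that multiplies like the basis u_\<sigma> extends linearly to a homomorphism.
  The condition at the neutral element accounts for a unit that need not be u_1.\<close>

lemma twisted_hom:
  fixes c :: "'q \<times> 'q => 'k::field"
  assumes tw: "twisted_algebra (\<lambda>x. x) Q (\<lambda>_ x. x) c" and A: "kalg A"
    and w: "\<And>\<sigma>. \<sigma> \<in> carrier Q ==> w \<sigma> \<in> carrier A"
    and ww: "\<And>\<sigma> \<tau>. \<sigma> \<in> carrier Q ==> \<tau> \<in> carrier Q ==> w \<sigma> \<otimes>\<^bsub>A\<^esub> w \<tau> = c (\<sigma>, \<tau>) \<odot>\<^bsub>A\<^esub> w (\<sigma> \<otimes>\<^bsub>Q\<^esub> \<tau>)"
    and w1: "w \<one>\<^bsub>Q\<^esub> = c (\<one>\<^bsub>Q\<^esub>, \<one>\<^bsub>Q\<^esub>) \<odot>\<^bsub>A\<^esub> \<one>\<^bsub>A\<^esub>"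
  obtains F where "kalg_hom (twisted (\<lambda>x. x) Q (\<lambda>_ x. x) c) A F"
    "\<And>\<sigma> a. \<sigma> \<in> carrier Q ==> F (mon_elem \<sigma> a) = a \<odot>\<^bsub>A\<^esub> w \<sigma>"
proof -
  interpret twisted_algebra "\<lambda>x. x" Q "\<lambda>_ x. x" c by fact
  interpret A: kalg A by fact
  interpret W: kalg W by (rule kalg_twisted)
  let ?F = "\<lambda>f. \<Oplus>\<^bsub>A\<^esub>\<sigma>\<in>carrier Q. f \<sigma> \<odot>\<^bsub>A\<^esub> w \<sigma>"
  have cl: "?F f \<in> carrier A" for f by (intro A.finsum_closed) (simp add: w)
  have F_add: "?F (f \<oplus>\<^bsub>W\<^esub> g) = ?F f \<oplus>\<^bsub>A\<^esub> ?F g" for f g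
  proof -
    have "?F (f \<oplus>\<^bsub>W\<^esub> g) = (\<Oplus>\<^bsub>A\<^esub>\<sigma>\<in>carrier Q. f \<sigma> \<odot>\<^bsub>A\<^esub> w \<sigma> \<oplus>\<^bsub>A\<^esub> g \<sigma> \<odot>\<^bsub>A\<^esub> w \<sigma>)"
      by (rule A.finsum_cong') (simp_all add: twisted_simps(5) A.smult_ladd w)
    also have "\<dots> = ?F f \<oplus>\<^bsub>A\<^esub> ?F g" by (rule A.finsum_addf) (simp_all add: w)
    finally show ?thesis .
  qed
  have smult: "?F (k \<odot>\<^bsub>W\<^esub> f) = k \<odot>\<^bsub>A\<^esub> ?F f" for k f
  proof -
    have "?F (k \<odot>\<^bsub>W\<^esub> f) = (\<Oplus>\<^bsub>A\<^esub>\<sigma>\<in>carrier Q. k \<odot>\<^bsub>A\<^esub> (f \<sigma> \<odot>\<^bsub>A\<^esub> w \<sigma>))"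
      by (rule A.finsum_cong') (simp_all add: twisted_simps(6) A.smult_smult w)
    also have "\<dots> = k \<odot>\<^bsub>A\<^esub> ?F f" by (rule A.smult_finsum[symmetric]) (simp_all add: w finite_Q)
    finally show ?thesis .
  qed
  have F_mon: "?F (mon_elem \<sigma> a) = a \<odot>\<^bsub>A\<^esub> w \<sigma>" if "\<sigma> \<in> carrier Q" for \<sigma> a
    using that finite_Q by (subst A.finsum_delta[of _ \<sigma>]) (simp_all add: mon_elem_def w)
  have F_zero: "?F \<zero>\<^bsub>W\<^esub> = \<zero>\<^bsub>A\<^esub>"
    using smult[of 0 "\<zero>\<^bsub>W\<^esub>"] cl by (simp del: A.finsum_zero)
  have mult: "?F (f \<otimes>\<^bsub>W\<^esub> g) = ?F f \<otimes>\<^bsub>A\<^esub> ?F g" if f: "f \<in> carrier W" and g: "g \<in> carrier W" for f g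
    using f
  proof (induction f rule: twisted_induct)
    case zero show ?case unfolding twisted_zero F_zero using cl by simp
  next
    case (add x y) then show ?case
      unfolding twisted_ldistr F_add by (simp only: A.l_distr cl)
  next
    case (mon \<sigma> a)
    note \<sigma> = mon
    show ?case using g
    proof (induction g rule: twisted_induct)
      case zero show ?case unfolding twisted_zero F_zero using cl by simp
    next
      case (add x y) then show ?case
        unfolding twisted_rdistr F_add by (simp only: A.r_distr cl)
    next
      case (mon \<tau> b)
      show ?case
        unfolding mon_mult[OF \<sigma> mon] F_mon[OF \<sigma>]
          F_mon[OF mon]
          F_mon[OF Q.m_closed[OF \<sigma> mon]]
        using \<sigma> mon by (simp add: w A.smult_lmult A.smult_rmult ww A.smult_smult mult_ac)
    qed
  qed
  have one: "?F \<one>\<^bsub>W\<^esub> = \<one>\<^bsub>A\<^esub>"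
    unfolding one_mon F_mon[OF Q.one_closed] w1 A.smult_smult[OF A.one_closed]
    using c_nonzero[OF Q.one_closed Q.one_closed] by simp
  have "kalg_hom W A ?F"
    by (intro kalg_hom.intro kalg_hom_axioms.intro W.kalg_axioms A.kalg_axioms cl F_add mult one smult)
  then show thesis using F_mon that by blast
qed

text \<open>Brauer classes consist of structure constants, so an enumeration \<open>e\<close> of the
  finite group is chosen to give the twisted algebra coordinates.\<close>

lemma twisted_iso_sc:
  fixes c :: "'q \<times> 'q => 'k::field"
  assumes tw: "twisted_algebra (\<lambda>x. x) Q (\<lambda>_ x. x) c"
  obtains S F where "kalg_hom (twisted (\<lambda>x. x) Q (\<lambda>_ x. x) c) (sc_algebra S) F"
    "bij_betw F (carrier (twisted (\<lambda>x. x) Q (\<lambda>_ x. x) c)) (carrier (sc_algebra S))"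
proof -
  interpret twisted_algebra "\<lambda>x. x" Q "\<lambda>_ x. x" c by fact
  let ?n = "card (carrier Q)"
  obtain e where e: "bij_betw e {..<?n} (carrier Q)"
    using ex_bij_betw_nat_finite[OF finite_Q] by (auto simp: atLeast0LessThan)
  define S where "S = \<lparr>sc_dim = ?n, sc_unit = (\<lambda>l. \<one>\<^bsub>W\<^esub> (e l)),
    sc_prod = (\<lambda>i j l. if e l = e i \<otimes>\<^bsub>Q\<^esub> e j then c (e i, e j) else 0)\<rparr>"
  let ?F = "\<lambda>x l. if l < ?n then x (e l) else 0"
  have eQ: "e l \<in> carrier Q" if "l < ?n" for l using e that by (auto simp: bij_betw_def)
  have bij: "bij_betw ?F (carrier W) (carrier (sc_algebra S))"
  proof (rule bij_betwI[where g = "\<lambda>y \<rho>. if \<rho> \<in> carrier Q then y (inv_into {..<?n} e \<rho>) else 0"])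
    fix x assume x: "x \<in> carrier W"
    show "(\<lambda>\<rho>. if \<rho> \<in> carrier Q then ?F x (inv_into {..<?n} e \<rho>) else 0) = x"
    proof
      fix \<rho>
      show "(if \<rho> \<in> carrier Q then ?F x (inv_into {..<?n} e \<rho>) else 0) = x \<rho>"
      proof (cases "\<rho> \<in> carrier Q")
        case True
        then have "\<rho> \<in> e ` {..<?n}" using e by (simp add: bij_betw_def)
        then show ?thesis using True inv_into_into[of \<rho> e "{..<?n}"] by (simp add: f_inv_into_f)
      qed (use x in \<open>simp add: twisted_simps\<close>)
    qed
  next
    fix y assume y: "y \<in> carrier (sc_algebra S)"
    show "?F (\<lambda>\<rho>. if \<rho> \<in> carrier Q then y (inv_into {..<?n} e \<rho>) else 0) = y"
    proof
      fix l
      show "?F (\<lambda>\<rho>. if \<rho> \<in> carrier Q then y (inv_into {..<?n} e \<rho>) else 0) l = y l"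
        using e eQ y by (cases "l < ?n") (auto simp: bij_betw_def sc_simps S_def)
    qed
  qed (auto simp: sc_simps twisted_simps S_def)
  have mult: "?F (x \<otimes>\<^bsub>W\<^esub> y) = ?F x \<otimes>\<^bsub>sc_algebra S\<^esub> ?F y" for x y
  proof
    fix l
    show "?F (x \<otimes>\<^bsub>W\<^esub> y) l = (?F x \<otimes>\<^bsub>sc_algebra S\<^esub> ?F y) l"
    proof (cases "l < ?n")
      case True
      let ?g = "\<lambda>\<sigma> \<tau>. if e l = \<sigma> \<otimes>\<^bsub>Q\<^esub> \<tau> then x \<sigma> * y \<tau> * c (\<sigma>, \<tau>) else 0"
      have "(\<Sum>i<?n. \<Sum>j<?n. ?F x i * ?F y j * sc_prod S i j l) = (\<Sum>i<?n. \<Sum>j<?n. ?g (e i) (e j))"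
        by (intro sum.cong refl) (simp add: S_def)
      also have "\<dots> = (\<Sum>i<?n. \<Sum>\<tau>\<in>carrier Q. ?g (e i) \<tau>)"
        by (intro sum.cong refl sum.reindex_bij_betw[OF e])
      also have "\<dots> = (\<Sum>\<sigma>\<in>carrier Q. \<Sum>\<tau>\<in>carrier Q. ?g \<sigma> \<tau>)"
        by (rule sum.reindex_bij_betw[OF e])
      finally show ?thesis using True by (simp add: sc_simps(6) twisted_simps(2) S_def)
    qed (simp add: sc_simps S_def)
  qed
  have "kalg_hom W (sc_algebra S) ?F"
    by (rule kalg_transport(2)[OF kalg_twisted bij])
      (rule mult | (simp add: sc_simps(2-5) twisted_simps(3-6) S_def fun_eq_iff; fail))+
  with bij show thesis using that by blast
qed

section \<open>Symbol algebras\<close>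

definition zp_sq :: "nat => (nat \<times> nat) monoid" where
  "zp_sq p = \<lparr>carrier = {..<p} \<times> {..<p},
     monoid.mult = (\<lambda>x y. ((fst x + fst y) mod p, (snd x + snd y) mod p)), one = (0, 0)\<rparr>"

text \<open>Exponents of i_2 and i_1 are added modulo p: moving i_1 past i_2 gives the power of
  \<zeta>, and a carry in either exponent gives a factor \<open>a\<close> or
  \<open>b\<close>.\<close>

definition symbol_cocycle :: "nat => 'k::field => 'k => 'k => (nat \<times> nat) \<times> (nat \<times> nat) => 'k" where
  "symbol_cocycle p a b \<zeta> =
     (\<lambda>(x, y). \<zeta> ^ (snd x * fst y) * a ^ ((fst x + fst y) div p) * b ^ ((snd x + snd y) div p))"

lemma symbol_cocycle_apply:
  "symbol_cocycle p a b \<zeta> ((v, u), (v', u')) = \<zeta> ^ (u * v') * a ^ ((v + v') div p) * b ^ ((u + u') div p)"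
  by (simp add: symbol_cocycle_def)

lemma zp_sq_simps [simp]:
  "carrier (zp_sq p) = {..<p} \<times> {..<p}" "\<one>\<^bsub>zp_sq p\<^esub> = (0, 0)"
  "x \<otimes>\<^bsub>zp_sq p\<^esub> y = ((fst x + fst y) mod p, (snd x + snd y) mod p)"
  by (simp_all add: zp_sq_def)

lemma comm_group_zp_sq: "0 < p ==> comm_group (zp_sq p)"
proof (rule comm_groupI)
  fix x :: "nat \<times> nat" assume p: "0 < p" and x: "x \<in> carrier (zp_sq p)"
  show "\<exists>y\<in>carrier (zp_sq p). y \<otimes>\<^bsub>zp_sq p\<^esub> x = \<one>\<^bsub>zp_sq p\<^esub>"
    by (rule bexI[of _ "((p - fst x) mod p, (p - snd x) mod p)"])
      (use p x in \<open>auto simp: mod_add_left_eq\<close>)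
qed (auto simp: mod_simps add_ac)

text \<open>The cocycle has the value 1 at the neutral pair, so the unit of the twisted algebra is
  i_2^0 i_1^0 itself, as in the symbol algebra.\<close>

lemma symbol_algebra_eq_twisted:
  "symbol_algebra p a b \<zeta> = twisted (\<lambda>x. x) (zp_sq p) (\<lambda>_ x. x) (symbol_cocycle p a b \<zeta>)"
proof -
  have "(\<lambda>f g e. \<Sum>(v, u)\<in>{..<p} \<times> {..<p}. \<Sum>(v', u')\<in>{..<p} \<times> {..<p}.
                if e = ((v + v') mod p, (u + u') mod p)
                then f (v, u) * g (v', u') * \<zeta> ^ (u * v') * a ^ ((v + v') div p) * b ^ ((u + u') div p)
                else 0) = (\<lambda>x y \<rho>. \<Sum>\<sigma>\<in>carrier (zp_sq p). \<Sum>\<tau>\<in>carrier (zp_sq p).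
        if \<rho> = \<sigma> \<otimes>\<^bsub>zp_sq p\<^esub> \<tau> then x \<sigma> * y \<tau> * symbol_cocycle p a b \<zeta> (\<sigma>, \<tau>) else 0)"
    by (intro ext) (auto simp: symbol_cocycle_def mult.assoc intro!: sum.cong)
  moreover have "(\<lambda>e. if e = (0, 0) then 1 else 0) =
      (\<lambda>\<rho>. if \<rho> = \<one>\<^bsub>zp_sq p\<^esub> then inverse (symbol_cocycle p a b \<zeta> (\<one>\<^bsub>zp_sq p\<^esub>, \<one>\<^bsub>zp_sq p\<^esub>)) else 0)"
    by (auto simp: symbol_cocycle_def)
  moreover have "{f. \<forall>e. e \<notin> {..<p} \<times> {..<p} \<longrightarrow> f e = 0} = {x :: nat \<times> nat => 'a. \<forall>\<rho>. \<rho> \<notin> carrier (zp_sq p) \<longrightarrow> x \<rho> = 0}"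
    by simp
  ultimately show ?thesis
    unfolding symbol_algebra_def twisted_def by simp
qed

lemma power_mod_eq: "\<zeta> ^ p = 1 ==> \<zeta> ^ (n mod p) = (\<zeta> :: 'k::field) ^ n"
  by (metis mult_1 div_mult_mod_eq mult.commute power_add power_mult power_one)

text \<open>The carry of addition modulo p is a 2-cocycle: three summands produce the same total
  carry in either bracketing. It serves both for symbols and for the cocycle \<open>f\<close> of
  \<open>kummer_product\<close>.\<close>

lemma carry_div: "0 < p ==> (x + y) div p + (w + (x + y) mod p) div p = (w + x + y) div (p::nat)"
proof -
  assume "0 < p"
  have "w + x + y = (w + (x + y) mod p) + p * ((x + y) div p)" by (simp add: add.assoc)
  then show ?thesis using \<open>0 < p\<close> by (metis add.commute div_mult_self2 not_gr_zero)
qed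

locale symbol =
  fixes p :: nat and a b \<zeta> :: "'k::field"
  assumes p2: "2 \<le> p" and prim: "primitive_root_of_unity p \<zeta>" and a0: "a \<noteq> 0" and b0: "b \<noteq> 0"
begin

lemma zeta_p: "\<zeta> ^ p = 1" using prim by (simp add: primitive_root_of_unity_def)
lemma zeta_0: "\<zeta> \<noteq> 0" using zeta_p p2 by (auto simp: power_0_left)
lemma zeta_ne: "0 < j ==> j < p ==> \<zeta> ^ j \<noteq> 1" using prim by (simp add: primitive_root_of_unity_def)

sublocale twisted_algebra "\<lambda>x. x" "zp_sq p" "\<lambda>_ x. x" "symbol_cocycle p a b \<zeta>"
proof (intro twisted_algebra.intro twisted_algebra_axioms.intro)
  show "group (zp_sq p)" using comm_group_zp_sq[of p] p2 by (simp add: comm_group_def)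
  fix \<sigma> \<tau> \<rho> assume "\<sigma> \<in> carrier (zp_sq p)" "\<tau> \<in> carrier (zp_sq p)" "\<rho> \<in> carrier (zp_sq p)"
  have p: "0 < p" using p2 by simp
  have 1: "\<zeta> ^ (u * ((x + y) mod p)) = \<zeta> ^ (u * x) * \<zeta> ^ (u * y)" for u x y
    using power_mod_eq[of "\<zeta> ^ u" p "x + y"] zeta_p by (simp add: power_mult power_add flip: power_mult[of \<zeta> p u] power_mult) 
      (metis mult.commute power_mult power_one)
  have 2: "\<zeta> ^ (((x + y) mod p) * u) = \<zeta> ^ (x * u) * \<zeta> ^ (y * u)" for u x y
    using 1[of u x y] by (simp add: mult.commute)
  \<comment> \<open>The carry identity, applied below to the scalars \<open>a\<close> and
    \<open>b\<close>.\<close>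
  have 3: "c ^ ((x + y) div p) * c ^ ((w + (x + y) mod p) div p) = c ^ ((w + x) div p) * c ^ (((w + x) mod p + y) div p)"
    for c :: 'k and w x y
  proof -
    have "(w + x) div p + ((w + x) mod p + y) div p = (w + x + y) div p"
      using carry_div[OF p, of w x y] by (simp add: add_ac)
    then show ?thesis unfolding power_add[symmetric] carry_div[OF p] by simp
  qed
  show "symbol_cocycle p a b \<zeta> (\<tau>, \<rho>) * symbol_cocycle p a b \<zeta> (\<sigma>, \<tau> \<otimes>\<^bsub>zp_sq p\<^esub> \<rho>) =
      symbol_cocycle p a b \<zeta> (\<sigma>, \<tau>) * symbol_cocycle p a b \<zeta> (\<sigma> \<otimes>\<^bsub>zp_sq p\<^esub> \<tau>, \<rho>)"
  proof -
    have "symbol_cocycle p a b \<zeta> (\<tau>, \<rho>) * symbol_cocycle p a b \<zeta> (\<sigma>, \<tau> \<otimes>\<^bsub>zp_sq p\<^esub> \<rho>) =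
       \<zeta> ^ (snd \<tau> * fst \<rho>) * \<zeta> ^ (snd \<sigma> * fst \<tau>) * \<zeta> ^ (snd \<sigma> * fst \<rho>) *
       (a ^ ((fst \<tau> + fst \<rho>) div p) * a ^ ((fst \<sigma> + (fst \<tau> + fst \<rho>) mod p) div p)) *
       (b ^ ((snd \<tau> + snd \<rho>) div p) * b ^ ((snd \<sigma> + (snd \<tau> + snd \<rho>) mod p) div p))"
      by (simp add: symbol_cocycle_def 1)
    also have "\<dots> = symbol_cocycle p a b \<zeta> (\<sigma>, \<tau>) * symbol_cocycle p a b \<zeta> (\<sigma> \<otimes>\<^bsub>zp_sq p\<^esub> \<tau>, \<rho>)"
      unfolding 3 by (simp add: symbol_cocycle_def 2)
    finally show ?thesis .
  qed
  show "symbol_cocycle p a b \<zeta> (\<sigma>, \<tau>) \<noteq> 0"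
    using a0 b0 zeta_0 by (simp add: symbol_cocycle_def)
qed (use p2 in auto)

lemma symbol_eq_W: "symbol_algebra p a b \<zeta> = W"
  by (rule symbol_algebra_eq_twisted)

text \<open>Nondegeneracy of the commutator pairing: i_1 at (0, 1) detects the exponent of i_2, and
  i_2 at (1, 0) detects that of i_1, because \<zeta> has order exactly p.\<close>

lemma simple_central_symbol: "simple_central (symbol_algebra p a b \<zeta>)"
  unfolding symbol_eq_W
proof (rule simple_central_twisted[OF twisted_algebra_axioms comm_group_zp_sq])
  fix \<sigma> assume \<sigma>: "\<sigma> \<in> carrier (zp_sq p)" "\<sigma> \<noteq> \<one>\<^bsub>zp_sq p\<^esub>"
  obtain v u where vu: "\<sigma> = (v, u)" "v < p" "u < p" using \<sigma> by auto
  show "\<exists>\<mu>\<in>carrier (zp_sq p). symbol_cocycle p a b \<zeta> (\<mu>, \<sigma>) \<noteq> symbol_cocycle p a b \<zeta> (\<sigma>, \<mu>)"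
  proof (cases "v = 0")
    case False
    then show ?thesis
      using vu p2 zeta_ne[of v] b0 by (intro bexI[of _ "(0, 1)"]) (auto simp: symbol_cocycle_apply)
  next
    case True
    then have "0 < u" using vu \<sigma>(2) by simp
    then show ?thesis
      using vu p2 zeta_ne[of u] a0 True by (intro bexI[of _ "(1, 0)"]) (auto simp: symbol_cocycle_apply)
  qed
qed (use p2 in simp)

abbreviation "i1 \<equiv> mon_elem (0::nat, Suc 0) (1::'k)"
abbreviation "i2 \<equiv> mon_elem (Suc 0, 0::nat) (1::'k)"

lemma i_closed: "i1 \<in> carrier W" "i2 \<in> carrier W"
  using p2 by (auto intro!: mon_closed)

lemma i1_pow: "u < p ==> i1 [^]\<^bsub>W\<^esub> u = mon_elem (0, u) 1"
proof (induction u)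
  case 0
  interpret W: kalg W by (rule kalg_twisted)
  show ?case using one_mon by (simp add: symbol_cocycle_apply)
next
  case (Suc u)
  interpret W: kalg W by (rule kalg_twisted)
  show ?case using Suc p2 by (simp add: mon_mult symbol_cocycle_apply)
qed

lemma i2_pow: "v < p ==> i2 [^]\<^bsub>W\<^esub> v = mon_elem (v, 0) 1"
proof (induction v)
  case 0
  interpret W: kalg W by (rule kalg_twisted)
  show ?case using one_mon by (simp add: symbol_cocycle_apply)
next
  case (Suc u)
  interpret W: kalg W by (rule kalg_twisted)
  show ?case using Suc p2 by (simp add: mon_mult symbol_cocycle_apply)
qed

lemma smult_mon: "k \<odot>\<^bsub>W\<^esub> mon_elem \<sigma> x = mon_elem \<sigma> (k * x)"
  by (auto simp: twisted_simps(6) mon_elem_def)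

lemma one_W: "\<one>\<^bsub>W\<^esub> = mon_elem (0, 0) 1"
  using one_mon by (simp add: symbol_cocycle_apply)

lemma i_relations:
  "i1 [^]\<^bsub>W\<^esub> p = b \<odot>\<^bsub>W\<^esub> \<one>\<^bsub>W\<^esub>" "i2 [^]\<^bsub>W\<^esub> p = a \<odot>\<^bsub>W\<^esub> \<one>\<^bsub>W\<^esub>"
  "i1 \<otimes>\<^bsub>W\<^esub> i2 = \<zeta> \<odot>\<^bsub>W\<^esub> (i2 \<otimes>\<^bsub>W\<^esub> i1)"
proof -
  interpret W: kalg W by (rule kalg_twisted)
  define q where "q = p - 1"
  have q: "Suc q = p" "q < p" using p2 by (auto simp: q_def)
  have "i1 [^]\<^bsub>W\<^esub> p = mon_elem (0, q) 1 \<otimes>\<^bsub>W\<^esub> i1"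
    using W.nat_pow_Suc[of i1 q] unfolding q(1) i1_pow[OF q(2)] .
  also have "\<dots> = b \<odot>\<^bsub>W\<^esub> \<one>\<^bsub>W\<^esub>"
    using q p2 by (simp add: mon_mult one_W smult_mon symbol_cocycle_apply)
  finally show "i1 [^]\<^bsub>W\<^esub> p = b \<odot>\<^bsub>W\<^esub> \<one>\<^bsub>W\<^esub>" .
  have "i2 [^]\<^bsub>W\<^esub> p = mon_elem (q, 0) 1 \<otimes>\<^bsub>W\<^esub> i2"
    using W.nat_pow_Suc[of i2 q] unfolding q(1) i2_pow[OF q(2)] .
  also have "\<dots> = a \<odot>\<^bsub>W\<^esub> \<one>\<^bsub>W\<^esub>"
    using q p2 by (simp add: mon_mult one_W smult_mon symbol_cocycle_apply)
  finally show "i2 [^]\<^bsub>W\<^esub> p = a \<odot>\<^bsub>W\<^esub> \<one>\<^bsub>W\<^esub>" .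
  show "i1 \<otimes>\<^bsub>W\<^esub> i2 = \<zeta> \<odot>\<^bsub>W\<^esub> (i2 \<otimes>\<^bsub>W\<^esub> i1)"
    using p2 by (simp add: mon_mult smult_mon symbol_cocycle_apply)
qed

lemma mon_eq:
  assumes "v < p" "u < p"
  shows "mon_elem (v, u) x = x \<odot>\<^bsub>W\<^esub> (i2 [^]\<^bsub>W\<^esub> v \<otimes>\<^bsub>W\<^esub> i1 [^]\<^bsub>W\<^esub> u)"
  using assms by (simp add: i1_pow i2_pow mon_mult smult_mon symbol_cocycle_apply)

lemma generated_symbol: "generated_by W {i1, i2}"
proof (rule generated_byI)
  interpret W: kalg W by (rule kalg_twisted)
  show "{i1, i2} \<subseteq> carrier W" using i_closed by simp
  fix M x assume M: "subalg W M" "{i1, i2} \<subseteq> M" and x: "x \<in> carrier W"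
  show "x \<in> M" using x
  proof (induction x rule: twisted_induct)
    case zero
    have "0 \<odot>\<^bsub>W\<^esub> \<one>\<^bsub>W\<^esub> \<in> M" using M(1) unfolding subalg_def by metis
    then show ?case by (simp only: W.smult_l0 W.one_closed)
  next
    case (add x y) then show ?case using M(1) unfolding subalg_def by metis
  next
    case (mon \<sigma> x)
    then obtain v u where vu: "\<sigma> = (v, u)" "v < p" "u < p" by auto
    have "i2 [^]\<^bsub>W\<^esub> v \<in> M" "i1 [^]\<^bsub>W\<^esub> u \<in> M" using M by (auto intro!: W.subalg_nat_pow)
    then show ?case unfolding vu(1) mon_eq[OF vu(2,3)] using M(1) unfolding subalg_def by metis
  qed
qed

end

section \<open>Powers of skew-commuting elements and the presentation of symbol algebras\<close>

context kalg
begin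

lemma smult_pow: "x \<in> carrier A ==> (c \<odot> x) [^] (n::nat) = c ^ n \<odot> (x [^] n)"
  by (induction n) (simp_all add: smult_lmult smult_rmult smult_smult mult.commute)

lemma skew_pow:
  assumes x: "x \<in> carrier A" and y: "y \<in> carrier A" and xy: "x \<otimes> y = \<theta> \<odot> (y \<otimes> x)"
  shows "x [^] (u::nat) \<otimes> y [^] (v::nat) = \<theta> ^ (u * v) \<odot> (y [^] v \<otimes> x [^] u)"
proof -
  have 1: "x \<otimes> y [^] v = \<theta> ^ v \<odot> (y [^] v \<otimes> x)" for v :: nat
  proof (induction v)
    case (Suc v)
    have "x \<otimes> y [^] Suc v = (x \<otimes> y [^] v) \<otimes> y" using x y by (simp add: m_assoc)
    also have "\<dots> = \<theta> ^ v \<odot> (y [^] v \<otimes> (x \<otimes> y))" using x y by (simp add: Suc smult_lmult m_assoc)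
    also have "\<dots> = \<theta> ^ Suc v \<odot> (y [^] Suc v \<otimes> x)"
      using x y by (simp add: xy smult_rmult smult_smult m_assoc mult.commute)
    finally show ?case .
  qed (use x in simp)
  show ?thesis
  proof (induction u)
    case (Suc u)
    have "x [^] Suc u \<otimes> y [^] v = x [^] u \<otimes> (x \<otimes> y [^] v)" using x y by (simp add: m_assoc)
    also have "\<dots> = \<theta> ^ v \<odot> ((x [^] u \<otimes> y [^] v) \<otimes> x)" using x y by (simp add: 1 smult_rmult m_assoc)
    also have "\<dots> = \<theta> ^ (Suc u * v) \<odot> (y [^] v \<otimes> x [^] Suc u)"
      using x y by (simp add: Suc smult_lmult smult_smult m_assoc power_add)
    finally show ?case .
  qed (use x y in simp)
qed

text \<open>Reduction of exponents modulo p; the quotient becomes a power of the scalar, matching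
  the carries of \<open>symbol_cocycle\<close>.\<close>

lemma pow_mod:
  assumes x: "x \<in> carrier A" and xp: "x [^] p = c \<odot> \<one>"
  shows "x [^] (n::nat) = c ^ (n div p) \<odot> x [^] (n mod p)"
proof -
  have "x [^] n = x [^] (p * (n div p) + n mod p)" by simp
  also have "\<dots> = (x [^] p) [^] (n div p) \<otimes> x [^] (n mod p)"
    using x by (simp only: nat_pow_mult[symmetric] nat_pow_pow)
  finally show ?thesis using x by (simp add: xp smult_pow smult_lmult)
qed

end

text \<open>Universal property of the presentation: for any pair satisfying the relations, the
  products y^v x^u multiply by the symbol cocycle, so \<open>twisted_hom\<close> applies.\<close>

lemma (in symbol) symbol_hom:
  assumes A: "kalg A" and x: "x \<in> carrier A" and y: "y \<in> carrier A"
    and xp: "x [^]\<^bsub>A\<^esub> p = b \<odot>\<^bsub>A\<^esub> \<one>\<^bsub>A\<^esub>" and yp: "y [^]\<^bsub>A\<^esub> p = a \<odot>\<^bsub>A\<^esub> \<one>\<^bsub>A\<^esub>"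
    and xy: "x \<otimes>\<^bsub>A\<^esub> y = \<zeta> \<odot>\<^bsub>A\<^esub> (y \<otimes>\<^bsub>A\<^esub> x)"
  obtains F where "kalg_hom W A F" "F i1 = x" "F i2 = y"
proof -
  interpret A: kalg A by fact
  let ?w = "\<lambda>\<sigma>. y [^]\<^bsub>A\<^esub> fst \<sigma> \<otimes>\<^bsub>A\<^esub> x [^]\<^bsub>A\<^esub> snd (\<sigma> :: nat \<times> nat)"
  obtain F where F: "kalg_hom W A F" "\<And>\<sigma> k. \<sigma> \<in> carrier (zp_sq p) ==> F (mon_elem \<sigma> k) = k \<odot>\<^bsub>A\<^esub> ?w \<sigma>"
  proof (rule twisted_hom[OF twisted_algebra_axioms A, of ?w])
    fix \<sigma> \<tau> :: "nat \<times> nat"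
    obtain v u v' u' where vu: "\<sigma> = (v, u)" "\<tau> = (v', u')" by (metis prod.exhaust)
    have "?w \<sigma> \<otimes>\<^bsub>A\<^esub> ?w \<tau> = y [^]\<^bsub>A\<^esub> v \<otimes>\<^bsub>A\<^esub> (x [^]\<^bsub>A\<^esub> u \<otimes>\<^bsub>A\<^esub> y [^]\<^bsub>A\<^esub> v') \<otimes>\<^bsub>A\<^esub> x [^]\<^bsub>A\<^esub> u'"
      using x y vu by (simp add: A.m_assoc)
    also have "\<dots> = \<zeta> ^ (u * v') \<odot>\<^bsub>A\<^esub> ((y [^]\<^bsub>A\<^esub> v \<otimes>\<^bsub>A\<^esub> y [^]\<^bsub>A\<^esub> v') \<otimes>\<^bsub>A\<^esub> (x [^]\<^bsub>A\<^esub> u \<otimes>\<^bsub>A\<^esub> x [^]\<^bsub>A\<^esub> u'))"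
      unfolding A.skew_pow[OF x y xy] using x y by (simp add: A.m_assoc A.smult_lmult A.smult_rmult)
    also have "\<dots> = \<zeta> ^ (u * v') \<odot>\<^bsub>A\<^esub> (y [^]\<^bsub>A\<^esub> (v + v') \<otimes>\<^bsub>A\<^esub> x [^]\<^bsub>A\<^esub> (u + u'))"
      using x y by (simp add: A.nat_pow_mult)
    also have "\<dots> = symbol_cocycle p a b \<zeta> (\<sigma>, \<tau>) \<odot>\<^bsub>A\<^esub> ?w (\<sigma> \<otimes>\<^bsub>zp_sq p\<^esub> \<tau>)"
      unfolding A.pow_mod[OF y yp, of "v + v'"] A.pow_mod[OF x xp, of "u + u'"]
      using x y by (simp add: vu symbol_cocycle_apply A.smult_lmult A.smult_rmult A.smult_smult mult_ac)
    finally show "?w \<sigma> \<otimes>\<^bsub>A\<^esub> ?w \<tau> = symbol_cocycle p a b \<zeta> (\<sigma>, \<tau>) \<odot>\<^bsub>A\<^esub> ?w (\<sigma> \<otimes>\<^bsub>zp_sq p\<^esub> \<tau>)" .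
  qed (use x y in \<open>simp_all add: symbol_cocycle_apply\<close>)
  have "F i1 = x" "F i2 = y" using F(2)[of "(0, Suc 0)" 1] F(2)[of "(Suc 0, 0)" 1] p2 x y by simp_all
  with F(1) show thesis using that by blast
qed

text \<open>Written without subtraction, as it lives in a monoid. For the powers of an element with
  g^p = 1 the two extra terms agree and cancel, so multiplication by \<open>g\<close> preserves the
  sum of its powers.\<close>

lemma (in abelian_monoid) finsum_shift:
  fixes f :: "nat => 'a"
  assumes "\<And>i. f i \<in> carrier G"
  shows "(\<Oplus>i\<in>{..<n}. f (Suc i)) \<oplus> f 0 = (\<Oplus>i\<in>{..<n}. f i) \<oplus> f n"
proof (induction n)
  case (Suc n)
  have "(\<Oplus>i\<in>{..<Suc n}. f (Suc i)) \<oplus> f 0 = f (Suc n) \<oplus> ((\<Oplus>i\<in>{..<n}. f (Suc i)) \<oplus> f 0)"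
    unfolding lessThan_Suc using assms by (subst finsum_insert) (auto intro!: finsum_closed a_assoc)
  also have "\<dots> = f (Suc n) \<oplus> (f n \<oplus> (\<Oplus>i\<in>{..<n}. f i))"
    unfolding Suc using assms by (simp add: a_comm finsum_closed Pi_def)
  also have "\<dots> = (\<Oplus>i\<in>{..<Suc n}. f i) \<oplus> f (Suc n)"
    unfolding lessThan_Suc using assms by (subst finsum_insert) (auto intro!: finsum_closed a_comm)
  finally show ?case .
qed (simp add: assms)

lemma sum_power_root:
  fixes \<theta> :: "'k::field"
  assumes "primitive_root_of_unity p \<theta>" "i < p"
  shows "(\<Sum>k<p. \<theta> ^ (k * i)) = (if i = 0 then of_nat p else 0)"
proof (cases "i = 0")
  case False
  then have "\<theta> ^ i \<noteq> 1" "(\<theta> ^ i) ^ p = 1"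
    using assms by (auto simp: primitive_root_of_unity_def simp flip: power_mult)
      (metis mult.commute power_mult power_one)
  then have "(\<Sum>k<p. (\<theta> ^ i) ^ k) = 0" by (simp add: geometric_sum)
  then show ?thesis using False by (simp add: mult.commute flip: power_mult)
qed simp

section \<open>Splitting off a corner by a skew-commuting pair\<close>

context kalg
begin

lemma skew_mult_pow: "[|x \<in> carrier A; y \<in> carrier A; x \<otimes> y = \<theta> \<odot> (y \<otimes> x)|] ==> x [^] (u::nat) \<otimes> y = \<theta> ^ u \<odot> (y \<otimes> x [^] u)"
  using skew_pow[of x y \<theta> u 1] by simp

lemma commute_pow: "[|x \<in> carrier A; y \<in> carrier A; x \<otimes> y = y \<otimes> x|] ==> x \<otimes> y [^] (v::nat) = y [^] v \<otimes> x"
  using skew_pow[of x y 1 1 v] by simp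

text \<open>As g^p = 1, the powers of \<open>g\<close> yield an idempotent for each character of the
  cyclic group of order p, and conjugation by the invertible \<open>j\<close> moves these
  idempotents cyclically. \<open>e\<close> belongs to the trivial character; its p conjugates under
  powers of \<open>j\<close> are orthogonal with sum 1, which gives full matrix units of size
  p.\<close>

lemma cyclic_corner:
  assumes g: "g \<in> carrier A" and j: "j \<in> carrier A" and gp: "g [^] p = \<one>" and jp: "j [^] p = c \<odot> \<one>"
    and c: "c \<noteq> 0" and jg: "j \<otimes> g = \<theta> \<odot> (g \<otimes> j)" and prim: "primitive_root_of_unity p \<theta>"
    and pk: "of_nat p \<noteq> (0 :: 'k)"
  shows "\<exists>e\<in>carrier A. e \<otimes> e = e \<and> g \<otimes> e = e \<and> e \<otimes> g = e \<and>
    (\<forall>w. \<theta> ^ w \<noteq> 1 \<longrightarrow> e \<otimes> (j [^] w \<otimes> e) = \<zero>) \<and>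
    brauer_equiv A (corner A e) \<and> (\<one> \<noteq> \<zero> \<longrightarrow> e \<noteq> \<zero>)"
proof -
  have p: "0 < p" and \<theta>p: "\<theta> ^ p = 1" and \<theta>n: "\<And>i. 0 < i ==> i < p ==> \<theta> ^ i \<noteq> 1"
    using prim by (auto simp: primitive_root_of_unity_def)
  let ?s = "\<Oplus>i\<in>{..<p}. g [^] i"
  define e where "e = inverse (of_nat p) \<odot> ?s"
  have s: "?s \<in> carrier A" using g by (intro finsum_closed) simp
  then have e: "e \<in> carrier A" by (simp add: e_def)
  have shift: "(\<Oplus>i\<in>{..<p}. g [^] Suc i) = ?s"
  proof -
    have "(\<Oplus>i\<in>{..<p}. g [^] Suc i) \<oplus> \<one> = ?s \<oplus> \<one>"
      using finsum_shift[of "\<lambda>i. g [^] i" p] g gp by simp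
    then show ?thesis using s g by (subst (asm) add.right_cancel) (auto intro!: finsum_closed)
  qed
  have "g \<otimes> ?s = (\<Oplus>i\<in>{..<p}. g \<otimes> g [^] i)" using g by (intro finsum_rdistr) simp_all
  also have "\<dots> = (\<Oplus>i\<in>{..<p}. g [^] Suc i)"
    using g nat_pow_Suc2[OF g] by (intro finsum_cong') simp_all
  finally have ge: "g \<otimes> e = e" using shift s g by (simp add: e_def smult_rmult)
  have "?s \<otimes> g = (\<Oplus>i\<in>{..<p}. g [^] i \<otimes> g)" using g by (intro finsum_ldistr) simp_all
  then have eg: "e \<otimes> g = e" using shift s g by (simp add: e_def smult_lmult)
  have gie: "g [^] (i::nat) \<otimes> e = e" for i
    by (induction i) (use g e in \<open>simp_all add: m_assoc ge\<close>)
  have "?s \<otimes> e = (\<Oplus>i\<in>{..<p}. g [^] i \<otimes> e)" using g e by (intro finsum_ldistr) simp_all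
  also have "\<dots> = (\<Oplus>i\<in>{..<p}. 1 \<odot> e)" using e by (intro finsum_cong') (simp_all add: gie)
  also have "\<dots> = (\<Sum>i<p. 1) \<odot> e" by (rule finsum_smult[symmetric]) (simp_all add: e)
  finally have ee: "e \<otimes> e = e"
    using s e pk by (subst (1) e_def) (simp add: smult_lmult smult_smult)
  \<comment> \<open>Both \<open>e \<otimes> g\<close> and \<open>g \<otimes> e\<close> equal
    \<open>e\<close>, while moving \<open>g\<close> through j^w costs \<theta>^w; so the element
    equals \<theta>^w times itself.\<close>
  have ejg: "e \<otimes> (j [^] w \<otimes> e) = \<zero>" if w: "\<theta> ^ w \<noteq> 1" for w :: nat
  proof -
    let ?T = "e \<otimes> (j [^] w \<otimes> e)"
    have T: "?T \<in> carrier A" using e j by simp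
    have "?T = e \<otimes> ((j [^] w \<otimes> g) \<otimes> e)" using e j g by (simp add: m_assoc ge)
    also have "\<dots> = \<theta> ^ w \<odot> ((e \<otimes> g) \<otimes> (j [^] w \<otimes> e))"
      unfolding skew_mult_pow[OF j g jg] using e j g by (simp add: m_assoc smult_lmult smult_rmult)
    finally have "?T = \<theta> ^ w \<odot> ?T" unfolding eg .
    then have "(1 - \<theta> ^ w) \<odot> ?T = \<zero>"
      using smult_ladd[OF T, of "1 - \<theta> ^ w" "\<theta> ^ w"] T by (simp add: add.r_cancel_one')
    then show ?thesis using smult_cancel0[OF T, of "1 - \<theta> ^ w"] w by auto
  qed
  \<comment> \<open>\<open>E k l\<close> stands for j^k e j^(-l); the inverse power is written as
    c^(-1) j^(p - l), which keeps exponents natural.\<close>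
  define E where "E k l = inverse c \<odot> (j [^] k \<otimes> (e \<otimes> j [^] (p - l)))" for k l :: nat
  have Ecl: "E k l \<in> carrier A" for k l using e j by (simp add: E_def)
  have E00: "E 0 0 = e" using e j c by (simp add: E_def jp smult_rmult smult_smult)
  \<comment> \<open>The exponent runs from 1 to 2 p - 1 and is a multiple of p only for l = m, where
    j^p = c makes the product \<open>c \<odot> e\<close>.\<close>
  have jw: "e \<otimes> (j [^] ((p - l) + m) \<otimes> e) = (if l = m then c \<odot> e else \<zero>)" if "l < p" "m < p" for l m
  proof (cases "l = m")
    case True
    then show ?thesis using that e by (simp add: jp smult_lmult smult_rmult ee)
  next
    case False
    have "\<theta> ^ ((p - l) + m) \<noteq> 1"
    proof (cases "m < l")
      case True
      then show ?thesis using that by (intro \<theta>n) auto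
    next
      case m: False
      have eq: "(p - l) + m = p + (m - l)" using that m by simp
      have "\<theta> ^ (m - l) \<noteq> 1" using False m that by (intro \<theta>n) auto
      then show ?thesis unfolding eq by (simp add: power_add \<theta>p)
    qed
    then show ?thesis using False ejg by simp
  qed
  have EE: "E k l \<otimes> E m n = (if l = m then E k n else \<zero>)" if "k < p" "l < p" "m < p" "n < p" for k l m n
  proof -
    have "E k l \<otimes> E m n = (inverse c * inverse c) \<odot> (j [^] k \<otimes> (e \<otimes> ((j [^] (p - l) \<otimes> j [^] m) \<otimes> (e \<otimes> j [^] (p - n)))))"
      using e j by (simp add: E_def smult_lmult smult_rmult smult_smult m_assoc)
    also have "\<dots> = (inverse c * inverse c) \<odot> (j [^] k \<otimes> ((e \<otimes> (j [^] ((p - l) + m) \<otimes> e)) \<otimes> j [^] (p - n)))"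
      using e j by (simp add: nat_pow_mult m_assoc)
    also have "\<dots> = (if l = m then E k n else \<zero>)"
      unfolding jw[OF that(2,3)] using e j c by (simp add: E_def smult_lmult smult_rmult smult_smult mult.assoc)
    finally show ?thesis .
  qed
  \<comment> \<open>Conjugation by j^k multiplies g^i by \<theta>^(k i), so \<open>E k k\<close> is
    the idempotent of another character of the cyclic group.\<close>
  have Ekk: "E k k = (\<Oplus>i\<in>{..<p}. (inverse (of_nat p) * \<theta> ^ (k * i)) \<odot> g [^] i)" if k: "k < p" for k
  proof -
    have "e \<otimes> j [^] (p - k) = (\<Oplus>i\<in>{..<p}. inverse (of_nat p) \<odot> (g [^] i \<otimes> j [^] (p - k)))"
      unfolding e_def using g j s by (simp add: smult_lmult finsum_ldistr smult_finsum Pi_def)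
    then have "j [^] k \<otimes> (e \<otimes> j [^] (p - k)) = (\<Oplus>i\<in>{..<p}. j [^] k \<otimes> (inverse (of_nat p) \<odot> (g [^] i \<otimes> j [^] (p - k))))"
      using g j by (simp add: finsum_rdistr Pi_def)
    then have "E k k = (\<Oplus>i\<in>{..<p}. inverse c \<odot> (j [^] k \<otimes> (inverse (of_nat p) \<odot> (g [^] i \<otimes> j [^] (p - k)))))"
      unfolding E_def using g j by (simp add: smult_finsum Pi_def)
    also have "\<dots> = (\<Oplus>i\<in>{..<p}. (inverse (of_nat p) * \<theta> ^ (k * i)) \<odot> g [^] i)"
    proof (rule finsum_cong'[OF refl])
      fix i assume "i \<in> {..<p}"
      have "j [^] k \<otimes> (g [^] i \<otimes> j [^] (p - k)) = (j [^] k \<otimes> g [^] i) \<otimes> j [^] (p - k)"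
        using g j by (simp add: m_assoc)
      also have "\<dots> = \<theta> ^ (k * i) \<odot> (g [^] i \<otimes> (j [^] k \<otimes> j [^] (p - k)))"
        unfolding skew_pow[OF j g jg] using g j by (simp add: smult_lmult m_assoc)
      also have "\<dots> = (\<theta> ^ (k * i) * c) \<odot> g [^] i"
        using g j k by (simp add: nat_pow_mult jp smult_rmult smult_smult)
      finally show "inverse c \<odot> (j [^] k \<otimes> (inverse (of_nat p) \<odot> (g [^] i \<otimes> j [^] (p - k)))) =
          (inverse (of_nat p) * \<theta> ^ (k * i)) \<odot> g [^] i"
        using g j c by (simp add: smult_rmult smult_smult field_simps)
    qed (use g in simp)
    finally show ?thesis .
  qed
  have "(\<Oplus>k\<in>{..<p}. E k k) = (\<Oplus>k\<in>{..<p}. \<Oplus>i\<in>{..<p}. (inverse (of_nat p) * \<theta> ^ (k * i)) \<odot> g [^] i)"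
    using g by (intro finsum_cong') (auto simp: Ekk intro!: finsum_closed)
  also have "\<dots> = (\<Oplus>i\<in>{..<p}. \<Oplus>k\<in>{..<p}. (inverse (of_nat p) * \<theta> ^ (k * i)) \<odot> g [^] i)"
    using g by (intro finsum_swap) auto
  also have "\<dots> = (\<Oplus>i\<in>{..<p}. (\<Sum>k<p. inverse (of_nat p) * \<theta> ^ (k * i)) \<odot> g [^] i)"
    using g by (intro finsum_cong' finsum_smult[symmetric]) auto
  \<comment> \<open>Orthogonality of characters: summing over \<open>k\<close> first leaves only the
    term i = 0.\<close>
  also have "\<dots> = (\<Oplus>i\<in>{..<p}. (if i = 0 then 1 else 0) \<odot> g [^] i)"
    using g pk by (intro finsum_cong') (auto simp: sum_power_root[OF prim] simp flip: sum_distrib_left)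
  also have "\<dots> = \<one>" using g p by (subst finsum_delta[of _ 0]) auto
  finally have Esum: "(\<Oplus>k\<in>{..<p}. E k k) = \<one>" .
  note bc = brauer_equiv_corner[of p E, OF Ecl EE Esum p, unfolded E00]
  have "e \<noteq> \<zero>" if nz: "\<one> \<noteq> \<zero>"
  proof
    assume "e = \<zero>"
    then have "E k k = \<zero>" for k using j by (simp add: E_def)
    then show False using Esum nz by simp
  qed
  then show ?thesis using ee ge eg ejg bc(2) by (intro bexI[OF _ e]) simp
qed

text \<open>A corner that consists of multiples of a nonzero \<open>e\<close> is a copy of the base
  field.\<close>

lemma brauer_equiv_field_of_corner:
  assumes e: "e \<in> carrier A" "e \<otimes> e = e" "e \<noteq> \<zero>" and b: "brauer_equiv A (corner A e)"
    and scalar: "\<And>r. r \<in> carrier A ==> \<exists>k. e \<otimes> (r \<otimes> e) = k \<odot> e"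
  shows "brauer_equiv A (sc_algebra sc_one)"
proof -
  have C: "kalg (corner A e)" by (rule kalg_corner[OF e(1,2)])
  obtain F where F: "kalg_hom field_algebra (sc_algebra sc_one) F"
    "bij_betw F (carrier field_algebra) (carrier (sc_algebra (sc_one :: 'k struct_consts)))"
    using sc_one_iso(2) kalg_field_algebra sc_one_iso(1) by (rule iso_relE)
  have h: "kalg_hom field_algebra (corner A e) (\<lambda>k. k \<odot> e)"
    by (intro kalg_hom.intro kalg_hom_axioms.intro kalg_field_algebra C)
      (use e in \<open>auto simp: field_algebra_def smult_ladd smult_lmult smult_rmult smult_smult mult.commute\<close>)
  interpret h: kalg_hom field_algebra "corner A e" "\<lambda>k. k \<odot> e" by (rule h)
  have "inj_on (\<lambda>k. k \<odot> e) (carrier field_algebra)"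
  proof (rule inj_onI)
    fix k l assume "k \<odot> e = l \<odot> e"
    then have "(k - l) \<odot> e = \<zero>"
      using smult_ladd[OF e(1), of "k - l" l] e(1) by (simp add: add.r_cancel_one')
    then show "k = l" using smult_cancel0[OF e(1), of "k - l"] e(3) by auto
  qed
  moreover have "y \<in> (\<lambda>k. k \<odot> e) ` carrier field_algebra" if "y \<in> carrier (corner A e)" for y
  proof -
    have "e \<otimes> (y \<otimes> e) = y" "y \<in> carrier A" using that by auto
    then obtain k where "y = k \<odot> e" using scalar[of y] by auto
    then show ?thesis by (simp add: field_algebra_def)
  qed
  ultimately have "bij_betw (\<lambda>k. k \<odot> e) (carrier field_algebra) (carrier (corner A e))"
    using h.closed by (auto simp: bij_betw_def simp del: corner_simps)
  then have i: "iso_rel field_algebra (corner A e)" by (rule iso_relI[OF h])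
  have "brauer_equiv (corner A e) (sc_algebra sc_one)"
    by (rule iso_rel_imp_brauer_equiv[OF iso_rel_trans[OF iso_rel_sym[OF i kalg_field_algebra C] sc_one_iso(2)
      C kalg_field_algebra sc_one_iso(1)] C sc_one_iso(1)])
  then show ?thesis by (rule brauer_equiv_trans[OF b _ kalg_axioms C sc_one_iso(1)])
qed

end

text \<open>For a = 1 the generator i_2 plays the part of \<open>g\<close> and i_1 that of
  \<open>j\<close> in \<open>cyclic_corner\<close>; for b = 1 the roles are exchanged. The corner is
  one-dimensional, since \<open>e\<close> absorbs the powers of one generator and kills the
  nontrivial powers of the other.\<close>

lemma (in symbol) brauer_class_trivial:
  assumes pk: "of_nat p \<noteq> (0 :: 'k)" and ab: "a = 1 \<or> b = 1"
  shows "brauer_class (symbol_algebra p a b \<zeta>) = \<one>\<^bsub>brauer_group\<^esub>"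
proof -
  interpret W: kalg W by (rule kalg_twisted)
  have nz: "\<one>\<^bsub>W\<^esub> \<noteq> \<zero>\<^bsub>W\<^esub>"
    using simple_central_symbol unfolding symbol_eq_W simple_central_def by blast
  have one_smult: "k \<odot>\<^bsub>W\<^esub> \<one>\<^bsub>W\<^esub> = \<one>\<^bsub>W\<^esub>" if "k = 1" for k using that by simp
  \<comment> \<open>Multiples of \<open>e\<close> are closed under sums and scalars, so only the
    monomials i_2^v i_1^u have to be compressed.\<close>
  have red: "\<exists>k. e \<otimes>\<^bsub>W\<^esub> (r \<otimes>\<^bsub>W\<^esub> e) = k \<odot>\<^bsub>W\<^esub> e"
    if e: "e \<in> carrier W" and mon: "\<And>v u. v < p ==> u < p ==> \<exists>k. e \<otimes>\<^bsub>W\<^esub> ((i2 [^]\<^bsub>W\<^esub> v \<otimes>\<^bsub>W\<^esub> i1 [^]\<^bsub>W\<^esub> u) \<otimes>\<^bsub>W\<^esub> e) = k \<odot>\<^bsub>W\<^esub> e"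
      and r: "r \<in> carrier W" for e r
    using r
  proof (induction r rule: twisted_induct)
    case zero
    have "e \<otimes>\<^bsub>W\<^esub> (\<zero>\<^bsub>W\<^esub> \<otimes>\<^bsub>W\<^esub> e) = 0 \<odot>\<^bsub>W\<^esub> e" using e by (simp only: W.l_null W.r_null W.smult_l0)
    then show ?case by blast
  next
    case (add x y)
    then obtain k l where kl: "e \<otimes>\<^bsub>W\<^esub> (x \<otimes>\<^bsub>W\<^esub> e) = k \<odot>\<^bsub>W\<^esub> e" "e \<otimes>\<^bsub>W\<^esub> (y \<otimes>\<^bsub>W\<^esub> e) = l \<odot>\<^bsub>W\<^esub> e" by blast
    have "e \<otimes>\<^bsub>W\<^esub> ((x \<oplus>\<^bsub>W\<^esub> y) \<otimes>\<^bsub>W\<^esub> e) = (k + l) \<odot>\<^bsub>W\<^esub> e"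
      using e add(1,2) kl by (simp only: W.l_distr W.r_distr W.smult_ladd W.m_closed)
    then show ?case by blast
  next
    case (mon \<sigma> x)
    then obtain v u where vu: "\<sigma> = (v, u)" "v < p" "u < p" by auto
    let ?q = "i2 [^]\<^bsub>W\<^esub> v \<otimes>\<^bsub>W\<^esub> i1 [^]\<^bsub>W\<^esub> u"
    have q: "?q \<in> carrier W" by (intro W.m_closed W.nat_pow_closed i_closed)
    obtain k where k: "e \<otimes>\<^bsub>W\<^esub> (?q \<otimes>\<^bsub>W\<^esub> e) = k \<odot>\<^bsub>W\<^esub> e"
      using \<open>\<And>v u. v < p ==> u < p ==> \<exists>k. e \<otimes>\<^bsub>W\<^esub> ((i2 [^]\<^bsub>W\<^esub> v \<otimes>\<^bsub>W\<^esub> i1 [^]\<^bsub>W\<^esub> u) \<otimes>\<^bsub>W\<^esub> e) = k \<odot>\<^bsub>W\<^esub> e\<close>[OF vu(2,3)] by blast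
    have "e \<otimes>\<^bsub>W\<^esub> (mon_elem \<sigma> x \<otimes>\<^bsub>W\<^esub> e) = (x * k) \<odot>\<^bsub>W\<^esub> e"
      unfolding vu(1) mon_eq[OF vu(2,3)] W.smult_lmult[OF q e] W.smult_rmult[OF e W.m_closed[OF q e]] k
      by (rule W.smult_smult[OF e])
    then show ?case by blast
  qed
  have "brauer_equiv W (sc_algebra sc_one)"
    using ab
  proof
    assume a1: "a = 1"
    have gp: "i2 [^]\<^bsub>W\<^esub> p = \<one>\<^bsub>W\<^esub>" unfolding i_relations(2) by (rule one_smult[OF a1])
    obtain e where e: "e \<in> carrier W" "e \<otimes>\<^bsub>W\<^esub> e = e" "i2 \<otimes>\<^bsub>W\<^esub> e = e" "e \<otimes>\<^bsub>W\<^esub> i2 = e"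
      "\<forall>w. \<zeta> ^ w \<noteq> 1 \<longrightarrow> e \<otimes>\<^bsub>W\<^esub> (i1 [^]\<^bsub>W\<^esub> w \<otimes>\<^bsub>W\<^esub> e) = \<zero>\<^bsub>W\<^esub>" "brauer_equiv W (corner W e)" "\<one>\<^bsub>W\<^esub> \<noteq> \<zero>\<^bsub>W\<^esub> \<longrightarrow> e \<noteq> \<zero>\<^bsub>W\<^esub>"
      using W.cyclic_corner[OF i_closed(2,1) gp i_relations(1) b0 i_relations(3) prim pk] by blast
    have pw: "e \<otimes>\<^bsub>W\<^esub> i2 [^]\<^bsub>W\<^esub> (v::nat) = e" for v
      by (induction v) (simp_all add: e(1,4) i_closed W.nat_pow_closed flip: W.m_assoc)
    show ?thesis
    proof (rule W.brauer_equiv_field_of_corner[OF e(1,2) mp[OF e(7) nz] e(6)], rule red[OF e(1)])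
      fix v u assume vu: "v < p" "u < p"
      have "e \<otimes>\<^bsub>W\<^esub> ((i2 [^]\<^bsub>W\<^esub> v \<otimes>\<^bsub>W\<^esub> i1 [^]\<^bsub>W\<^esub> u) \<otimes>\<^bsub>W\<^esub> e) = (e \<otimes>\<^bsub>W\<^esub> i2 [^]\<^bsub>W\<^esub> v) \<otimes>\<^bsub>W\<^esub> (i1 [^]\<^bsub>W\<^esub> u \<otimes>\<^bsub>W\<^esub> e)"
        by (simp only: W.m_assoc W.m_closed W.nat_pow_closed i_closed e(1))
      also have "\<dots> = (if u = 0 then 1 else 0) \<odot>\<^bsub>W\<^esub> e"
        unfolding pw using spec[OF e(5), of u] zeta_ne[of u] vu e(1,2) by (cases "u = 0") simp_all
      finally show "\<exists>k. e \<otimes>\<^bsub>W\<^esub> ((i2 [^]\<^bsub>W\<^esub> v \<otimes>\<^bsub>W\<^esub> i1 [^]\<^bsub>W\<^esub> u) \<otimes>\<^bsub>W\<^esub> e) = k \<odot>\<^bsub>W\<^esub> e" by blast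
    qed
  next
    assume b1: "b = 1"
    have gp: "i1 [^]\<^bsub>W\<^esub> p = \<one>\<^bsub>W\<^esub>" unfolding i_relations(1) by (rule one_smult[OF b1])
    \<comment> \<open>With the generators exchanged the skew relation holds for the inverse of
      \<zeta>, which is again primitive.\<close>
    have prim': "primitive_root_of_unity p (inverse \<zeta>)"
      using prim by (simp add: primitive_root_of_unity_def power_inverse)
    have rel: "i2 \<otimes>\<^bsub>W\<^esub> i1 = inverse \<zeta> \<odot>\<^bsub>W\<^esub> (i1 \<otimes>\<^bsub>W\<^esub> i2)"
      unfolding i_relations(3) using zeta_0 by (simp add: W.smult_smult i_closed)
    obtain e where e: "e \<in> carrier W" "e \<otimes>\<^bsub>W\<^esub> e = e" "i1 \<otimes>\<^bsub>W\<^esub> e = e" "e \<otimes>\<^bsub>W\<^esub> i1 = e"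
      "\<forall>w. inverse \<zeta> ^ w \<noteq> 1 \<longrightarrow> e \<otimes>\<^bsub>W\<^esub> (i2 [^]\<^bsub>W\<^esub> w \<otimes>\<^bsub>W\<^esub> e) = \<zero>\<^bsub>W\<^esub>" "brauer_equiv W (corner W e)" "\<one>\<^bsub>W\<^esub> \<noteq> \<zero>\<^bsub>W\<^esub> \<longrightarrow> e \<noteq> \<zero>\<^bsub>W\<^esub>"
      using W.cyclic_corner[OF i_closed(1,2) gp i_relations(2) a0 rel prim' pk] by blast
    have pw: "i1 [^]\<^bsub>W\<^esub> (v::nat) \<otimes>\<^bsub>W\<^esub> e = e" for v
      by (induction v) (simp_all add: e(1,3) i_closed W.nat_pow_closed W.m_assoc)
    show ?thesis
    proof (rule W.brauer_equiv_field_of_corner[OF e(1,2) mp[OF e(7) nz] e(6)], rule red[OF e(1)])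
      fix v u assume vu: "v < p" "u < p"
      have "e \<otimes>\<^bsub>W\<^esub> ((i2 [^]\<^bsub>W\<^esub> v \<otimes>\<^bsub>W\<^esub> i1 [^]\<^bsub>W\<^esub> u) \<otimes>\<^bsub>W\<^esub> e) = e \<otimes>\<^bsub>W\<^esub> (i2 [^]\<^bsub>W\<^esub> v \<otimes>\<^bsub>W\<^esub> (i1 [^]\<^bsub>W\<^esub> u \<otimes>\<^bsub>W\<^esub> e))"
        by (simp only: W.m_assoc W.m_closed W.nat_pow_closed i_closed e(1))
      also have "\<dots> = (if v = 0 then 1 else 0) \<odot>\<^bsub>W\<^esub> e"
        unfolding pw using spec[OF e(5), of v] zeta_ne[of v] vu e(1,2) by (cases "v = 0") (simp_all add: power_inverse)
      finally show "\<exists>k. e \<otimes>\<^bsub>W\<^esub> ((i2 [^]\<^bsub>W\<^esub> v \<otimes>\<^bsub>W\<^esub> i1 [^]\<^bsub>W\<^esub> u) \<otimes>\<^bsub>W\<^esub> e) = k \<odot>\<^bsub>W\<^esub> e" by blast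
    qed
  qed
  then show ?thesis
    unfolding symbol_eq_W brauer_group_one by (rule brauer_class_eqI[OF _ W.kalg_axioms sc_one_iso(1)])
qed

section \<open>Commutation tested on generators, and bilinearity of symbols\<close>

lemma (in kalg_hom) commute_generated:
  assumes gen: "generated_by A gs" and z: "z \<in> carrier B"
    and c: "\<And>g. g \<in> gs ==> f g \<otimes>\<^bsub>B\<^esub> z = z \<otimes>\<^bsub>B\<^esub> f g" and x: "x \<in> carrier A"
  shows "f x \<otimes>\<^bsub>B\<^esub> z = z \<otimes>\<^bsub>B\<^esub> f x"
proof -
  let ?M = "{x \<in> carrier A. f x \<otimes>\<^bsub>B\<^esub> z = z \<otimes>\<^bsub>B\<^esub> f x}"
  have "subalg A ?M"
    unfolding subalg_def
  proof (intro conjI ballI allI)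
    fix x y assume xy: "x \<in> ?M" "y \<in> ?M"
    then have *: "f x \<in> carrier B" "f y \<in> carrier B" "f x \<otimes>\<^bsub>B\<^esub> z = z \<otimes>\<^bsub>B\<^esub> f x" "f y \<otimes>\<^bsub>B\<^esub> z = z \<otimes>\<^bsub>B\<^esub> f y"
      by auto
    show "x \<oplus>\<^bsub>A\<^esub> y \<in> ?M"
      using xy z by (simp add: hom_add T.l_distr T.r_distr)
    have "f x \<otimes>\<^bsub>B\<^esub> f y \<otimes>\<^bsub>B\<^esub> z = z \<otimes>\<^bsub>B\<^esub> (f x \<otimes>\<^bsub>B\<^esub> f y)"
      using * z by (metis T.m_assoc)
    then show "x \<otimes>\<^bsub>A\<^esub> y \<in> ?M" using xy by (simp add: hom_mult)
  qed (use z in \<open>auto simp: hom_one hom_smult T.smult_lmult T.smult_rmult\<close>)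
  then have "x \<in> ?M"
    by (rule generated_byD[OF gen _ _ x]) (use c generated_by_subset[OF gen] in auto)
  then show ?thesis by simp
qed

text \<open>The elements commuting with a given one form a subalgebra, so commutation spreads from
  generators to everything in one argument and after that in the other.\<close>

lemma hom_commute:
  assumes f: "kalg_hom A R f" and g: "kalg_hom A' R g"
    and genA: "generated_by A gs" and genB: "generated_by A' hs"
    and c: "\<And>x y. x \<in> gs ==> y \<in> hs ==> f x \<otimes>\<^bsub>R\<^esub> g y = g y \<otimes>\<^bsub>R\<^esub> f x"
    and x: "x \<in> carrier A" and y: "y \<in> carrier A'"
  shows "f x \<otimes>\<^bsub>R\<^esub> g y = g y \<otimes>\<^bsub>R\<^esub> f x"
proof -
  interpret f: kalg_hom A R f by fact
  interpret g: kalg_hom A' R g by fact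
  have 1: "f u \<otimes>\<^bsub>R\<^esub> g v = g v \<otimes>\<^bsub>R\<^esub> f u" if "v \<in> hs" "u \<in> carrier A" for u v
    by (rule f.commute_generated[OF genA _ _ that(2)]) (use that(1) generated_by_subset[OF genB] c in auto)
  show ?thesis
    by (rule g.commute_generated[OF genB _ _ y, symmetric]) (use 1 x in auto)
qed

text \<open>Symbol algebras in the form that the Brauer group demands. \<open>F\<close> and its left
  inverse \<open>F'\<close> transfer homomorphisms out of the symbol algebra, and the images of i_1,
  i_2 still generate.\<close>

lemma (in symbol) symbol_sc:
  obtains S F F' where "simple_central (sc_algebra S)" "brauer_class (symbol_algebra p a b \<zeta>) = brauer_class (sc_algebra S)"
    "kalg_hom W (sc_algebra S) F" "kalg_hom (sc_algebra S) W F'"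
    "\<forall>x\<in>carrier W. F' (F x) = x" "generated_by (sc_algebra S) {F i1, F i2}"
proof -
  obtain S F where F: "kalg_hom W (sc_algebra S) F" "bij_betw F (carrier W) (carrier (sc_algebra S))"
    by (rule twisted_iso_sc[OF twisted_algebra_axioms])
  interpret F: kalg_hom W "sc_algebra S" F by (rule F(1))
  let ?G = "inv_into (carrier W) F"
  have inj: "inj_on F (carrier W)" and im: "F ` carrier W = carrier (sc_algebra S)"
    using F(2) by (auto simp: bij_betw_def)
  have GF: "?G (F x) = x" if "x \<in> carrier W" for x by (rule inv_into_f_f[OF inj that])
  have Gc: "?G y \<in> carrier W" "F (?G y) = y" if "y \<in> carrier (sc_algebra S)" for y
    using that unfolding im[symmetric] by (auto simp: inv_into_into f_inv_into_f)
  have GI: "?G y = x" if "F x = y" "x \<in> carrier W" for x y using GF[OF that(2)] that(1) by simp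
  have G: "kalg_hom (sc_algebra S) W ?G"
  proof (intro kalg_hom.intro kalg_hom_axioms.intro F.S.kalg_axioms F.T.kalg_axioms)
    fix x y assume xy: "x \<in> carrier (sc_algebra S)" "y \<in> carrier (sc_algebra S)"
    show "?G (x \<oplus>\<^bsub>sc_algebra S\<^esub> y) = ?G x \<oplus>\<^bsub>W\<^esub> ?G y"
      by (rule GI) (simp_all only: F.hom_add Gc[OF xy(1)] Gc[OF xy(2)] F.S.a_closed)
    show "?G (x \<otimes>\<^bsub>sc_algebra S\<^esub> y) = ?G x \<otimes>\<^bsub>W\<^esub> ?G y"
      by (rule GI) (simp_all only: F.hom_mult Gc[OF xy(1)] Gc[OF xy(2)] F.S.m_closed)
  next
    fix x c assume x: "x \<in> carrier (sc_algebra S)"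
    show "?G (c \<odot>\<^bsub>sc_algebra S\<^esub> x) = c \<odot>\<^bsub>W\<^esub> ?G x"
      by (rule GI) (simp_all only: F.hom_smult Gc[OF x] F.S.smult_closed)
  next
    show "?G \<one>\<^bsub>sc_algebra S\<^esub> = \<one>\<^bsub>W\<^esub>"
      by (rule GI) (simp_all only: F.hom_one F.S.one_closed)
  qed (rule Gc(1))
  have gen: "generated_by (sc_algebra S) {F i1, F i2}"
    using F.generated_image[OF generated_symbol im] by simp
  have sc: "simple_central (sc_algebra S)"
    using simple_central_transport[OF simple_central_symbol[unfolded symbol_eq_W] F] .
  have cl: "brauer_class (symbol_algebra p a b \<zeta>) = brauer_class (sc_algebra S)"
    unfolding symbol_eq_W
    by (rule brauer_class_eqI[OF iso_rel_imp_brauer_equiv[OF iso_relI[OF F]]]) (rule F.S.kalg_axioms F.T.kalg_axioms)+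
  show thesis by (rule that[OF sc cl F(1) G _ gen]) (use GF in blast)
qed

lemma (in symbol) symbol_class_closed: "brauer_class (symbol_algebra p a b \<zeta>) \<in> carrier brauer_group"
proof -
  obtain S where "simple_central (sc_algebra S)" "brauer_class (symbol_algebra p a b \<zeta>) = brauer_class (sc_algebra S)"
    by (rule symbol_sc)
  then show ?thesis by (simp add: brauer_class_closed)
qed

text \<open>In (a,b) \<otimes> (a,c) with generators I and J, the elements x = I_1 J_1 and y =
  I_2^(-1) J_2 rearrange the generators into two commuting pairs: (x, I_2) satisfies the relations
  of (a,bc), and (J_1, y) those of (1,c). The inverse of I_2 is a^(-1) I_2^(p-1).\<close>

lemma (in kalg) bilinear_relations:
  assumes cl: "I1 \<in> carrier A" "I2 \<in> carrier A" "J1 \<in> carrier A" "J2 \<in> carrier A"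
    and pw: "I1 [^] p = b \<odot> \<one>" "I2 [^] p = a \<odot> \<one>" "J1 [^] p = c \<odot> \<one>" "J2 [^] p = a \<odot> \<one>"
    and sk: "I1 \<otimes> I2 = \<zeta> \<odot> (I2 \<otimes> I1)" "J1 \<otimes> J2 = \<zeta> \<odot> (J2 \<otimes> J1)"
    and cm: "I1 \<otimes> J1 = J1 \<otimes> I1" "I1 \<otimes> J2 = J2 \<otimes> I1" "I2 \<otimes> J1 = J1 \<otimes> I2" "I2 \<otimes> J2 = J2 \<otimes> I2"
    and a: "a \<noteq> 0" and \<zeta>: "\<zeta> ^ p = 1" and p: "0 < p"
  defines "x \<equiv> I1 \<otimes> J1" and "y \<equiv> inverse a \<odot> (I2 [^] (p - 1) \<otimes> J2)"
  shows "x \<in> carrier A" "y \<in> carrier A" "x [^] p = (b * c) \<odot> \<one>" "x \<otimes> I2 = \<zeta> \<odot> (I2 \<otimes> x)" "y [^] p = 1 \<odot> \<one>"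
    "J1 \<otimes> y = \<zeta> \<odot> (y \<otimes> J1)" "x \<otimes> J1 = J1 \<otimes> x" "x \<otimes> y = y \<otimes> x" "I2 \<otimes> y = y \<otimes> I2"
    "I2 \<otimes> y = J2" "x \<otimes> J1 [^] (p - 1) = c \<odot> I1"
proof -
  define q where "q = p - 1"
  have q: "Suc q = p" "p - 1 = q" using p by (auto simp: q_def)
  have I2q: "I2 \<otimes> I2 [^] q = a \<odot> \<one>" "I2 [^] q \<otimes> I2 = a \<odot> \<one>" and J1q: "J1 \<otimes> J1 [^] q = c \<odot> \<one>"
    using pw(2,3) nat_pow_Suc2[of I2 q] nat_pow_Suc2[of J1 q] nat_pow_Suc[of I2 q] cl unfolding q(1) by simp_all
  note comm = commute_pow[OF cl(3) cl(2) cm(3)[symmetric], of q] commute_pow[OF cl(4) cl(2) cm(4)[symmetric], of q]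
  have skq: "I1 \<otimes> I2 [^] q = \<zeta> ^ q \<odot> (I2 [^] q \<otimes> I1)"
    using skew_pow[OF cl(1,2) sk(1), of 1 q] cl by simp
  show xc: "x \<in> carrier A" and yc: "y \<in> carrier A" using cl by (simp_all add: x_def y_def)
  have "x [^] p = I1 [^] p \<otimes> J1 [^] p"
    unfolding x_def by (rule pow_mult_distrib[OF cm(1) cl(1,3)])
  then show "x [^] p = (b * c) \<odot> \<one>" using pw by (simp add: smult_lmult smult_rmult smult_smult mult.commute)
  have "x \<otimes> I2 = I1 \<otimes> (I2 \<otimes> J1)" using cl by (simp add: x_def m_assoc cm(3)[symmetric])
  also have "\<dots> = (I1 \<otimes> I2) \<otimes> J1" using cl by (simp add: m_assoc)
  also have "\<dots> = \<zeta> \<odot> (I2 \<otimes> x)" using cl by (simp add: sk smult_lmult m_assoc x_def)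
  finally show "x \<otimes> I2 = \<zeta> \<odot> (I2 \<otimes> x)" .
  have "(I2 [^] q \<otimes> J2) [^] p = (I2 [^] q) [^] p \<otimes> J2 [^] p"
    by (rule pow_mult_distrib) (use cl comm in simp_all)
  also have "(I2 [^] q) [^] p = (I2 [^] p) [^] q"
    using cl by (simp add: nat_pow_pow mult.commute)
  also have "\<dots> \<otimes> J2 [^] p = (a ^ q * a) \<odot> \<one>" using pw by (simp add: smult_pow smult_lmult smult_rmult smult_smult mult.commute)
  also have "a ^ q * a = a ^ p" unfolding q(1)[symmetric] by simp
  finally show "y [^] p = 1 \<odot> \<one>" unfolding y_def q(2)
    using cl a by (simp add: smult_pow smult_smult power_inverse)
  have "J1 \<otimes> y = inverse a \<odot> ((J1 \<otimes> I2 [^] q) \<otimes> J2)" unfolding y_def q(2) using cl by (simp add: smult_rmult m_assoc)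
  also have "\<dots> = inverse a \<odot> (I2 [^] q \<otimes> (J1 \<otimes> J2))" unfolding comm(1) using cl by (simp add: m_assoc)
  also have "\<dots> = \<zeta> \<odot> (y \<otimes> J1)" unfolding sk y_def q(2) using cl
    by (simp add: smult_rmult smult_lmult smult_smult m_assoc mult.commute)
  finally show Jy: "J1 \<otimes> y = \<zeta> \<odot> (y \<otimes> J1)" .
  show "x \<otimes> J1 = J1 \<otimes> x" using cl by (simp add: x_def cm(1) m_assoc)
  have "I1 \<otimes> y = inverse a \<odot> ((I1 \<otimes> I2 [^] q) \<otimes> J2)" unfolding y_def q(2) using cl by (simp add: smult_rmult m_assoc)
  also have "\<dots> = (inverse a * \<zeta> ^ q) \<odot> (I2 [^] q \<otimes> (I1 \<otimes> J2))" unfolding skq using cl by (simp add: smult_lmult smult_smult m_assoc)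
  also have "\<dots> = \<zeta> ^ q \<odot> (y \<otimes> I1)" unfolding cm(2) y_def q(2) using cl by (simp add: smult_lmult smult_smult m_assoc mult.commute)
  finally have Iy: "I1 \<otimes> y = \<zeta> ^ q \<odot> (y \<otimes> I1)" .
  \<comment> \<open>In passing y, the factor J_1 contributes \<zeta> and I_1 contributes
    \<zeta>^(p-1); together they cancel.\<close>
  have "x \<otimes> y = I1 \<otimes> (J1 \<otimes> y)" using cl yc by (simp add: x_def m_assoc)
  also have "\<dots> = \<zeta> \<odot> ((I1 \<otimes> y) \<otimes> J1)" unfolding Jy using cl yc by (simp add: smult_rmult m_assoc)
  also have "\<dots> = (\<zeta> * \<zeta> ^ q) \<odot> (y \<otimes> x)" unfolding Iy x_def using cl yc by (simp add: smult_lmult smult_smult m_assoc)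
  also have "\<zeta> * \<zeta> ^ q = 1" using \<zeta> unfolding q(1)[symmetric] by simp
  finally show "x \<otimes> y = y \<otimes> x" using xc yc by simp
  have 1: "I2 \<otimes> y = J2" unfolding y_def q(2) using cl a I2q(1)
    by (simp add: smult_rmult smult_smult smult_lmult flip: m_assoc)
  have "y \<otimes> I2 = inverse a \<odot> ((I2 [^] q \<otimes> I2) \<otimes> J2)"
    unfolding y_def q(2) using cl by (simp add: smult_lmult m_assoc cm(4))
  then have 2: "y \<otimes> I2 = J2" unfolding I2q(2) using cl a by (simp add: smult_lmult smult_smult)
  show "I2 \<otimes> y = y \<otimes> I2" "I2 \<otimes> y = J2" using 1 2 by simp_all
  show "x \<otimes> J1 [^] (p - 1) = c \<odot> I1" unfolding q(2) x_def using cl J1q by (simp add: m_assoc smult_rmult)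
qed

text \<open>(a,b)(a,c) equals (a,bc)(1,c), and the last symbol is trivial. The equality comes from
  the rearranged pairs of \<open>bilinear_relations\<close>: they define a homomorphism from the
  tensor product of (a,bc) and (1,c), injective by simplicity and onto because the four old
  generators can be recovered.\<close>

lemma symbol_class_bilinear:
  fixes a b c \<zeta> :: "'k::field"
  assumes p2: "2 \<le> p" and prim: "primitive_root_of_unity p \<zeta>" and a: "a \<noteq> 0" and b: "b \<noteq> 0" and c: "c \<noteq> 0"
    and pk: "of_nat p \<noteq> (0 :: 'k)"
  shows "brauer_class (symbol_algebra p a b \<zeta>) \<otimes>\<^bsub>brauer_group\<^esub> brauer_class (symbol_algebra p a c \<zeta>) =
    brauer_class (symbol_algebra p a (b * c) \<zeta>)"
proof -
  interpret br: comm_monoid "brauer_group :: 'k struct_consts set monoid" by (rule comm_monoid_brauer_group)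
  interpret s1: symbol p a b \<zeta> using assms by unfold_locales
  interpret s2: symbol p a c \<zeta> using assms by unfold_locales
  interpret s3: symbol p a "b * c" \<zeta> using assms by unfold_locales auto
  interpret s4: symbol p 1 c \<zeta> using assms by unfold_locales auto
  obtain S1 F1 F1' where S1: "simple_central (sc_algebra S1)" "brauer_class (symbol_algebra p a b \<zeta>) = brauer_class (sc_algebra S1)"
    "kalg_hom s1.W (sc_algebra S1) F1" "generated_by (sc_algebra S1) {F1 s1.i1, F1 s1.i2}"
    using s1.symbol_sc by metis
  obtain S2 F2 F2' where S2: "simple_central (sc_algebra S2)" "brauer_class (symbol_algebra p a c \<zeta>) = brauer_class (sc_algebra S2)"
    "kalg_hom s2.W (sc_algebra S2) F2" "generated_by (sc_algebra S2) {F2 s1.i1, F2 s1.i2}"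
    using s2.symbol_sc by metis
  obtain S3 F3 F3' where S3: "simple_central (sc_algebra S3)" "brauer_class (symbol_algebra p a (b * c) \<zeta>) = brauer_class (sc_algebra S3)"
    "kalg_hom s3.W (sc_algebra S3) F3" "kalg_hom (sc_algebra S3) s3.W F3'" "\<forall>x\<in>carrier s3.W. F3' (F3 x) = x"
    "generated_by (sc_algebra S3) {F3 s1.i1, F3 s1.i2}"
    by (rule s3.symbol_sc)
  obtain S4 F4 F4' where S4: "simple_central (sc_algebra S4)" "brauer_class (symbol_algebra p 1 c \<zeta>) = brauer_class (sc_algebra S4)"
    "kalg_hom s4.W (sc_algebra S4) F4" "kalg_hom (sc_algebra S4) s4.W F4'" "\<forall>x\<in>carrier s4.W. F4' (F4 x) = x"
    "generated_by (sc_algebra S4) {F4 s1.i1, F4 s1.i2}"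
    by (rule s4.symbol_sc)
  interpret F1: kalg_hom s1.W "sc_algebra S1" F1 by (rule S1(3))
  interpret F2: kalg_hom s2.W "sc_algebra S2" F2 by (rule S2(3))
  interpret t: tensor "sc_algebra S1" S2 by (intro tensor.intro F1.T.kalg_axioms F2.T.kalg_axioms)
  interpret R: kalg t.B by (rule t.kalg_tens)
  have sR: "simple_central t.B" by (rule t.simple_central_tens[OF S1(1) S2(1)])
  define I1 I2 J1 J2 where "I1 = pure_tensor (sc_algebra S1) S2 (F1 s1.i1) \<one>\<^bsub>sc_algebra S2\<^esub>"
    and "I2 = pure_tensor (sc_algebra S1) S2 (F1 s1.i2) \<one>\<^bsub>sc_algebra S2\<^esub>"
    and "J1 = pure_tensor (sc_algebra S1) S2 \<one>\<^bsub>sc_algebra S1\<^esub> (F2 s1.i1)"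
    and "J2 = pure_tensor (sc_algebra S1) S2 \<one>\<^bsub>sc_algebra S1\<^esub> (F2 s1.i2)"
  note defs = I1_def I2_def J1_def J2_def
  note ic1 = F1.closed[OF s1.i_closed(1)] F1.closed[OF s1.i_closed(2)]
  note ic2 = F2.closed[OF s2.i_closed(1)] F2.closed[OF s2.i_closed(2)]
  have gen: "generated_by t.B {I1, I2, J1, J2}"
    using t.generated_tens[OF S1(4) S2(4)] by (simp add: defs insert_commute)
  have cl: "I1 \<in> carrier t.B" "I2 \<in> carrier t.B" "J1 \<in> carrier t.B" "J2 \<in> carrier t.B"
    using ic1 by (simp_all add: defs t.pure_closed)
  have powL: "pure_tensor (sc_algebra S1) S2 x \<one>\<^bsub>sc_algebra S2\<^esub> [^]\<^bsub>t.B\<^esub> n = pure_tensor (sc_algebra S1) S2 (x [^]\<^bsub>sc_algebra S1\<^esub> n) \<one>\<^bsub>sc_algebra S2\<^esub>"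
    if "x \<in> carrier (sc_algebra S1)" for x and n :: nat
    by (induction n) (use that in \<open>simp_all add: t.one_eq_pure t.pure_mult\<close>)
  have powR: "pure_tensor (sc_algebra S1) S2 \<one>\<^bsub>sc_algebra S1\<^esub> x [^]\<^bsub>t.B\<^esub> n = pure_tensor (sc_algebra S1) S2 \<one>\<^bsub>sc_algebra S1\<^esub> (x [^]\<^bsub>sc_algebra S2\<^esub> n)"
    for x and n :: nat
    by (induction n) (simp_all add: t.one_eq_pure t.pure_mult)
  have smL: "pure_tensor (sc_algebra S1) S2 (k \<odot>\<^bsub>sc_algebra S1\<^esub> x) \<one>\<^bsub>sc_algebra S2\<^esub> = k \<odot>\<^bsub>t.B\<^esub> pure_tensor (sc_algebra S1) S2 x \<one>\<^bsub>sc_algebra S2\<^esub>"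
    if "x \<in> carrier (sc_algebra S1)" for k x
    by (rule tens_eqI[of _ "sc_algebra S1" S2])
      (use that in \<open>simp_all add: t.pure_closed t.tens_closed tens_simps(6,7) F1.T.smult_smult mult.commute\<close>)
  have pw: "I1 [^]\<^bsub>t.B\<^esub> p = b \<odot>\<^bsub>t.B\<^esub> \<one>\<^bsub>t.B\<^esub>" "I2 [^]\<^bsub>t.B\<^esub> p = a \<odot>\<^bsub>t.B\<^esub> \<one>\<^bsub>t.B\<^esub>"
    "J1 [^]\<^bsub>t.B\<^esub> p = c \<odot>\<^bsub>t.B\<^esub> \<one>\<^bsub>t.B\<^esub>" "J2 [^]\<^bsub>t.B\<^esub> p = a \<odot>\<^bsub>t.B\<^esub> \<one>\<^bsub>t.B\<^esub>"
    unfolding defs powL[OF ic1(1)] powL[OF ic1(2)] powR F1.hom_nat_pow[OF s1.i_closed(1), symmetric]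
      F1.hom_nat_pow[OF s1.i_closed(2), symmetric] F2.hom_nat_pow[OF s2.i_closed(1), symmetric]
      F2.hom_nat_pow[OF s2.i_closed(2), symmetric] s1.i_relations s2.i_relations
    by (simp_all add: F1.hom_smult F1.hom_one F2.hom_smult F2.hom_one smL t.pure_smult t.one_eq_pure)
  have sk: "I1 \<otimes>\<^bsub>t.B\<^esub> I2 = \<zeta> \<odot>\<^bsub>t.B\<^esub> (I2 \<otimes>\<^bsub>t.B\<^esub> I1)" "J1 \<otimes>\<^bsub>t.B\<^esub> J2 = \<zeta> \<odot>\<^bsub>t.B\<^esub> (J2 \<otimes>\<^bsub>t.B\<^esub> J1)"
  proof -
    have "F1 s1.i1 \<otimes>\<^bsub>sc_algebra S1\<^esub> F1 s1.i2 = \<zeta> \<odot>\<^bsub>sc_algebra S1\<^esub> (F1 s1.i2 \<otimes>\<^bsub>sc_algebra S1\<^esub> F1 s1.i1)"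
      using arg_cong[OF s1.i_relations(3), of F1] by (simp only: F1.hom_mult F1.hom_smult s1.i_closed F1.S.m_closed)
    then show "I1 \<otimes>\<^bsub>t.B\<^esub> I2 = \<zeta> \<odot>\<^bsub>t.B\<^esub> (I2 \<otimes>\<^bsub>t.B\<^esub> I1)"
      using ic1 by (simp add: defs t.pure_mult smL)
    have "F2 s1.i1 \<otimes>\<^bsub>sc_algebra S2\<^esub> F2 s1.i2 = \<zeta> \<odot>\<^bsub>sc_algebra S2\<^esub> (F2 s1.i2 \<otimes>\<^bsub>sc_algebra S2\<^esub> F2 s1.i1)"
      using arg_cong[OF s2.i_relations(3), of F2] by (simp only: F2.hom_mult F2.hom_smult s2.i_closed F2.S.m_closed)
    then show "J1 \<otimes>\<^bsub>t.B\<^esub> J2 = \<zeta> \<odot>\<^bsub>t.B\<^esub> (J2 \<otimes>\<^bsub>t.B\<^esub> J1)"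
      by (simp add: defs t.pure_mult t.pure_smult)
  qed
  have cm: "I1 \<otimes>\<^bsub>t.B\<^esub> J1 = J1 \<otimes>\<^bsub>t.B\<^esub> I1" "I1 \<otimes>\<^bsub>t.B\<^esub> J2 = J2 \<otimes>\<^bsub>t.B\<^esub> I1"
    "I2 \<otimes>\<^bsub>t.B\<^esub> J1 = J1 \<otimes>\<^bsub>t.B\<^esub> I2" "I2 \<otimes>\<^bsub>t.B\<^esub> J2 = J2 \<otimes>\<^bsub>t.B\<^esub> I2"
    using ic1 ic2 by (simp_all add: defs t.pure_mult)
  have p0: "0 < p" using p2 by simp
  note br = R.bilinear_relations[OF cl pw sk cm a s1.zeta_p p0]
  define x y where "x = I1 \<otimes>\<^bsub>t.B\<^esub> J1" and "y = inverse a \<odot>\<^bsub>t.B\<^esub> (I2 [^]\<^bsub>t.B\<^esub> (p - 1) \<otimes>\<^bsub>t.B\<^esub> J2)"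
  note br = br[folded x_def y_def]
  obtain f where f: "kalg_hom s3.W t.B f" "f s1.i1 = x" "f s1.i2 = I2"
    by (rule s3.symbol_hom[OF R.kalg_axioms br(1) cl(2) br(3) pw(2) br(4)])
  obtain g where g: "kalg_hom s4.W t.B g" "g s1.i1 = J1" "g s1.i2 = y"
    by (rule s4.symbol_hom[OF R.kalg_axioms cl(3) br(2) pw(3) br(5) br(6)])
  interpret f: kalg_hom s3.W t.B f by (rule f(1))
  interpret g: kalg_hom s4.W t.B g by (rule g(1))
  interpret F3: kalg_hom s3.W "sc_algebra S3" F3 by (rule S3(3))
  interpret F4: kalg_hom s4.W "sc_algebra S4" F4 by (rule S4(3))
  interpret F3': kalg_hom "sc_algebra S3" s3.W F3' by (rule S3(4))
  interpret F4': kalg_hom "sc_algebra S4" s4.W F4' by (rule S4(4))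
  have hf: "kalg_hom (sc_algebra S3) t.B (f \<circ> F3')" by (rule F3'.hom_comp[OF f(1)])
  have hg: "kalg_hom (sc_algebra S4) t.B (g \<circ> F4')" by (rule F4'.hom_comp[OF g(1)])
  have fv: "(f \<circ> F3') (F3 s1.i1) = x" "(f \<circ> F3') (F3 s1.i2) = I2" "(g \<circ> F4') (F4 s1.i1) = J1" "(g \<circ> F4') (F4 s1.i2) = y"
    using f g bspec[OF S3(5) s3.i_closed(1)] bspec[OF S3(5) s3.i_closed(2)] bspec[OF S4(5) s4.i_closed(1)] bspec[OF S4(5) s4.i_closed(2)] by simp_all
  interpret t': tensor "sc_algebra S3" S4 by (intro tensor.intro F3.T.kalg_axioms F4.T.kalg_axioms)
  have comm: "(f \<circ> F3') u \<otimes>\<^bsub>t.B\<^esub> (g \<circ> F4') v = (g \<circ> F4') v \<otimes>\<^bsub>t.B\<^esub> (f \<circ> F3') u"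
    if "u \<in> carrier (sc_algebra S3)" "v \<in> carrier (sc_algebra S4)" for u v
    by (rule hom_commute[OF hf hg S3(6) S4(6) _ that]) (use fv br cm in \<open>auto simp del: o_apply\<close>)
  obtain F where F: "kalg_hom t'.B t.B F"
    "\<forall>u\<in>carrier (sc_algebra S3). \<forall>v\<in>carrier (sc_algebra S4).
      F (pure_tensor (sc_algebra S3) S4 u v) = (f \<circ> F3') u \<otimes>\<^bsub>t.B\<^esub> (g \<circ> F4') v"
    by (rule t'.tensor_hom[OF hf hg comm], assumption, assumption, rule that, assumption, blast)
  note F2' = F(2)[rule_format]
  interpret F: kalg_hom t'.B t.B F by (rule F(1))
  have sub: "subalg t.B (F ` carrier t'.B)" by (rule F.subalg_image[OF F.subalg_carrier])
  have inF: "(f \<circ> F3') u \<in> F ` carrier t'.B" if "u \<in> carrier (sc_algebra S3)" for u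
    using F2'[OF that F4.T.one_closed] kalg_hom.hom_one[OF hg] kalg_hom.closed[OF hf that] t'.pure_closed[OF that]
    by (metis R.r_one image_eqI)
  have inG: "(g \<circ> F4') v \<in> F ` carrier t'.B" if "v \<in> carrier (sc_algebra S4)" for v
    using F2'[OF F3.T.one_closed that] kalg_hom.hom_one[OF hf] kalg_hom.closed[OF hg that] t'.pure_closed[OF F3.T.one_closed]
    by (metis R.l_one image_eqI)
  have mem: "x \<in> F ` carrier t'.B" "I2 \<in> F ` carrier t'.B" "J1 \<in> F ` carrier t'.B" "y \<in> F ` carrier t'.B"
    using inF[OF F3.closed[OF s3.i_closed(1)]] inF[OF F3.closed[OF s3.i_closed(2)]]
      inG[OF F4.closed[OF s4.i_closed(1)]] inG[OF F4.closed[OF s4.i_closed(2)]] unfolding fv .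
  \<comment> \<open>Recovery of the old generators: J_2 = I_2 y, and I_1 = c^(-1) x
    J_1^(p-1).\<close>
  have "J2 \<in> F ` carrier t'.B" using br(10) mem(2,4) sub unfolding subalg_def by metis
  moreover have "I1 \<in> F ` carrier t'.B"
  proof -
    have "inverse c \<odot>\<^bsub>t.B\<^esub> (x \<otimes>\<^bsub>t.B\<^esub> J1 [^]\<^bsub>t.B\<^esub> (p - 1)) = I1"
      unfolding br(11) using c cl(1) by (simp add: R.smult_smult)
    moreover have "J1 [^]\<^bsub>t.B\<^esub> (p - 1) \<in> F ` carrier t'.B" by (rule R.subalg_nat_pow[OF sub mem(3)])
    ultimately show ?thesis using mem(1) sub unfolding subalg_def by metis
  qed
  ultimately have sub4: "{I1, I2, J1, J2} \<subseteq> F ` carrier t'.B" using mem by simp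
  have nz: "\<one>\<^bsub>t.B\<^esub> \<noteq> \<zero>\<^bsub>t.B\<^esub>" using sR by (simp add: simple_central_def)
  have iso: "iso_rel t'.B t.B"
    by (rule kalg_hom_iso_rel[OF F(1) t'.simple_central_tens[OF S3(1) S4(1)] nz F.surj_of_generated[OF gen sub4]])
  note k1 = F1.T.kalg_axioms F2.T.kalg_axioms and k2 = F3.T.kalg_axioms F4.T.kalg_axioms
  note sc1 = sc_tensor_iso_tens[OF k1] and sc2 = sc_tensor_iso_tens[OF k2]
  have "iso_rel (sc_algebra (sc_tensor S3 S4)) (sc_algebra (sc_tensor S1 S2))"
    by (rule iso_rel_trans[OF iso_rel_sym[OF sc2(2)] iso_rel_trans[OF iso sc1(2)]])
      (rule sc1(1) sc2(1) t.kalg_tens t'.kalg_tens)+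
  then have eq: "brauer_class (sc_algebra (sc_tensor S3 S4)) = brauer_class (sc_algebra (sc_tensor S1 S2))"
    by (rule brauer_class_eqI[OF iso_rel_imp_brauer_equiv]) (rule sc1(1) sc2(1))+
  have "brauer_class (symbol_algebra p a b \<zeta>) \<otimes>\<^bsub>brauer_group\<^esub> brauer_class (symbol_algebra p a c \<zeta>) =
      brauer_class (symbol_algebra p a (b * c) \<zeta>) \<otimes>\<^bsub>brauer_group\<^esub> brauer_class (symbol_algebra p 1 c \<zeta>)"
    unfolding S1(2) S2(2) S3(2) S4(2) brauer_group_mult[OF S1(1) S2(1)] brauer_group_mult[OF S3(1) S4(1)] eq ..
  also have "brauer_class (symbol_algebra p 1 c \<zeta>) = \<one>\<^bsub>brauer_group\<^esub>"
    using s4.brauer_class_trivial[OF pk] by simp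
  finally show ?thesis using s3.symbol_class_closed by simp
qed

section \<open>Tensor products of several symbols\<close>

lemma kalg_hom_inverse:
  assumes F: "kalg_hom A B F" and bij: "bij_betw F (carrier A) (carrier B)"
  shows "kalg_hom B A (inv_into (carrier A) F)"
proof -
  interpret F: kalg_hom A B F by fact
  let ?G = "inv_into (carrier A) F"
  have inj: "inj_on F (carrier A)" and im: "F ` carrier A = carrier B"
    using bij by (auto simp: bij_betw_def)
  have Gc: "?G y \<in> carrier A" "F (?G y) = y" if "y \<in> carrier B" for y
    using that unfolding im[symmetric] by (auto simp: inv_into_into f_inv_into_f)
  have GI: "?G y = x" if "F x = y" "x \<in> carrier A" for x y
    using inv_into_f_f[OF inj that(2)] that(1) by simp
  show ?thesis
  proof (intro kalg_hom.intro kalg_hom_axioms.intro F.S.kalg_axioms F.T.kalg_axioms)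
    fix x y assume xy: "x \<in> carrier B" "y \<in> carrier B"
    show "?G (x \<oplus>\<^bsub>B\<^esub> y) = ?G x \<oplus>\<^bsub>A\<^esub> ?G y"
      by (rule GI) (simp_all only: F.hom_add Gc[OF xy(1)] Gc[OF xy(2)] F.S.a_closed)
    show "?G (x \<otimes>\<^bsub>B\<^esub> y) = ?G x \<otimes>\<^bsub>A\<^esub> ?G y"
      by (rule GI) (simp_all only: F.hom_mult Gc[OF xy(1)] Gc[OF xy(2)] F.S.m_closed)
  next
    fix x c assume x: "x \<in> carrier B"
    show "?G (c \<odot>\<^bsub>B\<^esub> x) = c \<odot>\<^bsub>A\<^esub> ?G x"
      by (rule GI) (simp_all only: F.hom_smult Gc[OF x] F.S.smult_closed)
  next
    show "?G \<one>\<^bsub>B\<^esub> = \<one>\<^bsub>A\<^esub>"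
      by (rule GI) (simp_all only: F.hom_one F.S.one_closed)
  qed (rule Gc(1))
qed

text \<open>Besides the homomorphism a generating set and its image are recorded: in the next step
  of the induction in \<open>symbol_tensor_hom\<close>, commutation is tested on these
  generators.\<close>

lemma sc_tensor_hom:
  assumes f: "kalg_hom (sc_algebra S) C f" and g: "kalg_hom (sc_algebra T) C g"
    and gs: "generated_by (sc_algebra S) gs" and hs: "generated_by (sc_algebra T) hs"
    and c: "\<And>x y. x \<in> gs ==> y \<in> hs ==> f x \<otimes>\<^bsub>C\<^esub> g y = g y \<otimes>\<^bsub>C\<^esub> f x"
  shows "\<exists>\<phi> es. kalg_hom (sc_algebra (sc_tensor S T)) C \<phi> \<and> generated_by (sc_algebra (sc_tensor S T)) es \<and>
    \<phi> ` es = f ` gs \<union> g ` hs"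
proof -
  interpret f: kalg_hom "sc_algebra S" C f by fact
  interpret g: kalg_hom "sc_algebra T" C g by fact
  interpret t: tensor "sc_algebra S" T by (intro tensor.intro f.S.kalg_axioms g.S.kalg_axioms)
  obtain I where I: "kalg_hom t.B (sc_algebra (sc_tensor S T)) I"
    "bij_betw I (carrier t.B) (carrier (sc_algebra (sc_tensor S T)))"
    using sc_tensor_iso_tens(3)[OF f.S.kalg_axioms g.S.kalg_axioms] by metis
  interpret I: kalg_hom t.B "sc_algebra (sc_tensor S T)" I by (rule I(1))
  let ?J = "inv_into (carrier t.B) I"
  interpret J: kalg_hom "sc_algebra (sc_tensor S T)" t.B ?J by (rule kalg_hom_inverse[OF I])
  have comm: "f u \<otimes>\<^bsub>C\<^esub> g v = g v \<otimes>\<^bsub>C\<^esub> f u" if "u \<in> carrier (sc_algebra S)" "v \<in> carrier (sc_algebra T)" for u v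
    by (rule hom_commute[OF f g gs hs c that])
  obtain F where F: "kalg_hom t.B C F" "\<forall>u\<in>carrier (sc_algebra S). \<forall>v\<in>carrier (sc_algebra T).
      F (pure_tensor (sc_algebra S) T u v) = f u \<otimes>\<^bsub>C\<^esub> g v"
    by (rule t.tensor_hom[OF f g comm], assumption, assumption, rule that, assumption, blast)
  let ?E = "(\<lambda>x. pure_tensor (sc_algebra S) T x \<one>\<^bsub>sc_algebra T\<^esub>) ` gs \<union> pure_tensor (sc_algebra S) T \<one>\<^bsub>sc_algebra S\<^esub> ` hs"
  have gen: "generated_by t.B ?E" by (rule t.generated_tens[OF gs hs])
  have gen': "generated_by (sc_algebra (sc_tensor S T)) (I ` ?E)"
    by (rule I.generated_image[OF gen]) (use I(2) in \<open>simp add: bij_betw_def\<close>)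
  have inj: "inj_on I (carrier t.B)" using I(2) by (simp add: bij_betw_def)
  have hom: "kalg_hom (sc_algebra (sc_tensor S T)) C (F \<circ> ?J)" by (rule J.hom_comp[OF F(1)])
  have FJ: "(F \<circ> ?J) (I z) = F z" if "z \<in> ?E" for z
    using inv_into_f_f[OF inj, of z] subsetD[OF generated_by_subset[OF gen] that] by simp
  have gsc: "x \<in> carrier (sc_algebra S)" if "x \<in> gs" for x using generated_by_subset[OF gs] that by blast
  have hsc: "x \<in> carrier (sc_algebra T)" if "x \<in> hs" for x using generated_by_subset[OF hs] that by blast
  have "(F \<circ> ?J) ` I ` ?E = F ` ?E"
    unfolding image_image[of "F \<circ> ?J" I] by (rule image_cong[OF refl FJ])
  also have "\<dots> = (\<lambda>x. F (pure_tensor (sc_algebra S) T x \<one>\<^bsub>sc_algebra T\<^esub>)) ` gs \<union>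
      (\<lambda>x. F (pure_tensor (sc_algebra S) T \<one>\<^bsub>sc_algebra S\<^esub> x)) ` hs"
    unfolding image_Un image_image ..
  also have "(\<lambda>x. F (pure_tensor (sc_algebra S) T x \<one>\<^bsub>sc_algebra T\<^esub>)) ` gs = f ` gs"
  proof (rule image_cong[OF refl])
    fix x assume x: "x \<in> gs"
    show "F (pure_tensor (sc_algebra S) T x \<one>\<^bsub>sc_algebra T\<^esub>) = f x"
      using F(2)[rule_format, OF gsc[OF x] g.S.one_closed] f.closed[OF gsc[OF x]] by (simp add: g.hom_one)
  qed
  also have "(\<lambda>x. F (pure_tensor (sc_algebra S) T \<one>\<^bsub>sc_algebra S\<^esub> x)) ` hs = g ` hs"
  proof (rule image_cong[OF refl])
    fix x assume x: "x \<in> hs"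
    show "F (pure_tensor (sc_algebra S) T \<one>\<^bsub>sc_algebra S\<^esub> x) = g x"
      using F(2)[rule_format, OF f.S.one_closed hsc[OF x]] g.closed[OF hsc[OF x]] by (simp add: f.hom_one)
  qed
  finally show ?thesis using hom gen' by blast
qed

lemma sc_one_hom:
  assumes "kalg C"
  shows "\<exists>\<phi>. kalg_hom (sc_algebra sc_one) C \<phi> \<and> generated_by (sc_algebra (sc_one :: 'k::field struct_consts)) {}"
proof -
  interpret C: kalg C by fact
  interpret s: kalg "sc_algebra (sc_one :: 'k struct_consts)" by (rule sc_one_iso(1))
  have "kalg_hom (sc_algebra sc_one) C (\<lambda>x. x 0 \<odot>\<^bsub>C\<^esub> \<one>\<^bsub>C\<^esub>)"
    by (intro kalg_hom.intro kalg_hom_axioms.intro sc_one_iso(1) C.kalg_axioms)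
      (simp_all add: sc_simps(2-) sc_one_def C.smult_ladd C.smult_lmult C.smult_smult)
  moreover have "generated_by (sc_algebra (sc_one :: 'k struct_consts)) {}"
  proof (rule generated_byI)
    fix M x assume M: "subalg (sc_algebra (sc_one :: 'k struct_consts)) M" and x: "x \<in> carrier (sc_algebra (sc_one :: 'k struct_consts))"
    have "x = x 0 \<odot>\<^bsub>sc_algebra sc_one\<^esub> \<one>\<^bsub>sc_algebra sc_one\<^esub>"
    proof
      fix l show "x l = (x 0 \<odot>\<^bsub>sc_algebra sc_one\<^esub> \<one>\<^bsub>sc_algebra sc_one\<^esub>) l"
        using x by (cases "l = 0") (simp_all add: sc_simps sc_one_def)
    qed
    then show "x \<in> M" using M unfolding subalg_def by metis
  qed simp
  ultimately show ?thesis by blast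
qed

text \<open>Symbol pairs in \<open>C\<close> that commute with one another define a homomorphism
  from the tensor product of the symbol algebras. The induction carries the image of the generators
  along, because commutation with the next pair must be known for it.\<close>

lemma symbol_tensor_hom:
  fixes a b :: "nat => 'k::field"
  assumes C: "kalg C" and p2: "2 \<le> p" and prim: "primitive_root_of_unity p \<zeta>"
    and cl: "\<And>j. j \<in> {1..t} ==> x j \<in> carrier C" "\<And>j. j \<in> {1..t} ==> y j \<in> carrier C"
    and nz: "\<And>j. j \<in> {1..t} ==> a j \<noteq> 0" "\<And>j. j \<in> {1..t} ==> b j \<noteq> 0"
    and pw: "\<And>j. j \<in> {1..t} ==> x j [^]\<^bsub>C\<^esub> p = b j \<odot>\<^bsub>C\<^esub> \<one>\<^bsub>C\<^esub>" "\<And>j. j \<in> {1..t} ==> y j [^]\<^bsub>C\<^esub> p = a j \<odot>\<^bsub>C\<^esub> \<one>\<^bsub>C\<^esub>"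
    and sk: "\<And>j. j \<in> {1..t} ==> x j \<otimes>\<^bsub>C\<^esub> y j = \<zeta> \<odot>\<^bsub>C\<^esub> (y j \<otimes>\<^bsub>C\<^esub> x j)"
    and cm: "\<And>i j u v. [|i \<in> {1..t}; j \<in> {1..t}; i < j; u \<in> {x i, y i}; v \<in> {x j, y j}|] ==> u \<otimes>\<^bsub>C\<^esub> v = v \<otimes>\<^bsub>C\<^esub> u"
  shows "q \<le> t ==> \<exists>S \<phi> gs. simple_central (sc_algebra S) \<and>
      brauer_class (sc_algebra S) = (\<Otimes>\<^bsub>brauer_group\<^esub>j\<in>{1..q}. brauer_class (symbol_algebra p (a j) (b j) \<zeta>)) \<and>
      kalg_hom (sc_algebra S) C \<phi> \<and> generated_by (sc_algebra S) gs \<and> \<phi> ` gs = x ` {1..q} \<union> y ` {1..q}"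
proof (induction q)
  case 0
  interpret br: comm_monoid "brauer_group :: 'k struct_consts set monoid" by (rule comm_monoid_brauer_group)
  obtain \<phi> where \<phi>: "kalg_hom (sc_algebra sc_one) C \<phi>" "generated_by (sc_algebra (sc_one :: 'k struct_consts)) {}"
    using sc_one_hom[OF C] by blast
  show ?case
    by (rule exI[of _ sc_one], rule exI[of _ \<phi>], rule exI[of _ "{}"])
      (simp add: sc_one_iso(3) \<phi> brauer_group_one)
next
  case (Suc q)
  interpret br: comm_monoid "brauer_group :: 'k struct_consts set monoid" by (rule comm_monoid_brauer_group)
  interpret C: kalg C by fact
  obtain S \<phi> gs where S: "simple_central (sc_algebra S)"
      "brauer_class (sc_algebra S) = (\<Otimes>\<^bsub>brauer_group\<^esub>j\<in>{1..q}. brauer_class (symbol_algebra p (a j) (b j) \<zeta>))"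
      "kalg_hom (sc_algebra S) C \<phi>" "generated_by (sc_algebra S) gs" "\<phi> ` gs = x ` {1..q} \<union> y ` {1..q}"
    using Suc.IH Suc.prems by (elim meta_impE) (simp, blast)
  let ?j = "Suc q"
  have j: "?j \<in> {1..t}" using Suc.prems by simp
  interpret s: symbol p "a ?j" "b ?j" \<zeta>
    using p2 prim nz[OF j] by unfold_locales
  obtain T F F' where T: "simple_central (sc_algebra T)"
    "brauer_class (symbol_algebra p (a ?j) (b ?j) \<zeta>) = brauer_class (sc_algebra T)"
    "kalg_hom s.W (sc_algebra T) F" "kalg_hom (sc_algebra T) s.W F'" "\<forall>x\<in>carrier s.W. F' (F x) = x"
    "generated_by (sc_algebra T) {F s.i1, F s.i2}"
    by (rule s.symbol_sc)
  interpret F': kalg_hom "sc_algebra T" s.W F' by (rule T(4))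
  obtain f where f: "kalg_hom s.W C f" "f s.i1 = x ?j" "f s.i2 = y ?j"
    by (rule s.symbol_hom[OF C cl(1)[OF j] cl(2)[OF j] pw(1)[OF j] pw(2)[OF j] sk[OF j]])
  have fF: "kalg_hom (sc_algebra T) C (f \<circ> F')" by (rule F'.hom_comp[OF f(1)])
  have im: "(f \<circ> F') ` {F s.i1, F s.i2} = {x ?j, y ?j}"
    using f(2,3) bspec[OF T(5) s.i_closed(1)] bspec[OF T(5) s.i_closed(2)] by simp
  have comm: "\<phi> u \<otimes>\<^bsub>C\<^esub> (f \<circ> F') v = (f \<circ> F') v \<otimes>\<^bsub>C\<^esub> \<phi> u" if "u \<in> gs" "v \<in> {F s.i1, F s.i2}" for u v
  proof -
    have "\<phi> u \<in> x ` {1..q} \<union> y ` {1..q}" "(f \<circ> F') v \<in> {x ?j, y ?j}"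
      using imageI[OF that(1), of \<phi>] imageI[OF that(2), of "f \<circ> F'"] unfolding S(5) im .
    then obtain i where i: "i \<in> {1..q}" "\<phi> u \<in> {x i, y i}" by blast
    show ?thesis
      by (rule cm[of i ?j]) (use i Suc.prems \<open>(f \<circ> F') v \<in> {x ?j, y ?j}\<close> in auto)
  qed
  obtain \<psi> es where \<psi>: "kalg_hom (sc_algebra (sc_tensor S T)) C \<psi>" "generated_by (sc_algebra (sc_tensor S T)) es"
    "\<psi> ` es = \<phi> ` gs \<union> (f \<circ> F') ` {F s.i1, F s.i2}"
    using sc_tensor_hom[OF S(3) fF S(4) T(6) comm] by blast
  have sym: "brauer_class (symbol_algebra p (a i) (b i) \<zeta>) \<in> carrier brauer_group" if "i \<in> {1..t}" for i
    by (rule symbol.symbol_class_closed, rule symbol.intro[OF p2 prim nz(1)[OF that] nz(2)[OF that]])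
  have ins: "{1..Suc q} = insert ?j {1..q}" by auto
  have "(\<Otimes>\<^bsub>brauer_group\<^esub>j\<in>{1..Suc q}. brauer_class (symbol_algebra p (a j) (b j) \<zeta>)) =
     brauer_class (symbol_algebra p (a ?j) (b ?j) \<zeta>) \<otimes>\<^bsub>brauer_group\<^esub>
       (\<Otimes>\<^bsub>brauer_group\<^esub>j\<in>{1..q}. brauer_class (symbol_algebra p (a j) (b j) \<zeta>))"
    unfolding ins by (rule br.finprod_insert) (use sym Suc.prems in \<open>auto intro!: Pi_I sym\<close>)
  also have "\<dots> = brauer_class (sc_algebra (sc_tensor T S))"
    unfolding S(2)[symmetric] T(2) by (rule brauer_group_mult[OF T(1) S(1)])
  also have "\<dots> = brauer_class (sc_algebra (sc_tensor S T))"
    using br.m_comm[OF brauer_class_closed[OF T(1)] brauer_class_closed[OF S(1)]]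
    unfolding brauer_group_mult[OF T(1) S(1)] brauer_group_mult[OF S(1) T(1)] .
  finally have "brauer_class (sc_algebra (sc_tensor S T)) =
    (\<Otimes>\<^bsub>brauer_group\<^esub>j\<in>{1..Suc q}. brauer_class (symbol_algebra p (a j) (b j) \<zeta>))" by simp
  moreover have "\<psi> ` es = x ` {1..Suc q} \<union> y ` {1..Suc q}"
    unfolding \<psi>(3) S(5) im by (auto simp: atLeastAtMostSuc_conv)
  ultimately show ?case
    using \<psi>(1,2) simple_central_sc_tensor[OF S(1) T(1)] by blast
qed

section \<open>A trace dual basis for a finite group of automorphisms\<close>

locale automorphism_group =
  fixes N :: "('l::field => 'l) set"
  assumes fin: "finite N" and id: "id \<in> N" and comp: "[|\<sigma> \<in> N; \<tau> \<in> N|] ==> \<sigma> \<circ> \<tau> \<in> N"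
    and add: "\<sigma> \<in> N ==> \<sigma> (x + y) = \<sigma> x + \<sigma> y" and mult: "\<sigma> \<in> N ==> \<sigma> (x * y) = \<sigma> x * \<sigma> y"
    and inj: "\<sigma> \<in> N ==> \<sigma> x = 0 ==> x = 0" and surj: "\<sigma> \<in> N ==> surj \<sigma>"
begin

lemma hom0: "\<sigma> \<in> N ==> \<sigma> 0 = 0"
  using add[of \<sigma> 0 0] by (metis add_0_right add_cancel_right_right)

lemma hom_sum: "\<sigma> \<in> N ==> \<sigma> (\<Sum>i\<in>I. f i) = (\<Sum>i\<in>I. \<sigma> (f i))"
  by (induction I rule: infinite_finite_induct) (simp_all add: hom0 add)

definition tr :: "'l => 'l" where "tr x = (\<Sum>\<sigma>\<in>N. \<sigma> x)"

text \<open>Left translation is injective on the finite set \<open>N\<close>, hence permutes the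
  summands of the trace.\<close>

lemma tr_fixed: 
  assumes "\<sigma> \<in> N"
  shows "\<sigma> (tr x) = tr x"
proof -
  have inj: "inj_on (\<lambda>\<tau>. \<sigma> \<circ> \<tau>) N"
  proof (rule inj_onI, rule ext)
    fix \<tau> \<tau>' y assume "\<tau> \<in> N" "\<tau>' \<in> N" "\<sigma> \<circ> \<tau> = \<sigma> \<circ> \<tau>'"
    then have "\<sigma> (\<tau> y) = \<sigma> (\<tau>' y)" by (metis comp_apply)
    moreover have "\<sigma> (\<tau> y - \<tau>' y) = \<sigma> (\<tau> y) - \<sigma> (\<tau>' y)"
      using add[OF assms, of "\<tau> y - \<tau>' y" "\<tau>' y"] by simp
    ultimately show "\<tau> y = \<tau>' y" using local.inj[OF assms, of "\<tau> y - \<tau>' y"] by simp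
  qed
  have "(\<lambda>\<tau>. \<sigma> \<circ> \<tau>) ` N = N"
    by (rule endo_inj_surj[OF fin _ inj]) (use comp assms in blast)
  then have "(\<Sum>\<tau>\<in>N. \<tau> x) = (\<Sum>\<tau>\<in>(\<lambda>\<tau>. \<sigma> \<circ> \<tau>) ` N. \<tau> x)" by simp
  also have "\<dots> = (\<Sum>\<tau>\<in>N. \<sigma> (\<tau> x))" by (simp add: sum.reindex[OF inj])
  finally show ?thesis unfolding tr_def hom_sum[OF assms] by (rule sym)
qed

lemma tr_mult_fixed: "(\<And>\<sigma>. \<sigma> \<in> N ==> \<sigma> c = c) ==> tr (c * x) = c * tr x"
  unfolding tr_def sum_distrib_left by (intro sum.cong refl) (simp add: mult)

text \<open>The automorphisms to be killed are treated one after the other. If \<sigma> moves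
  \<open>y\<close>, then (\<tau> y - \<sigma> y) / (y - \<sigma> y) is 1 at the identity and 0 at
  \<sigma>; multiplying the old sums by this function costs a doubling of the system.\<close>

lemma galois_coordinates:
  assumes "F \<subseteq> N - {id}"
  shows "\<exists>(l::nat) b w. (\<Sum>i<l. b i * w i) = (1::'l) \<and> (\<forall>\<sigma>\<in>F. (\<Sum>i<l. b i * \<sigma> (w i)) = 0)"
  using finite_subset[OF assms finite_Diff[OF fin]] assms
proof (induction F rule: finite_induct)
  case empty
  show ?case by (rule exI[of _ 1], rule exI[of _ "\<lambda>_. 1"], rule exI[of _ "\<lambda>_. 1"]) simp
next
  case (insert \<sigma> F)
  then obtain l :: nat and b w where 1: "(\<Sum>i<l. b i * w i) = 1" and 2: "\<And>\<tau>. \<tau> \<in> F ==> (\<Sum>i<l. b i * \<tau> (w i)) = 0"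
    by auto
  have \<sigma>: "\<sigma> \<in> N" "\<sigma> \<noteq> id" using insert.prems by auto
  then obtain y where y: "\<sigma> y \<noteq> y" by (auto simp: fun_eq_iff)
  \<comment> \<open>The first half of the new system takes \<open>y\<close> into its second entries,
    the other half takes -\<sigma> y into its first entries; together they realise the factor
    \<open>?k * (\<tau> y - \<sigma> y)\<close>.\<close>
  let ?k = "inverse (y - \<sigma> y)"
  let ?b = "\<lambda>i. if i < l then ?k * b i else - (?k * \<sigma> y * b (i - l))"
  let ?w = "\<lambda>i. if i < l then y * w i else w (i - l)"
  have key: "(\<Sum>i<l + l. ?b i * \<tau> (?w i)) = ?k * (\<tau> y - \<sigma> y) * (\<Sum>i<l. b i * \<tau> (w i))"
    if m: "\<And>u v. \<tau> (u * v) = \<tau> u * \<tau> v" for \<tau>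
  proof -
    have sp: "(\<Sum>i<l + n. f i) = (\<Sum>i<l. f i) + (\<Sum>i<n. f (l + i))" for f :: "nat => 'l" and n
      by (induction n) (simp_all add: add.assoc)
    show ?thesis
      unfolding sp by (simp add: m sum_distrib_left algebra_simps sum_negf sum_subtractf[symmetric])
  qed
  have m: "\<tau> (u * v) = \<tau> u * \<tau> v" if "\<tau> \<in> N" for \<tau> u v using mult[OF that] .
  have k1: "(\<Sum>i<l + l. ?b i * ?w i) = 1"
    using key[of "\<lambda>x. x"] y by (simp add: 1)
  have k2: "(\<Sum>i<l + l. ?b i * \<tau> (?w i)) = 0" if "\<tau> \<in> insert \<sigma> F" for \<tau>
  proof -
    have \<tau>: "\<tau> \<in> N" using that insert.prems by auto
    show ?thesis unfolding key[OF m[OF \<tau>]] using that 2 by auto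
  qed
  show ?case
    by (rule exI[of _ "l + l"], rule exI[of _ ?b], rule exI[of _ ?w], rule conjI[OF k1], rule ballI, rule k2)
qed

text \<open>A system of Galois coordinates of least length is independent over the fixed field of
  \<open>N\<close>, and z = \<Sum> b_i tr(w_i z) expands every \<open>z\<close>. Comparing this
  expansion of b_j with the trivial one gives the duality.\<close>

lemma dual_basis:
  obtains l :: nat and b w where "0 < l" "\<And>\<sigma>. \<sigma> \<in> N ==> (\<Sum>i<l. b i * \<sigma> (w i)) = (if \<sigma> = id then 1 else 0)"
    "\<And>i j. i < l ==> j < l ==> tr (w i * b j) = (if i = j then 1 else 0)"
proof -
  define P where "P l = (\<exists>b w. \<forall>\<sigma>\<in>N. (\<Sum>i<l. b i * \<sigma> (w i)) = (if \<sigma> = id then 1 else (0::'l)))" for l :: nat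
  obtain l0 :: nat and b0 w0 where "(\<Sum>i<l0. b0 i * w0 i) = (1::'l)" "\<forall>\<sigma>\<in>N - {id}. (\<Sum>i<l0. b0 i * \<sigma> (w0 i)) = 0"
    using galois_coordinates[OF order_refl] by metis
  then have "P l0" unfolding P_def by (intro exI[of _ b0] exI[of _ w0]) auto
  define l where "l = (LEAST l. P l)"
  have "P l" unfolding l_def by (rule LeastI[of P l0]) (rule \<open>P l0\<close>)
  then obtain b w where bw: "\<And>\<sigma>. \<sigma> \<in> N ==> (\<Sum>i<l. b i * \<sigma> (w i)) = (if \<sigma> = id then 1 else (0::'l))"
    unfolding P_def by blast
  have l: "0 < l" using bw[OF id] by (cases "l = 0") auto
  have indep: "c j = 0" if j: "j < l" and c: "\<And>i \<sigma>. \<sigma> \<in> N ==> \<sigma> (c i) = c i" and z: "(\<Sum>i<l. b i * c i) = 0" for c j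
  proof (rule ccontr)
    assume cj: "c j \<noteq> 0"
    define e where "e i = (if i < j then i else Suc i)" for i
    have e: "bij_betw e {..<l - 1} ({..<l} - {j})"
      unfolding bij_betw_def
    proof
      show "inj_on e {..<l - 1}" by (rule inj_onI) (simp add: e_def split: if_splits)
      show "e ` {..<l - 1} = {..<l} - {j}"
      proof (intro equalityI subsetI)
        fix i assume "i \<in> e ` {..<l - 1}"
        then obtain k where "k < l - 1" "i = e k" by blast
        then show "i \<in> {..<l} - {j}" by (simp add: e_def split: if_splits)
      next
        fix i assume i: "i \<in> {..<l} - {j}"
        show "i \<in> e ` {..<l - 1}"
        proof (cases "i < j")
          case True
          then show ?thesis using i j by (intro image_eqI[of _ _ i]) (simp_all add: e_def)
        next
          case False
          then have ji: "j < i" using i by simp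
          then obtain k where k: "i = Suc k" by (cases i) auto
          show ?thesis using i ji unfolding k by (intro image_eqI[of _ _ k]) (simp_all add: e_def)
        qed
      qed
    qed
    \<comment> \<open>If \<Sum> b_i c_i = 0 with invariant c_i and c_j nonzero, then b_j can be
      eliminated; the second entries change accordingly, and a shorter system would result.\<close>
    define w' where "w' i = w i - c i / c j * w j" for i
    have "(\<Sum>i<l - 1. b (e i) * \<sigma> (w' (e i))) = (if \<sigma> = id then 1 else 0)" if \<sigma>: "\<sigma> \<in> N" for \<sigma>
    proof -
      have sd: "\<sigma> (u - v) = \<sigma> u - \<sigma> v" for u v using add[OF \<sigma>, of "u - v" v] by simp
      have ci: "\<sigma> (c i / c j) = c i / c j" for i
      proof -
        have "\<sigma> (c i / c j) * c j = c i" using mult[OF \<sigma>, of "c i / c j" "c j"] cj c[OF \<sigma>] by simp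
        then show ?thesis using cj by (simp add: field_simps)
      qed
      have "(\<Sum>i<l - 1. b (e i) * \<sigma> (w' (e i))) = (\<Sum>i\<in>{..<l} - {j}. b i * \<sigma> (w' i))"
        by (rule sum.reindex_bij_betw[OF e])
      also have "\<dots> = (\<Sum>i<l. b i * \<sigma> (w' i))"
        using j cj by (intro sum.mono_neutral_left) (auto simp: w'_def hom0[OF \<sigma>])
      also have "\<dots> = (\<Sum>i<l. b i * \<sigma> (w i)) - (\<Sum>i<l. b i * c i) * (\<sigma> (w j) / c j)"
        unfolding w'_def sd mult[OF \<sigma>] ci by (simp add: algebra_simps sum_subtractf sum_distrib_left)
      finally show ?thesis using bw[OF \<sigma>] z by simp
    qed
    then have "P (l - 1)" unfolding P_def by (intro exI[of _ "\<lambda>i. b (e i)"] exI[of _ "\<lambda>i. w' (e i)"]) simp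
    then have "l \<le> l - 1" unfolding l_def by (rule Least_le)
    then show False using l by simp
  qed
  \<comment> \<open>Exchanging the sums over \<open>i\<close> and \<sigma> leaves only the summand
    of the identity.\<close>
  have expand: "(\<Sum>i<l. b i * tr (w i * z)) = z" for z
  proof -
    have "(\<Sum>i<l. b i * tr (w i * z)) = (\<Sum>i<l. \<Sum>\<sigma>\<in>N. b i * \<sigma> (w i) * \<sigma> z)"
      unfolding tr_def sum_distrib_left by (intro sum.cong refl) (simp add: mult mult.assoc)
    also have "\<dots> = (\<Sum>\<sigma>\<in>N. (\<Sum>i<l. b i * \<sigma> (w i)) * \<sigma> z)"
      by (subst sum.swap) (simp add: sum_distrib_right)
    also have "\<dots> = (\<Sum>\<sigma>\<in>N. if \<sigma> = id then z else 0)"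
      by (intro sum.cong refl) (simp add: bw)
    also have "\<dots> = z" using fin id by simp
    finally show ?thesis .
  qed
  have dual: "tr (w i * b j) = (if i = j then 1 else 0)" if "i < l" "j < l" for i j
  proof -
    let ?c = "\<lambda>i. tr (w i * b j) - (if i = j then 1 else 0)"
    have one: "\<sigma> 1 = 1" if "\<sigma> \<in> N" for \<sigma>
      using mult[OF that, of 1 1] inj[OF that, of 1] by auto
    have sd: "\<sigma> (u - v) = \<sigma> u - \<sigma> v" if "\<sigma> \<in> N" for \<sigma> u v using add[OF that, of "u - v" v] by simp
    have "(\<Sum>i<l. b i * ?c i) = (\<Sum>i<l. b i * tr (w i * b j)) - (\<Sum>i<l. b i * (if i = j then 1 else 0))"
      by (simp only: right_diff_distrib sum_subtractf)
    also have "(\<Sum>i<l. b i * (if i = j then 1 else 0)) = (\<Sum>i<l. if i = j then b i else 0)"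
      by (intro sum.cong) auto
    also have "\<dots> = b j" using \<open>j < l\<close> by simp
    finally have "(\<Sum>i<l. b i * ?c i) = 0" unfolding expand[of "b j"] by simp
    then have "?c i = 0"
    proof (rule indep[where c = ?c and j = i, OF \<open>i < l\<close>, rotated])
      fix k \<sigma> assume \<sigma>: "\<sigma> \<in> N"
      show "\<sigma> (?c k) = ?c k"
        unfolding sd[OF \<sigma>] tr_fixed[OF \<sigma>] using one[OF \<sigma>] hom0[OF \<sigma>] by simp
    qed
    then show ?thesis by simp
  qed
  show thesis by (rule that[OF l bw dual])
qed

end

section \<open>Reduction of the crossed product\<close>

lemma field_ring_homD:
  assumes "h \<in> ring_hom field_ring field_ring"
  shows "h (x + y) = h x + h y" "h (x * y) = h x * h y" "h 1 = 1"
  using assms by (auto simp: ring_hom_def)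

lemma galois_group_simps [simp]:
  "\<sigma> \<otimes>\<^bsub>galois_group h\<^esub> \<tau> = \<sigma> \<circ> \<tau>" "\<one>\<^bsub>galois_group h\<^esub> = id"
  by (simp_all add: galois_group_def)

lemma galois_groupD:
  assumes "\<sigma> \<in> carrier (galois_group h)"
  shows "\<sigma> (x + y) = \<sigma> x + \<sigma> y" "\<sigma> (x * y) = \<sigma> x * \<sigma> y" "\<sigma> 1 = 1" "\<sigma> (h c) = h c" "bij \<sigma>"
  using assms by (auto simp: galois_group_def ring_iso_def ring_hom_def bij_betw_def)

lemma crossed_product_eq_twisted:
  "crossed_product h c = twisted h (galois_group h) (\<lambda>\<sigma>. \<sigma>) c"
  by (simp add: crossed_product_def twisted_def Let_def cong: if_cong)

text \<open>The situation after forgetting the group \<open>G\<close>: the exponents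
  \<open>\<kappa> \<tau> i\<close> describe the action on the Kummer generators, while
  \<open>z\<close> are arbitrary nonzero scalars and \<open>d\<close> arbitrary exponents. The
  premise \<open>fixed\<close> says that invariant elements come from \<open>k\<close>.\<close>

locale kummer_product =
  fixes p t :: nat and \<zeta> :: "'k::field" and h :: "'k => 'l::field" and a z :: "nat => 'k" and \<alpha> :: "nat => 'l"
    and \<sigma> :: "nat => 'l => 'l" and \<kappa> :: "('l => 'l) => nat => nat" and d :: "nat => nat => nat"
  assumes p2: "2 \<le> p" and prim: "primitive_root_of_unity p \<zeta>" and pk: "of_nat p \<noteq> (0 :: 'k)"
    and h: "h \<in> ring_hom field_ring field_ring"
    and group: "group (galois_group h)" and fin: "finite (carrier (galois_group h))"
    and fixed: "\<And>x. (\<And>\<tau>. \<tau> \<in> carrier (galois_group h) ==> \<tau> x = x) ==> x \<in> range h"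
    and a0: "\<And>i. i \<in> {1..t} ==> a i \<noteq> 0" and z0: "\<And>i. i \<in> {1..t} ==> z i \<noteq> 0"
    and \<alpha>p: "\<And>i. i \<in> {1..t} ==> \<alpha> i ^ p = h (a i)"
    and \<kappa>p: "\<And>\<tau> i. \<tau> \<in> carrier (galois_group h) ==> i \<in> {1..t} ==> \<kappa> \<tau> i < p"
    and act_\<alpha>: "\<And>\<tau> i. \<tau> \<in> carrier (galois_group h) ==> i \<in> {1..t} ==> \<tau> (\<alpha> i) = h (\<zeta> ^ \<kappa> \<tau> i) * \<alpha> i"
    and \<sigma>: "\<And>j. j \<in> {1..t} ==> \<sigma> j \<in> carrier (galois_group h)"
    and \<kappa>\<sigma>: "\<And>i j. i \<in> {1..t} ==> j \<in> {1..t} ==> \<kappa> (\<sigma> j) i = (if i = j then 1 else 0)"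
begin

abbreviation "\<Gamma> \<equiv> carrier (galois_group h)"

definition pairs :: "(nat \<times> nat) set" where "pairs = {(i, j). i \<in> {1..t} \<and> j \<in> {1..t} \<and> i < j}"

text \<open>A cocycle on (Z/p)^t pulled back along \<open>\<kappa>\<close>: the first product is
  bilinear and produces the commutators, the second is the carry of addition modulo p and makes
  \<open>z i\<close> appear in p-th powers.\<close>

definition f :: "('l => 'l) => ('l => 'l) => 'k" where
  "f \<tau> \<rho> = (\<Prod>(i, j)\<in>pairs. \<zeta> ^ (d i j * (\<kappa> \<tau> j * \<kappa> \<rho> i))) * (\<Prod>i\<in>{1..t}. z i ^ ((\<kappa> \<tau> i + \<kappa> \<rho> i) div p))"

lemma \<zeta>p: "\<zeta> ^ p = 1" using prim by (simp add: primitive_root_of_unity_def)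
lemma \<zeta>0: "\<zeta> \<noteq> 0" using \<zeta>p p2 by (auto simp: power_0_left)
lemma p0: "0 < p" using p2 by simp

lemma id_\<Gamma>: "id \<in> \<Gamma>" using group.is_monoid[OF group, THEN monoid.one_closed] by simp
lemma comp_\<Gamma>: "\<tau> \<in> \<Gamma> ==> \<rho> \<in> \<Gamma> ==> \<tau> \<circ> \<rho> \<in> \<Gamma>"
  using monoid.m_closed[OF group.is_monoid[OF group], of \<tau> \<rho>] by simp

lemma h_nz: "h x = 0 ==> x = 0"
  by (metis field_ring_homD(2,3)[OF h] mult_zero_left right_inverse zero_neq_one)

lemma h_eq: "h x = h y ==> x = y"
proof -
  assume "h x = h y"
  then have "h (x - y) = 0" using field_ring_homD(1)[OF h, of "x - y" y] by simp
  then show "x = y" using h_nz by fastforce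
qed

lemma \<alpha>0: "i \<in> {1..t} ==> \<alpha> i \<noteq> 0"
proof
  assume i: "i \<in> {1..t}" and "\<alpha> i = 0"
  then have "h (a i) = 0" using \<alpha>p[OF i] p0 by (simp add: power_0_left)
  then show False using h_nz a0[OF i] by blast
qed

lemma root_eqI: "\<zeta> ^ x = \<zeta> ^ y ==> x < p ==> y < p ==> x = (y::nat)"
proof -
  have le: "x = y" if "\<zeta> ^ x = \<zeta> ^ y" "x < p" "y < p" "x \<le> y" for x y
  proof (rule ccontr)
    assume "x \<noteq> y"
    then have "0 < y - x" "y - x < p" using that by auto
    moreover have "\<zeta> ^ (y - x) = 1"
      using that(1) \<zeta>0 \<open>x \<le> y\<close> by (simp add: power_diff)
    ultimately show False using prim by (auto simp: primitive_root_of_unity_def)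
  qed
  then show "\<zeta> ^ x = \<zeta> ^ y ==> x < p ==> y < p ==> x = y"
    using le[of x y] le[of y x] by (metis nle_le)
qed

lemma \<kappa>_eqI:
  assumes "\<tau> \<in> \<Gamma>" "i \<in> {1..t}" "\<tau> (\<alpha> i) = h (\<zeta> ^ n) * \<alpha> i"
  shows "\<kappa> \<tau> i = n mod p"
proof (rule root_eqI)
  have "h (\<zeta> ^ \<kappa> \<tau> i) * \<alpha> i = h (\<zeta> ^ n) * \<alpha> i" using act_\<alpha>[OF assms(1,2)] unfolding assms(3) by (rule sym)
  then have "h (\<zeta> ^ \<kappa> \<tau> i) = h (\<zeta> ^ n)" unfolding mult_right_cancel[OF \<alpha>0[OF assms(2)]] .
  then show "\<zeta> ^ \<kappa> \<tau> i = \<zeta> ^ (n mod p)" using h_eq power_mod_eq[OF \<zeta>p] by metis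
qed (use \<kappa>p assms p0 in auto)

lemma \<kappa>_comp: "\<tau> \<in> \<Gamma> ==> \<rho> \<in> \<Gamma> ==> i \<in> {1..t} ==> \<kappa> (\<tau> \<circ> \<rho>) i = (\<kappa> \<tau> i + \<kappa> \<rho> i) mod p"
  by (rule \<kappa>_eqI)
    (simp_all add: comp_\<Gamma> act_\<alpha> galois_groupD(2,4)[where h = h] power_add field_ring_homD(2)[OF h])

lemma \<kappa>_id: "i \<in> {1..t} ==> \<kappa> id i = 0"
  using \<kappa>_eqI[OF id_\<Gamma>, of i 0] by (simp add: field_ring_homD(3)[OF h])

lemma finite_pairs: "finite pairs"
  by (rule finite_subset[of _ "{1..t} \<times> {1..t}"]) (auto simp: pairs_def)

lemma f_nz: "f \<tau> \<rho> \<noteq> 0"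
proof -
  have "(\<Prod>i\<in>{1..t}. z i ^ ((\<kappa> \<tau> i + \<kappa> \<rho> i) div p)) \<noteq> 0" using z0 by (auto simp: prod_zero_iff)
  moreover have "(\<Prod>(i, j)\<in>pairs. \<zeta> ^ (d i j * (\<kappa> \<tau> j * \<kappa> \<rho> i))) \<noteq> 0" 
    using \<zeta>0 by (auto simp: prod_zero_iff finite_pairs)
  ultimately show ?thesis by (simp add: f_def)
qed

text \<open>Both kinds of factor are cocycles separately: the bilinear one because \<zeta>^p = 1
  makes reduction of exponents harmless, the other by \<open>carry_div\<close>.\<close>

lemma f_cocycle:
  assumes "\<tau> \<in> \<Gamma>" "\<rho> \<in> \<Gamma>" "\<upsilon> \<in> \<Gamma>"
  shows "f \<rho> \<upsilon> * f \<tau> (\<rho> \<circ> \<upsilon>) = f \<tau> \<rho> * f (\<tau> \<circ> \<rho>) \<upsilon>"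
proof -
  let ?e = "\<lambda>\<tau> \<rho> (i, j). \<zeta> ^ (d i j * (\<kappa> \<tau> j * \<kappa> \<rho> i))"
  let ?c = "\<lambda>\<tau> \<rho> i. z i ^ ((\<kappa> \<tau> i + \<kappa> \<rho> i) div p)"
  have mod1: "\<zeta> ^ (m * (x * ((u + v) mod p))) = \<zeta> ^ (m * (x * u)) * \<zeta> ^ (m * (x * v))" for m x u v
  proof -
    have "(\<zeta> ^ (m * x)) ^ p = 1" using \<zeta>p by (metis mult.commute power_mult power_one)
    from power_mod_eq[OF this, of "u + v"] show ?thesis
      by (simp add: power_add mult.assoc flip: power_mult)
  qed
  have mod2: "\<zeta> ^ (m * (((u + v) mod p) * x)) = \<zeta> ^ (m * (u * x)) * \<zeta> ^ (m * (v * x))" for m x u v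
    using mod1[of m x u v] by (simp add: mult.commute[of x])
  have e: "?e \<rho> \<upsilon> q * ?e \<tau> (\<rho> \<circ> \<upsilon>) q = ?e \<tau> \<rho> q * ?e (\<tau> \<circ> \<rho>) \<upsilon> q" if "q \<in> pairs" for q
  proof -
    obtain i j where ij: "q = (i, j)" by (cases q)
    have q: "q = (i, j)" "i \<in> {1..t}" "j \<in> {1..t}" using that ij by (auto simp: pairs_def)
    show ?thesis unfolding q(1) prod.case \<kappa>_comp[OF assms(2,3) q(2)] \<kappa>_comp[OF assms(1,2) q(3)] mod1 mod2
      by (simp only: mult_ac)
  qed
  have c: "?c \<rho> \<upsilon> i * ?c \<tau> (\<rho> \<circ> \<upsilon>) i = ?c \<tau> \<rho> i * ?c (\<tau> \<circ> \<rho>) \<upsilon> i" if i: "i \<in> {1..t}" for i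
  proof -
    have "(\<kappa> \<tau> i + \<kappa> \<rho> i) div p + ((\<kappa> \<tau> i + \<kappa> \<rho> i) mod p + \<kappa> \<upsilon> i) div p = (\<kappa> \<tau> i + \<kappa> \<rho> i + \<kappa> \<upsilon> i) div p"
      using carry_div[OF p0, of "\<kappa> \<tau> i" "\<kappa> \<rho> i" "\<kappa> \<upsilon> i"] by (simp add: add_ac)
    then show ?thesis
      unfolding power_add[symmetric] \<kappa>_comp[OF assms(2,3) i] \<kappa>_comp[OF assms(1,2) i] carry_div[OF p0] by simp
  qed
  have "f \<rho> \<upsilon> * f \<tau> (\<rho> \<circ> \<upsilon>) = (\<Prod>q\<in>pairs. ?e \<rho> \<upsilon> q * ?e \<tau> (\<rho> \<circ> \<upsilon>) q) * (\<Prod>i\<in>{1..t}. ?c \<rho> \<upsilon> i * ?c \<tau> (\<rho> \<circ> \<upsilon>) i)"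
    unfolding f_def prod.distrib by (simp only: mult_ac)
  also have "\<dots> = (\<Prod>q\<in>pairs. ?e \<tau> \<rho> q * ?e (\<tau> \<circ> \<rho>) \<upsilon> q) * (\<Prod>i\<in>{1..t}. ?c \<tau> \<rho> i * ?c (\<tau> \<circ> \<rho>) \<upsilon> i)"
    by (simp only: prod.cong[OF refl e] prod.cong[OF refl c])
  also have "\<dots> = f \<tau> \<rho> * f (\<tau> \<circ> \<rho>) \<upsilon>"
    unfolding f_def prod.distrib by (simp only: mult_ac)
  finally show ?thesis .
qed

lemma f_one: 
  assumes "\<And>i. i \<in> {1..t} ==> \<kappa> \<nu> i = 0" "\<tau> \<in> \<Gamma>"
  shows "f \<tau> \<nu> = 1" "f \<nu> \<tau> = 1"
proof -
  have "i \<in> {1..t}" "j \<in> {1..t}" if "(i, j) \<in> pairs" for i j using that by (auto simp: pairs_def)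
  then show "f \<tau> \<nu> = 1" "f \<nu> \<tau> = 1"
    using assms \<kappa>p[OF assms(2)] unfolding f_def by (auto intro!: prod.neutral simp: div_less)
qed

sublocale twisted_algebra h "galois_group h" "\<lambda>\<tau>. \<tau>" "\<lambda>(\<tau>, \<rho>). h (f \<tau> \<rho>)"
proof (intro twisted_algebra.intro twisted_algebra_axioms.intro group fin)
  fix \<tau> \<rho> \<upsilon> assume \<tau>: "\<tau> \<in> \<Gamma>" "\<rho> \<in> \<Gamma>"
  show "(case (\<tau>, \<rho>) of (\<tau>, \<rho>) => h (f \<tau> \<rho>)) \<noteq> 0"
    using f_nz h_nz by auto
  assume "\<upsilon> \<in> \<Gamma>"
  with \<tau> show "\<tau> (case (\<rho>, \<upsilon>) of (\<tau>, \<rho>) => h (f \<tau> \<rho>)) * (case (\<tau>, \<rho> \<otimes>\<^bsub>galois_group h\<^esub> \<upsilon>) of (\<tau>, \<rho>) => h (f \<tau> \<rho>)) =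
      (case (\<tau>, \<rho>) of (\<tau>, \<rho>) => h (f \<tau> \<rho>)) * (case (\<tau> \<otimes>\<^bsub>galois_group h\<^esub> \<rho>, \<upsilon>) of (\<tau>, \<rho>) => h (f \<tau> \<rho>))"
    using f_cocycle[of \<tau> \<rho> \<upsilon>] by (simp add: galois_groupD(4)[where h = h] flip: field_ring_homD(2)[OF h])
qed (simp_all add: galois_groupD(1,2,4)[where h = h] field_ring_homD[OF h])

section \<open>The subgroup \<open>N\<close> fixing the Kummer generators and its fixed field
  \<open>K\<close>\<close>

definition N :: "('l => 'l) set" where "N = {\<tau> \<in> \<Gamma>. \<forall>i\<in>{1..t}. \<kappa> \<tau> i = 0}"

definition K :: "'l set" where "K = {x. \<forall>\<nu>\<in>N. \<nu> x = x}"

lemma NI: "\<tau> \<in> \<Gamma> ==> (\<And>i. i \<in> {1..t} ==> \<kappa> \<tau> i = 0) ==> \<tau> \<in> N" by (simp add: N_def)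
lemma ND: "\<nu> \<in> N ==> \<nu> \<in> \<Gamma>" "\<nu> \<in> N ==> i \<in> {1..t} ==> \<kappa> \<nu> i = 0" by (simp_all add: N_def)

lemma f_N: "\<nu> \<in> N ==> \<tau> \<in> \<Gamma> ==> f \<tau> \<nu> = 1" "\<nu> \<in> N ==> \<tau> \<in> \<Gamma> ==> f \<nu> \<tau> = 1"
  using f_one[of \<nu> \<tau>] ND by auto

lemma id_N: "id \<in> N" using id_\<Gamma> \<kappa>_id by (simp add: N_def)

lemma inv_comp: 
  assumes "\<tau> \<in> \<Gamma>"
  shows "inv\<^bsub>galois_group h\<^esub> \<tau> \<in> \<Gamma>" "\<tau> \<circ> inv\<^bsub>galois_group h\<^esub> \<tau> = id" "inv\<^bsub>galois_group h\<^esub> \<tau> \<circ> \<tau> = id"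
  using Q.inv_closed[OF assms] Q.r_inv[OF assms] Q.l_inv[OF assms] by simp_all

text \<open>The quotient of the two automorphisms has all exponents zero, since
  \<open>\<kappa>\<close> is additive modulo p. So the exponents alone decide in which coset of
  \<open>N\<close> an automorphism lies.\<close>

lemma same_coset:
  assumes "\<tau> \<in> \<Gamma>" "\<rho> \<in> \<Gamma>" "\<And>i. i \<in> {1..t} ==> \<kappa> \<tau> i = \<kappa> \<rho> i"
  obtains \<nu> where "\<nu> \<in> N" "\<rho> = \<tau> \<circ> \<nu>"
proof
  let ?i = "inv\<^bsub>galois_group h\<^esub> \<tau>"
  show "?i \<circ> \<rho> \<in> N"
  proof (rule NI)
    show "?i \<circ> \<rho> \<in> \<Gamma>" using assms inv_comp by (intro comp_\<Gamma>)
    fix i assume i: "i \<in> {1..t}"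
    have "\<kappa> (?i \<circ> \<rho>) i = \<kappa> (?i \<circ> \<tau>) i"
      unfolding \<kappa>_comp[OF inv_comp(1)[OF assms(1)] assms(2) i] \<kappa>_comp[OF inv_comp(1)[OF assms(1)] assms(1) i] assms(3)[OF i] ..
    then show "\<kappa> (?i \<circ> \<rho>) i = 0" using inv_comp[OF assms(1)] \<kappa>_id[OF i] by simp
  qed
  show "\<rho> = \<tau> \<circ> (?i \<circ> \<rho>)" using inv_comp[OF assms(1)] by (simp flip: comp_assoc)
qed

sublocale NG: automorphism_group N
proof
  show "finite N" using fin by (simp add: N_def)
  show "id \<in> N" by (rule id_N)
  show "\<tau> \<circ> \<rho> \<in> N" if "\<tau> \<in> N" "\<rho> \<in> N" for \<tau> \<rho>
    using that by (intro NI comp_\<Gamma>) (auto simp: N_def \<kappa>_comp)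
  fix \<tau> x y assume "\<tau> \<in> N"
  then have \<tau>: "\<tau> \<in> \<Gamma>" by (rule ND)
  show "\<tau> (x + y) = \<tau> x + \<tau> y" "\<tau> (x * y) = \<tau> x * \<tau> y" using galois_groupD[OF \<tau>] by simp_all
  show "surj \<tau>" using galois_groupD(5)[where h = h, OF \<tau>] by (rule bij_is_surj)
  show "x = 0" if "\<tau> x = 0" using that galois_groupD(5)[where h = h, OF \<tau>] act_0[OF \<tau>] by (metis bij_pointE)
qed

lemma K_stable:
  assumes x: "x \<in> K" and \<tau>: "\<tau> \<in> \<Gamma>"
  shows "\<tau> x \<in> K"
  unfolding K_def
proof (intro CollectI ballI)
  fix \<nu> assume \<nu>: "\<nu> \<in> N"
  obtain \<mu> where \<mu>: "\<mu> \<in> N" "\<nu> \<circ> \<tau> = \<tau> \<circ> \<mu>"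
  proof (rule same_coset[of \<tau> "\<nu> \<circ> \<tau>"])
    fix i assume i: "i \<in> {1..t}"
    show "\<kappa> \<tau> i = \<kappa> (\<nu> \<circ> \<tau>) i"
      using \<kappa>_comp[OF ND(1)[OF \<nu>] \<tau> i] ND(2)[OF \<nu> i] \<kappa>p[OF \<tau> i] by simp
  qed (use \<nu> \<tau> ND comp_\<Gamma> in auto)
  have "\<nu> (\<tau> x) = \<tau> (\<mu> x)" using fun_cong[OF \<mu>(2), of x] by simp
  moreover have "\<mu> x = x" using \<mu>(1) x by (auto simp: K_def)
  ultimately show "\<nu> (\<tau> x) = \<tau> x" by simp
qed

text \<open>This locale does not ask the Galois group to be abelian. Modulo \<open>N\<close> it is,
  since \<open>\<kappa>\<close> embeds the quotient into (Z/p)^t, and \<open>N\<close> acts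
  trivially on \<open>K\<close>.\<close>

lemma K_commute:
  assumes x: "x \<in> K" and \<tau>: "\<tau> \<in> \<Gamma>" and \<rho>: "\<rho> \<in> \<Gamma>"
  shows "\<tau> (\<rho> x) = \<rho> (\<tau> x)"
proof -
  obtain \<mu> where \<mu>: "\<mu> \<in> N" "\<tau> \<circ> \<rho> = (\<rho> \<circ> \<tau>) \<circ> \<mu>"
    by (rule same_coset[of "\<rho> \<circ> \<tau>" "\<tau> \<circ> \<rho>"]) (use \<tau> \<rho> comp_\<Gamma> in \<open>auto simp: \<kappa>_comp add.commute\<close>)
  have "\<mu> x = x" using \<mu>(1) x by (auto simp: K_def)
  then show ?thesis using fun_cong[OF \<mu>(2), of x] by simp
qed

lemma K_ops: 
  "x \<in> K ==> y \<in> K ==> x * y \<in> K" "x \<in> K ==> y \<in> K ==> x + y \<in> K" "h c \<in> K" "x \<in> K ==> inverse x \<in> K"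
  "NG.tr x \<in> K" "1 \<in> K" "i \<in> {1..t} ==> \<alpha> i \<in> K"
proof -
  show "x \<in> K ==> y \<in> K ==> x * y \<in> K" "x \<in> K ==> y \<in> K ==> x + y \<in> K" "h c \<in> K" "x \<in> K ==> inverse x \<in> K" "1 \<in> K"
    by (auto simp: K_def ND(1) act_add act_mult act_h act_1 act_inverse)
  show "NG.tr x \<in> K" by (simp add: K_def NG.tr_fixed)
  show "\<alpha> i \<in> K" if "i \<in> {1..t}" using that by (simp add: K_def act_\<alpha> ND field_ring_homD(3)[OF h])
qed

lemma K_power: "x \<in> K ==> x ^ n \<in> K" by (induction n) (simp_all add: K_ops)
lemma K_sum: "(\<And>i. i \<in> I ==> g i \<in> K) ==> (\<Sum>i\<in>I. g i) \<in> K"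
  by (induction I rule: infinite_finite_induct) (use K_ops(3)[of 0] h_0 in \<open>auto intro: K_ops\<close>)
lemma K_prod: "(\<And>i. i \<in> I ==> g i \<in> K) ==> (\<Prod>i\<in>I. g i) \<in> K"
  by (induction I rule: infinite_finite_induct) (auto intro: K_ops)

section \<open>Compression of the crossed product by the sum over \<open>N\<close>\<close>

definition el :: "'l => ('l => 'l) => 'l" where "el x = mon_elem id x"
definition u :: "('l => 'l) => ('l => 'l) => 'l" where "u \<tau> = mon_elem \<tau> 1"
text \<open>The sum over \<open>N\<close> absorbs each u_\<nu> with \<nu> in \<open>N\<close>,
  because \<open>f\<close> is trivial there, and T x T = tr(x) T. Products b T w formed with a trace
  dual basis are therefore matrix units.\<close>

definition T :: "('l => 'l) => 'l" where "T = finsum W u N"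

sublocale W: kalg W by (rule kalg_twisted)

lemma f_id: "\<tau> \<in> \<Gamma> ==> f id \<tau> = 1" "\<tau> \<in> \<Gamma> ==> f \<tau> id = 1"
  using f_N[OF id_N] by auto

lemma el_closed [simp]: "el x \<in> carrier W" unfolding el_def by (rule mon_closed[OF id_\<Gamma>])
lemma u_closed [simp]: "\<tau> \<in> \<Gamma> ==> u \<tau> \<in> carrier W" unfolding u_def by (rule mon_closed)
lemma T_closed [simp]: "T \<in> carrier W" unfolding T_def by (rule W.finsum_closed) (simp add: ND(1))

lemma el_mult: "el x \<otimes>\<^bsub>W\<^esub> el y = el (x * y)"
  unfolding el_def mon_mult[OF id_\<Gamma> id_\<Gamma>] by (simp add: f_id id_\<Gamma> h_one)

lemma el_u: "\<tau> \<in> \<Gamma> ==> el x \<otimes>\<^bsub>W\<^esub> u \<tau> = mon_elem \<tau> x"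
  unfolding el_def u_def by (simp add: mon_mult id_\<Gamma> f_id h_one)

lemma u_el: "\<tau> \<in> \<Gamma> ==> u \<tau> \<otimes>\<^bsub>W\<^esub> el x = el (\<tau> x) \<otimes>\<^bsub>W\<^esub> u \<tau>"
  unfolding el_def u_def by (simp add: mon_mult id_\<Gamma> f_id h_one galois_groupD(3)[where h = h])

lemma u_u: "\<tau> \<in> \<Gamma> ==> \<rho> \<in> \<Gamma> ==> u \<tau> \<otimes>\<^bsub>W\<^esub> u \<rho> = el (h (f \<tau> \<rho>)) \<otimes>\<^bsub>W\<^esub> u (\<tau> \<circ> \<rho>)"
  unfolding el_u[OF comp_\<Gamma>] unfolding u_def by (simp add: mon_mult galois_groupD(3)[where h = h])

lemma el_add: "el x \<oplus>\<^bsub>W\<^esub> el y = el (x + y)"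
  by (auto simp: el_def mon_elem_def twisted_simps(5))

lemma el_smult: "k \<odot>\<^bsub>W\<^esub> el x = el (h k * x)"
  by (auto simp: el_def mon_elem_def twisted_simps(6))

lemma el_one: "el 1 = \<one>\<^bsub>W\<^esub>"
  unfolding one_mon el_def using f_id(1)[OF id_\<Gamma>] by (simp add: h_one)

lemma el_zero: "el 0 = \<zero>\<^bsub>W\<^esub>"
  by (auto simp: el_def mon_elem_def twisted_simps(4))

lemma el_finsum: "finite I ==> finsum W (\<lambda>i. el (g i)) I = el (\<Sum>i\<in>I. g i)"
  by (induction I rule: finite_induct) (simp_all add: el_zero el_add W.finsum_insert)

lemma u_N_u: "\<nu> \<in> N ==> \<tau> \<in> \<Gamma> ==> u \<tau> \<otimes>\<^bsub>W\<^esub> u \<nu> = u (\<tau> \<circ> \<nu>)" "\<nu> \<in> N ==> \<tau> \<in> \<Gamma> ==> u \<nu> \<otimes>\<^bsub>W\<^esub> u \<tau> = u (\<nu> \<circ> \<tau>)"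
  by (simp_all add: u_u ND(1) f_N h_one el_one comp_\<Gamma>)

lemma comp_inj_on: "\<tau> \<in> \<Gamma> ==> inj_on ((\<circ>) \<tau>) S" "\<tau> \<in> \<Gamma> ==> inj_on (\<lambda>\<nu>. \<nu> \<circ> \<tau>) S"
proof -
  assume \<tau>: "\<tau> \<in> \<Gamma>"
  show "inj_on ((\<circ>) \<tau>) S"
  proof (rule inj_onI)
    fix x y assume "\<tau> \<circ> x = \<tau> \<circ> y"
    then have "inv\<^bsub>galois_group h\<^esub> \<tau> \<circ> \<tau> \<circ> x = inv\<^bsub>galois_group h\<^esub> \<tau> \<circ> \<tau> \<circ> y" by (metis comp_assoc)
    then show "x = y" unfolding inv_comp(3)[OF \<tau>] by simp
  qed
  show "inj_on (\<lambda>\<nu>. \<nu> \<circ> \<tau>) S"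
  proof (rule inj_onI)
    fix x y assume "x \<circ> \<tau> = y \<circ> \<tau>"
    then have "x \<circ> (\<tau> \<circ> inv\<^bsub>galois_group h\<^esub> \<tau>) = y \<circ> (\<tau> \<circ> inv\<^bsub>galois_group h\<^esub> \<tau>)" by (metis comp_assoc)
    then show "x = y" unfolding inv_comp(2)[OF \<tau>] by simp
  qed
qed

text \<open>\<open>N\<close> is normal because \<open>\<kappa>\<close> is additive modulo p. One
  inclusion suffices, as both cosets have the size of \<open>N\<close>.\<close>

lemma coset_image: "\<tau> \<in> \<Gamma> ==> (\<circ>) \<tau> ` N = (\<lambda>\<nu>. \<nu> \<circ> \<tau>) ` N"
proof -
  assume \<tau>: "\<tau> \<in> \<Gamma>"
  have "(\<lambda>\<nu>. \<nu> \<circ> \<tau>) ` N \<subseteq> (\<circ>) \<tau> ` N"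
  proof (rule image_subsetI)
    fix \<nu> assume \<nu>: "\<nu> \<in> N"
    obtain \<mu> where "\<mu> \<in> N" "\<nu> \<circ> \<tau> = \<tau> \<circ> \<mu>"
    proof (rule same_coset[of \<tau> "\<nu> \<circ> \<tau>"])
      fix i assume i: "i \<in> {1..t}"
      show "\<kappa> \<tau> i = \<kappa> (\<nu> \<circ> \<tau>) i"
        using \<kappa>_comp[OF ND(1)[OF \<nu>] \<tau> i] ND(2)[OF \<nu> i] \<kappa>p[OF \<tau> i] by simp
    qed (use \<nu> \<tau> ND comp_\<Gamma> in auto)
    then show "\<nu> \<circ> \<tau> \<in> (\<circ>) \<tau> ` N" by simp
  qed
  then show ?thesis
    using card_image[OF comp_inj_on(1)[OF \<tau>], of N] card_image[OF comp_inj_on(2)[OF \<tau>], of N] NG.fin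
    by (metis card_subset_eq finite_imageI)
qed

lemma u_T: "\<tau> \<in> \<Gamma> ==> u \<tau> \<otimes>\<^bsub>W\<^esub> T = finsum W u ((\<circ>) \<tau> ` N)"
proof -
  assume \<tau>: "\<tau> \<in> \<Gamma>"
  have "u \<tau> \<otimes>\<^bsub>W\<^esub> T = finsum W (\<lambda>\<nu>. u \<tau> \<otimes>\<^bsub>W\<^esub> u \<nu>) N"
    unfolding T_def by (rule W.finsum_rdistr) (simp_all add: NG.fin \<tau> ND(1))
  also have "\<dots> = finsum W (\<lambda>\<nu>. u (\<tau> \<circ> \<nu>)) N"
    by (rule W.finsum_cong') (simp_all add: u_N_u \<tau> comp_\<Gamma> ND(1))
  also have "\<dots> = finsum W u ((\<circ>) \<tau> ` N)"
    by (rule W.finsum_reindex[symmetric, OF _ comp_inj_on(1)[OF \<tau>]]) (rule Pi_I, elim imageE, simp only: u_closed comp_\<Gamma> \<tau> ND(1))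
  finally show ?thesis .
qed

lemma T_u: "\<tau> \<in> \<Gamma> ==> T \<otimes>\<^bsub>W\<^esub> u \<tau> = u \<tau> \<otimes>\<^bsub>W\<^esub> T"
proof -
  assume \<tau>: "\<tau> \<in> \<Gamma>"
  have "T \<otimes>\<^bsub>W\<^esub> u \<tau> = finsum W (\<lambda>\<nu>. u \<nu> \<otimes>\<^bsub>W\<^esub> u \<tau>) N"
    unfolding T_def by (rule W.finsum_ldistr) (simp_all add: NG.fin \<tau> ND(1))
  also have "\<dots> = finsum W (\<lambda>\<nu>. u (\<nu> \<circ> \<tau>)) N"
    by (rule W.finsum_cong') (simp_all add: u_N_u \<tau> comp_\<Gamma> ND(1))
  also have "\<dots> = finsum W u ((\<lambda>\<nu>. \<nu> \<circ> \<tau>) ` N)"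
    by (rule W.finsum_reindex[symmetric, OF _ comp_inj_on(2)[OF \<tau>]]) (rule Pi_I, elim imageE, simp only: u_closed comp_\<Gamma> \<tau> ND(1))
  finally show ?thesis unfolding u_T[OF \<tau>] coset_image[OF \<tau>] .
qed

lemma u_N_T: "\<nu> \<in> N ==> u \<nu> \<otimes>\<^bsub>W\<^esub> T = T"
proof -
  assume \<nu>: "\<nu> \<in> N"
  have "(\<circ>) \<nu> ` N = N"
    by (rule endo_inj_surj[OF NG.fin _ comp_inj_on(1)[OF ND(1)[OF \<nu>]]]) (use NG.comp \<nu> in blast)
  then show ?thesis unfolding u_T[OF ND(1)[OF \<nu>]] by (simp add: T_def)
qed

text \<open>Each u_\<nu> of the first sum moves past x as u_\<nu> x = \<nu>(x) u_\<nu> and is then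
  absorbed by the second \<open>T\<close>.\<close>

lemma T_el_T: "T \<otimes>\<^bsub>W\<^esub> (el x \<otimes>\<^bsub>W\<^esub> T) = el (NG.tr x) \<otimes>\<^bsub>W\<^esub> T"
proof -
  have "T \<otimes>\<^bsub>W\<^esub> (el x \<otimes>\<^bsub>W\<^esub> T) = finsum W (\<lambda>\<nu>. u \<nu> \<otimes>\<^bsub>W\<^esub> (el x \<otimes>\<^bsub>W\<^esub> T)) N"
    by (subst (1) T_def, rule W.finsum_ldistr) (simp_all add: NG.fin ND(1))
  also have "\<dots> = finsum W (\<lambda>\<nu>. el (\<nu> x) \<otimes>\<^bsub>W\<^esub> T) N"
  proof (rule W.finsum_cong')
    fix \<nu> assume \<nu>: "\<nu> \<in> N"
    have "u \<nu> \<otimes>\<^bsub>W\<^esub> (el x \<otimes>\<^bsub>W\<^esub> T) = (u \<nu> \<otimes>\<^bsub>W\<^esub> el x) \<otimes>\<^bsub>W\<^esub> T"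
      by (simp only: W.m_assoc u_closed[OF ND(1)[OF \<nu>]] el_closed T_closed)
    also have "\<dots> = el (\<nu> x) \<otimes>\<^bsub>W\<^esub> (u \<nu> \<otimes>\<^bsub>W\<^esub> T)"
      unfolding u_el[OF ND(1)[OF \<nu>]] by (simp only: W.m_assoc u_closed[OF ND(1)[OF \<nu>]] el_closed T_closed)
    finally show "u \<nu> \<otimes>\<^bsub>W\<^esub> (el x \<otimes>\<^bsub>W\<^esub> T) = el (\<nu> x) \<otimes>\<^bsub>W\<^esub> T" unfolding u_N_T[OF \<nu>] .
  qed simp_all
  also have "\<dots> = finsum W (\<lambda>\<nu>. el (\<nu> x)) N \<otimes>\<^bsub>W\<^esub> T"
    by (rule W.finsum_ldistr[symmetric]) (simp_all add: NG.fin)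
  finally show ?thesis unfolding el_finsum[OF NG.fin] NG.tr_def .
qed

text \<open>With a trace dual basis these are matrix units for \<tau> = id; for other \<tau> they
  are the same units with u_\<tau> inserted, and they describe the corner.\<close>

definition B :: "'l => ('l => 'l) => 'l => ('l => 'l) => 'l" where
  "B b \<tau> w = el b \<otimes>\<^bsub>W\<^esub> (u \<tau> \<otimes>\<^bsub>W\<^esub> (T \<otimes>\<^bsub>W\<^esub> el w))"

lemma B_closed [simp]: "\<tau> \<in> \<Gamma> ==> B b \<tau> w \<in> carrier W" by (simp add: B_def)

text \<open>The inner part T w b' T collapses to tr(w b') T. The trace then moves past u_\<tau>, and
  the two basis elements multiply by \<open>f\<close>.\<close>

lemma B_mult:
  assumes \<tau>: "\<tau> \<in> \<Gamma>" and \<rho>: "\<rho> \<in> \<Gamma>"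
  shows "B b \<tau> w \<otimes>\<^bsub>W\<^esub> B b' \<rho> w' = B (b * \<tau> (NG.tr (w * b')) * h (f \<tau> \<rho>)) (\<tau> \<circ> \<rho>) w'"
proof -
  note cl = u_closed[OF \<tau>] u_closed[OF \<rho>] el_closed T_closed W.m_closed comp_\<Gamma>[OF \<tau> \<rho>]
  have "B b \<tau> w \<otimes>\<^bsub>W\<^esub> B b' \<rho> w' = el b \<otimes>\<^bsub>W\<^esub> (u \<tau> \<otimes>\<^bsub>W\<^esub> (T \<otimes>\<^bsub>W\<^esub> ((el w \<otimes>\<^bsub>W\<^esub> el b') \<otimes>\<^bsub>W\<^esub> ((u \<rho> \<otimes>\<^bsub>W\<^esub> T) \<otimes>\<^bsub>W\<^esub> el w'))))"
    unfolding B_def by (simp only: W.m_assoc cl)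
  also have "\<dots> = el b \<otimes>\<^bsub>W\<^esub> (u \<tau> \<otimes>\<^bsub>W\<^esub> ((T \<otimes>\<^bsub>W\<^esub> (el (w * b') \<otimes>\<^bsub>W\<^esub> T)) \<otimes>\<^bsub>W\<^esub> (u \<rho> \<otimes>\<^bsub>W\<^esub> el w')))"
    unfolding T_u[OF \<rho>, symmetric] el_mult by (simp only: W.m_assoc cl)
  also have "\<dots> = el b \<otimes>\<^bsub>W\<^esub> ((u \<tau> \<otimes>\<^bsub>W\<^esub> el (NG.tr (w * b'))) \<otimes>\<^bsub>W\<^esub> ((T \<otimes>\<^bsub>W\<^esub> u \<rho>) \<otimes>\<^bsub>W\<^esub> el w'))"
    unfolding T_el_T by (simp only: W.m_assoc cl)
  also have "\<dots> = (el b \<otimes>\<^bsub>W\<^esub> el (\<tau> (NG.tr (w * b')))) \<otimes>\<^bsub>W\<^esub> ((u \<tau> \<otimes>\<^bsub>W\<^esub> u \<rho>) \<otimes>\<^bsub>W\<^esub> (T \<otimes>\<^bsub>W\<^esub> el w'))"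
    unfolding u_el[OF \<tau>] T_u[OF \<rho>] by (simp only: W.m_assoc cl)
  also have "\<dots> = (el (b * \<tau> (NG.tr (w * b'))) \<otimes>\<^bsub>W\<^esub> el (h (f \<tau> \<rho>))) \<otimes>\<^bsub>W\<^esub> (u (\<tau> \<circ> \<rho>) \<otimes>\<^bsub>W\<^esub> (T \<otimes>\<^bsub>W\<^esub> el w'))"
    unfolding u_u[OF \<tau> \<rho>] by (simp only: el_mult[symmetric] W.m_assoc cl u_closed[OF comp_\<Gamma>[OF \<tau> \<rho>]])
  finally show ?thesis unfolding el_mult B_def .
qed

text \<open>u_\<nu> T = T makes the choice of representative irrelevant: seen through
  \<open>T\<close>, the crossed product depends on automorphisms modulo \<open>N\<close>
  only.\<close>

lemma B_coset:
  assumes "\<tau> \<in> \<Gamma>" "\<rho> \<in> \<Gamma>" "\<And>i. i \<in> {1..t} ==> \<kappa> \<tau> i = \<kappa> \<rho> i"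
  shows "B b \<tau> w = B b \<rho> w"
proof -
  obtain \<nu> where \<nu>: "\<nu> \<in> N" "\<rho> = \<tau> \<circ> \<nu>" by (rule same_coset[OF assms])
  note cl = u_closed[OF assms(1)] u_closed[OF ND(1)[OF \<nu>(1)]] el_closed T_closed W.m_closed
  have "u \<rho> \<otimes>\<^bsub>W\<^esub> (T \<otimes>\<^bsub>W\<^esub> el w) = u \<tau> \<otimes>\<^bsub>W\<^esub> ((u \<nu> \<otimes>\<^bsub>W\<^esub> T) \<otimes>\<^bsub>W\<^esub> el w)"
    unfolding \<nu>(2) u_N_u(1)[OF \<nu>(1) assms(1), symmetric] by (simp only: W.m_assoc cl)
  then show ?thesis unfolding B_def u_N_T[OF \<nu>(1)] by simp
qed

lemma B_add: "\<tau> \<in> \<Gamma> ==> B b \<tau> w \<oplus>\<^bsub>W\<^esub> B b' \<tau> w = B (b + b') \<tau> w"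
  unfolding B_def el_add[symmetric] by (simp add: W.l_distr)

lemma B_smult: "\<tau> \<in> \<Gamma> ==> k \<odot>\<^bsub>W\<^esub> B b \<tau> w = B (h k * b) \<tau> w"
  unfolding B_def el_smult[symmetric] by (simp add: W.smult_lmult)

end

section \<open>Generation of the Galois group, and values of the cocycle on generators\<close>

context kummer_product begin

text \<open>\<open>N\<close> and the \<sigma>_i generate: multiplication by inverses of the
  \<sigma>_i clears the exponents. The outer induction is on the last index whose exponent may be
  nonzero, the inner one on that exponent.\<close>

lemma gamma_induct [consumes 1, case_names kernel gen comp]:
  assumes "\<tau> \<in> \<Gamma>" and kernel: "\<And>\<nu>. \<nu> \<in> N ==> P \<nu>" and gen: "\<And>i. i \<in> {1..t} ==> P (\<sigma> i)"
    and comp: "\<And>\<tau> \<rho>. [|\<tau> \<in> \<Gamma>; \<rho> \<in> \<Gamma>; P \<tau>; P \<rho>|] ==> P (\<tau> \<circ> \<rho>)"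
  shows "P \<tau>"
proof -
  have "P \<tau>" if "q \<le> t" "\<tau> \<in> \<Gamma>" "\<forall>i\<in>{1..t}. q < i \<longrightarrow> \<kappa> \<tau> i = 0" for q \<tau>
    using that
  proof (induction q arbitrary: \<tau>)
    case 0
    then show ?case by (intro kernel NI) auto
  next
    case (Suc q)
    note outer = Suc
    have q: "Suc q \<in> {1..t}" using Suc.prems(1) by simp
    have "P \<tau>" if "c = \<kappa> \<tau> (Suc q)" "\<tau> \<in> \<Gamma>" "\<forall>i\<in>{1..t}. Suc q < i \<longrightarrow> \<kappa> \<tau> i = 0" for c \<tau>
      using that
    proof (induction c arbitrary: \<tau>)
      case 0
      show ?case
      proof (rule outer(1))
        show "\<forall>i\<in>{1..t}. q < i \<longrightarrow> \<kappa> \<tau> i = 0"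
        proof (intro ballI impI)
          fix i assume "i \<in> {1..t}" "q < i"
          then show "\<kappa> \<tau> i = 0" using 0 by (cases "i = Suc q") auto
        qed
      qed (use 0 outer(2) in auto)
    next
      case (Suc c)
      \<comment> \<open>Splitting off one \<sigma>_i lowers the exponent at \<open>Suc q\<close> by
        one and leaves the others alone.\<close>
      define \<upsilon> where "\<upsilon> = \<tau> \<circ> inv\<^bsub>galois_group h\<^esub> \<sigma> (Suc q)"
      have \<upsilon>: "\<upsilon> \<in> \<Gamma>" unfolding \<upsilon>_def by (rule comp_\<Gamma>[OF Suc.prems(2) inv_comp(1)[OF \<sigma>[OF q]]])
      have \<tau>: "\<tau> = \<upsilon> \<circ> \<sigma> (Suc q)" unfolding \<upsilon>_def comp_assoc inv_comp(3)[OF \<sigma>[OF q]] by simp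
      have \<kappa>: "\<kappa> \<tau> i = (\<kappa> \<upsilon> i + (if i = Suc q then 1 else 0)) mod p" if "i \<in> {1..t}" for i
        unfolding \<tau> \<kappa>_comp[OF \<upsilon> \<sigma>[OF q] that] \<kappa>\<sigma>[OF that q] ..
      have "\<kappa> \<upsilon> (Suc q) = c"
        using \<kappa>[OF q] Suc.prems(1) \<kappa>p[OF \<upsilon> q] by (simp add: mod_Suc split: if_splits)
      moreover have "\<kappa> \<upsilon> i = 0" if "i \<in> {1..t}" "Suc q < i" for i
        using \<kappa>[OF that(1)] Suc.prems(3) that \<kappa>p[OF \<upsilon> that(1)] by simp
      ultimately have "P \<upsilon>" using Suc.IH[OF _ \<upsilon>] by simp
      then show ?case unfolding \<tau> by (rule comp[OF \<upsilon> \<sigma>[OF q] _ gen[OF q]])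
    qed
    from this[OF refl Suc.prems(2,3)] show ?case .
  qed
  from this[OF order_refl assms(1)] show ?thesis by simp
qed

lemma funpow_\<Gamma>: "\<tau> \<in> \<Gamma> ==> (\<tau> ^^ m) \<in> \<Gamma>"
  by (induction m) (simp_all add: id_\<Gamma> comp_\<Gamma> del: o_apply)

lemma funpow_\<kappa>: "[|i \<in> {1..t}; j \<in> {1..t}|] ==> \<kappa> (\<sigma> j ^^ m) i = (if i = j then m mod p else 0)"
proof (induction m)
  case (Suc m)
  then show ?case
    unfolding funpow.simps \<kappa>_comp[OF \<sigma>[OF Suc.prems(2)] funpow_\<Gamma>[OF \<sigma>[OF Suc.prems(2)]] Suc.prems(1)] \<kappa>\<sigma>[OF Suc.prems]
    by (simp add: mod_Suc_eq)
qed (simp add: \<kappa>_id)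

lemma funpow_p: "j \<in> {1..t} ==> \<sigma> j ^^ p \<in> N"
  by (rule NI) (simp_all add: funpow_\<Gamma> \<sigma> funpow_\<kappa>)

text \<open>Of the two orders only (\<sigma>_j, \<sigma>_i) with i < j picks up the bilinear factor;
  this asymmetry is the commutator of the basis elements. There is no carry, since all exponents add
  up to at most 1.\<close>

lemma f_\<sigma>: 
  assumes "i \<in> {1..t}" "j \<in> {1..t}" "i < j"
  shows "f (\<sigma> i) (\<sigma> j) = 1" "f (\<sigma> j) (\<sigma> i) = \<zeta> ^ d i j"
proof -
  have z: "(\<Prod>l\<in>{1..t}. z l ^ ((\<kappa> (\<sigma> i) l + \<kappa> (\<sigma> j) l) div p)) = 1"
    "(\<Prod>l\<in>{1..t}. z l ^ ((\<kappa> (\<sigma> j) l + \<kappa> (\<sigma> i) l) div p)) = 1"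
    using assms p2 by (auto intro!: prod.neutral simp: \<kappa>\<sigma>)
  have "(\<Prod>(k, l)\<in>pairs. \<zeta> ^ (d k l * (\<kappa> (\<sigma> i) l * \<kappa> (\<sigma> j) k))) = 1"
    using assms by (auto intro!: prod.neutral simp: \<kappa>\<sigma> pairs_def)
  then show "f (\<sigma> i) (\<sigma> j) = 1" unfolding f_def z by simp
  have ij: "(i, j) \<in> pairs" using assms by (simp add: pairs_def)
  have "(\<Prod>(k, l)\<in>pairs. \<zeta> ^ (d k l * (\<kappa> (\<sigma> j) l * \<kappa> (\<sigma> i) k))) =
      (\<Prod>q\<in>pairs. if q = (i, j) then \<zeta> ^ d i j else 1)"
    using assms by (intro prod.cong refl) (auto simp: \<kappa>\<sigma> pairs_def split: if_split_asm)
  also have "\<dots> = \<zeta> ^ d i j" using ij by (simp add: prod.delta finite_pairs)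
  finally show "f (\<sigma> j) (\<sigma> i) = \<zeta> ^ d i j" unfolding f_def z by simp
qed

text \<open>When the p-th power of u_\<sigma> is built step by step, the only carry happens at the
  last step, and there it contributes \<open>z j\<close>.\<close>

lemma f_\<sigma>_pow:
  assumes j: "j \<in> {1..t}" and m: "m < p"
  shows "f (\<sigma> j ^^ m) (\<sigma> j) = (if Suc m = p then z j else 1)"
proof -
  have "(\<Prod>(k, l)\<in>pairs. \<zeta> ^ (d k l * (\<kappa> (\<sigma> j ^^ m) l * \<kappa> (\<sigma> j) k))) = 1"
    using j by (auto intro!: prod.neutral simp: \<kappa>\<sigma> funpow_\<kappa> pairs_def)
  moreover have "(\<Prod>l\<in>{1..t}. z l ^ ((\<kappa> (\<sigma> j ^^ m) l + \<kappa> (\<sigma> j) l) div p)) =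
      (\<Prod>l\<in>{1..t}. if l = j then z j ^ (Suc m div p) else 1)"
    using j m p2 by (intro prod.cong refl) (auto simp: \<kappa>\<sigma> funpow_\<kappa>)
  moreover have "\<dots> = z j ^ (Suc m div p)" using j by (simp add: prod.delta)
  moreover have "Suc m div p = (if Suc m = p then 1 else 0)" using m p2 by auto
  ultimately show ?thesis unfolding f_def by simp
qed

end

text \<open>A trace dual basis chosen once and for all; \<open>NG.dual_basis\<close> provides
  one.\<close>

locale kummer_corner = kummer_product +
  fixes l :: nat and b w :: "nat => 'b"
  assumes l: "0 < l" and dual1: "\<And>\<nu>. \<nu> \<in> N ==> (\<Sum>i<l. b i * \<nu> (w i)) = (if \<nu> = id then 1 else 0)"
    and dual2: "\<And>i j. i < l ==> j < l ==> NG.tr (w i * b j) = (if i = j then 1 else 0)"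
begin

text \<open>For \<open>x\<close> in \<open>K\<close> this is the copy of x u_\<tau> in the corner at
  \<open>e\<close>: by \<open>V_mult\<close> these elements multiply as in the crossed product of
  K/k with the same cocycle.\<close>

definition V :: "'b => ('b => 'b) => ('b => 'b) => 'b" where "V x \<tau> = B (b 0 * x) \<tau> (w 0)"

abbreviation "e \<equiv> B (b 0) id (w 0)"
abbreviation "C \<equiv> corner W e"

lemma B_0: "\<tau> \<in> \<Gamma> ==> B 0 \<tau> x = \<zero>\<^bsub>W\<^esub>"
  unfolding B_def el_zero by simp

lemma units_mult:
  assumes "i < l" "j < l" "k < l" "m < l"
  shows "B (b i) id (w j) \<otimes>\<^bsub>W\<^esub> B (b k) id (w m) = (if j = k then B (b i) id (w m) else \<zero>\<^bsub>W\<^esub>)"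
  unfolding B_mult[OF id_\<Gamma> id_\<Gamma>] dual2[OF assms(2,3)] f_id[OF id_\<Gamma>] by (simp add: h_one B_0 id_\<Gamma>)

lemma u_id: "u id = \<one>\<^bsub>W\<^esub>" unfolding u_def el_one[symmetric] el_def ..

text \<open>Expanding \<open>T\<close> shows that u_\<nu> occurs with the coefficient \<Sum> b_i
  \<nu>(w_i), so the relation \<open>dual1\<close> says exactly that the diagonal units add up to
  1.\<close>

lemma units_sum: "(\<Oplus>\<^bsub>W\<^esub>i\<in>{..<l}. B (b i) id (w i)) = \<one>\<^bsub>W\<^esub>"
proof -
  have B: "B (b i) id (w i) = (\<Oplus>\<^bsub>W\<^esub>\<nu>\<in>N. el (b i * \<nu> (w i)) \<otimes>\<^bsub>W\<^esub> u \<nu>)" for i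
  proof -
    have "T \<otimes>\<^bsub>W\<^esub> el (w i) = (\<Oplus>\<^bsub>W\<^esub>\<nu>\<in>N. u \<nu> \<otimes>\<^bsub>W\<^esub> el (w i))"
      unfolding T_def by (rule W.finsum_ldistr) (simp_all add: NG.fin ND(1))
    then have "B (b i) id (w i) = el (b i) \<otimes>\<^bsub>W\<^esub> (\<Oplus>\<^bsub>W\<^esub>\<nu>\<in>N. u \<nu> \<otimes>\<^bsub>W\<^esub> el (w i))"
      unfolding B_def u_id by (simp add: ND(1))
    also have "\<dots> = (\<Oplus>\<^bsub>W\<^esub>\<nu>\<in>N. el (b i) \<otimes>\<^bsub>W\<^esub> (u \<nu> \<otimes>\<^bsub>W\<^esub> el (w i)))"
      by (rule W.finsum_rdistr) (simp_all add: NG.fin ND(1))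
    also have "\<dots> = (\<Oplus>\<^bsub>W\<^esub>\<nu>\<in>N. el (b i * \<nu> (w i)) \<otimes>\<^bsub>W\<^esub> u \<nu>)"
      by (rule W.finsum_cong') (simp_all add: u_el ND(1) el_mult flip: W.m_assoc)
    finally show ?thesis .
  qed
  have "(\<Oplus>\<^bsub>W\<^esub>i\<in>{..<l}. B (b i) id (w i)) = (\<Oplus>\<^bsub>W\<^esub>\<nu>\<in>N. \<Oplus>\<^bsub>W\<^esub>i\<in>{..<l}. el (b i * \<nu> (w i)) \<otimes>\<^bsub>W\<^esub> u \<nu>)"
    unfolding B by (rule W.finsum_swap) (simp_all add: NG.fin ND(1))
  also have "\<dots> = (\<Oplus>\<^bsub>W\<^esub>\<nu>\<in>N. if \<nu> = id then \<one>\<^bsub>W\<^esub> else \<zero>\<^bsub>W\<^esub>)"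
  proof (rule W.finsum_cong')
    fix \<nu> assume \<nu>: "\<nu> \<in> N"
    have "(\<Oplus>\<^bsub>W\<^esub>i\<in>{..<l}. el (b i * \<nu> (w i)) \<otimes>\<^bsub>W\<^esub> u \<nu>) = (\<Oplus>\<^bsub>W\<^esub>i\<in>{..<l}. el (b i * \<nu> (w i))) \<otimes>\<^bsub>W\<^esub> u \<nu>"
      by (rule W.finsum_ldistr[symmetric]) (simp_all add: \<nu> ND(1))
    also have "\<dots> = el (if \<nu> = id then 1 else 0) \<otimes>\<^bsub>W\<^esub> u \<nu>"
      unfolding el_finsum[OF finite_lessThan] dual1[OF \<nu>] ..
    also have "\<dots> = (if \<nu> = id then \<one>\<^bsub>W\<^esub> else \<zero>\<^bsub>W\<^esub>)"
      by (cases "\<nu> = id") (simp_all add: el_one el_zero u_id ND(1)[OF \<nu>])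
    finally show "(\<Oplus>\<^bsub>W\<^esub>i\<in>{..<l}. el (b i * \<nu> (w i)) \<otimes>\<^bsub>W\<^esub> u \<nu>) = (if \<nu> = id then \<one>\<^bsub>W\<^esub> else \<zero>\<^bsub>W\<^esub>)" .
  qed simp_all
  also have "\<dots> = \<one>\<^bsub>W\<^esub>" by (subst W.finsum_delta[where j = id]) (simp_all add: NG.fin id_N)
  finally show ?thesis .
qed

lemma corner: "kalg C" "brauer_equiv W C"
  by (rule W.brauer_equiv_corner[where E = "\<lambda>i j. B (b i) id (w j)" and n = l]; 
      simp add: units_mult units_sum l id_\<Gamma>)+

sublocale C: kalg C by (rule corner)

lemma one_W_nz: "\<one>\<^bsub>W\<^esub> \<noteq> \<zero>\<^bsub>W\<^esub>"
proof
  assume "\<one>\<^bsub>W\<^esub> = \<zero>\<^bsub>W\<^esub>"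
  from fun_cong[OF this, of id] show False unfolding el_one[symmetric] by (simp add: el_def mon_elem_def twisted_simps(4))
qed

text \<open>Every diagonal unit factors through \<open>e\<close>; were \<open>e\<close> zero, their
  sum 1 would be zero as well.\<close>

lemma e_nz: "e \<noteq> \<zero>\<^bsub>W\<^esub>"
proof
  assume e: "e = \<zero>\<^bsub>W\<^esub>"
  have "B (b i) id (w i) = \<zero>\<^bsub>W\<^esub>" if "i < l" for i
  proof -
    have "B (b i) id (w i) = (B (b i) id (w 0) \<otimes>\<^bsub>W\<^esub> e) \<otimes>\<^bsub>W\<^esub> B (b 0) id (w i)"
      using that l by (simp add: units_mult)
    then show ?thesis unfolding e by (simp add: id_\<Gamma>)
  qed
  then have "(\<Oplus>\<^bsub>W\<^esub>i\<in>{..<l}. B (b i) id (w i)) = \<zero>\<^bsub>W\<^esub>" 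
    by (intro W.add.finprod_one_eqI) simp
  then show False unfolding units_sum using one_W_nz by blast
qed

text \<open>An element \<open>y\<close> of \<open>K\<close> is fixed by \<open>N\<close>, so it
  comes out of the trace in \<open>B_mult\<close>, and tr(w_0 b_0) = 1.\<close>

lemma V_mult:
  assumes "\<tau> \<in> \<Gamma>" "\<rho> \<in> \<Gamma>" "y \<in> K"
  shows "V x \<tau> \<otimes>\<^bsub>W\<^esub> V y \<rho> = V (x * \<tau> y * h (f \<tau> \<rho>)) (\<tau> \<circ> \<rho>)"
proof -
  have "NG.tr (w 0 * (b 0 * y)) = NG.tr (y * (w 0 * b 0))" by (simp only: mult_ac)
  also have "\<dots> = y" using assms(3) l by (subst NG.tr_mult_fixed) (simp_all add: K_def dual2)
  finally show ?thesis unfolding V_def B_mult[OF assms(1,2)] by (simp only: mult.assoc)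
qed

lemma V_e: "V 1 id = e" by (simp add: V_def)

lemma V_closed [simp]: "\<tau> \<in> \<Gamma> ==> x \<in> K ==> V x \<tau> \<in> carrier C"
  using V_mult[OF id_\<Gamma>, of \<tau> x 1] V_mult[OF _ id_\<Gamma>, of \<tau> 1 x]
  by (simp add: V_e K_ops(6) f_id h_one act_1) (simp add: V_def)

lemma V_add: "\<tau> \<in> \<Gamma> ==> V x \<tau> \<oplus>\<^bsub>W\<^esub> V y \<tau> = V (x + y) \<tau>"
  unfolding V_def by (simp add: B_add distrib_left)

lemma V_smult: "\<tau> \<in> \<Gamma> ==> k \<odot>\<^bsub>W\<^esub> V x \<tau> = V (h k * x) \<tau>"
  unfolding V_def by (simp add: B_smult mult_ac)

lemma V_coset: "[|\<tau> \<in> \<Gamma>; \<rho> \<in> \<Gamma>; \<And>i. i \<in> {1..t} ==> \<kappa> \<tau> i = \<kappa> \<rho> i|] ==> V x \<tau> = V x \<rho>"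
  unfolding V_def by (rule B_coset)

text \<open>Traces lie in \<open>K\<close>, so compressing a monomial by \<open>e\<close> yields an
  element \<open>V x \<tau>\<close> with \<open>x\<close> in \<open>K\<close>.\<close>

lemma corner_mon: "\<tau> \<in> \<Gamma> ==> e \<otimes>\<^bsub>W\<^esub> (mon_elem \<tau> x \<otimes>\<^bsub>W\<^esub> e) = V (NG.tr (w 0 * (x * \<tau> (b 0)))) \<tau>"
proof -
  assume \<tau>: "\<tau> \<in> \<Gamma>"
  note cl = u_closed[OF \<tau>] el_closed T_closed W.m_closed
  have "mon_elem \<tau> x \<otimes>\<^bsub>W\<^esub> e = el x \<otimes>\<^bsub>W\<^esub> ((u \<tau> \<otimes>\<^bsub>W\<^esub> el (b 0)) \<otimes>\<^bsub>W\<^esub> (T \<otimes>\<^bsub>W\<^esub> el (w 0)))"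
    unfolding el_u[OF \<tau>, symmetric] B_def u_id by (simp only: W.m_assoc W.l_one cl)
  also have "\<dots> = (el x \<otimes>\<^bsub>W\<^esub> el (\<tau> (b 0))) \<otimes>\<^bsub>W\<^esub> (u \<tau> \<otimes>\<^bsub>W\<^esub> (T \<otimes>\<^bsub>W\<^esub> el (w 0)))"
    unfolding u_el[OF \<tau>] by (simp only: W.m_assoc cl)
  finally have "mon_elem \<tau> x \<otimes>\<^bsub>W\<^esub> e = B (x * \<tau> (b 0)) \<tau> (w 0)" unfolding el_mult B_def .
  then show ?thesis
    unfolding V_def by (simp add: B_mult id_\<Gamma> \<tau> f_id h_one)
qed

text \<open>Every element of the corner is its own compression, and the compression of a sum of
  monomials is a sum of elements \<open>V x \<tau>\<close>.\<close>

lemma corner_in_subalg: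
  assumes M: "subalg C M" and V: "\<And>x \<tau>. x \<in> K ==> \<tau> \<in> \<Gamma> ==> V x \<tau> \<in> M" and y: "y \<in> carrier C"
  shows "y \<in> M"
proof -
  have "e \<otimes>\<^bsub>W\<^esub> (y \<otimes>\<^bsub>W\<^esub> e) \<in> M" if "y \<in> carrier W" for y
    using that
  proof (induction y rule: twisted_induct)
    case zero
    have "(0::'a) \<odot>\<^bsub>C\<^esub> V 1 id \<in> M" using M V[OF K_ops(6) id_\<Gamma>] unfolding subalg_def by blast
    moreover have "(0::'a) \<odot>\<^bsub>C\<^esub> V 1 id = \<zero>\<^bsub>W\<^esub>" using id_\<Gamma> by (simp add: V_e)
    moreover have "e \<otimes>\<^bsub>W\<^esub> (\<zero>\<^bsub>W\<^esub> \<otimes>\<^bsub>W\<^esub> e) = \<zero>\<^bsub>W\<^esub>" by (simp only: W.l_null W.r_null B_closed[OF id_\<Gamma>] W.zero_closed)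
    ultimately show ?case by (simp only: corner_simps)
  next
    case (add x y)
    have "e \<otimes>\<^bsub>W\<^esub> ((x \<oplus>\<^bsub>W\<^esub> y) \<otimes>\<^bsub>W\<^esub> e) = (e \<otimes>\<^bsub>W\<^esub> (x \<otimes>\<^bsub>W\<^esub> e)) \<oplus>\<^bsub>C\<^esub> (e \<otimes>\<^bsub>W\<^esub> (y \<otimes>\<^bsub>W\<^esub> e))"
      using add.hyps id_\<Gamma> by (simp add: W.l_distr W.r_distr)
    moreover have "(e \<otimes>\<^bsub>W\<^esub> (x \<otimes>\<^bsub>W\<^esub> e)) \<oplus>\<^bsub>C\<^esub> (e \<otimes>\<^bsub>W\<^esub> (y \<otimes>\<^bsub>W\<^esub> e)) \<in> M"
      using M add.IH unfolding subalg_def by blast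
    ultimately show ?case by (simp only:)
  next
    case (mon \<tau> x)
    show ?case unfolding corner_mon[OF mon] by (rule V[OF K_ops(5) mon])
  qed
  from this[of y] y show ?thesis by simp
qed

definition Y :: "nat => ('b => 'b) => 'b" where "Y j = V (\<alpha> j) id"
text \<open>The correction in front of u_j: by \<open>\<sigma>_R\<close> the automorphisms
  \<sigma>_i with i < j multiply it by \<zeta>^(d_ij), which cancels the commutator, while
  \<sigma>_j and the later ones fix it.\<close>

definition R :: "nat => 'b" where "R j = (\<Prod>i\<in>{1..<j}. \<alpha> i ^ d i j)"
definition U :: "nat => ('b => 'b) => 'b" where "U j = V (R j) (\<sigma> j)"

lemma R_K: "j \<in> {1..t} ==> R j \<in> K"
  unfolding R_def by (intro K_prod K_power K_ops) auto

lemma R_nz: "j \<in> {1..t} ==> R j \<noteq> 0"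
  unfolding R_def by (simp add: \<alpha>0)

lemma \<sigma>_\<alpha>: "i \<in> {1..t} ==> j \<in> {1..t} ==> \<sigma> j (\<alpha> i) = (if i = j then h \<zeta> else 1) * \<alpha> i"
  by (simp add: act_\<alpha> \<sigma> \<kappa>\<sigma> h_one)

lemma act_prod: "\<tau> \<in> \<Gamma> ==> \<tau> (\<Prod>i\<in>I. g i) = (\<Prod>i\<in>I. \<tau> (g i))"
  by (induction I rule: infinite_finite_induct) (simp_all add: act_1 act_mult)

lemma \<sigma>_R: "i \<in> {1..t} ==> j \<in> {1..t} ==> \<sigma> i (R j) = (if i < j then h (\<zeta> ^ d i j) else 1) * R j"
proof -
  assume i: "i \<in> {1..t}" and j: "j \<in> {1..t}"
  have "\<sigma> i (R j) = (\<Prod>k\<in>{1..<j}. \<sigma> i (\<alpha> k ^ d k j))"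
    unfolding R_def by (rule act_prod[OF \<sigma>[OF i]])
  also have "\<dots> = (\<Prod>k\<in>{1..<j}. (if k = i then h (\<zeta> ^ d i j) else 1) * \<alpha> k ^ d k j)"
    using i j by (intro prod.cong refl) (auto simp: act_power \<sigma> \<sigma>_\<alpha> power_mult_distrib h_power)
  also have "\<dots> = (if i < j then h (\<zeta> ^ d i j) else 1) * R j"
    unfolding prod.distrib R_def using i by (simp add: prod.delta')
  finally show ?thesis .
qed

end

section \<open>Relations between the generators of the corner, and generation\<close>

context kummer_corner begin

lemma V_cong: 
  assumes "\<tau> \<in> \<Gamma>" "\<rho> \<in> \<Gamma>" "x = y" "\<And>i. i \<in> {1..t} ==> \<kappa> \<tau> i = \<kappa> \<rho> i"
  shows "V x \<tau> = V y \<rho>"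
  unfolding assms(3) by (rule V_coset[OF assms(1,2,4)])

lemma V_id_mult: "y \<in> K ==> V x id \<otimes>\<^bsub>W\<^esub> V y id = V (x * y) id"
  by (simp add: V_mult id_\<Gamma> f_id h_one)

lemma V_id_pow: "x \<in> K ==> V x id [^]\<^bsub>C\<^esub> (n::nat) = V (x ^ n) id"
  by (induction n) (simp_all add: V_e V_id_mult mult.commute)

lemma V_h: "V (h c) id = c \<odot>\<^bsub>C\<^esub> \<one>\<^bsub>C\<^esub>"
  using V_smult[OF id_\<Gamma>, of c 1] by (simp add: V_e)

lemma UY_closed: "j \<in> {1..t} ==> U j \<in> carrier C" "j \<in> {1..t} ==> Y j \<in> carrier C"
  unfolding U_def Y_def by (rule V_closed; simp add: \<sigma> R_K id_\<Gamma> K_ops(7))+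

lemma Y_pow: "j \<in> {1..t} ==> Y j [^]\<^bsub>C\<^esub> p = a j \<odot>\<^bsub>C\<^esub> \<one>\<^bsub>C\<^esub>"
  unfolding Y_def V_id_pow[OF K_ops(7)] \<alpha>p V_h ..

text \<open>The scalar that \<open>U j\<close> has as its p-th power: \<open>z j\<close> from the
  carry of \<open>f\<close>, and the p-th power of \<open>R j\<close> because \<alpha>_i^p =
  a_i.\<close>

definition bb :: "nat => 'a" where "bb j = z j * (\<Prod>i\<in>{1..<j}. a i ^ d i j)"

lemma bb_nz: "j \<in> {1..t} ==> bb j \<noteq> 0"
  unfolding bb_def using z0 a0 by simp

lemma R_pow: "j \<in> {1..t} ==> R j ^ p * h (z j) = h (bb j)"
proof -
  assume j: "j \<in> {1..t}"
  have "R j ^ p = (\<Prod>i\<in>{1..<j}. h (a i ^ d i j))"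
    unfolding R_def prod_power_distrib
  proof (rule prod.cong[OF refl])
    fix i assume "i \<in> {1..<j}"
    then have i: "i \<in> {1..t}" using j by auto
    have "(\<alpha> i ^ d i j) ^ p = (\<alpha> i ^ p) ^ d i j" by (simp only: power_mult[symmetric] mult.commute)
    then show "(\<alpha> i ^ d i j) ^ p = h (a i ^ d i j)" unfolding \<alpha>p[OF i] h_power .
  qed
  then show ?thesis unfolding bb_def h_mult h_prod by (simp only: mult.commute)
qed

text \<open>\<sigma>_j fixes R_j, so the factors R_j simply accumulate.\<close>

lemma U_pow: 
  assumes j: "j \<in> {1..t}"
  shows "U j [^]\<^bsub>C\<^esub> p = bb j \<odot>\<^bsub>C\<^esub> \<one>\<^bsub>C\<^esub>"
proof -
  have fix1: "(\<sigma> j ^^ n) (R j) = R j" for n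
    using j by (induction n) (simp_all add: \<sigma>_R)
  have "U j [^]\<^bsub>C\<^esub> n = V (R j ^ n * h (if n = p then z j else 1)) (\<sigma> j ^^ n)" if "n \<le> p" for n
    using that
  proof (induction n)
    case 0
    have "\<one>\<^bsub>C\<^esub> = V (1 * h 1) id" unfolding h_one by (simp only: V_e mult_1 corner_simps)
    then show ?case using p0 by (simp only: nat_pow_0 C.nat_pow_0 funpow.simps power_0 if_False less_imp_neq)
  next
    case (Suc n)
    have n: "n < p" using Suc.prems by simp
    have IH: "U j [^]\<^bsub>C\<^esub> n = V (R j ^ n) (\<sigma> j ^^ n)"
      using Suc.IH[OF less_imp_le[OF n]] unfolding if_not_P[OF less_imp_neq[OF n]] h_one mult_1_right .
    have "U j [^]\<^bsub>C\<^esub> Suc n = V (R j ^ n) (\<sigma> j ^^ n) \<otimes>\<^bsub>W\<^esub> U j"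
      unfolding C.nat_pow_Suc IH corner_simps ..
    also have "\<dots> = V (R j ^ n * (\<sigma> j ^^ n) (R j) * h (f (\<sigma> j ^^ n) (\<sigma> j))) ((\<sigma> j ^^ n) \<circ> \<sigma> j)"
      unfolding U_def by (rule V_mult[OF funpow_\<Gamma>[OF \<sigma>[OF j]] \<sigma>[OF j] R_K[OF j]])
    also have "\<dots> = V (R j ^ Suc n * h (if Suc n = p then z j else 1)) (\<sigma> j ^^ Suc n)"
      unfolding f_\<sigma>_pow[OF j n] fix1 funpow_Suc_right by (simp only: power_Suc2)
    finally show ?case .
  qed
  from this[of p] have "U j [^]\<^bsub>C\<^esub> p = V (R j ^ p * h (z j)) (\<sigma> j ^^ p)" by simp
  \<comment> \<open>The p-th power of \<sigma>_j lies in \<open>N\<close>, which \<open>V\<close>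
    does not distinguish from the identity.\<close>
  also have "\<dots> = V (h (bb j)) id"
    using j by (intro V_cong) (simp_all add: R_pow funpow_\<Gamma> \<sigma> id_\<Gamma> funpow_\<kappa> \<kappa>_id)
  finally show ?thesis unfolding V_h .
qed

lemma U_Y:
  assumes "i \<in> {1..t}" "j \<in> {1..t}"
  shows "U i \<otimes>\<^bsub>C\<^esub> Y j = (if i = j then \<zeta> else 1) \<odot>\<^bsub>C\<^esub> (Y j \<otimes>\<^bsub>C\<^esub> U i)"
proof -
  have "U i \<otimes>\<^bsub>W\<^esub> Y j = V (R i * \<sigma> i (\<alpha> j)) (\<sigma> i)"
    unfolding U_def Y_def using assms by (simp add: V_mult \<sigma> id_\<Gamma> K_ops(7) f_id h_one)
  also have "\<dots> = (if i = j then \<zeta> else 1) \<odot>\<^bsub>W\<^esub> V (\<alpha> j * R i) (\<sigma> i)"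
    using assms by (auto simp: V_smult \<sigma> \<sigma>_\<alpha> h_one mult_ac)
  also have "V (\<alpha> j * R i) (\<sigma> i) = Y j \<otimes>\<^bsub>W\<^esub> U i"
    unfolding U_def Y_def using assms by (simp add: V_mult \<sigma> id_\<Gamma> R_K f_id h_one)
  finally show ?thesis unfolding corner_simps .
qed

lemma Y_Y: "i \<in> {1..t} ==> j \<in> {1..t} ==> Y i \<otimes>\<^bsub>C\<^esub> Y j = Y j \<otimes>\<^bsub>C\<^esub> Y i"
  unfolding Y_def by (simp add: V_id_mult K_ops(7) mult.commute)

text \<open>Moving \<sigma>_i past R_j on one side costs the same scalar as
  \<open>f (\<sigma> j) (\<sigma> i)\<close> on the other; \<sigma>_j fixes R_i because i <
  j.\<close>

lemma U_U:
  assumes "i \<in> {1..t}" "j \<in> {1..t}" "i < j"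
  shows "U i \<otimes>\<^bsub>C\<^esub> U j = U j \<otimes>\<^bsub>C\<^esub> U i"
proof -
  have "V (R i * \<sigma> i (R j) * h (f (\<sigma> i) (\<sigma> j))) (\<sigma> i \<circ> \<sigma> j) = V (R j * \<sigma> j (R i) * h (f (\<sigma> j) (\<sigma> i))) (\<sigma> j \<circ> \<sigma> i)"
    by (rule V_cong)
      (use assms in \<open>simp_all add: comp_\<Gamma> \<sigma> \<sigma>_R f_\<sigma> h_one \<kappa>_comp add.commute del: o_apply\<close>)
  then show ?thesis unfolding U_def using assms by (simp add: V_mult \<sigma> R_K)
qed

text \<open>A subalgebra that contains all \<open>U j\<close> and \<open>Y j\<close> is shown to
  contain every \<open>V x \<tau>\<close>. The case of the identity automorphism amounts to
  generating the field \<open>K\<close>.\<close>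

context
  fixes M
  assumes M: "subalg C M" and UM: "\<And>j. j \<in> {1..t} ==> U j \<in> M" and YM: "\<And>j. j \<in> {1..t} ==> Y j \<in> M"
begin

lemma M_ops: "x \<in> M ==> y \<in> M ==> x \<oplus>\<^bsub>W\<^esub> y \<in> M" "x \<in> M ==> y \<in> M ==> x \<otimes>\<^bsub>W\<^esub> y \<in> M"
    "x \<in> M ==> c \<odot>\<^bsub>W\<^esub> x \<in> M" "e \<in> M"
  using M unfolding subalg_def corner_simps by blast+

lemma M_h: "V (h c) id \<in> M"
  unfolding V_h corner_simps by (rule M_ops(3)[OF M_ops(4)])

lemma M_mult: "x \<in> K ==> y \<in> K ==> V x id \<in> M ==> V y id \<in> M ==> V (x * y) id \<in> M"
  unfolding V_id_mult[symmetric] by (rule M_ops(2))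

lemma M_sum: "finite I ==> (\<And>i. i \<in> I ==> V (g i) id \<in> M) ==> V (\<Sum>i\<in>I. g i) id \<in> M"
proof (induction I rule: finite_induct)
  case empty
  show ?case unfolding sum.empty using M_h[of 0] unfolding h_0 .
next
  case (insert x F)
  then have "V (g x) id \<oplus>\<^bsub>W\<^esub> V (\<Sum>i\<in>F. g i) id \<in> M" by (intro M_ops(1)) blast+
  then show ?case unfolding sum.insert[OF insert.hyps(1,2)] V_add[OF id_\<Gamma>] .
qed

text \<open>Kummer theory by Lagrange resolvents. The induction is on the last index whose \<sigma>
  may move \<open>x\<close>: splitting \<open>x\<close> into eigenvectors of that \<sigma> and
  dividing an eigenvector for \<zeta>^c by the c-th power of the matching \<alpha> makes it
  invariant.\<close>

lemma M_K: 
  assumes x: "x \<in> K"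
  shows "V x id \<in> M"
proof -
  have "V x id \<in> M" if "q \<le> t" "x \<in> K" "\<forall>i\<in>{1..t}. q < i \<longrightarrow> \<sigma> i x = x" for q x
    using that
  proof (induction q arbitrary: x)
    case 0
    \<comment> \<open>Fixed by \<open>N\<close> and by every \<sigma>_i, hence by the whole Galois
      group according to \<open>gamma_induct\<close>.\<close>
    have "x \<in> range h"
    proof (rule fixed)
      fix \<tau> assume "\<tau> \<in> \<Gamma>"
      then show "\<tau> x = x"
        by (induction \<tau> rule: gamma_induct) (use 0 in \<open>auto simp: K_def\<close>)
    qed
    then obtain c where "x = h c" by (rule rangeE)
    then show ?case using M_h[of c] by (simp only:)
  next
    case (Suc q)
    let ?s = "\<sigma> (Suc q)" and ?\<alpha> = "\<alpha> (Suc q)" and ?\<theta> = "inverse \<zeta>"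
    have q: "Suc q \<in> {1..t}" using Suc.prems(1) by simp
    have \<theta>p: "?\<theta> ^ p = 1" using \<zeta>p by (simp add: power_inverse)
    have \<theta>: "primitive_root_of_unity p ?\<theta>"
      using prim unfolding primitive_root_of_unity_def power_inverse by (metis inverse_1 inverse_inverse_eq)
    have xp: "(?s ^^ p) x = x" using funpow_p[OF q] Suc.prems(2) by (simp add: K_def)
    have pw: "(?s ^^ m) x \<in> K" for m by (rule K_stable[OF Suc.prems(2) funpow_\<Gamma>[OF \<sigma>[OF q]]])
    \<comment> \<open>The Lagrange resolvent for the eigenvalue \<zeta>^c; the p-th power of
      \<sigma> acts trivially on \<open>K\<close>, so the sum over m < p is cyclic.\<close>
    define y where "y c = (\<Sum>m<p. h (?\<theta> ^ (m * c)) * (?s ^^ m) x)" for c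
    have yK: "y c \<in> K" for c unfolding y_def by (intro K_sum K_ops(1,3) pw)
    have sy: "?s (y c) = h (\<zeta> ^ c) * y c" for c
    proof -
      let ?g = "\<lambda>m. h (?\<theta> ^ (m * c)) * (?s ^^ m) x"
      have "?g p = ?g 0"
        using xp \<theta>p by (simp add: power_mult)
      then have shift: "(\<Sum>m<p. ?g (Suc m)) = (\<Sum>m<p. ?g m)"
        using sum.lessThan_Suc_shift[of ?g p] sum.lessThan_Suc[of ?g p] by simp
      have "?s (y c) = (\<Sum>m<p. h (?\<theta> ^ (m * c)) * (?s ^^ Suc m) x)"
        unfolding y_def act_sum[OF \<sigma>[OF q]] by (simp add: act_mult act_h \<sigma>[OF q])
      also have "\<dots> = (\<Sum>m<p. h (\<zeta> ^ c) * ?g (Suc m))"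
      proof (rule sum.cong[OF refl])
        fix m
        have "\<zeta> ^ c * ?\<theta> ^ (Suc m * c) = ?\<theta> ^ (m * c)"
          using \<zeta>0 by (simp add: power_add field_simps power_inverse)
        then show "h (?\<theta> ^ (m * c)) * (?s ^^ Suc m) x = h (\<zeta> ^ c) * ?g (Suc m)"
          by (simp only: h_mult[symmetric] mult.assoc[symmetric])
      qed
      also have "\<dots> = h (\<zeta> ^ c) * y c"
        unfolding sum_distrib_left[symmetric] shift y_def ..
      finally show ?thesis .
    qed
    have yM: "V (y c) id \<in> M" for c
    proof -
      \<comment> \<open>Invariant under \<open>?s\<close> because eigenvalues cancel, and under the
        later \<sigma>_i because these commute with \<open>?s\<close> on \<open>K\<close> and fix
        both \<open>x\<close> and \<open>?\<alpha>\<close>; so the induction hypothesis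
        applies.\<close>
      let ?v = "y c * inverse (?\<alpha> ^ c)"
      have vK: "?v \<in> K" by (intro K_ops(1,4) yK K_power K_ops(7)[OF q])
      have "V ?v id \<in> M"
      proof (rule Suc.IH[OF _ vK], use q in simp, intro ballI impI)
        fix i assume i: "i \<in> {1..t}" "q < i"
        show "\<sigma> i ?v = ?v"
        proof (cases "i = Suc q")
          case True
          have "h (\<zeta> ^ c) \<noteq> 0" using \<zeta>0 h_nz by (metis power_eq_0_iff)
          then show ?thesis unfolding True
            by (simp add: act_mult act_inverse act_power \<sigma>[OF q] sy \<sigma>_\<alpha>[OF q q] power_mult_distrib h_power)
        next
          case False
          then have "\<sigma> i x = x" using Suc.prems(3) i by simp
          then have "\<sigma> i (y c) = y c"
            unfolding y_def act_sum[OF \<sigma>[OF i(1)]]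
            by (simp add: act_mult act_h \<sigma>[OF i(1)] K_commute[OF Suc.prems(2) \<sigma>[OF i(1)] funpow_\<Gamma>[OF \<sigma>[OF q]]])
          then show ?thesis
            using False by (simp add: act_mult act_inverse act_power \<sigma>[OF i(1)] \<sigma>_\<alpha>[OF q i(1)])
        qed
      qed
      moreover have "V (?\<alpha> ^ c) id \<in> M"
        unfolding V_id_pow[OF K_ops(7)[OF q], symmetric]
        using C.subalg_nat_pow[OF M YM[OF q]] by (simp add: Y_def)
      ultimately have "V (?v * ?\<alpha> ^ c) id \<in> M"
        by (rule M_mult[OF vK K_power[OF K_ops(7)[OF q]]])
      moreover have "?v * ?\<alpha> ^ c = y c" using \<alpha>0[OF q] by (simp add: mult.assoc)
      ultimately show ?thesis by (simp only:)
    qed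
    \<comment> \<open>The resolvents add up to p x by orthogonality of the powers of \<zeta>, and p
      is invertible in \<open>k\<close>.\<close>
    have "(\<Sum>c<p. y c) = (\<Sum>m<p. h (\<Sum>c<p. ?\<theta> ^ (c * m)) * (?s ^^ m) x)"
      unfolding y_def by (subst sum.swap) (simp add: h_sum sum_distrib_left sum_distrib_right mult_ac)
    also have "\<dots> = (\<Sum>m<p. if m = 0 then h (of_nat p) * x else 0)"
      by (rule sum.cong[OF refl]) (simp add: sum_power_root[OF \<theta>] h_0)
    also have "\<dots> = h (of_nat p) * x" using p0 by simp
    finally have sum: "(\<Sum>c<p. y c) = h (of_nat p) * x" .
    have "h (of_nat p) \<noteq> 0" using pk h_nz by blast
    then have "(\<Sum>c<p. h (inverse (of_nat p)) * y c) = x"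
      unfolding sum_distrib_left[symmetric] sum h_inverse by (simp flip: mult.assoc)
    moreover have "V (\<Sum>c<p. h (inverse (of_nat p)) * y c) id \<in> M"
      by (intro M_sum M_mult K_ops(3) yK M_h yM) simp
    ultimately show ?case by (simp only:)
  qed
  from this[OF order_refl x] show ?thesis by simp
qed

text \<open>By \<open>gamma_induct\<close> it is enough to treat three cases: on \<open>N\<close>
  the element \<open>V 1 \<nu>\<close> is the unit \<open>e\<close>, for \<sigma>_j the invertible
  R_j can be divided out of \<open>U j\<close>, and a composition costs only the nonzero scalar
  \<open>f\<close>.\<close>

lemma M_V:
  assumes x: "x \<in> K" and \<tau>: "\<tau> \<in> \<Gamma>"
  shows "V x \<tau> \<in> M"
proof -
  have "V 1 \<tau> \<in> M"
    using \<tau>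
  proof (induction \<tau> rule: gamma_induct)
    case (kernel \<nu>)
    have "V 1 \<nu> = V 1 id" by (rule V_coset) (simp_all add: ND kernel id_\<Gamma> \<kappa>_id)
    then show ?case using M_ops(4) by (simp add: V_e)
  next
    case (gen j)
    have "V (inverse (R j)) id \<otimes>\<^bsub>W\<^esub> U j = V 1 (\<sigma> j)"
      unfolding U_def using R_nz[OF gen] gen by (simp add: V_mult id_\<Gamma> \<sigma> R_K f_id h_one)
    moreover have "V (inverse (R j)) id \<otimes>\<^bsub>W\<^esub> U j \<in> M"
      by (intro M_ops(2) M_K K_ops(4) R_K gen UM)
    ultimately show ?case by simp
  next
    case (comp \<tau> \<rho>)
    have "inverse (f \<tau> \<rho>) \<odot>\<^bsub>W\<^esub> (V 1 \<tau> \<otimes>\<^bsub>W\<^esub> V 1 \<rho>) = V 1 (\<tau> \<circ> \<rho>)"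
      using comp(1,2) f_nz[of \<tau> \<rho>] h_nz[of "f \<tau> \<rho>"]
      by (simp add: V_mult K_ops(6) act_1 V_smult comp_\<Gamma> h_inverse del: o_apply)
        (metis left_inverse)
    moreover have "inverse (f \<tau> \<rho>) \<odot>\<^bsub>W\<^esub> (V 1 \<tau> \<otimes>\<^bsub>W\<^esub> V 1 \<rho>) \<in> M"
      by (intro M_ops(2,3) comp)
    ultimately show ?case by (simp only:)
  qed
  then have "V x id \<otimes>\<^bsub>W\<^esub> V 1 \<tau> \<in> M" by (intro M_ops(2) M_K x)
  then show ?thesis using \<tau> by (simp add: V_mult id_\<Gamma> K_ops(6) f_id h_one)
qed

end

lemma corner_generated: "generated_by C (U ` {1..t} \<union> Y ` {1..t})"
proof (rule generated_byI)
  show "U ` {1..t} \<union> Y ` {1..t} \<subseteq> carrier C" by (intro Un_least image_subsetI UY_closed)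
  fix M x assume M: "subalg C M" "U ` {1..t} \<union> Y ` {1..t} \<subseteq> M" and x: "x \<in> carrier C"
  have V: "V y \<tau> \<in> M" if "y \<in> K" "\<tau> \<in> \<Gamma>" for y \<tau>
    by (rule M_V[OF M(1) _ _ that]) (use M(2) in blast)+
  show "x \<in> M" by (rule corner_in_subalg[OF M(1) _ x]) (rule V)
qed

text \<open>The tensor product of the symbols maps onto the corner because the \<open>U j\<close>
  and \<open>Y j\<close> generate it, and injectively because it is simple; the corner in turn is
  Brauer equivalent to the crossed product.\<close>

lemma class_W: "brauer_class W = (\<Otimes>\<^bsub>brauer_group\<^esub>j\<in>{1..t}. brauer_class (symbol_algebra p (a j) (bb j) \<zeta>))"
proof -
  have "\<exists>S \<phi> gs. simple_central (sc_algebra S) \<and>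
      brauer_class (sc_algebra S) = (\<Otimes>\<^bsub>brauer_group\<^esub>j\<in>{1..t}. brauer_class (symbol_algebra p (a j) (bb j) \<zeta>)) \<and>
      kalg_hom (sc_algebra S) C \<phi> \<and> generated_by (sc_algebra S) gs \<and> \<phi> ` gs = U ` {1..t} \<union> Y ` {1..t}"
  proof (rule symbol_tensor_hom[OF corner(1) p2 prim UY_closed a0 bb_nz U_pow Y_pow])
    show "U j \<otimes>\<^bsub>C\<^esub> Y j = \<zeta> \<odot>\<^bsub>C\<^esub> (Y j \<otimes>\<^bsub>C\<^esub> U j)" if "j \<in> {1..t}" for j
      using U_Y[OF that that] by (simp only: if_True refl)
    have UY: "U i \<otimes>\<^bsub>C\<^esub> Y j = Y j \<otimes>\<^bsub>C\<^esub> U i" if "i \<in> {1..t}" "j \<in> {1..t}" "i \<noteq> j" for i j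
      unfolding U_Y[OF that(1,2)] using that
      by (simp only: if_False C.smult_1 C.m_closed UY_closed)
    show "g \<otimes>\<^bsub>C\<^esub> v = v \<otimes>\<^bsub>C\<^esub> g" if ij: "i \<in> {1..t}" "j \<in> {1..t}" "i < j" and "g \<in> {U i, Y i}" "v \<in> {U j, Y j}" for i j g v
    proof -
      have ne: "i \<noteq> j" "j \<noteq> i" using ij by auto
      consider "g = U i" "v = U j" | "g = U i" "v = Y j" | "g = Y i" "v = U j" | "g = Y i" "v = Y j"
        using \<open>g \<in> {U i, Y i}\<close> \<open>v \<in> {U j, Y j}\<close> by blast
      then show ?thesis
      proof cases
        case 1 show ?thesis unfolding 1 by (rule U_U[OF ij])
      next
        case 2 show ?thesis unfolding 2 by (rule UY[OF ij(1,2) ne(1)])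
      next
        case 3 show ?thesis unfolding 3 by (rule UY[OF ij(2,1) ne(2), symmetric])
      next
        case 4 show ?thesis unfolding 4 by (rule Y_Y[OF ij(1,2)])
      qed
    qed
  qed (assumption | rule order_refl)+
  then obtain S \<phi> gs where S: "simple_central (sc_algebra S)"
      "brauer_class (sc_algebra S) = (\<Otimes>\<^bsub>brauer_group\<^esub>j\<in>{1..t}. brauer_class (symbol_algebra p (a j) (bb j) \<zeta>))"
      "kalg_hom (sc_algebra S) C \<phi>" "generated_by (sc_algebra S) gs" "\<phi> ` gs = U ` {1..t} \<union> Y ` {1..t}"
    by blast
  have kS: "kalg (sc_algebra S)" using S(1) unfolding simple_central_def by (rule conjunct1)
  have "iso_rel (sc_algebra S) C"
  proof (rule kalg_hom_iso_rel[OF S(3,1)])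
    show "\<one>\<^bsub>C\<^esub> \<noteq> \<zero>\<^bsub>C\<^esub>" unfolding corner_simps by (rule e_nz)
    fix y assume "y \<in> carrier C"
    then show "\<exists>x\<in>carrier (sc_algebra S). y = \<phi> x"
      by (rule kalg_hom.surj_of_generated[OF S(3) corner_generated, rotated])
        (unfold S(5)[symmetric], rule image_mono[OF generated_by_subset[OF S(4)]])
  qed
  then have "brauer_class (sc_algebra S) = brauer_class C"
    by (intro brauer_class_eqI iso_rel_imp_brauer_equiv kS corner(1))
  moreover have "brauer_class W = brauer_class C"
    by (rule brauer_class_eqI[OF corner(2) W.kalg_axioms corner(1)])
  ultimately show ?thesis using S(2) by simp
qed

end

context kummer_product
begin

lemma brauer_class_crossed_product:
  "brauer_class (crossed_product h (\<lambda>(\<tau>, \<rho>). h (f \<tau> \<rho>))) =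
    (\<Otimes>\<^bsub>brauer_group\<^esub>j\<in>{1..t}. brauer_class (symbol_algebra p (a j) (z j * (\<Prod>i\<in>{1..<j}. a i ^ d i j)) \<zeta>))"
proof -
  obtain l :: nat and b w where dual: "0 < l" "\<And>\<nu>. \<nu> \<in> N ==> (\<Sum>i<l. b i * \<nu> (w i)) = (if \<nu> = id then 1 else 0)"
    "\<And>i j. i < l ==> j < l ==> NG.tr (w i * b j) = (if i = j then 1 else 0)"
  proof (rule NG.dual_basis)
    fix l :: nat and b w
    assume 1: "0 < l" and 2: "\<And>\<nu>. \<nu> \<in> N ==> (\<Sum>i<l. b i * \<nu> (w i)) = (if \<nu> = id then 1 else 0)"
      and 3: "\<And>i j. i < l ==> j < l ==> NG.tr (w i * b j) = (if i = j then 1 else 0)"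
    show thesis
    proof (rule that)
      show "0 < l" by (rule 1)
      show "(\<Sum>i<l. b i * \<nu> (w i)) = (if \<nu> = id then 1 else 0)" if "\<nu> \<in> N" for \<nu> by (rule 2[OF that])
      show "NG.tr (w i * b j) = (if i = j then 1 else 0)" if "i < l" "j < l" for i j by (rule 3[OF that])
    qed
  qed
  interpret kummer_corner p t \<zeta> h a z \<alpha> \<sigma> \<kappa> d l b w by unfold_locales
      (rule dual(1), rule dual(2), assumption, rule dual(3), assumption+)
  show ?thesis using class_W unfolding crossed_product_eq_twisted bb_def .
qed

end

section \<open>Products of symbol algebras\<close>

lemma symbolI: "[|2 \<le> p; primitive_root_of_unity p \<zeta>; a \<noteq> 0; b \<noteq> 0|] ==> symbol p a b \<zeta>"
  by (rule symbol.intro)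

text \<open>Replacing i_1 by c^(-1) i_1 turns the relations of (a, c^p) into those of (a,
  1).\<close>

lemma symbol_class_power_p:
  fixes a c \<zeta> :: "'k::field"
  assumes p2: "2 \<le> p" and prim: "primitive_root_of_unity p \<zeta>" and a: "a \<noteq> 0" and c: "c \<noteq> 0"
    and pk: "of_nat p \<noteq> (0 :: 'k)"
  shows "brauer_class (symbol_algebra p a (c ^ p) \<zeta>) = \<one>\<^bsub>brauer_group\<^esub>"
proof -
  interpret s: symbol p a 1 \<zeta> by (rule symbolI[OF p2 prim a one_neq_zero])
  interpret t: symbol p a "c ^ p" \<zeta> by (rule symbolI[OF p2 prim a power_not_zero[OF c]])
  interpret tW: kalg t.W by (rule t.kalg_twisted)
  interpret sW: kalg s.W by (rule s.kalg_twisted)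
  let ?x = "inverse c \<odot>\<^bsub>t.W\<^esub> t.i1"
  have x: "?x \<in> carrier t.W" by (rule tW.smult_closed[OF t.i_closed(1)])
  obtain F where F: "kalg_hom s.W t.W F" "F s.i1 = ?x" "F s.i2 = t.i2"
  proof (rule s.symbol_hom[OF tW.kalg_axioms x t.i_closed(2)])
    show "?x [^]\<^bsub>t.W\<^esub> p = 1 \<odot>\<^bsub>t.W\<^esub> \<one>\<^bsub>t.W\<^esub>"
      unfolding tW.smult_pow[OF t.i_closed(1)] t.i_relations(1) tW.smult_smult[OF tW.one_closed]
      using c by (simp add: power_inverse)
    show "t.i2 [^]\<^bsub>t.W\<^esub> p = a \<odot>\<^bsub>t.W\<^esub> \<one>\<^bsub>t.W\<^esub>" by (rule t.i_relations(2))
    show "?x \<otimes>\<^bsub>t.W\<^esub> t.i2 = \<zeta> \<odot>\<^bsub>t.W\<^esub> (t.i2 \<otimes>\<^bsub>t.W\<^esub> ?x)"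
      by (simp only: tW.smult_lmult tW.smult_rmult t.i_closed t.i_relations(3) tW.smult_smult tW.m_closed mult.commute)
  qed
  interpret F: kalg_hom s.W t.W F by (rule F(1))
  have scs: "simple_central s.W" using s.simple_central_symbol unfolding s.symbol_eq_W .
  have sct: "simple_central t.W" using t.simple_central_symbol unfolding t.symbol_eq_W .
  have "iso_rel s.W t.W"
  proof (rule kalg_hom_iso_rel[OF F(1) scs])
    show "\<one>\<^bsub>t.W\<^esub> \<noteq> \<zero>\<^bsub>t.W\<^esub>" using sct unfolding simple_central_def by (elim conjE)
    fix y assume y: "y \<in> carrier t.W"
    show "\<exists>x\<in>carrier s.W. y = F x"
    proof (rule F.surj_of_generated[OF t.generated_symbol _ y])
      have "F (c \<odot>\<^bsub>s.W\<^esub> s.i1) = t.i1"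
        unfolding F.hom_smult[OF s.i_closed(1)] F(2) tW.smult_smult[OF t.i_closed(1)]
        using c by (simp add: t.i_closed)
      then have "t.i1 \<in> F ` carrier s.W" using sW.smult_closed[OF s.i_closed(1)] by (metis imageI)
      moreover have "t.i2 \<in> F ` carrier s.W" using F(3) s.i_closed(2) by (metis imageI)
      ultimately show "{t.i1, t.i2} \<subseteq> F ` carrier s.W" by simp
    qed
  qed
  then have "brauer_class s.W = brauer_class t.W"
    by (rule brauer_class_eqI[OF iso_rel_imp_brauer_equiv]) (rule sW.kalg_axioms tW.kalg_axioms)+
  then show ?thesis
    using s.brauer_class_trivial[OF pk disjI2[OF refl]] unfolding s.symbol_eq_W t.symbol_eq_W by simp
qed

context
  fixes p :: nat and \<zeta> :: "'k::field"
  assumes p2: "2 \<le> p" and prim: "primitive_root_of_unity p \<zeta>" and pk: "of_nat p \<noteq> (0 :: 'k)"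
begin

interpretation br: comm_monoid "brauer_group :: 'k struct_consts set monoid" by (rule comm_monoid_brauer_group)

abbreviation (input) sy :: "'k => 'k => 'k struct_consts set" where
  "sy x y \<equiv> brauer_class (symbol_algebra p x y \<zeta>)"

lemma sy_closed: "x \<noteq> 0 ==> y \<noteq> 0 ==> sy x y \<in> carrier brauer_group"
  by (rule symbol.symbol_class_closed[OF symbolI[OF p2 prim]])

lemma sy_one: "x \<noteq> 0 ==> sy x 1 = \<one>\<^bsub>brauer_group\<^esub>"
  by (rule symbol.brauer_class_trivial[OF symbolI[OF p2 prim _ one_neq_zero] pk disjI2[OF refl]])

lemma sy_mult: "x \<noteq> 0 ==> y \<noteq> 0 ==> w \<noteq> 0 ==> sy x (y * w) = sy x y \<otimes>\<^bsub>brauer_group\<^esub> sy x w"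
  by (rule symbol_class_bilinear[OF p2 prim _ _ _ pk, symmetric])

lemma sy_pow:
  assumes "x \<noteq> 0" "y \<noteq> 0"
  shows "sy x (y ^ n) = sy x y [^]\<^bsub>brauer_group\<^esub> (n::nat)"
proof (induction n)
  case 0
  show ?case using sy_one[OF assms(1)] by simp
next
  case (Suc n)
  have "sy x (y ^ Suc n) = sy x (y ^ n) \<otimes>\<^bsub>brauer_group\<^esub> sy x y"
    unfolding power_Suc2 by (rule sy_mult[OF assms(1) power_not_zero[OF assms(2)] assms(2)])
  then show ?case unfolding Suc.IH br.nat_pow_Suc .
qed

lemma sy_prod:
  assumes x: "x \<noteq> 0" and "finite I" "\<And>i. i \<in> I ==> g i \<noteq> 0"
  shows "sy x (\<Prod>i\<in>I. g i ^ e i) = (\<Otimes>\<^bsub>brauer_group\<^esub>i\<in>I. sy x (g i) [^]\<^bsub>brauer_group\<^esub> (e i :: nat))"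
  using assms(2,3)
proof (induction I rule: finite_induct)
  case empty
  show ?case using sy_one[OF x] by simp
next
  case (insert i I)
  have g: "g j \<noteq> 0" if "j \<in> insert i I" for j using insert.prems that by blast
  have cl: "sy x (g j) [^]\<^bsub>brauer_group\<^esub> e j \<in> carrier brauer_group" if "j \<in> insert i I" for j
    by (rule br.nat_pow_closed[OF sy_closed[OF x g[OF that]]])
  have nz: "(\<Prod>i\<in>I. g i ^ e i) \<noteq> 0" using g insert.hyps(1) by simp
  have "sy x (\<Prod>i\<in>insert i I. g i ^ e i) = sy x (g i ^ e i) \<otimes>\<^bsub>brauer_group\<^esub> sy x (\<Prod>i\<in>I. g i ^ e i)"
    unfolding prod.insert[OF insert.hyps] by (rule sy_mult[OF x power_not_zero[OF g] nz]) simp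
  also have "\<dots> = sy x (g i) [^]\<^bsub>brauer_group\<^esub> e i \<otimes>\<^bsub>brauer_group\<^esub> (\<Otimes>\<^bsub>brauer_group\<^esub>i\<in>I. sy x (g i) [^]\<^bsub>brauer_group\<^esub> e i)"
    using insert.IH g by (simp add: sy_pow[OF x])
  also have "\<dots> = (\<Otimes>\<^bsub>brauer_group\<^esub>i\<in>insert i I. sy x (g i) [^]\<^bsub>brauer_group\<^esub> e i)"
    by (rule br.finprod_insert[symmetric]) (use insert.hyps cl in auto)
  finally show ?case .
qed

text \<open>Bilinearity expands the second slot of every symbol; what remains is to reorganise the
  iterated product over j and i < j as a product over pairs.\<close>

lemma symbol_product:
  fixes a z :: "nat => 'k" and d :: "nat => nat => nat"
  assumes a: "\<And>i. i \<in> {1..t} ==> a i \<noteq> 0" and z: "\<And>i. i \<in> {1..t} ==> z i \<noteq> 0"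
  shows "(\<Otimes>\<^bsub>brauer_group\<^esub>j\<in>{1..t}. sy (a j) (z j * (\<Prod>i\<in>{1..<j}. a i ^ d i j))) =
    (\<Otimes>\<^bsub>brauer_group\<^esub>j\<in>{1..t}. sy (a j) (z j)) \<otimes>\<^bsub>brauer_group\<^esub>
      finprod brauer_group (\<lambda>(i, j). sy (a j) (a i) [^]\<^bsub>brauer_group\<^esub> d i j) {(i, j). i \<in> {1..t} \<and> j \<in> {1..t} \<and> i < j}"
proof -
  let ?g = "\<lambda>(i, j). sy (a j) (a i) [^]\<^bsub>brauer_group\<^esub> d i j"
  have cl: "sy (a j) (a i) [^]\<^bsub>brauer_group\<^esub> d i j \<in> carrier brauer_group" if "i \<in> {1..t}" "j \<in> {1..t}" for i j
    by (rule br.nat_pow_closed[OF sy_closed[OF a[OF that(2)] a[OF that(1)]]])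
  have sub: "i \<in> {1..t}" if "i \<in> {1..<j}" "j \<in> {1..t}" for i j using that by auto
  have "(\<Otimes>\<^bsub>brauer_group\<^esub>j\<in>{1..t}. sy (a j) (z j * (\<Prod>i\<in>{1..<j}. a i ^ d i j))) =
    (\<Otimes>\<^bsub>brauer_group\<^esub>j\<in>{1..t}. sy (a j) (z j) \<otimes>\<^bsub>brauer_group\<^esub> (\<Otimes>\<^bsub>brauer_group\<^esub>i\<in>{1..<j}. sy (a j) (a i) [^]\<^bsub>brauer_group\<^esub> d i j))"
  proof (rule br.finprod_cong'[OF refl])
    show "(\<lambda>j. sy (a j) (z j) \<otimes>\<^bsub>brauer_group\<^esub> (\<Otimes>\<^bsub>brauer_group\<^esub>i\<in>{1..<j}. sy (a j) (a i) [^]\<^bsub>brauer_group\<^esub> d i j)) \<in> {1..t} \<rightarrow> carrier brauer_group"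
      by (intro Pi_I br.m_closed sy_closed br.finprod_closed a z cl) (assumption | rule sub, assumption)+
    fix j assume j: "j \<in> {1..t}"
    have nz: "(\<Prod>i\<in>{1..<j}. a i ^ d i j) \<noteq> 0" using a[OF sub[OF _ j]] by simp
    show "sy (a j) (z j * (\<Prod>i\<in>{1..<j}. a i ^ d i j)) =
        sy (a j) (z j) \<otimes>\<^bsub>brauer_group\<^esub> (\<Otimes>\<^bsub>brauer_group\<^esub>i\<in>{1..<j}. sy (a j) (a i) [^]\<^bsub>brauer_group\<^esub> d i j)"
    proof -
      have "sy (a j) (\<Prod>i\<in>{1..<j}. a i ^ d i j) = (\<Otimes>\<^bsub>brauer_group\<^esub>i\<in>{1..<j}. sy (a j) (a i) [^]\<^bsub>brauer_group\<^esub> d i j)"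
        by (rule sy_prod[OF a[OF j]]) (rule finite_atLeastLessThan, rule a[OF sub[OF _ j]])
      then show ?thesis unfolding sy_mult[OF a[OF j] z[OF j] nz] by (simp only:)
    qed
  qed
  also have "\<dots> = (\<Otimes>\<^bsub>brauer_group\<^esub>j\<in>{1..t}. sy (a j) (z j)) \<otimes>\<^bsub>brauer_group\<^esub>
      (\<Otimes>\<^bsub>brauer_group\<^esub>j\<in>{1..t}. (\<Otimes>\<^bsub>brauer_group\<^esub>i\<in>{1..<j}. sy (a j) (a i) [^]\<^bsub>brauer_group\<^esub> d i j))"
    by (rule br.finprod_multf; intro Pi_I sy_closed br.finprod_closed a z cl; (assumption | rule sub, assumption)+)
  also have "(\<Otimes>\<^bsub>brauer_group\<^esub>j\<in>{1..t}. (\<Otimes>\<^bsub>brauer_group\<^esub>i\<in>{1..<j}. sy (a j) (a i) [^]\<^bsub>brauer_group\<^esub> d i j)) =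
      (\<Otimes>\<^bsub>brauer_group\<^esub>j\<in>{1..t}. finprod brauer_group ?g ((\<lambda>i. (i, j)) ` {1..<j}))"
  proof (rule br.finprod_cong'[OF refl])
    have im: "?g \<in> (\<lambda>i. (i, j)) ` {1..<j} \<rightarrow> carrier brauer_group" if "j \<in> {1..t}" for j
      using cl[OF sub[OF _ that] that] by auto
    show "(\<lambda>j. finprod brauer_group ?g ((\<lambda>i. (i, j)) ` {1..<j})) \<in> {1..t} \<rightarrow> carrier brauer_group"
      by (intro Pi_I br.finprod_closed im)
    fix j assume j: "j \<in> {1..t}"
    show "(\<Otimes>\<^bsub>brauer_group\<^esub>i\<in>{1..<j}. sy (a j) (a i) [^]\<^bsub>brauer_group\<^esub> d i j) = finprod brauer_group ?g ((\<lambda>i. (i, j)) ` {1..<j})"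
      by (subst br.finprod_reindex[OF im[OF j]]) (simp_all add: inj_on_def)
  qed
  \<comment> \<open>The pairs are partitioned by their second component.\<close>
  also have "\<dots> = finprod brauer_group ?g (\<Union>((\<lambda>j. (\<lambda>i. (i, j)) ` {1..<j}) ` {1..t}))"
  proof (rule br.finprod_UN_disjoint[symmetric])
    show "?g x \<in> carrier brauer_group" if "j \<in> {1..t}" "x \<in> (\<lambda>i. (i, j)) ` {1..<j}" for j x
      using that cl[OF sub[OF _ that(1)] that(1)] by auto
  qed (auto simp: pairwise_def disjnt_def)
  also have "(\<Union>((\<lambda>j. (\<lambda>i. (i, j)) ` {1..<j}) ` {1..t})) = {(i, j). i \<in> {1..t} \<and> j \<in> {1..t} \<and> i < j}"
  proof (rule equalityI; rule subsetI)
    fix x assume "x \<in> {(i, j). i \<in> {1..t} \<and> j \<in> {1..t} \<and> i < j}"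
    then obtain i j where "x = (i, j)" "i \<in> {1..<j}" "j \<in> {1..t}" by auto
    then show "x \<in> (\<Union>j\<in>{1..t}. (\<lambda>i. (i, j)) ` {1..<j})" by blast
  qed auto
  finally show ?thesis .
qed

end

section \<open>The obstruction as a crossed product\<close>

lemma group_mult_of_field: "group (mult_of field_ring :: 'k::field monoid)"
proof (rule groupI)
  show "\<exists>y\<in>carrier (mult_of field_ring). y \<otimes>\<^bsub>mult_of field_ring\<^esub> x = \<one>\<^bsub>mult_of field_ring\<^esub>"
    if "x \<in> carrier (mult_of field_ring)" for x :: 'k
    using that by (intro bexI[of _ "inverse x"]) auto
qed auto

lemma inv_mult_of_field: "x \<noteq> 0 ==> inv\<^bsub>mult_of field_ring\<^esub> x = inverse (x :: 'k::field)"
  by (rule group.inv_equality[OF group_mult_of_field]) auto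

lemma root_group_simps:
  "x \<otimes>\<^bsub>root_group \<zeta>\<^esub> y = x * y" "\<one>\<^bsub>root_group \<zeta>\<^esub> = 1"
  by (simp_all add: root_group_def subgroup_generated_def)

lemma root_group_nz: "x \<in> carrier (root_group \<zeta>) ==> x \<noteq> 0"
  unfolding root_group_def carrier_subgroup_generated
  using group.generate_in_carrier[OF group_mult_of_field, of "carrier (mult_of field_ring) \<inter> {\<zeta>}" x] by auto

lemma inv_root_group: "x \<in> carrier (root_group \<zeta>) ==> inv\<^bsub>root_group \<zeta>\<^esub> x = inverse x"
  using group.inv_subgroup_generated[OF group_mult_of_field, of x "{\<zeta>}"] root_group_nz[of x \<zeta>] inv_mult_of_field
  unfolding root_group_def by metis

text \<open>Cohomologous cocycles give isomorphic algebras: the basis element u_\<sigma> is rescaled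
  by \<open>b \<sigma>\<close>, so coordinates are divided by it.\<close>

lemma (in twisted_algebra) brauer_class_coboundary:
  assumes b: "\<And>\<sigma>. \<sigma> \<in> carrier Q ==> b \<sigma> \<noteq> 0"
    and c': "\<And>\<sigma> \<tau>. \<sigma> \<in> carrier Q ==> \<tau> \<in> carrier Q ==> c' (\<sigma>, \<tau>) = b \<sigma> * act \<sigma> (b \<tau>) * inverse (b (\<sigma> \<otimes>\<^bsub>Q\<^esub> \<tau>)) * c (\<sigma>, \<tau>)"
  shows "brauer_class (twisted h Q act c') = brauer_class W"
proof -
  let ?B = "twisted h Q act c'"
  let ?g = "\<lambda>x \<rho>. x \<rho> * inverse (b \<rho>)"
  have bij: "bij_betw ?g (carrier W) (carrier ?B)"
  proof (rule bij_betw_byWitness[where f' = "\<lambda>x \<rho>. x \<rho> * b \<rho>"])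
    have e: "x \<rho> * inverse (b \<rho>) * b \<rho> = x \<rho>" "x \<rho> * b \<rho> * inverse (b \<rho>) = x \<rho>" 
      if "\<forall>\<rho>. \<rho> \<notin> carrier Q \<longrightarrow> x \<rho> = 0" for x \<rho>
      using that b[of \<rho>] by (cases "\<rho> \<in> carrier Q"; simp)+
    show "\<forall>x\<in>carrier W. (\<lambda>\<rho>. ?g x \<rho> * b \<rho>) = x" "\<forall>x\<in>carrier ?B. ?g (\<lambda>\<rho>. x \<rho> * b \<rho>) = x"
      unfolding twisted_simps by (simp_all add: e)
  qed (auto simp: twisted_simps)
  have mult: "?g (x \<otimes>\<^bsub>W\<^esub> y) = ?g x \<otimes>\<^bsub>?B\<^esub> ?g y" for x y
  proof
    fix \<rho>
    show "?g (x \<otimes>\<^bsub>W\<^esub> y) \<rho> = (?g x \<otimes>\<^bsub>?B\<^esub> ?g y) \<rho>"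
      unfolding twisted_simps sum_distrib_right
    proof (intro sum.cong refl)
      fix \<sigma> \<tau> assume st: "\<sigma> \<in> carrier Q" "\<tau> \<in> carrier Q"
      have "act \<sigma> (b \<tau>) * act \<sigma> (inverse (b \<tau>)) = 1"
        using st by (simp add: act_1 b flip: act_mult)
      then have "b \<sigma> \<noteq> 0" "act \<sigma> (b \<tau>) \<noteq> 0" using b[OF st(1)] by auto
      then show "(if \<rho> = \<sigma> \<otimes>\<^bsub>Q\<^esub> \<tau> then x \<sigma> * act \<sigma> (y \<tau>) * c (\<sigma>, \<tau>) else 0) * inverse (b \<rho>) =
          (if \<rho> = \<sigma> \<otimes>\<^bsub>Q\<^esub> \<tau> then x \<sigma> * inverse (b \<sigma>) * act \<sigma> (y \<tau> * inverse (b \<tau>)) * c' (\<sigma>, \<tau>) else 0)"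
        using st by (simp add: c' act_mult act_inverse) (simp add: field_simps)
    qed
  qed
  have one: "?g \<one>\<^bsub>W\<^esub> = \<one>\<^bsub>?B\<^esub>"
    unfolding twisted_simps using b[of "\<one>\<^bsub>Q\<^esub>"] by (auto simp: c' act_one fun_eq_iff)
  have tr: "kalg ?B" "iso_rel W ?B"
    by (rule kalg_transport[OF kalg_twisted bij]; (rule mult | rule one | simp add: twisted_simps algebra_simps))+
  show ?thesis
    by (rule brauer_class_eqI[OF iso_rel_imp_brauer_equiv[OF tr(2) kalg_twisted tr(1)] kalg_twisted tr(1), symmetric])
qed

text \<open>Turns membership in a cohomology class into an explicit formula with a cochain
  \<open>b\<close>.\<close>

lemma coset_coboundaries:
  "coboundaries2 H M act #>\<^bsub>cocycles2 H M act\<^esub> g =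
    {(\<lambda>x\<in>carrier H \<times> carrier H. (\<lambda>(\<sigma>, \<tau>)\<in>carrier H \<times> carrier H.
        (b \<sigma> \<otimes>\<^bsub>M\<^esub> act \<sigma> (b \<tau>)) \<otimes>\<^bsub>M\<^esub> inv\<^bsub>M\<^esub> b (\<sigma> \<otimes>\<^bsub>H\<^esub> \<tau>)) x \<otimes>\<^bsub>M\<^esub> g x) | b. b \<in> carrier H \<rightarrow> carrier M}"
  by (rule Set.set_eqI)
    (unfold r_coset_def coboundaries2_def UN_iff mem_Collect_eq cocycles2_def monoid.simps partial_object.simps, blast)

text \<open>The comparison cochain \<open>B\<close> takes values in the units of \<open>k\<close>,
  and \<open>f\<close> need not consist of roots of unity. Being cohomologous over this larger group
  is enough, because the obstruction is formed after mapping \<gamma> to coefficients in the units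
  of L.\<close>

lemma obstruction_eqI:
  fixes h :: "'k::field => 'l::field" and c0 f :: "('l => 'l) \<times> ('l => 'l) => 'k"
  assumes tw: "twisted_algebra h (galois_group h) (\<lambda>\<sigma>. \<sigma>) (\<lambda>x. h (f x))"
    and \<gamma>: "\<gamma> \<in> carrier (H2 (galois_group h) (root_group \<zeta>) (\<lambda>_ z. z))" and c0: "c0 \<in> \<gamma>"
    and B: "\<And>\<sigma>. \<sigma> \<in> carrier (galois_group h) ==> B \<sigma> \<noteq> 0"
    and c0f: "\<And>\<sigma> \<tau>. \<sigma> \<in> carrier (galois_group h) ==> \<tau> \<in> carrier (galois_group h) ==>
      c0 (\<sigma>, \<tau>) = B \<sigma> * B \<tau> * inverse (B (\<sigma> \<circ> \<tau>)) * f (\<sigma>, \<tau>)"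
  shows "obstruction h \<gamma> = brauer_class (crossed_product h (\<lambda>x. h (f x)))"
proof -
  let ?\<Gamma> = "carrier (galois_group h)" and ?M = "mult_of field_ring :: 'l monoid" and ?Z = "root_group \<zeta>"
  interpret tw: twisted_algebra h "galois_group h" "\<lambda>\<sigma>. \<sigma>" "\<lambda>x. h (f x)" by (rule tw)
  have comp: "\<sigma> \<circ> \<tau> \<in> ?\<Gamma>" if "\<sigma> \<in> ?\<Gamma>" "\<tau> \<in> ?\<Gamma>" for \<sigma> \<tau> using tw.Q.m_closed[OF that] by simp
  obtain g where g: "\<gamma> = coboundaries2 (galois_group h) ?Z (\<lambda>_ z. z) #>\<^bsub>cocycles2 (galois_group h) ?Z (\<lambda>_ z. z)\<^esub> g"
    using \<gamma> unfolding H2_def FactGroup_def by (auto simp: RCOSETS_def)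
  \<comment> \<open>All members of \<gamma> are compared with one base point \<open>g\<close> of the
    coset.\<close>
  have mem: "\<exists>b. (\<forall>\<sigma>\<in>?\<Gamma>. b \<sigma> \<noteq> 0) \<and> (\<forall>\<sigma>\<in>?\<Gamma>. \<forall>\<tau>\<in>?\<Gamma>. c (\<sigma>, \<tau>) = b \<sigma> * b \<tau> * inverse (b (\<sigma> \<circ> \<tau>)) * g (\<sigma>, \<tau>))" 
    if c: "c \<in> \<gamma>" for c
  proof -
    obtain b where b: "b \<in> ?\<Gamma> \<rightarrow> carrier ?Z" and cb: "c = (\<lambda>x\<in>?\<Gamma> \<times> ?\<Gamma>. (\<lambda>(\<sigma>, \<tau>)\<in>?\<Gamma> \<times> ?\<Gamma>.
        (b \<sigma> \<otimes>\<^bsub>?Z\<^esub> b \<tau>) \<otimes>\<^bsub>?Z\<^esub> inv\<^bsub>?Z\<^esub> b (\<sigma> \<otimes>\<^bsub>galois_group h\<^esub> \<tau>)) x \<otimes>\<^bsub>?Z\<^esub> g x)"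
      using c unfolding g coset_coboundaries by blast
    have bz: "b \<sigma> \<in> carrier ?Z" if "\<sigma> \<in> ?\<Gamma>" for \<sigma> using b that by (rule funcset_mem)
    have "c (\<sigma>, \<tau>) = b \<sigma> * b \<tau> * inverse (b (\<sigma> \<circ> \<tau>)) * g (\<sigma>, \<tau>)" if "\<sigma> \<in> ?\<Gamma>" "\<tau> \<in> ?\<Gamma>" for \<sigma> \<tau>
      unfolding cb using that by (simp add: root_group_simps inv_root_group[OF bz[OF comp[OF that]]])
    then show ?thesis using root_group_nz[OF bz] by blast
  qed
  obtain b0 where b0: "\<And>\<sigma>. \<sigma> \<in> ?\<Gamma> ==> b0 \<sigma> \<noteq> 0"
    "\<And>\<sigma> \<tau>. \<sigma> \<in> ?\<Gamma> ==> \<tau> \<in> ?\<Gamma> ==> c0 (\<sigma>, \<tau>) = b0 \<sigma> * b0 \<tau> * inverse (b0 (\<sigma> \<circ> \<tau>)) * g (\<sigma>, \<tau>)"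
    using mem[OF c0] by blast
  have cls: "brauer_class (crossed_product h c') = brauer_class (crossed_product h (\<lambda>x. h (f x)))"
    if c': "c' \<in> H2_map (galois_group h) ?M (\<lambda>\<sigma> x. \<sigma> x) h \<gamma>" for c'
  proof -
    obtain c where c: "c \<in> \<gamma>" "c' \<in> coboundaries2 (galois_group h) ?M (\<lambda>\<sigma> x. \<sigma> x) #>\<^bsub>cocycles2 (galois_group h) ?M (\<lambda>\<sigma> x. \<sigma> x)\<^esub>
        (\<lambda>x\<in>?\<Gamma> \<times> ?\<Gamma>. h (c x))"
      using c' unfolding H2_map_def by blast
    obtain b' where b': "b' \<in> ?\<Gamma> \<rightarrow> carrier ?M" and cb': "c' = (\<lambda>x\<in>?\<Gamma> \<times> ?\<Gamma>. (\<lambda>(\<sigma>, \<tau>)\<in>?\<Gamma> \<times> ?\<Gamma>.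
        (b' \<sigma> \<otimes>\<^bsub>?M\<^esub> \<sigma> (b' \<tau>)) \<otimes>\<^bsub>?M\<^esub> inv\<^bsub>?M\<^esub> b' (\<sigma> \<otimes>\<^bsub>galois_group h\<^esub> \<tau>)) x \<otimes>\<^bsub>?M\<^esub> (\<lambda>x\<in>?\<Gamma> \<times> ?\<Gamma>. h (c x)) x)"
      using c(2) unfolding coset_coboundaries by blast
    have b'z: "b' \<sigma> \<noteq> 0" if "\<sigma> \<in> ?\<Gamma>" for \<sigma> using funcset_mem[OF b' that] by auto
    obtain b1 where b1: "\<And>\<sigma>. \<sigma> \<in> ?\<Gamma> ==> b1 \<sigma> \<noteq> 0"
      "\<And>\<sigma> \<tau>. \<sigma> \<in> ?\<Gamma> ==> \<tau> \<in> ?\<Gamma> ==> c (\<sigma>, \<tau>) = b1 \<sigma> * b1 \<tau> * inverse (b1 (\<sigma> \<circ> \<tau>)) * g (\<sigma>, \<tau>)"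
      using mem[OF c(1)] by blast
    \<comment> \<open>The cochain that relates \<open>c\<close> to \<open>f\<close>, composed along
      the chain \<open>c\<close>, \<open>g\<close>, \<open>c0\<close>, \<open>f\<close>.\<close>
    define e where "e \<sigma> = b1 \<sigma> * inverse (b0 \<sigma>) * B \<sigma>" for \<sigma>
    have e: "e \<sigma> \<noteq> 0" if "\<sigma> \<in> ?\<Gamma>" for \<sigma> using b1(1) b0(1) B that by (simp add: e_def)
    have ce: "c (\<sigma>, \<tau>) = e \<sigma> * e \<tau> * inverse (e (\<sigma> \<circ> \<tau>)) * f (\<sigma>, \<tau>)" if st: "\<sigma> \<in> ?\<Gamma>" "\<tau> \<in> ?\<Gamma>" for \<sigma> \<tau>
    proof -
      have "g (\<sigma>, \<tau>) = inverse (b0 \<sigma> * b0 \<tau>) * b0 (\<sigma> \<circ> \<tau>) * c0 (\<sigma>, \<tau>)"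
        unfolding b0(2)[OF st] using b0(1)[OF st(1)] b0(1)[OF st(2)] b0(1)[OF comp[OF st]] by (simp add: field_simps del: o_apply)
      then show ?thesis
        unfolding b1(2)[OF st] c0f[OF st] e_def
        using b0(1)[OF comp[OF st]] by (simp add: field_simps del: o_apply)
    qed
    show ?thesis
      unfolding crossed_product_eq_twisted
    proof (rule tw.brauer_class_coboundary[where b = "\<lambda>\<sigma>. b' \<sigma> * h (e \<sigma>)"])
      show "b' \<sigma> * h (e \<sigma>) \<noteq> 0" if "\<sigma> \<in> ?\<Gamma>" for \<sigma> using b'z[OF that] e[OF that] tw.h_inj by auto
      show "c' (\<sigma>, \<tau>) = b' \<sigma> * h (e \<sigma>) * \<sigma> (b' \<tau> * h (e \<tau>)) *
          inverse (b' (\<sigma> \<otimes>\<^bsub>galois_group h\<^esub> \<tau>) * h (e (\<sigma> \<otimes>\<^bsub>galois_group h\<^esub> \<tau>))) * h (f (\<sigma>, \<tau>))" if st: "\<sigma> \<in> ?\<Gamma>" "\<tau> \<in> ?\<Gamma>" for \<sigma> \<tau>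
      proof -
        have "c' (\<sigma>, \<tau>) = b' \<sigma> * \<sigma> (b' \<tau>) * inverse (b' (\<sigma> \<circ> \<tau>)) * h (c (\<sigma>, \<tau>))"
          unfolding cb' using st by (simp add: inv_mult_of_field[OF b'z[OF comp[OF st]]])
        then show ?thesis
          unfolding ce[OF st] using st
          by (simp add: tw.act_mult tw.act_h tw.h_mult tw.h_inverse mult_ac del: o_apply)
      qed
    qed
  qed
  \<comment> \<open>\<open>the_elem\<close> asks for a singleton, so it must also be seen that there
    is at least one cocycle.\<close>
  have "H2_map (galois_group h) ?M (\<lambda>\<sigma> x. \<sigma> x) h \<gamma> \<noteq> {}"
  proof -
    have "(\<lambda>_. 1) \<in> ?\<Gamma> \<rightarrow> carrier ?M" by simp
    then show ?thesis using c0 unfolding H2_map_def coset_coboundaries by blast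
  qed
  then have "(\<lambda>c. brauer_class (crossed_product h c)) ` H2_map (galois_group h) ?M (\<lambda>\<sigma> x. \<sigma> x) h \<gamma> =
      {brauer_class (crossed_product h (\<lambda>x. h (f x)))}"
    by (simp only: image_cong[OF refl cls] image_constant_conv if_False)
  then show ?thesis unfolding obstruction_def by simp
qed

section \<open>Normal forms in the central extension\<close>

text \<open>The kernel of the extension is written additively: \<open>c k\<close> will be
  \<iota>(\<zeta>^k), so commutators and powers of the lifts are recorded by natural exponents.
  \<open>q i\<close> will be p^(n_i).\<close>

locale central_presentation = group G for G (structure) +
  fixes c :: "nat => 'a" and s :: "nat => 'a" and d :: "nat => nat => nat" and m q :: "nat => nat" and t :: nat
  assumes c_closed [simp]: "c i \<in> carrier G" and c_0: "c 0 = \<one>" and c_add: "c (i + j) = c i \<otimes> c j"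
    and c_central: "g \<in> carrier G ==> g \<otimes> c i = c i \<otimes> g"
    and s_closed: "i \<in> {1..t} ==> s i \<in> carrier G"
    and s_comm: "[|i \<in> {1..t}; j \<in> {1..t}; i < j|] ==> s j \<otimes> s i = c (d i j) \<otimes> (s i \<otimes> s j)"
    and s_pow: "i \<in> {1..t} ==> s i [^] q i = c (m i)"
begin

lemma c_left: 
  assumes g: "g \<in> carrier G" and k: "k \<in> carrier G"
  shows "g \<otimes> (c i \<otimes> k) = c i \<otimes> (g \<otimes> k)"
proof -
  have "g \<otimes> (c i \<otimes> k) = (g \<otimes> c i) \<otimes> k" by (rule m_assoc[OF g c_closed k, symmetric])
  also have "\<dots> = c i \<otimes> (g \<otimes> k)" unfolding c_central[OF g] by (rule m_assoc[OF c_closed g k])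
  finally show ?thesis .
qed

lemma c_c: "k \<in> carrier G ==> c i \<otimes> (c j \<otimes> k) = c (i + j) \<otimes> k"
  unfolding c_add by (rule m_assoc[OF c_closed c_closed, symmetric])

lemma c_pow: "c i [^] (n :: nat) = c (n * i)"
  by (induction n) (simp_all add: c_0 c_add[symmetric] add.commute)

lemma pow_comm:
  assumes x: "x \<in> carrier G" and y: "y \<in> carrier G" and xy: "x \<otimes> y = c e \<otimes> (y \<otimes> x)"
  shows "x [^] (n :: nat) \<otimes> y = c (n * e) \<otimes> (y \<otimes> x [^] n)"
proof (induction n)
  case 0
  show ?case using x y by (simp add: c_0)
next
  case (Suc n)
  have "x [^] Suc n \<otimes> y = x [^] n \<otimes> (c e \<otimes> (y \<otimes> x))"
    using x y by (simp add: m_assoc xy)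
  also have "\<dots> = c e \<otimes> ((x [^] n \<otimes> y) \<otimes> x)"
    using x y by (simp add: c_left[of "x [^] n"] m_assoc)
  also have "\<dots> = c (Suc n * e) \<otimes> (y \<otimes> x [^] Suc n)"
    unfolding Suc.IH using x y by (simp add: m_assoc c_c)
  finally show ?case .
qed

lemma pow_pow_comm:
  assumes x: "x \<in> carrier G" and y: "y \<in> carrier G" and xy: "x \<otimes> y = c e \<otimes> (y \<otimes> x)"
  shows "x [^] (n :: nat) \<otimes> y [^] (k :: nat) = c (e * n * k) \<otimes> (y [^] k \<otimes> x [^] n)"
proof (induction k)
  case 0
  show ?case using x by (simp add: c_0)
next
  case (Suc k)
  have "x [^] n \<otimes> y [^] Suc k = (x [^] n \<otimes> y [^] k) \<otimes> y"
    using x y by (simp add: m_assoc)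
  also have "\<dots> = c (e * n * k) \<otimes> (y [^] k \<otimes> (x [^] n \<otimes> y))"
    unfolding Suc.IH using x y by (simp add: m_assoc)
  also have "\<dots> = c (e * n * Suc k) \<otimes> (y [^] Suc k \<otimes> x [^] n)"
    unfolding pow_comm[OF x y xy] using x y by (simp add: m_assoc c_left[of "y [^] k"] c_c algebra_simps)
  finally show ?case .
qed

primrec nf :: "(nat => nat) => nat => 'a" where
  "nf e 0 = \<one>"
| "nf e (Suc n) = nf e n \<otimes> s (Suc n) [^] e (Suc n)"

lemma nf_closed: "n \<le> t ==> nf e n \<in> carrier G"
  by (induction n) (simp_all add: s_closed)

lemma nf_cong: "(\<And>i. i \<in> {1..n} ==> e i = e' i) ==> nf e n = nf e' n"
  by (induction n) simp_all

text \<open>Only lifts of smaller index occur in \<open>nf e n\<close>, so every exchange is one of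
  the relations for s_j s_i with i < j.\<close>

lemma s_nf:
  assumes j: "j \<in> {1..t}"
  shows "n < j ==> s j [^] (x :: nat) \<otimes> nf e n = c (\<Sum>i\<in>{1..n}. d i j * x * e i) \<otimes> (nf e n \<otimes> s j [^] x)"
proof (induction n)
  case 0
  show ?case using s_closed[OF j] by (simp add: c_0)
next
  case (Suc n)
  have n: "Suc n \<in> {1..t}" "n \<le> t" "Suc n < j" using Suc.prems j by auto
  note cl = s_closed[OF j] s_closed[OF n(1)] nf_closed[OF n(2), of e]
  have "s j [^] x \<otimes> nf e (Suc n) = (s j [^] x \<otimes> nf e n) \<otimes> s (Suc n) [^] e (Suc n)"
    using cl by (simp add: m_assoc)
  also have "\<dots> = c (\<Sum>i\<in>{1..n}. d i j * x * e i) \<otimes> (nf e n \<otimes> (s j [^] x \<otimes> s (Suc n) [^] e (Suc n)))"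
    using Suc cl by (simp add: m_assoc)
  also have "\<dots> = c (\<Sum>i\<in>{1..Suc n}. d i j * x * e i) \<otimes> (nf e (Suc n) \<otimes> s j [^] x)"
    unfolding pow_pow_comm[OF cl(1,2) s_comm[OF n(1) j n(3)]] using cl by (simp add: m_assoc c_left[of "nf e n"] c_c)
  finally show ?case .
qed

text \<open>Collection: moving e_j copies of s_j to the right past e'_i copies of s_i, for each i <
  j, costs d_ij e_j e'_i in the exponent of the central factor. Exponents are added without
  reduction; that is left to \<open>nf_reduce\<close>.\<close>

lemma nf_mult:
  "n \<le> t ==> nf e n \<otimes> nf e' n = c (\<Sum>j\<in>{1..n}. \<Sum>i\<in>{1..<j}. d i j * e j * e' i) \<otimes> nf (\<lambda>i. e i + e' i) n"
proof (induction n)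
  case 0
  show ?case by (simp add: c_0)
next
  case (Suc n)
  have n: "Suc n \<in> {1..t}" "n \<le> t" using Suc.prems by auto
  let ?s = "s (Suc n)"
  let ?k = "\<Sum>i\<in>{1..n}. d i (Suc n) * e (Suc n) * e' i"
  note cl = s_closed[OF n(1)] nf_closed[OF n(2)]
  have "nf e (Suc n) \<otimes> nf e' (Suc n) = nf e n \<otimes> ((?s [^] e (Suc n) \<otimes> nf e' n) \<otimes> ?s [^] e' (Suc n))"
    using cl by (simp add: m_assoc)
  also have "\<dots> = c ?k \<otimes> ((nf e n \<otimes> nf e' n) \<otimes> (?s [^] e (Suc n) \<otimes> ?s [^] e' (Suc n)))"
    unfolding s_nf[OF n(1) lessI] using cl by (simp add: m_assoc c_left[of "nf e n"])
  also have "\<dots> = c (\<Sum>j\<in>{1..Suc n}. \<Sum>i\<in>{1..<j}. d i j * e j * e' i) \<otimes> nf (\<lambda>i. e i + e' i) (Suc n)"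
    unfolding Suc.IH[OF n(2)] using cl
    by (simp add: m_assoc c_c nat_pow_mult add.commute atLeastLessThanSuc_atLeastAtMost)
  finally show ?case .
qed

text \<open>Each complete block of q_i factors s_i becomes the central element
  \<open>c (m i)\<close> and moves to the front.\<close>

lemma nf_reduce:
  "n \<le> t ==> nf e n = c (\<Sum>i\<in>{1..n}. m i * (e i div q i)) \<otimes> nf (\<lambda>i. e i mod q i) n"
proof (induction n)
  case 0
  show ?case by (simp add: c_0)
next
  case (Suc n)
  have n: "Suc n \<in> {1..t}" "n \<le> t" using Suc.prems by auto
  let ?s = "s (Suc n)" and ?q = "q (Suc n)" and ?e = "e (Suc n)"
  note cl = s_closed[OF n(1)] nf_closed[OF n(2)]
  have "?s [^] ?e = (?s [^] ?q) [^] (?e div ?q) \<otimes> ?s [^] (?e mod ?q)"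
    using cl by (simp add: nat_pow_pow nat_pow_mult)
  then have "?s [^] ?e = c (?e div ?q * m (Suc n)) \<otimes> ?s [^] (?e mod ?q)"
    unfolding s_pow[OF n(1)] c_pow .
  then show ?case
    using Suc.IH[OF n(2)] cl by (simp add: m_assoc c_left[of "nf (\<lambda>i. e i mod q i) n"] c_c mult.commute)
qed

text \<open>The cocycle of the section by normal forms: a bilinear part from collection and a carry
  part from reduction modulo q_i.\<close>

lemma nf_product:
  "nf e t \<otimes> nf e' t = c ((\<Sum>j\<in>{1..t}. \<Sum>i\<in>{1..<j}. d i j * e j * e' i) + (\<Sum>i\<in>{1..t}. m i * ((e i + e' i) div q i))) \<otimes>
    nf (\<lambda>i. (e i + e' i) mod q i) t"
  unfolding nf_mult[OF order_refl] nf_reduce[OF order_refl, of "\<lambda>i. e i + e' i"] by (simp add: c_c nf_closed)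

end

section \<open>Exponents with respect to the given generators\<close>

text \<open>The given generators need not be the standard generators of the cyclic factors:
  \<sigma>_i has some coordinate v_i, a unit modulo q_i. Dividing the i-th coordinate by v_i
  produces exponents for which \<sigma>_i has exponent 1.\<close>

lemma product_coordinates:
  fixes q :: "nat => nat" and \<phi> :: "(nat => int) => 'h"
  assumes H: "group H" and phi: "\<phi> \<in> iso (product_group {1..t} (\<lambda>i. integer_mod_group (q i))) H"
    and q: "\<And>i. i \<in> {1..t} ==> 1 < q i"
    and \<sigma>: "\<And>i. i \<in> {1..t} ==> \<sigma> i \<in> carrier H"
    and gen: "\<And>i. i \<in> {1..t} ==> generate H {\<sigma> i} = subproduct \<phi> {1..t} (\<lambda>i. integer_mod_group (q i)) {i}"
  obtains \<epsilon> :: "'h => nat => nat" where "finite (carrier H)"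
    "\<And>\<tau> i. i \<in> {1..t} ==> \<epsilon> \<tau> i < q i"
    "\<And>\<tau> \<rho> i. [|\<tau> \<in> carrier H; \<rho> \<in> carrier H; i \<in> {1..t}|] ==> \<epsilon> (\<tau> \<otimes>\<^bsub>H\<^esub> \<rho>) i = (\<epsilon> \<tau> i + \<epsilon> \<rho> i) mod q i"
    "\<And>i j. [|i \<in> {1..t}; j \<in> {1..t}|] ==> \<epsilon> (\<sigma> j) i = (if i = j then 1 else 0)"
    "\<And>\<tau> \<rho>. [|\<tau> \<in> carrier H; \<rho> \<in> carrier H; \<And>i. i \<in> {1..t} ==> \<epsilon> \<tau> i = \<epsilon> \<rho> i|] ==> \<tau> = \<rho>"
proof -
  interpret H: group H by (rule H)
  let ?C = "\<lambda>i. integer_mod_group (q i)"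
  let ?P = "product_group {1..t} ?C"
  have P: "group ?P" by (rule product_group) simp
  interpret P: group ?P by (rule P)
  have bij: "bij_betw \<phi> (carrier ?P) (carrier H)" and hom: "\<phi> \<in> hom ?P H" using phi by (simp_all add: iso_def)
  have q0: "q i \<noteq> 0" if "i \<in> {1..t}" for i using q[OF that] by simp
  have cC: "carrier (?C i) = {0..<int (q i)}" if "i \<in> {1..t}" for i
    using q0[OF that] by (simp add: carrier_integer_mod_group)
  have cP: "carrier ?P = (\<Pi>\<^sub>E i\<in>{1..t}. {0..<int (q i)})"
    unfolding carrier_product_group by (rule PiE_cong) (rule cC)
  have fin: "finite (carrier H)"
  proof -
    have "finite (carrier ?P)" unfolding cP by (rule finite_PiE) simp_all
    then show ?thesis using bij bij_betw_finite by blast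
  qed
  define \<psi> where "\<psi> = inv_into (carrier ?P) \<phi>"
  have \<psi>: "\<psi> \<tau> \<in> carrier ?P" "\<phi> (\<psi> \<tau>) = \<tau>" if "\<tau> \<in> carrier H" for \<tau>
    using bij that unfolding \<psi>_def bij_betw_def by (metis inv_into_into, metis f_inv_into_f)
  have \<psi>\<phi>: "\<psi> (\<phi> x) = x" if "x \<in> carrier ?P" for x
    using bij that unfolding \<psi>_def bij_betw_def by (metis inv_into_f_f)
  have \<psi>_mult: "\<psi> (\<tau> \<otimes>\<^bsub>H\<^esub> \<rho>) i = (\<psi> \<tau> i + \<psi> \<rho> i) mod int (q i)" 
    if "\<tau> \<in> carrier H" "\<rho> \<in> carrier H" "i \<in> {1..t}" for \<tau> \<rho> i
  proof -
    have "\<tau> \<otimes>\<^bsub>H\<^esub> \<rho> = \<phi> (\<psi> \<tau> \<otimes>\<^bsub>?P\<^esub> \<psi> \<rho>)"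
      using hom_mult[OF hom \<psi>(1)[OF that(1)] \<psi>(1)[OF that(2)]] \<psi>(2)[OF that(1)] \<psi>(2)[OF that(2)] by simp
    then have "\<psi> (\<tau> \<otimes>\<^bsub>H\<^esub> \<rho>) = \<psi> \<tau> \<otimes>\<^bsub>?P\<^esub> \<psi> \<rho>"
      using \<psi>\<phi>[OF P.m_closed[OF \<psi>(1)[OF that(1)] \<psi>(1)[OF that(2)]]] by simp
    then show ?thesis using that(3) by simp
  qed
  have "\<psi> \<one>\<^bsub>H\<^esub> = \<one>\<^bsub>?P\<^esub>" using \<psi>\<phi>[OF P.one_closed] hom_one[OF hom P H] by simp
  then have \<psi>_one: "\<psi> \<one>\<^bsub>H\<^esub> i = 0" if "i \<in> {1..t}" for i using that by simp
  define v where "v i = \<psi> (\<sigma> i) i" for i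
  have v_other: "\<psi> (\<sigma> j) i = 0" if "i \<in> {1..t}" "j \<in> {1..t}" "i \<noteq> j" for i j
  proof -
    have "\<sigma> j \<in> subproduct \<phi> {1..t} ?C {j}"
      unfolding gen[OF that(2), symmetric] by (rule generate.incl) simp
    then obtain x where "\<sigma> j = \<phi> x" "x \<in> carrier ?P" "\<forall>i\<in>{1..t} - {j}. x i = \<one>\<^bsub>?C i\<^esub>"
      unfolding subproduct_def by blast
    then show ?thesis using that \<psi>\<phi> by simp
  qed
  \<comment> \<open>The image under \<phi> of the standard generator is a power of \<sigma>_i, and
    this power is an inverse of v_i modulo q_i.\<close>
  have "\<exists>w. (int w * v i) mod int (q i) = 1" if i: "i \<in> {1..t}" for i
  proof -
    define x where "x = (\<lambda>j\<in>{1..t}. if j = i then 1 else 0 :: int)"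
    have x: "x \<in> carrier ?P" unfolding cP x_def using q by (fastforce simp: PiE_iff)
    have "\<phi> x \<in> subproduct \<phi> {1..t} ?C {i}"
      unfolding subproduct_def by (intro imageI CollectI conjI x) (simp add: x_def)
    then have "\<phi> x \<in> {\<sigma> i [^]\<^bsub>H\<^esub> k | k. k \<in> (UNIV :: nat set)}"
      unfolding gen[OF i, symmetric] H.generate_pow_on_finite_carrier[OF fin \<sigma>[OF i]] .
    then obtain w :: nat where w: "\<phi> x = \<sigma> i [^]\<^bsub>H\<^esub> w" by blast
    have "\<psi> (\<sigma> i [^]\<^bsub>H\<^esub> k) i = (int k * v i) mod int (q i)" for k :: nat
    proof (induction k)
      case 0
      show ?case using \<psi>_one[OF i] by simp
    next
      case (Suc k)
      show ?case
        unfolding H.nat_pow_Suc \<psi>_mult[OF H.nat_pow_closed[OF \<sigma>[OF i]] \<sigma>[OF i] i] Suc.IH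
        by (simp add: v_def mod_add_left_eq mod_add_right_eq algebra_simps)
    qed
    from this[of w] have "(int w * v i) mod int (q i) = x i" unfolding w[symmetric] \<psi>\<phi>[OF x] ..
    then show ?thesis using i by (auto simp: x_def)
  qed
  then obtain w where w: "\<And>i. i \<in> {1..t} ==> (int (w i) * v i) mod int (q i) = 1" by metis
  define \<epsilon> where "\<epsilon> \<tau> i = nat ((int (w i) * \<psi> \<tau> i) mod int (q i))" for \<tau> i
  have int_\<epsilon>: "int (\<epsilon> \<tau> i) = (int (w i) * \<psi> \<tau> i) mod int (q i)" if "i \<in> {1..t}" for \<tau> i
    using q0[OF that] by (simp add: \<epsilon>_def)
  show thesis
  proof (rule that[of \<epsilon>])
    show "finite (carrier H)" by (rule fin)
    show "\<epsilon> \<tau> i < q i" if "i \<in> {1..t}" for \<tau> i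
    proof -
      have "int (\<epsilon> \<tau> i) < int (q i)" unfolding int_\<epsilon>[OF that] using q0[OF that] by simp
      then show ?thesis by simp
    qed
    show "\<epsilon> (\<tau> \<otimes>\<^bsub>H\<^esub> \<rho>) i = (\<epsilon> \<tau> i + \<epsilon> \<rho> i) mod q i" if "\<tau> \<in> carrier H" "\<rho> \<in> carrier H" "i \<in> {1..t}" for \<tau> \<rho> i
    proof -
      have "int (\<epsilon> (\<tau> \<otimes>\<^bsub>H\<^esub> \<rho>) i) = int ((\<epsilon> \<tau> i + \<epsilon> \<rho> i) mod q i)"
        unfolding of_nat_mod of_nat_add int_\<epsilon>[OF that(3)] \<psi>_mult[OF that]
        by (simp add: mod_simps algebra_simps)
      then show ?thesis by simp
    qed
    show "\<epsilon> (\<sigma> j) i = (if i = j then 1 else 0)" if "i \<in> {1..t}" "j \<in> {1..t}" for i j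
    proof (cases "i = j")
      case True
      then have "int (\<epsilon> (\<sigma> j) i) = 1" using int_\<epsilon>[OF that(1)] w[OF that(1)] by (simp add: v_def)
      then show ?thesis using True by simp
    next
      case False
      then have "int (\<epsilon> (\<sigma> j) i) = 0" using int_\<epsilon>[OF that(1)] v_other[OF that False] by simp
      then show ?thesis using False by simp
    qed
    show "\<tau> = \<rho>" if "\<tau> \<in> carrier H" "\<rho> \<in> carrier H" and e: "\<And>i. i \<in> {1..t} ==> \<epsilon> \<tau> i = \<epsilon> \<rho> i" for \<tau> \<rho>
    proof -
      \<comment> \<open>The coordinate is recovered from the exponent by multiplying with v_i, so
        the exponents determine the automorphism.\<close>
      have rec: "\<psi> \<tau> i = (v i * int (\<epsilon> \<tau> i)) mod int (q i)" if \<tau>: "\<tau> \<in> carrier H" and i: "i \<in> {1..t}" for \<tau> i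
      proof -
        have "(v i * int (\<epsilon> \<tau> i)) mod int (q i) = (((int (w i) * v i) mod int (q i)) * \<psi> \<tau> i) mod int (q i)"
          unfolding int_\<epsilon>[OF i] by (simp add: mod_simps mult_ac)
        also have "\<dots> = \<psi> \<tau> i" using \<psi>(1)[OF \<tau>] i unfolding w[OF i] cP by (auto simp: PiE_iff)
        finally show ?thesis ..
      qed
      have "\<psi> \<tau> = \<psi> \<rho>"
      proof (rule PiE_ext)
        show "\<psi> \<tau> \<in> (\<Pi>\<^sub>E i\<in>{1..t}. {0..<int (q i)})" "\<psi> \<rho> \<in> (\<Pi>\<^sub>E i\<in>{1..t}. {0..<int (q i)})"
          using \<psi>(1)[OF that(1)] \<psi>(1)[OF that(2)] unfolding cP .
        show "\<psi> \<tau> i = \<psi> \<rho> i" if "i \<in> {1..t}" for i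
          using rec[OF \<open>\<tau> \<in> carrier H\<close> that] rec[OF \<open>\<rho> \<in> carrier H\<close> that] e[OF that] by simp
      qed
      then have "\<phi> (\<psi> \<tau>) = \<phi> (\<psi> \<rho>)" by (rule arg_cong)
      then show ?thesis unfolding \<psi>(2)[OF that(1)] \<psi>(2)[OF that(2)] .
    qed
  qed
qed

text \<open>Bookkeeping of carries: \<open>f\<close> carries at multiples of p with value z_i. The
  powers of z_i with exponents \<open>e i div p\<close> form the cochain that turns this into
  carries at q_i = p q'_i with value \<zeta>^(m_i), because z_i^(q'_i) = \<zeta>^(m_i).\<close>

lemma (in kummer_product) f_coboundary:
  assumes e: "\<And>i. i \<in> {1..t} ==> \<kappa> \<tau> i = e i mod p" "\<And>i. i \<in> {1..t} ==> \<kappa> \<rho> i = e' i mod p"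
    and q: "\<And>i. i \<in> {1..t} ==> q i = p * q' i" and zq: "\<And>i. i \<in> {1..t} ==> z i ^ q' i = \<zeta> ^ m i"
  shows "(\<Prod>i\<in>{1..t}. z i ^ (e i div p)) * (\<Prod>i\<in>{1..t}. z i ^ (e' i div p)) * f \<tau> \<rho> =
    (\<Prod>i\<in>{1..t}. z i ^ (((e i + e' i) mod q i) div p)) *
      \<zeta> ^ ((\<Sum>j\<in>{1..t}. \<Sum>i\<in>{1..<j}. d i j * e j * e' i) + (\<Sum>i\<in>{1..t}. m i * ((e i + e' i) div q i)))"
proof -
  have "(\<Prod>(i, j)\<in>pairs. \<zeta> ^ (d i j * (\<kappa> \<tau> j * \<kappa> \<rho> i))) = (\<Prod>x\<in>pairs. \<zeta> ^ (case x of (i, j) => d i j * e j * e' i))"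
  proof (rule prod.cong[OF refl])
    fix x assume "x \<in> pairs"
    then obtain i j where x: "x = (i, j)" "i \<in> {1..t}" "j \<in> {1..t}" by (auto simp: pairs_def)
    \<comment> \<open>Exponents of \<zeta> matter only modulo p, so the reduced exponents
      \<open>\<kappa>\<close> may be replaced by \<open>e\<close> and \<open>e'\<close>.\<close>
    have "(d i j * (\<kappa> \<tau> j * \<kappa> \<rho> i)) mod p = (d i j * e j * e' i) mod p"
      unfolding e(1)[OF x(3)] e(2)[OF x(2)]
      using mod_mult_right_eq[of "d i j" "e j mod p * (e' i mod p)" p] mod_mult_right_eq[of "d i j" "e j * e' i" p]
      unfolding mod_mult_eq mult.assoc by metis
    then have "\<zeta> ^ (d i j * (\<kappa> \<tau> j * \<kappa> \<rho> i)) = \<zeta> ^ (d i j * e j * e' i)"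
      using power_mod_eq[OF \<zeta>p] by metis
    then show "(case x of (i, j) => \<zeta> ^ (d i j * (\<kappa> \<tau> j * \<kappa> \<rho> i))) = \<zeta> ^ (case x of (i, j) => d i j * e j * e' i)"
      unfolding x(1) prod.case .
  qed
  also have "\<dots> = \<zeta> ^ (\<Sum>x\<in>pairs. case x of (i, j) => d i j * e j * e' i)" by (rule power_sum[symmetric])
  also have "(\<Sum>x\<in>pairs. case x of (i, j) => d i j * e j * e' i) =
      (\<Sum>(j, i)\<in>Sigma {1..t} (\<lambda>j. {1..<j}). d i j * e j * e' i)"
    by (rule sum.reindex_bij_witness[of _ "\<lambda>(j, i). (i, j)" "\<lambda>(i, j). (j, i)"]) (auto simp: pairs_def)
  also have "\<dots> = (\<Sum>j\<in>{1..t}. \<Sum>i\<in>{1..<j}. d i j * e j * e' i)"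
    by (rule sum.Sigma[symmetric]) simp_all
  finally have 1: "(\<Prod>(i, j)\<in>pairs. \<zeta> ^ (d i j * (\<kappa> \<tau> j * \<kappa> \<rho> i))) = \<zeta> ^ (\<Sum>j\<in>{1..t}. \<Sum>i\<in>{1..<j}. d i j * e j * e' i)" .
  have "z i ^ (e i div p) * z i ^ (e' i div p) * z i ^ ((\<kappa> \<tau> i + \<kappa> \<rho> i) div p) =
      z i ^ (((e i + e' i) mod q i) div p) * \<zeta> ^ (m i * ((e i + e' i) div q i))" if i: "i \<in> {1..t}" for i
  proof -
    let ?n = "e i + e' i"
    have "z i ^ (e i div p) * z i ^ (e' i div p) * z i ^ ((\<kappa> \<tau> i + \<kappa> \<rho> i) div p) = z i ^ (?n div p)"
      unfolding e(1)[OF i] e(2)[OF i] power_add[symmetric] div_add1_eq[of "e i" "e' i" p] ..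
    \<comment> \<open>Every multiple of q_i that is dropped before dividing by p lowers the quotient
      by q'_i.\<close>
    also have "?n div p = (?n mod q i) div p + q' i * (?n div q i)"
    proof -
      have "?n = ?n mod q i + p * (q' i * (?n div q i))"
        using mod_mult_div_eq[of ?n "q i"] unfolding q[OF i] by (simp only: mult.assoc)
      then have "?n div p = (?n mod q i + p * (q' i * (?n div q i))) div p" by (rule arg_cong)
      also have "\<dots> = (?n mod q i) div p + q' i * (?n div q i)" using p0 by (simp add: div_mult_self2)
      finally show ?thesis .
    qed
    also have "z i ^ \<dots> = z i ^ ((?n mod q i) div p) * \<zeta> ^ (m i * (?n div q i))"
      unfolding power_add power_mult zq[OF i] ..
    finally show ?thesis .
  qed
  then have 2: "(\<Prod>i\<in>{1..t}. z i ^ (e i div p) * z i ^ (e' i div p) * z i ^ ((\<kappa> \<tau> i + \<kappa> \<rho> i) div p)) =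
      (\<Prod>i\<in>{1..t}. z i ^ (((e i + e' i) mod q i) div p) * \<zeta> ^ (m i * ((e i + e' i) div q i)))"
    by (rule prod.cong[OF refl])
  then have 3: "(\<Prod>i\<in>{1..t}. z i ^ (e i div p)) * (\<Prod>i\<in>{1..t}. z i ^ (e' i div p)) * (\<Prod>i\<in>{1..t}. z i ^ ((\<kappa> \<tau> i + \<kappa> \<rho> i) div p)) =
      (\<Prod>i\<in>{1..t}. z i ^ (((e i + e' i) mod q i) div p)) * \<zeta> ^ (\<Sum>i\<in>{1..t}. m i * ((e i + e' i) div q i))"
    unfolding prod.distrib power_sum[symmetric] .
  have "(\<Prod>i\<in>{1..t}. z i ^ (e i div p)) * (\<Prod>i\<in>{1..t}. z i ^ (e' i div p)) * f \<tau> \<rho> =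
      ((\<Prod>i\<in>{1..t}. z i ^ (e i div p)) * (\<Prod>i\<in>{1..t}. z i ^ (e' i div p)) * (\<Prod>i\<in>{1..t}. z i ^ ((\<kappa> \<tau> i + \<kappa> \<rho> i) div p))) *
      \<zeta> ^ (\<Sum>j\<in>{1..t}. \<Sum>i\<in>{1..<j}. d i j * e j * e' i)"
    unfolding f_def 1 by (simp only: mult_ac)
  then show ?thesis unfolding 3 power_add by (simp only: mult_ac)
qed

theorem theorem2p5:
  fixes p t r :: nat
    and n m :: "nat \<Rightarrow> nat"
    and d :: "nat \<Rightarrow> nat \<Rightarrow> nat"
    and A :: "nat set"
    and C :: "nat \<Rightarrow> int monoid"
    and \<zeta> Z :: "'k::field"
    and h :: "'k \<Rightarrow> 'l::field"
    and \<phi> :: "(nat \<Rightarrow> int) \<Rightarrow> ('l \<Rightarrow> 'l)"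
    and \<sigma> :: "nat \<Rightarrow> ('l \<Rightarrow> 'l)"
    and a :: "nat \<Rightarrow> 'k"
    and \<alpha> :: "nat \<Rightarrow> 'l"
    and G :: "'g monoid"
    and \<iota> :: "'k \<Rightarrow> 'g"
    and \<pi> :: "'g \<Rightarrow> ('l \<Rightarrow> 'l)"
    and s :: "nat \<Rightarrow> 'g"
    and \<gamma> :: "(('l \<Rightarrow> 'l) \<times> ('l \<Rightarrow> 'l) \<Rightarrow> 'k) set"
  assumes p: "Factorial_Ring.prime p" "odd p"
    and char: "CHAR('k) \<noteq> p"
    and zeta: "primitive_root_of_unity p \<zeta>"
    and C: "C = (\<lambda>i. integer_mod_group (p ^ n i))"
    and n_mono: "mono_on {1..t} n"
    and galois: "galois_extension h"
    and phi: "\<phi> \<in> iso (product_group {1..t} C) (galois_group h)"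
    and extension: "central_extension (root_group \<zeta>) \<iota> G \<pi> (galois_group h)"
    and nonsplit: "\<not> split_extension G \<pi> (galois_group h)"
    and gamma: "has_extension_class (root_group \<zeta>) \<iota> G \<pi> (galois_group h) \<gamma>"
    and sigma: "\<forall>i\<in>{1..t}. \<sigma> i \<in> carrier (galois_group h) \<and>
                  generate (galois_group h) {\<sigma> i} = subproduct \<phi> {1..t} C {i}"
    and a: "\<forall>i\<in>{1..t}. a i \<noteq> 0"
    and alpha: "\<forall>i\<in>{1..t}. \<alpha> i ^ p = h (a i) \<and>
                  \<alpha> i \<in> fixed_field (subproduct \<phi> {1..t} C ({1..t} - {i}))"
    and sigma_alpha: "\<forall>i\<in>{1..t}. \<forall>j\<in>{1..t}.
                  \<sigma> j (\<alpha> i) = h (\<zeta> ^ (if i = j then 1 else 0)) * \<alpha> i"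
    and s: "\<forall>i\<in>{1..t}. s i \<in> carrier G \<and> \<pi> (s i) = \<sigma> i"
    and d: "\<forall>i\<in>{1..t}. \<forall>j\<in>{1..t}. d i j < p \<and>
                  s i \<otimes>\<^bsub>G\<^esub> s j = \<iota> (\<zeta> ^ d j i) \<otimes>\<^bsub>G\<^esub> s j \<otimes>\<^bsub>G\<^esub> s i"
    and m: "\<forall>i\<in>{1..t}. m i < p \<and> s i [^]\<^bsub>G\<^esub> (p ^ n i) = \<iota> (\<zeta> ^ m i)"
    and r: "r = Max {i \<in> {1..t}. m i > 0}"
    and A: "A = {i \<in> {1..t}. n i = n r \<and> m i > 0}"
    and Z: "(\<exists>i\<in>{1..t}. m i > 0) \<longrightarrow>
              primitive_root_of_unity (p ^ n r) Z \<and> \<zeta> = Z ^ (p ^ (n r - 1))"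
  shows "obstruction h \<gamma> =
           (\<Otimes>\<^bsub>brauer_group\<^esub>i\<in>A. brauer_class (symbol_algebra p (a i) (Z ^ m i) \<zeta>))
           \<otimes>\<^bsub>brauer_group\<^esub>
           finprod brauer_group
             (\<lambda>(i, j). brauer_class (symbol_algebra p (a j) (a i) \<zeta>) [^]\<^bsub>brauer_group\<^esub> d i j)
             {(i, j). i \<in> {1..t} \<and> j \<in> {1..t} \<and> i < j}"
proof -
  let ?\<Gamma> = "carrier (galois_group h)" and ?Z = "root_group \<zeta>"
  define q where "q i = p ^ n i" for i
  have p2: "2 \<le> p" using p(1) by (rule prime_ge_2_nat)
  then have p0: "0 < p" by simp
  have \<zeta>p: "\<zeta> ^ p = 1" and \<zeta>1: "\<zeta> \<noteq> 1"
    using zeta p2 unfolding primitive_root_of_unity_def by (simp, metis One_nat_def Suc_1 less_le_trans lessI power_one_right zero_less_one)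
  have \<zeta>0: "\<zeta> \<noteq> 0" using \<zeta>p p0 by (auto simp: power_0_left)
  \<comment> \<open>\<open>CHAR\<close> would divide the prime p and thus be 1 or p; both are
    excluded.\<close>
  have pk: "of_nat p \<noteq> (0 :: 'k)"
  proof
    assume "of_nat p = (0 :: 'k)"
    then have "CHAR('k) dvd p" by (simp add: of_nat_eq_0_iff_char_dvd)
    then have "CHAR('k) = 1" using p(1) char unfolding prime_nat_iff by blast
    then show False using of_nat_CHAR[where ?'a = 'k] by simp
  qed
  have h: "h \<in> ring_hom field_ring field_ring" and fixed: "fixed_field ?\<Gamma> = range h"
    using galois by (simp_all add: galois_extension_def)
  have gZ: "group ?Z" and gG: "group G" and gH: "group (galois_group h)" and \<iota>: "\<iota> \<in> hom ?Z G" "inj_on \<iota> (carrier ?Z)"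
    and \<pi>: "\<pi> \<in> hom G (galois_group h)" and ker: "\<iota> ` carrier ?Z = kernel G (galois_group h) \<pi>"
    and central: "\<And>x g. x \<in> carrier ?Z \<Longrightarrow> g \<in> carrier G \<Longrightarrow> \<iota> x \<otimes>\<^bsub>G\<^esub> g = g \<otimes>\<^bsub>G\<^esub> \<iota> x"
    using extension by (auto simp: central_extension_def mon_def epi_def)
  interpret Z: group ?Z by (rule gZ)
  interpret G: group G by (rule gG)
  interpret H: group "galois_group h" by (rule gH)
  have \<sigma>: "\<sigma> i \<in> ?\<Gamma>" if "i \<in> {1..t}" for i using sigma that by blast
  have gen: "generate (galois_group h) {\<sigma> i} = subproduct \<phi> {1..t} (\<lambda>i. integer_mod_group (q i)) {i}" if "i \<in> {1..t}" for i
    using sigma that unfolding C q_def by blast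
  have phi': "\<phi> \<in> iso (product_group {1..t} (\<lambda>i. integer_mod_group (q i))) (galois_group h)"
    using phi unfolding C q_def .
  have h_eq: "x = y" if "h x = h y" for x y
  proof (rule ccontr)
    assume "x \<noteq> y"
    have "h (x - y) = 0" using field_ring_homD(1)[OF h, of "x - y" y] that by simp
    then have "h ((x - y) * inverse (x - y)) = 0" unfolding field_ring_homD(2)[OF h] by simp
    then show False using \<open>x \<noteq> y\<close> field_ring_homD(3)[OF h] by simp
  qed
  have h0: "h 0 = 0"
  proof -
    have "0 + h 0 = h 0 + h 0" using field_ring_homD(1)[OF h, of 0 0] by (simp only: add_0_left)
    then show ?thesis unfolding add_right_cancel by (rule sym)
  qed
  have a0: "a i \<noteq> 0" and \<alpha>p: "\<alpha> i ^ p = h (a i)" if "i \<in> {1..t}" for i using a alpha that by blast+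
  have \<alpha>0: "\<alpha> i \<noteq> 0" if i: "i \<in> {1..t}" for i
  proof
    assume "\<alpha> i = 0"
    then have "h (a i) = h 0" using \<alpha>p[OF i] p0 h0 by (simp add: power_0_left)
    then show False using h_eq a0[OF i] by blast
  qed
  \<comment> \<open>A trivial factor would force \<sigma>_i = id, although \<sigma>_i multiplies the
    nonzero \<alpha>_i by \<zeta>.\<close>
  have n0: "n i \<noteq> 0" if i: "i \<in> {1..t}" for i
  proof
    assume "n i = 0"
    then have q1: "q i = 1" by (simp add: q_def)
    have "\<sigma> i \<in> generate (galois_group h) {\<sigma> i}" by (rule generate.incl) simp
    then obtain x where x: "\<sigma> i = \<phi> x" "x \<in> carrier (product_group {1..t} (\<lambda>i. integer_mod_group (q i)))"
        "\<forall>j\<in>{1..t} - {i}. x j = \<one>\<^bsub>integer_mod_group (q j)\<^esub>"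
      unfolding gen[OF i] subproduct_def by blast
    have "x i \<in> carrier (integer_mod_group (q i))" using x(2) i by (auto simp: PiE_iff)
    then have xi: "x i = 0" unfolding q1 by (simp add: carrier_integer_mod_group)
    have "x j = (\<one>\<^bsub>product_group {1..t} (\<lambda>i. integer_mod_group (q i))\<^esub>) j" for j
    proof (cases "j \<in> {1..t}")
      case True
      then show ?thesis using x(3) xi by (cases "j = i") auto
    next
      case False
      then show ?thesis using x(2) by (auto simp: PiE_iff extensional_def)
    qed
    then have "x = \<one>\<^bsub>product_group {1..t} (\<lambda>i. integer_mod_group (q i))\<^esub>" by (rule ext)
    then have "\<sigma> i = id"
      using x(1) hom_one[OF _ _ gH, of \<phi> "product_group {1..t} (\<lambda>i. integer_mod_group (q i))"] phi'
      by (simp add: iso_def)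
    then have "h \<zeta> * \<alpha> i = 1 * \<alpha> i" using sigma_alpha i by force
    then have "h \<zeta> = h 1" unfolding mult_right_cancel[OF \<alpha>0[OF i]] field_ring_homD(3)[OF h] .
    then show False using h_eq \<zeta>1 by blast
  qed
  have q1: "1 < q i" if "i \<in> {1..t}" for i
    unfolding q_def using n0[OF that] p2 by (intro one_less_power) auto
  have "\<exists>\<epsilon>. finite ?\<Gamma> \<and> (\<forall>\<tau>. \<forall>i\<in>{1..t}. \<epsilon> \<tau> i < q i) \<and>
      (\<forall>\<tau>\<in>?\<Gamma>. \<forall>\<rho>\<in>?\<Gamma>. \<forall>i\<in>{1..t}. \<epsilon> (\<tau> \<circ> \<rho>) i = (\<epsilon> \<tau> i + \<epsilon> \<rho> i) mod q i) \<and>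
      (\<forall>i\<in>{1..t}. \<forall>j\<in>{1..t}. \<epsilon> (\<sigma> j) i = (if i = j then 1 else 0 :: nat)) \<and>
      (\<forall>\<tau>\<in>?\<Gamma>. \<forall>\<rho>\<in>?\<Gamma>. (\<forall>i\<in>{1..t}. \<epsilon> \<tau> i = \<epsilon> \<rho> i) \<longrightarrow> \<tau> = \<rho>)"
  proof (rule product_coordinates[OF gH phi'])
    show "1 < q i" if "i \<in> {1..t}" for i by (rule q1[OF that])
    show "\<sigma> i \<in> ?\<Gamma>" if "i \<in> {1..t}" for i by (rule \<sigma>[OF that])
    show "generate (galois_group h) {\<sigma> i} = subproduct \<phi> {1..t} (\<lambda>i. integer_mod_group (q i)) {i}" if "i \<in> {1..t}" for i
      by (rule gen[OF that])
    fix \<epsilon> :: "('l \<Rightarrow> 'l) \<Rightarrow> nat \<Rightarrow> nat"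
    assume e1: "finite ?\<Gamma>" and e2: "\<And>\<tau> i. i \<in> {1..t} \<Longrightarrow> \<epsilon> \<tau> i < q i"
      and e3: "\<And>\<tau> \<rho> i. \<lbrakk>\<tau> \<in> ?\<Gamma>; \<rho> \<in> ?\<Gamma>; i \<in> {1..t}\<rbrakk> \<Longrightarrow> \<epsilon> (\<tau> \<otimes>\<^bsub>galois_group h\<^esub> \<rho>) i = (\<epsilon> \<tau> i + \<epsilon> \<rho> i) mod q i"
      and e4: "\<And>i j. \<lbrakk>i \<in> {1..t}; j \<in> {1..t}\<rbrakk> \<Longrightarrow> \<epsilon> (\<sigma> j) i = (if i = j then 1 else 0)"
      and e5: "\<And>\<tau> \<rho>. \<lbrakk>\<tau> \<in> ?\<Gamma>; \<rho> \<in> ?\<Gamma>; \<And>i. i \<in> {1..t} \<Longrightarrow> \<epsilon> \<tau> i = \<epsilon> \<rho> i\<rbrakk> \<Longrightarrow> \<tau> = \<rho>"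
    show ?thesis
    proof (intro exI[of _ \<epsilon>] conjI)
      show "finite ?\<Gamma>" by (rule e1)
      show "\<forall>\<tau>. \<forall>i\<in>{1..t}. \<epsilon> \<tau> i < q i" using e2 by blast
      show "\<forall>\<tau>\<in>?\<Gamma>. \<forall>\<rho>\<in>?\<Gamma>. \<forall>i\<in>{1..t}. \<epsilon> (\<tau> \<circ> \<rho>) i = (\<epsilon> \<tau> i + \<epsilon> \<rho> i) mod q i"
        using e3 unfolding galois_group_simps by blast
      show "\<forall>i\<in>{1..t}. \<forall>j\<in>{1..t}. \<epsilon> (\<sigma> j) i = (if i = j then 1 else 0)" using e4 by blast
      show "\<forall>\<tau>\<in>?\<Gamma>. \<forall>\<rho>\<in>?\<Gamma>. (\<forall>i\<in>{1..t}. \<epsilon> \<tau> i = \<epsilon> \<rho> i) \<longrightarrow> \<tau> = \<rho>" using e5 by blast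
    qed
  qed
  then obtain \<epsilon> where fin: "finite ?\<Gamma>" and \<epsilon>q: "\<And>\<tau> i. i \<in> {1..t} \<Longrightarrow> \<epsilon> \<tau> i < q i"
    and \<epsilon>_comp: "\<And>\<tau> \<rho> i. \<tau> \<in> ?\<Gamma> \<Longrightarrow> \<rho> \<in> ?\<Gamma> \<Longrightarrow> i \<in> {1..t} \<Longrightarrow> \<epsilon> (\<tau> \<circ> \<rho>) i = (\<epsilon> \<tau> i + \<epsilon> \<rho> i) mod q i"
    and \<epsilon>\<sigma>: "\<And>i j. i \<in> {1..t} \<Longrightarrow> j \<in> {1..t} \<Longrightarrow> \<epsilon> (\<sigma> j) i = (if i = j then 1 else 0 :: nat)"
    and \<epsilon>_inj: "\<And>\<tau> \<rho>. \<tau> \<in> ?\<Gamma> \<Longrightarrow> \<rho> \<in> ?\<Gamma> \<Longrightarrow> \<forall>i\<in>{1..t}. \<epsilon> \<tau> i = \<epsilon> \<rho> i \<Longrightarrow> \<tau> = \<rho>"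
    by blast
  have id\<Gamma>: "id \<in> ?\<Gamma>" using H.one_closed by (simp only: galois_group_simps)
  have comp\<Gamma>: "\<tau> \<circ> \<rho> \<in> ?\<Gamma>" if "\<tau> \<in> ?\<Gamma>" "\<rho> \<in> ?\<Gamma>" for \<tau> \<rho>
    using H.m_closed[OF that] by (simp only: galois_group_simps)
  have \<epsilon>_id: "\<epsilon> id i = 0" if i: "i \<in> {1..t}" for i
  proof -
    have "\<epsilon> id i = (\<epsilon> id i + \<epsilon> id i) mod q i" using \<epsilon>_comp[OF id\<Gamma> id\<Gamma> i] unfolding id_o .
    with \<epsilon>q[OF i, of id] show ?thesis by (cases "\<epsilon> id i + \<epsilon> id i < q i") (simp_all add: le_mod_geq)
  qed
  have \<zeta>Z: "\<zeta> ^ k \<in> carrier ?Z" for k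
  proof (induction k)
    case 0
    show ?case using Z.one_closed by (simp add: root_group_simps)
  next
    case (Suc k)
    have "\<zeta> \<in> carrier ?Z"
      unfolding root_group_def carrier_subgroup_generated using \<zeta>0 by (intro generate.incl) simp
    from Z.m_closed[OF this Suc.IH] show ?case by (simp add: root_group_simps)
  qed
  have \<iota>_closed: "\<iota> x \<in> carrier G" if "x \<in> carrier ?Z" for x by (rule hom_in_carrier[OF \<iota>(1) that])
  have \<iota>_mult: "\<iota> (x * y) = \<iota> x \<otimes>\<^bsub>G\<^esub> \<iota> y" if "x \<in> carrier ?Z" "y \<in> carrier ?Z" for x y
    using hom_mult[OF \<iota>(1) that] by (simp only: root_group_simps)
  define c where "c k = \<iota> (\<zeta> ^ k)" for k
  have s_closed: "s i \<in> carrier G" and \<pi>s: "\<pi> (s i) = \<sigma> i" if "i \<in> {1..t}" for i using s that by blast+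
  interpret P: central_presentation G c s d m q t
  proof
    show "c i \<in> carrier G" for i unfolding c_def by (rule \<iota>_closed[OF \<zeta>Z])
    show "c 0 = \<one>\<^bsub>G\<^esub>" using hom_one[OF \<iota>(1) gZ gG] by (simp add: c_def root_group_simps)
    show "c (i + j) = c i \<otimes>\<^bsub>G\<^esub> c j" for i j unfolding c_def power_add by (rule \<iota>_mult[OF \<zeta>Z \<zeta>Z])
    show "g \<otimes>\<^bsub>G\<^esub> c i = c i \<otimes>\<^bsub>G\<^esub> g" if "g \<in> carrier G" for g i
      unfolding c_def by (rule central[OF \<zeta>Z that, symmetric])
    show "s i \<in> carrier G" if "i \<in> {1..t}" for i by (rule s_closed[OF that])
    show "s j \<otimes>\<^bsub>G\<^esub> s i = c (d i j) \<otimes>\<^bsub>G\<^esub> (s i \<otimes>\<^bsub>G\<^esub> s j)" if "i \<in> {1..t}" "j \<in> {1..t}" "i < j" for i j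
    proof -
      have "s j \<otimes>\<^bsub>G\<^esub> s i = c (d i j) \<otimes>\<^bsub>G\<^esub> s i \<otimes>\<^bsub>G\<^esub> s j" using d that(1,2) unfolding c_def by blast
      then show ?thesis
        using G.m_assoc[OF _ s_closed[OF that(1)] s_closed[OF that(2)], of "c (d i j)"] \<iota>_closed[OF \<zeta>Z] by (simp add: c_def)
    qed
    show "s i [^]\<^bsub>G\<^esub> q i = c (m i)" if "i \<in> {1..t}" for i using m that unfolding c_def q_def by blast
  qed
  have \<pi>_mult: "\<pi> (x \<otimes>\<^bsub>G\<^esub> y) = \<pi> x \<circ> \<pi> y" if "x \<in> carrier G" "y \<in> carrier G" for x y
    using hom_mult[OF \<pi> that] by (simp only: galois_group_simps)
  have \<pi>_closed: "\<pi> x \<in> ?\<Gamma>" if "x \<in> carrier G" for x by (rule hom_in_carrier[OF \<pi> that])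
  have \<pi>_one: "\<pi> \<one>\<^bsub>G\<^esub> = id" using hom_one[OF \<pi> gG gH] by (simp only: galois_group_simps)
  \<comment> \<open>Coordinates and the action on \<alpha>_i are followed side by side, first for
    powers of one lift and below for normal forms, so that the one can be expressed by the
    other.\<close>
  have \<pi>_pow: "\<epsilon> (\<pi> (s j [^]\<^bsub>G\<^esub> k)) i = (if i = j then k mod q i else 0) \<and>
      \<pi> (s j [^]\<^bsub>G\<^esub> k) (\<alpha> i) = h (\<zeta> ^ (if i = j then k else 0)) * \<alpha> i" if i: "i \<in> {1..t}" and j: "j \<in> {1..t}" for i j and k :: nat
  proof (induction k)
    case 0
    show ?case unfolding G.nat_pow_0 \<pi>_one \<epsilon>_id[OF i] by (simp add: field_ring_homD(3)[OF h])
  next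
    case (Suc k)
    have cl: "s j [^]\<^bsub>G\<^esub> k \<in> carrier G" by (rule G.nat_pow_closed[OF s_closed[OF j]])
    have pi: "\<pi> (s j [^]\<^bsub>G\<^esub> Suc k) = \<pi> (s j [^]\<^bsub>G\<^esub> k) \<circ> \<sigma> j"
      unfolding G.nat_pow_Suc \<pi>_mult[OF cl s_closed[OF j]] \<pi>s[OF j] ..
    have "\<epsilon> (\<pi> (s j [^]\<^bsub>G\<^esub> Suc k)) i = (if i = j then Suc k mod q i else 0)"
      unfolding pi \<epsilon>_comp[OF \<pi>_closed[OF cl] \<sigma>[OF j] i] \<epsilon>\<sigma>[OF i j] conjunct1[OF Suc.IH] by (simp add: mod_Suc_eq)
    moreover have "\<pi> (s j [^]\<^bsub>G\<^esub> Suc k) (\<alpha> i) = h (\<zeta> ^ (if i = j then Suc k else 0)) * \<alpha> i"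
    proof -
      have "\<pi> (s j [^]\<^bsub>G\<^esub> Suc k) (\<alpha> i) = \<pi> (s j [^]\<^bsub>G\<^esub> k) (h (\<zeta> ^ (if i = j then 1 else 0)) * \<alpha> i)"
        unfolding pi o_apply using sigma_alpha i j by simp
      also have "\<dots> = h (\<zeta> ^ (if i = j then 1 else 0)) * (h (\<zeta> ^ (if i = j then k else 0)) * \<alpha> i)"
        unfolding galois_groupD(2,4)[OF \<pi>_closed[OF cl]] conjunct2[OF Suc.IH] ..
      also have "\<dots> = h (\<zeta> ^ (if i = j then Suc k else 0)) * \<alpha> i"
        by (simp add: field_ring_homD[OF h])
      finally show ?thesis .
    qed
    ultimately show ?case by (rule conjI)
  qed
  have \<pi>_nf: "l \<le> t \<Longrightarrow> \<epsilon> (\<pi> (P.nf e l)) i = (if i \<le> l then e i mod q i else 0) \<and>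
      \<pi> (P.nf e l) (\<alpha> i) = h (\<zeta> ^ (if i \<le> l then e i else 0)) * \<alpha> i" if i: "i \<in> {1..t}" for i l e
  proof (induction l)
    case 0
    have "\<not> i \<le> 0" using i by simp
    then show ?case unfolding P.nf.simps \<pi>_one \<epsilon>_id[OF i] by (simp add: field_ring_homD(3)[OF h])
  next
    case (Suc l)
    have l: "Suc l \<in> {1..t}" "l \<le> t" using Suc.prems by auto
    let ?x = "s (Suc l) [^]\<^bsub>G\<^esub> e (Suc l)"
    have cl: "P.nf e l \<in> carrier G" "?x \<in> carrier G"
      by (rule P.nf_closed[OF l(2)], rule G.nat_pow_closed[OF s_closed[OF l(1)]])
    have pi: "\<pi> (P.nf e (Suc l)) = \<pi> (P.nf e l) \<circ> \<pi> ?x" unfolding P.nf.simps \<pi>_mult[OF cl] ..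
    note IH = Suc.IH[OF l(2)] and x = \<pi>_pow[OF i l(1), of "e (Suc l)"]
    have "\<epsilon> (\<pi> (P.nf e (Suc l))) i = (if i \<le> Suc l then e i mod q i else 0)"
      unfolding pi \<epsilon>_comp[OF \<pi>_closed[OF cl(1)] \<pi>_closed[OF cl(2)] i] conjunct1[OF IH] conjunct1[OF x] by auto
    moreover have "\<pi> (P.nf e (Suc l)) (\<alpha> i) = h (\<zeta> ^ (if i \<le> Suc l then e i else 0)) * \<alpha> i"
      unfolding pi o_apply conjunct2[OF x] galois_groupD(2,4)[OF \<pi>_closed[OF cl(1)]] conjunct2[OF IH]
      by (auto simp: field_ring_homD[OF h] le_Suc_eq)
    ultimately show ?case by (rule conjI)
  qed
  \<comment> \<open>The section by normal forms. Its image under \<pi> has the coordinates of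
    \<tau>, and coordinates determine the automorphism.\<close>
  define S where "S \<tau> = P.nf (\<epsilon> \<tau>) t" for \<tau>
  have S_closed: "S \<tau> \<in> carrier G" for \<tau> unfolding S_def by (rule P.nf_closed) simp
  have \<pi>S: "\<pi> (S \<tau>) = \<tau>" if \<tau>: "\<tau> \<in> ?\<Gamma>" for \<tau>
  proof (rule \<epsilon>_inj[OF \<pi>_closed[OF S_closed] \<tau>], rule ballI)
    fix i assume i: "i \<in> {1..t}"
    then show "\<epsilon> (\<pi> (S \<tau>)) i = \<epsilon> \<tau> i"
      using \<pi>_nf[OF i, of t "\<epsilon> \<tau>"] \<epsilon>q[OF i, of \<tau>] by (simp add: S_def)
  qed
  \<comment> \<open>Writing \<tau> as the image of its normal form shows how it acts on \<alpha>_i;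
    reduced modulo p, the coordinate becomes the exponent \<open>\<kappa>\<close> of the Kummer
    product.\<close>
  have act: "\<tau> (\<alpha> i) = h (\<zeta> ^ \<epsilon> \<tau> i) * \<alpha> i" if \<tau>: "\<tau> \<in> ?\<Gamma>" and i: "i \<in> {1..t}" for \<tau> i
  proof -
    have "\<pi> (S \<tau>) (\<alpha> i) = h (\<zeta> ^ \<epsilon> \<tau> i) * \<alpha> i"
      using \<pi>_nf[OF i, of t "\<epsilon> \<tau>"] i by (simp add: S_def)
    then show ?thesis unfolding \<pi>S[OF \<tau>] .
  qed
  \<comment> \<open>\<open>r\<close> is the largest index with positive \<open>m\<close>, and
    \<open>n\<close> is monotone, so \<open>n r\<close> bounds all \<open>n i\<close> with
    \<open>m i\<close> positive and the natural number differences \<open>n r - n i\<close> are not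
    truncated.\<close>
  have mr: "Z ^ p ^ n r = 1 \<and> \<zeta> = Z ^ (p ^ (n r - 1)) \<and> n i \<le> n r" if i: "i \<in> {1..t}" "m i > 0" for i
  proof -
    let ?I = "{i \<in> {1..t}. m i > 0}"
    have "r \<in> ?I" unfolding r using i by (intro Max_in) auto
    moreover have "i \<le> r" unfolding r using i by (intro Max_ge) auto
    ultimately have "n i \<le> n r" using mono_onD[OF n_mono i(1), of r] by simp
    then show ?thesis using Z i unfolding primitive_root_of_unity_def by blast
  qed
  \<comment> \<open>Since \<zeta> is the power of \<open>Z\<close> with exponent p^(n r - 1), the
    power of \<open>Z\<close> with exponent p^(n r - n i) is a root of \<zeta> of degree p^(n i -
    1), and z_i is its m_i-th power. For n i = n r this is \<open>Z ^ m i\<close>; the value 1 suits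
    m_i = 0.\<close>
  define z where "z i = (if m i > 0 then Z ^ (m i * p ^ (n r - n i)) else 1)" for i
  have z0: "z i \<noteq> 0" if i: "i \<in> {1..t}" for i
  proof (cases "m i > 0")
    case True
    have "Z \<noteq> 0" using mr[OF i True] p0 by (auto simp: power_0_left)
    then show ?thesis by (simp add: z_def)
  qed (simp add: z_def)
  have zq: "z i ^ (p ^ (n i - 1)) = \<zeta> ^ m i" if i: "i \<in> {1..t}" for i
  proof (cases "m i > 0")
    case True
    have "(n r - n i) + (n i - 1) = n r - 1" using mr[OF i True] n0[OF i] by simp
    then have "p ^ (n r - n i) * p ^ (n i - 1) = p ^ (n r - 1)" by (simp flip: power_add)
    then have "z i ^ (p ^ (n i - 1)) = Z ^ (m i * p ^ (n r - 1))"
      using True by (simp add: z_def mult.assoc flip: power_mult)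
    also have "\<dots> = (Z ^ (p ^ (n r - 1))) ^ m i" by (simp only: power_mult[symmetric] mult.commute)
    finally show ?thesis using mr[OF i True] by simp
  qed (simp add: z_def)
  have qp: "q i = p * p ^ (n i - 1)" if "i \<in> {1..t}" for i
    unfolding q_def using n0[OF that] by (simp flip: power_Suc)
  interpret K: kummer_product p t \<zeta> h a z \<alpha> \<sigma> "\<lambda>\<tau> i. \<epsilon> \<tau> i mod p" d
  proof (rule kummer_product.intro)
    show "2 \<le> p" by (rule p2)
    show "primitive_root_of_unity p \<zeta>" by (rule zeta)
    show "of_nat p \<noteq> (0 :: 'k)" by (rule pk)
    show "h \<in> ring_hom field_ring field_ring" by (rule h)
    show "group (galois_group h)" by (rule gH)
    show "finite ?\<Gamma>" by (rule fin)
    show "x \<in> range h" if "\<And>\<tau>. \<tau> \<in> ?\<Gamma> \<Longrightarrow> \<tau> x = x" for x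
      using that unfolding fixed[symmetric] fixed_field_def by blast
    show "a i \<noteq> 0" if "i \<in> {1..t}" for i by (rule a0[OF that])
    show "z i \<noteq> 0" if "i \<in> {1..t}" for i by (rule z0[OF that])
    show "\<alpha> i ^ p = h (a i)" if "i \<in> {1..t}" for i by (rule \<alpha>p[OF that])
    show "\<epsilon> \<tau> i mod p < p" for \<tau> i by (rule mod_less_divisor[OF p0])
    show "\<tau> (\<alpha> i) = h (\<zeta> ^ (\<epsilon> \<tau> i mod p)) * \<alpha> i" if "\<tau> \<in> ?\<Gamma>" "i \<in> {1..t}" for \<tau> i
      unfolding power_mod_eq[OF \<zeta>p] by (rule act[OF that])
    show "\<sigma> j \<in> ?\<Gamma>" if "j \<in> {1..t}" for j by (rule \<sigma>[OF that])
    show "\<epsilon> (\<sigma> j) i mod p = (if i = j then 1 else 0)" if "i \<in> {1..t}" "j \<in> {1..t}" for i j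
      unfolding \<epsilon>\<sigma>[OF that] using p2 by simp
  qed
  obtain sec c0 where sec: "sec \<in> ?\<Gamma> \<rightarrow> carrier G" and c0: "c0 \<in> \<gamma>" and \<pi>sec: "\<forall>\<tau>\<in>?\<Gamma>. \<pi> (sec \<tau>) = \<tau>"
    and secm: "\<forall>\<tau>\<in>?\<Gamma>. \<forall>\<rho>\<in>?\<Gamma>. sec \<tau> \<otimes>\<^bsub>G\<^esub> sec \<rho> = \<iota> (c0 (\<tau>, \<rho>)) \<otimes>\<^bsub>G\<^esub> sec (\<tau> \<otimes>\<^bsub>galois_group h\<^esub> \<rho>)"
    and \<gamma>: "\<gamma> \<in> carrier (H2 (galois_group h) ?Z (\<lambda>_ z. z))"
    using gamma unfolding has_extension_class_def by blast
  have sec_closed: "sec \<tau> \<in> carrier G" if "\<tau> \<in> ?\<Gamma>" for \<tau> using sec that by (rule funcset_mem)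
  \<comment> \<open>A class is only given as a coset, so that its members have values in the root
    group must be read off from the description of cosets.\<close>
  have c0Z: "c0 (\<tau>, \<rho>) \<in> carrier ?Z" if t: "\<tau> \<in> ?\<Gamma>" "\<rho> \<in> ?\<Gamma>" for \<tau> \<rho>
  proof -
    obtain g where g: "g \<in> carrier (cocycles2 (galois_group h) ?Z (\<lambda>_ z. z))"
        "\<gamma> = coboundaries2 (galois_group h) ?Z (\<lambda>_ z. z) #>\<^bsub>cocycles2 (galois_group h) ?Z (\<lambda>_ z. z)\<^esub> g"
      using \<gamma> unfolding H2_def FactGroup_def by (auto simp: RCOSETS_def)
    obtain b where b: "b \<in> ?\<Gamma> \<rightarrow> carrier ?Z" and cb: "c0 = (\<lambda>x\<in>?\<Gamma> \<times> ?\<Gamma>. (\<lambda>(\<sigma>, \<tau>)\<in>?\<Gamma> \<times> ?\<Gamma>.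
        (b \<sigma> \<otimes>\<^bsub>?Z\<^esub> b \<tau>) \<otimes>\<^bsub>?Z\<^esub> inv\<^bsub>?Z\<^esub> b (\<sigma> \<otimes>\<^bsub>galois_group h\<^esub> \<tau>)) x \<otimes>\<^bsub>?Z\<^esub> g x)"
      using c0 unfolding g(2) coset_coboundaries by blast
    have "g \<in> ?\<Gamma> \<times> ?\<Gamma> \<rightarrow>\<^sub>E carrier ?Z" using g(1) by (simp add: cocycles2_def)
    then have gZ: "g (\<tau>, \<rho>) \<in> carrier ?Z" using t by (auto simp: PiE_iff)
    have "c0 (\<tau>, \<rho>) = (b \<tau> \<otimes>\<^bsub>?Z\<^esub> b \<rho>) \<otimes>\<^bsub>?Z\<^esub> inv\<^bsub>?Z\<^esub> b (\<tau> \<otimes>\<^bsub>galois_group h\<^esub> \<rho>) \<otimes>\<^bsub>?Z\<^esub> g (\<tau>, \<rho>)"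
      unfolding cb using t by simp
    also have "\<dots> \<in> carrier ?Z"
      by (intro Z.m_closed Z.inv_closed funcset_mem[OF b] H.m_closed t gZ)
    finally show ?thesis .
  qed
  \<comment> \<open>Two lifts of \<tau> differ by an element of the kernel, that is by a root of
    unity.\<close>
  have "\<forall>\<tau>\<in>?\<Gamma>. \<exists>l. l \<in> carrier ?Z \<and> S \<tau> = \<iota> l \<otimes>\<^bsub>G\<^esub> sec \<tau>"
  proof
    fix \<tau> assume \<tau>: "\<tau> \<in> ?\<Gamma>"
    let ?i = "inv\<^bsub>G\<^esub> sec \<tau>"
    have cl: "?i \<in> carrier G" by (rule G.inv_closed[OF sec_closed[OF \<tau>]])
    have "\<pi> (S \<tau>) = \<pi> (sec \<tau>)" using \<pi>S[OF \<tau>] \<pi>sec \<tau> by simp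
    then have "\<pi> (S \<tau> \<otimes>\<^bsub>G\<^esub> ?i) = \<pi> (sec \<tau> \<otimes>\<^bsub>G\<^esub> ?i)"
      unfolding \<pi>_mult[OF S_closed cl] \<pi>_mult[OF sec_closed[OF \<tau>] cl] by (rule arg_cong)
    also have "\<dots> = \<one>\<^bsub>galois_group h\<^esub>" unfolding G.r_inv[OF sec_closed[OF \<tau>]] by (rule hom_one[OF \<pi> gG gH])
    finally have "S \<tau> \<otimes>\<^bsub>G\<^esub> ?i \<in> \<iota> ` carrier ?Z"
      unfolding ker kernel_def using G.m_closed[OF S_closed cl] by simp
    then obtain l where l: "l \<in> carrier ?Z" "S \<tau> \<otimes>\<^bsub>G\<^esub> ?i = \<iota> l" by blast
    have "S \<tau> = (S \<tau> \<otimes>\<^bsub>G\<^esub> ?i) \<otimes>\<^bsub>G\<^esub> sec \<tau>"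
      using S_closed sec_closed[OF \<tau>] by (simp add: G.m_assoc)
    then show "\<exists>l. l \<in> carrier ?Z \<and> S \<tau> = \<iota> l \<otimes>\<^bsub>G\<^esub> sec \<tau>" using l by metis
  qed
  from bchoice[OF this] obtain lam where lam: "\<And>\<tau>. \<tau> \<in> ?\<Gamma> \<Longrightarrow> lam \<tau> \<in> carrier ?Z"
    and S_lam: "\<And>\<tau>. \<tau> \<in> ?\<Gamma> \<Longrightarrow> S \<tau> = \<iota> (lam \<tau>) \<otimes>\<^bsub>G\<^esub> sec \<tau>" by blast
  \<comment> \<open>The exponent of \<zeta> in the normal form cocycle, as given by
    \<open>P.nf_product\<close>.\<close>
  define E where "E \<tau> \<rho> = (\<Sum>j\<in>{1..t}. \<Sum>i\<in>{1..<j}. d i j * \<epsilon> \<tau> j * \<epsilon> \<rho> i) + (\<Sum>i\<in>{1..t}. m i * ((\<epsilon> \<tau> i + \<epsilon> \<rho> i) div q i))" for \<tau> \<rho>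
  \<comment> \<open>The product of two normal forms is computed by collection and again through the
    given section; cancelling the lift of the composite compares the two cocycles inside the root
    group.\<close>
  have key: "\<zeta> ^ E \<tau> \<rho> * lam (\<tau> \<circ> \<rho>) = lam \<tau> * lam \<rho> * c0 (\<tau>, \<rho>)" if t: "\<tau> \<in> ?\<Gamma>" "\<rho> \<in> ?\<Gamma>" for \<tau> \<rho>
  proof -
    note tr = comp\<Gamma>[OF t]
    note cl = \<iota>_closed[OF lam[OF t(1)]] \<iota>_closed[OF lam[OF t(2)]] \<iota>_closed[OF lam[OF tr]] \<iota>_closed[OF c0Z[OF t]]
      sec_closed[OF t(1)] sec_closed[OF t(2)] sec_closed[OF tr] \<iota>_closed[OF \<zeta>Z] G.m_closed
    have "S \<tau> \<otimes>\<^bsub>G\<^esub> S \<rho> = c (E \<tau> \<rho>) \<otimes>\<^bsub>G\<^esub> P.nf (\<lambda>i. (\<epsilon> \<tau> i + \<epsilon> \<rho> i) mod q i) t"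
      unfolding S_def E_def by (rule P.nf_product)
    also have "P.nf (\<lambda>i. (\<epsilon> \<tau> i + \<epsilon> \<rho> i) mod q i) t = S (\<tau> \<circ> \<rho>)"
      unfolding S_def by (rule P.nf_cong) (rule \<epsilon>_comp[OF t, symmetric])
    finally have 1: "S \<tau> \<otimes>\<^bsub>G\<^esub> S \<rho> = \<iota> (\<zeta> ^ E \<tau> \<rho> * lam (\<tau> \<circ> \<rho>)) \<otimes>\<^bsub>G\<^esub> sec (\<tau> \<circ> \<rho>)"
      unfolding c_def S_lam[OF tr] \<iota>_mult[OF \<zeta>Z lam[OF tr]] by (simp only: G.m_assoc cl)
    have "S \<tau> \<otimes>\<^bsub>G\<^esub> S \<rho> = \<iota> (lam \<tau>) \<otimes>\<^bsub>G\<^esub> ((sec \<tau> \<otimes>\<^bsub>G\<^esub> \<iota> (lam \<rho>)) \<otimes>\<^bsub>G\<^esub> sec \<rho>)"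
      unfolding S_lam[OF t(1)] S_lam[OF t(2)] by (simp only: G.m_assoc cl)
    also have "\<dots> = \<iota> (lam \<tau>) \<otimes>\<^bsub>G\<^esub> (\<iota> (lam \<rho>) \<otimes>\<^bsub>G\<^esub> (sec \<tau> \<otimes>\<^bsub>G\<^esub> sec \<rho>))"
      unfolding central[OF lam[OF t(2)] sec_closed[OF t(1)], symmetric] by (simp only: G.m_assoc cl)
    also have "sec \<tau> \<otimes>\<^bsub>G\<^esub> sec \<rho> = \<iota> (c0 (\<tau>, \<rho>)) \<otimes>\<^bsub>G\<^esub> sec (\<tau> \<circ> \<rho>)"
      using secm t unfolding galois_group_simps by blast
    also have "\<iota> (lam \<tau>) \<otimes>\<^bsub>G\<^esub> (\<iota> (lam \<rho>) \<otimes>\<^bsub>G\<^esub> (\<iota> (c0 (\<tau>, \<rho>)) \<otimes>\<^bsub>G\<^esub> sec (\<tau> \<circ> \<rho>))) =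
        (\<iota> (lam \<tau>) \<otimes>\<^bsub>G\<^esub> \<iota> (lam \<rho>) \<otimes>\<^bsub>G\<^esub> \<iota> (c0 (\<tau>, \<rho>))) \<otimes>\<^bsub>G\<^esub> sec (\<tau> \<circ> \<rho>)"
      by (simp only: G.m_assoc cl)
    also have "\<iota> (lam \<tau>) \<otimes>\<^bsub>G\<^esub> \<iota> (lam \<rho>) \<otimes>\<^bsub>G\<^esub> \<iota> (c0 (\<tau>, \<rho>)) = \<iota> (lam \<tau> * lam \<rho> * c0 (\<tau>, \<rho>))"
    proof -
      have "lam \<tau> * lam \<rho> \<in> carrier ?Z" using Z.m_closed[OF lam[OF t(1)] lam[OF t(2)]] unfolding root_group_simps .
      from \<iota>_mult[OF this c0Z[OF t]] show ?thesis unfolding \<iota>_mult[OF lam[OF t(1)] lam[OF t(2)]] by (rule sym)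
    qed
    finally have 2: "\<iota> (\<zeta> ^ E \<tau> \<rho> * lam (\<tau> \<circ> \<rho>)) \<otimes>\<^bsub>G\<^esub> sec (\<tau> \<circ> \<rho>) = \<iota> (lam \<tau> * lam \<rho> * c0 (\<tau>, \<rho>)) \<otimes>\<^bsub>G\<^esub> sec (\<tau> \<circ> \<rho>)"
      unfolding 1 .
    have in1: "\<zeta> ^ E \<tau> \<rho> * lam (\<tau> \<circ> \<rho>) \<in> carrier ?Z"
      using Z.m_closed[OF \<zeta>Z lam[OF tr]] unfolding root_group_simps .
    have in2: "lam \<tau> * lam \<rho> * c0 (\<tau>, \<rho>) \<in> carrier ?Z"
      using Z.m_closed[OF Z.m_closed[OF lam[OF t(1)] lam[OF t(2)]] c0Z[OF t]] unfolding root_group_simps .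
    have "\<iota> (\<zeta> ^ E \<tau> \<rho> * lam (\<tau> \<circ> \<rho>)) = \<iota> (lam \<tau> * lam \<rho> * c0 (\<tau>, \<rho>))"
      using 2 unfolding G.right_cancel[OF sec_closed[OF tr] \<iota>_closed[OF in1] \<iota>_closed[OF in2]] .
    then show ?thesis by (rule inj_onD[OF \<iota>(2) _ in1 in2])
  qed
  \<comment> \<open>The cochain of powers of z_i for which \<open>K.f_coboundary\<close> links
    \<open>K.f\<close> to the normal form cocycle. It has values in \<open>k\<close> only, not in
    the root group.\<close>
  define Y where "Y \<tau> = (\<Prod>i\<in>{1..t}. z i ^ (\<epsilon> \<tau> i div p))" for \<tau>
  have Y0: "Y \<tau> \<noteq> 0" for \<tau> unfolding Y_def using z0 by simp
  have Yf: "Y \<tau> * Y \<rho> * K.f \<tau> \<rho> = Y (\<tau> \<circ> \<rho>) * \<zeta> ^ E \<tau> \<rho>" if t: "\<tau> \<in> ?\<Gamma>" "\<rho> \<in> ?\<Gamma>" for \<tau> \<rho>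
  proof -
    have "Y (\<tau> \<circ> \<rho>) = (\<Prod>i\<in>{1..t}. z i ^ (((\<epsilon> \<tau> i + \<epsilon> \<rho> i) mod q i) div p))"
      unfolding Y_def by (rule prod.cong[OF refl]) (simp only: \<epsilon>_comp[OF t])
    then show ?thesis
      unfolding E_def using K.f_coboundary[of \<tau> "\<epsilon> \<tau>" \<rho> "\<epsilon> \<rho>" q "\<lambda>i. p ^ (n i - 1)" m, OF refl refl qp zq]
      by (simp only: Y_def)
  qed
  have lam0: "lam \<tau> \<noteq> 0" if "\<tau> \<in> ?\<Gamma>" for \<tau> by (rule root_group_nz[OF lam[OF that]])
  have hf: "(\<lambda>x. h (case x of (\<tau>, \<rho>) \<Rightarrow> K.f \<tau> \<rho>)) = (\<lambda>(\<tau>, \<rho>). h (K.f \<tau> \<rho>))" by (rule ext) (simp split: prod.split)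
  \<comment> \<open>Two comparisons are combined: \<open>lam\<close> between the given cocycle and
    the normal form cocycle, and \<open>Y\<close> between the latter and \<open>K.f\<close>.\<close>
  have "obstruction h \<gamma> = brauer_class (crossed_product h (\<lambda>x. h (case x of (\<tau>, \<rho>) \<Rightarrow> K.f \<tau> \<rho>)))"
  proof (rule obstruction_eqI[OF _ \<gamma> c0, where B = "\<lambda>\<tau>. Y \<tau> * inverse (lam \<tau>)"])
    show "twisted_algebra h (galois_group h) (\<lambda>\<sigma>. \<sigma>) (\<lambda>x. h (case x of (\<tau>, \<rho>) \<Rightarrow> K.f \<tau> \<rho>))"
      unfolding hf by (rule K.twisted_algebra_axioms)
    show "Y \<tau> * inverse (lam \<tau>) \<noteq> 0" if "\<tau> \<in> ?\<Gamma>" for \<tau> using Y0 lam0[OF that] by simp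
    show "c0 (\<tau>, \<rho>) = Y \<tau> * inverse (lam \<tau>) * (Y \<rho> * inverse (lam \<rho>)) * inverse (Y (\<tau> \<circ> \<rho>) * inverse (lam (\<tau> \<circ> \<rho>))) *
        (case (\<tau>, \<rho>) of (\<tau>, \<rho>) \<Rightarrow> K.f \<tau> \<rho>)" if t: "\<tau> \<in> ?\<Gamma>" "\<rho> \<in> ?\<Gamma>" for \<tau> \<rho>
    proof -
      let ?L = "lam (\<tau> \<circ> \<rho>)" and ?Y = "Y (\<tau> \<circ> \<rho>)" and ?l = "inverse (lam \<tau>) * inverse (lam \<rho>)"
      have "Y \<tau> * inverse (lam \<tau>) * (Y \<rho> * inverse (lam \<rho>)) * inverse (?Y * inverse ?L) * K.f \<tau> \<rho> =
          ?l * ?L * inverse ?Y * (Y \<tau> * Y \<rho> * K.f \<tau> \<rho>)"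
        by (simp only: inverse_mult_distrib inverse_inverse_eq mult_ac)
      also have "\<dots> = ?l * (inverse ?Y * ?Y) * (\<zeta> ^ E \<tau> \<rho> * ?L)"
        unfolding Yf[OF t] by (simp only: mult_ac)
      also have "\<dots> = (inverse (lam \<tau>) * lam \<tau>) * (inverse (lam \<rho>) * lam \<rho>) * c0 (\<tau>, \<rho>)"
        unfolding key[OF t] left_inverse[OF Y0] by (simp only: mult_ac mult_1)
      finally show ?thesis
        unfolding left_inverse[OF lam0[OF t(1)]] left_inverse[OF lam0[OF t(2)]] prod.case mult_1 by (rule sym)
    qed
  qed
  also have "\<dots> = (\<Otimes>\<^bsub>brauer_group\<^esub>j\<in>{1..t}. brauer_class (symbol_algebra p (a j) (z j * (\<Prod>i\<in>{1..<j}. a i ^ d i j)) \<zeta>))"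
    unfolding hf by (rule K.brauer_class_crossed_product)
  also have "\<dots> = (\<Otimes>\<^bsub>brauer_group\<^esub>j\<in>{1..t}. brauer_class (symbol_algebra p (a j) (z j) \<zeta>)) \<otimes>\<^bsub>brauer_group\<^esub>
      finprod brauer_group (\<lambda>(i, j). brauer_class (symbol_algebra p (a j) (a i) \<zeta>) [^]\<^bsub>brauer_group\<^esub> d i j)
        {(i, j). i \<in> {1..t} \<and> j \<in> {1..t} \<and> i < j}"
    by (rule symbol_product[OF p2 zeta pk a0 z0])
  also have "(\<Otimes>\<^bsub>brauer_group\<^esub>j\<in>{1..t}. brauer_class (symbol_algebra p (a j) (z j) \<zeta>)) =
      (\<Otimes>\<^bsub>brauer_group\<^esub>i\<in>A. brauer_class (symbol_algebra p (a i) (Z ^ m i) \<zeta>))"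
  proof (rule comm_monoid.finprod_mono_neutral_cong_right[OF comm_monoid_brauer_group])
    show "A \<subseteq> {1..t}" unfolding A by blast
    show "(\<lambda>j. brauer_class (symbol_algebra p (a j) (z j) \<zeta>)) \<in> {1..t} \<rightarrow> carrier brauer_group"
      by (rule Pi_I) (rule sy_closed[OF p2 zeta pk a0 z0])
    show "brauer_class (symbol_algebra p (a i) (z i) \<zeta>) = brauer_class (symbol_algebra p (a i) (Z ^ m i) \<zeta>)" if "i \<in> A" for i
    proof -
      have "z i = Z ^ m i" using that unfolding A by (simp add: z_def)
      then show ?thesis by (simp only:)
    qed
    fix i assume i: "i \<in> {1..t} - A"
    then have it: "i \<in> {1..t}" by blast
    show "brauer_class (symbol_algebra p (a i) (z i) \<zeta>) = \<one>\<^bsub>brauer_group\<^esub>"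
    proof (cases "m i > 0")
      case False
      then have "z i = 1" by (simp add: z_def)
      then show ?thesis using sy_one[OF p2 zeta pk a0[OF it]] by (simp only:)
    next
      case True
      \<comment> \<open>With m_i positive but i outside A, n i is strictly below n r, so a factor p
        can be split off the exponent in z_i.\<close>
      then have "n i < n r" using i mr[OF it True] unfolding A by fastforce
      then have "p ^ (n r - n i) = p ^ (n r - n i - 1) * p"
        by (metis Suc_diff_Suc diff_Suc_1 mult.commute power_Suc One_nat_def)
      then have zi: "z i = (Z ^ (m i * p ^ (n r - n i - 1))) ^ p"
        using True by (simp add: z_def mult.assoc flip: power_mult)
      then have "Z ^ (m i * p ^ (n r - n i - 1)) \<noteq> 0" using z0[OF it] p0 by (auto simp: power_0_left)
      then show ?thesis unfolding zi by (rule symbol_class_power_p[OF p2 zeta a0[OF it] _ pk])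
    qed
  qed simp
  finally show ?thesis .
qed

end
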